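(* Let $n\ge 1$ and let $\alpha\models n$ be a nonempty composition with at most one odd part. There is a canonical bidegree-preserving, $\mathfrak S_n$-equivariant chain isomorphism $$C_\bullet^{t,q}(\alpha)\;\cong\;\bigoplus_{\theta\in\mathcal D_n} C_\bullet(\gamma_\alpha(\theta)),$$ where the summand indexed by $\theta$ is placed in bidegree $(\deg_t\theta,\deg_q\theta)$. Moreover, for every $k$, $$\operatorname{ch}_{t,q}H_k(C_\bullet^{t,q}(\alpha))=\sum_{\substack{\theta\in\mathcal D_n\\ |F_\alpha(\theta)|=k-1}} t^{\deg_t\theta}q^{\deg_q\theta}\, r_{\gamma_\alpha(\theta)} .$$ Thus every bigraded homology Frobenius characteristic admits a nonnegative expansion in ribbon Schur functions and is therefore Schur-positive. The unique nonzero homology module contributed by $\theta$ occurs in degree $k=|F_\alpha(\theta)|+1$ and has dimension $$\#\{\pi\in\mathfrak S_n:\operatorname{Des}(\pi)=F_\alpha(\theta)\}.$$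
   Context: Conventions. $\mathbb N$ includes $0$; $[m]=\{1,\dots,m\}$, $[0]=\varnothing$; $\mathbb K$ is a field of characteristic zero and all vector spaces are over $\mathbb K$. For $m\ge0$, $m^+=\lceil m/2\rceil$ and $m^-=\lfloor m/2\rfloor$. A composition $\alpha=(\alpha_1,\dots,\alpha_r)\models n$ is a sequence of positive integers with sum $n$; $\ell(\alpha)=r$; its cut set is $D(\alpha)=\{\alpha_1,\alpha_1+\alpha_2,\dots,\alpha_1+\cdots+\alpha_{r-1}\}\subseteq[n-1]$. For $\beta,\alpha\models n$, $\beta\succeq\alpha$ ($\beta$ is a coarsening of $\alpha$) means $D(\beta)\subseteq D(\alpha)$. For $S\subseteq[n-1]$, $\gamma_S$ is the composition of $n$ with $D(\gamma_S)=S$. The ribbon Schur function is $r_\alpha=\sum_{\beta\succeq\alpha}(-1)^{\ell(\alpha)-\ell(\beta)}h_\beta$, with $h_\beta=h_{\beta_1}h_{\beta_2}\cdots$ complete homogeneous. $\operatorname{Des}(\pi)=\{i:\pi(i)>\pi(i+1)\}$. Classical ribbon complex. For $\beta=(\beta_1,\dots,\beta_k)\models n$, $\operatorname{OSP}_\beta[n]$ is the set of ordered set partitions $(B_1,\dots,B_k)$ of $[n]$ with $|B_i|=\beta_i$, and $M^\beta=\mathbb K[\operatorname{OSP}_\beta[n]]$ with the natural $\mathfrak S_n$-action on labels. $C_k(\alpha)=\bigoplus_{\beta\succeq\alpha,\ \ell(\beta)=k}M^\beta$ for $1\le k\le\ell(\alpha)$ (and $0$ otherwise), in homological degree $k$,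 with $\partial_k=\sum_{i=1}^{k-1}(-1)^{i-1}d_i$, where $d_i$ replaces $B_i,B_{i+1}$ by $B_i\sqcup B_{i+1}$. Decorations. $c(\cdot)$ is the number of cycles of a permutation, fixed points included. For $\sigma\in\mathfrak S_a$, $\sigma'\in\mathfrak S_b$, $\sigma\oplus\sigma'\in\mathfrak S_{a+b}$ acts as $\sigma$ on $[a]$ and by $a+j\mapsto a+\sigma'(j)$ on the rest. $\mathfrak R_s$ is the set of permutations of $\{\ast,1,\dots,s\}$ (rooted permutations); the cycle containing $\ast$ is the root cycle, written starting at $\ast$. For $\tau\in\mathfrak R_a$, $\upsilon\in\mathfrak R_b$ with root cycles $(\ast,a_1,\dots,a_u)$ and $(\ast,b_1,\dots,b_v)$, $\tau\star\upsilon\in\mathfrak R_{a+b}$ has root cycle $(\ast,a_1,\dots,a_u,a+b_1,\dots,a+b_v)$, and its nonroot cycles are those of $\tau$ together with those of $\upsilon$ with every letter shifted by $a$. For $m\ge1$, $\mathcal D_m=\mathfrak S_{m^+}\times\mathfrak R_{m^-}$; for $\xi=(\sigma,\tau)\in\mathcal D_m$, $\deg_q\xi=m^+-c(\sigma)$ and $\deg_t\xi=c(\sigma)+c(\tau)-1$. If $a,b$ are not both odd, $(\sigma,\tau)\diamond(\sigma',\tau')=(\sigma\oplus\sigma',\tau\star\tau')$ defines $\diamond:\mathcal D_a\times\mathcal D_b\to\mathcal D_{a+b}$ (associative, bidegree-additive). Decorated complex. $C_k^{t,q}(\alpha)$ has basis the elements $(B_1,\dots,B_k;\xi_1,\dots,\xi_k)$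 with $\beta\succeq\alpha$, $\ell(\beta)=k$, $(B_1,\dots,B_k)\in\operatorname{OSP}_\beta[n]$, $\xi_i\in\mathcal D_{\beta_i}$; it is bigraded by the sums of the $\deg_t\xi_i$ and of the $\deg_q\xi_i$; $\mathfrak S_n$ acts on block labels and fixes decorations. The differential is $\sum_{i=1}^{k-1}(-1)^{i-1}d_i^{t,q}$, where $d_i^{t,q}$ merges $B_i,B_{i+1}$ and replaces $\xi_i,\xi_{i+1}$ by $\xi_i\diamond\xi_{i+1}$ if $\beta_i,\beta_{i+1}$ are not both odd, and is $0$ if both are odd. Factorization cuts. Let $\alpha\models n$ have at most one odd part and $\theta=(\sigma,\tau)\in\mathcal D_n$. A cut $c\in D(\alpha)$ is a factorization cut of $\theta$ if (a) $\sigma([c^+])=[c^+]$; and (b) every nonroot cycle of $\tau$ lies entirely in $[c^-]$ or entirely in $\{c^-+1,\dots,n^-\}$, and in the root cycle $(\ast,a_1,\dots,a_u)$ all letters $\le c^-$ come before all letters $>c^-$. $F_\alpha(\theta)$ is the set of factorization cuts $c\in D(\alpha)$ of $\theta$, and $\gamma_\alpha(\theta)=\gamma_{F_\alpha(\theta)}$. For a finite-dimensional bigraded $\mathfrak S_n$-module $V=\bigoplus V_{d,e}$, $\operatorname{ch}_{t,q}V=\sum_{d,e}\operatorname{ch}(V_{d,e})t^dq^e$, with $\operatorname{ch}$ the Frobenius characteristic. The homology contributed by $\theta$ is that of the summand indexed by $\theta$. *)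

theory Defs
  imports
    "HOL-Library.Multiset"
    "HOL-Library.Function_Algebras"
    "HOL-Combinatorics.Permutations"
    "HOL-Combinatorics.Cycles"
    "HOL-Combinatorics.Orbits"
    "HOL-Computational_Algebra.Polynomial"
begin

section \<open>Compositions\<close>

definition is_composition :: "nat \<Rightarrow> nat list \<Rightarrow> bool" where
  "is_composition n \<alpha> \<longleftrightarrow> (\<forall>a\<in>set \<alpha>. 0 < a) \<and> sum_list \<alpha> = n"

definition cut_set :: "nat list \<Rightarrow> nat set" where
  "cut_set \<alpha> = {sum_list (take i \<alpha>) | i. 1 \<le> i \<and> i < length \<alpha>}"

definition coarsenings :: "nat list \<Rightarrow> nat list set" where
  "coarsenings \<alpha> = {\<beta>. is_composition (sum_list \<alpha>) \<beta> \<and> cut_set \<beta> \<subseteq> cut_set \<alpha>}"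

definition comp_of_cuts :: "nat \<Rightarrow> nat set \<Rightarrow> nat list" where
  "comp_of_cuts n S = (THE \<gamma>. is_composition n \<gamma> \<and> cut_set \<gamma> = S)"

definition Des :: "nat \<Rightarrow> (nat \<Rightarrow> nat) \<Rightarrow> nat set" where
  "Des n \<pi> = {i. 1 \<le> i \<and> i < n \<and> \<pi> i > \<pi> (i + 1)}"


section \<open>Formal power series in countably many variables\<close>

text \<open>
  Symmetric functions are realised inside the ring of formal power series in the variables
  \<open>x\<^sub>0, x\<^sub>1, \<dots>\<close>. A monomial is a finite multiset of variable indices, and a series is its
  coefficient function.
\<close>

typedef 'a mseries = "UNIV :: (nat multiset \<Rightarrow> 'a) set"
  morphisms mcoeff Abs_mseries ..

lemma mcoeff_Abs [simp]: "mcoeff (Abs_mseries f) = f"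
  by (simp add: Abs_mseries_inverse)

lemma mseries_eqI: "(\<And>M. mcoeff f M = mcoeff g M) \<Longrightarrow> f = g"
  by (metis ext mcoeff_inject)

lemma finite_mset_splits: "finite {(A, B). A + B = (M :: 'b multiset)}"
proof (rule finite_subset)
  let ?L = "{xs. set xs \<subseteq> set_mset M \<and> length xs \<le> size M}"
  show "{(A, B). A + B = M} \<subseteq> (\<lambda>xs. (mset xs, M - mset xs)) ` ?L"
  proof
    fix p assume p: "p \<in> {(A, B). A + B = M}"
    obtain xs where "fst p = mset xs" by (metis ex_mset)
    with p show "p \<in> (\<lambda>xs. (mset xs, M - mset xs)) ` ?L"
      by (intro image_eqI[of _ _ xs]) auto
  qed
  show "finite ((\<lambda>xs. (mset xs, M - mset xs)) ` ?L)"
    by (intro finite_imageI finite_lists_length_le) simp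
qed

instantiation mseries :: (comm_ring_1) comm_ring_1
begin

definition "0 = Abs_mseries (\<lambda>M. 0)"
definition "1 = Abs_mseries (\<lambda>M. if M = {#} then 1 else 0)"
definition "f + g = Abs_mseries (\<lambda>M. mcoeff f M + mcoeff g M)"
definition "- f = Abs_mseries (\<lambda>M. - mcoeff f M)"
definition "f - g = Abs_mseries (\<lambda>M. mcoeff f M - mcoeff g M)"
definition "f * g = Abs_mseries (\<lambda>M. \<Sum>(A, B) | A + B = M. mcoeff f A * mcoeff g B)"

instance
proof
  fix a b c :: "'a mseries"
  note defs = zero_mseries_def one_mseries_def plus_mseries_def uminus_mseries_def
    minus_mseries_def times_mseries_def
  show "a + b + c = a + (b + c)" "a + b = b + a" "0 + a = a" "- a + a = 0" "a - b = a + - b"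
    by (simp_all add: defs algebra_simps mcoeff_inverse)
  show "(0::'a mseries) \<noteq> 1"
  proof
    assume "(0::'a mseries) = 1"
    then have "mcoeff (0::'a mseries) {#} = mcoeff 1 {#}" by simp
    then show False by (simp add: defs)
  qed
  show "a * b = b * a"
  proof (rule mseries_eqI)
    fix M
    have "(\<Sum>(A, B) | A + B = M. mcoeff a A * mcoeff b B)
        = (\<Sum>(A, B) | A + B = M. mcoeff b A * mcoeff a B)"
      by (rule sum.reindex_bij_witness[where i = prod.swap and j = prod.swap])
         (auto simp: add.commute mult.commute)
    then show "mcoeff (a * b) M = mcoeff (b * a) M" by (simp add: defs)
  qed
  show "1 * a = a"
  proof (rule mseries_eqI)
    fix M
    have "(\<Sum>(A, B) | A + B = M. (if A = {#} then 1 else 0) * mcoeff a B)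
        = (\<Sum>(A, B) \<in> {({#} :: nat multiset, M)}. (if A = {#} then 1 else 0) * mcoeff a B)"
      by (rule sum.mono_neutral_right) (auto simp: finite_mset_splits split: if_splits)
    then show "mcoeff (1 * a) M = mcoeff a M" by (simp add: defs)
  qed
  show "(a + b) * c = a * c + b * c"
    by (rule mseries_eqI)
       (simp add: defs case_prod_unfold distrib_right sum.distrib)
  show "a * b * c = a * (b * c)"
  proof (rule mseries_eqI)
    fix M
    have "mcoeff (a * b * c) M
        = (\<Sum>p | fst p + snd p = M. \<Sum>r | fst r + snd r = fst p.
            mcoeff a (fst r) * mcoeff b (snd r) * mcoeff c (snd p))"
      by (simp add: defs case_prod_unfold sum_distrib_right)
    also have "\<dots> = (\<Sum>(p, r) \<in> (SIGMA p:{p. fst p + snd p = M}. {r. fst r + snd r = fst p}).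
            mcoeff a (fst r) * mcoeff b (snd r) * mcoeff c (snd p))"
      using finite_mset_splits by (subst sum.Sigma) (auto simp: case_prod_unfold)
    also have "\<dots> = (\<Sum>(p, r) \<in> (SIGMA p:{p. fst p + snd p = M}. {r. fst r + snd r = snd p}).
            mcoeff a (fst p) * (mcoeff b (fst r) * mcoeff c (snd r)))"
      by (rule sum.reindex_bij_witness[where
            i = "\<lambda>(p, r). ((fst p + fst r, snd r), (fst p, fst r))" and
            j = "\<lambda>(p, r). ((fst r, snd r + snd p), (snd r, snd p))"])
         (auto simp: ac_simps)
    also have "\<dots> = (\<Sum>p | fst p + snd p = M. \<Sum>r | fst r + snd r = snd p.
            mcoeff a (fst p) * (mcoeff b (fst r) * mcoeff c (snd r)))"
      using finite_mset_splits by (subst sum.Sigma) (auto simp: case_prod_unfold)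
    also have "\<dots> = mcoeff (a * (b * c)) M"
      by (simp add: defs case_prod_unfold sum_distrib_left)
    finally show "mcoeff (a * b * c) M = mcoeff (a * (b * c)) M" .
  qed
qed

end

definition mconst :: "'a::zero \<Rightarrow> 'a mseries" where
  "mconst c = Abs_mseries (\<lambda>M. if M = {#} then c else 0)"


section \<open>Symmetric functions\<close>

definition hsym :: "nat \<Rightarrow> 'a::comm_ring_1 mseries" where
  "hsym m = Abs_mseries (\<lambda>M. if size M = m then 1 else 0)"

text \<open>Power sums; only used for \<open>m \<ge> 1\<close>.\<close>

definition psum :: "nat \<Rightarrow> 'a::comm_ring_1 mseries" where
  "psum m = Abs_mseries (\<lambda>M. if \<exists>i. M = replicate_mset m i then 1 else 0)"

definition hcomp :: "nat list \<Rightarrow> 'a::comm_ring_1 mseries" where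
  "hcomp \<beta> = prod_list (map hsym \<beta>)"

definition ribbon :: "nat list \<Rightarrow> 'a::comm_ring_1 mseries" where
  "ribbon \<alpha> = (\<Sum>\<beta>\<in>coarsenings \<alpha>. (- 1) ^ (length \<alpha> - length \<beta>) * hcomp \<beta>)"

definition is_partition :: "nat list \<Rightarrow> bool" where
  "is_partition \<mu> \<longleftrightarrow> (\<forall>a\<in>set \<mu>. 0 < a) \<and> sorted_wrt (\<ge>) \<mu>"

text \<open>Tableaux are lists of rows in English notation.\<close>

definition ssyt :: "nat list \<Rightarrow> nat list list set" where
  "ssyt \<mu> = {T. map length T = \<mu> \<and> (\<forall>row\<in>set T. sorted row) \<and>
     (\<forall>i j. i + 1 < length T \<longrightarrow> j < length (T ! (i + 1)) \<longrightarrow> T ! i ! j < T ! (i + 1) ! j)}"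

definition schur :: "nat list \<Rightarrow> 'a::comm_ring_1 mseries" where
  "schur \<mu> = Abs_mseries (\<lambda>M. of_nat (card {T \<in> ssyt \<mu>. mset (concat T) = M}))"

text \<open>Over an unordered field of characteristic zero, nonnegative coefficients are natural numbers.\<close>

definition schur_positive :: "'a::comm_ring_1 mseries \<Rightarrow> bool" where
  "schur_positive f \<longleftrightarrow> (\<exists>P c. finite P \<and> (\<forall>\<mu>\<in>P. is_partition \<mu>) \<and>
     f = (\<Sum>\<mu>\<in>P. of_nat (c \<mu>) * schur \<mu>))"

definition ribbon_positive :: "'a::comm_ring_1 mseries \<Rightarrow> bool" where
  "ribbon_positive f \<longleftrightarrow> (\<exists>P c. finite P \<and> (\<forall>\<gamma>\<in>P. \<forall>a\<in>set \<gamma>. 0 < a) \<and>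
     f = (\<Sum>\<gamma>\<in>P. of_nat (c \<gamma>) * ribbon \<gamma>))"


section \<open>Linear algebra: free modules, subquotients, traces\<close>

text \<open>
  All vector spaces below are subspaces of a space \<open>'x \<Rightarrow> 'k\<close> with pointwise operations;
  \<open>free X\<close> is the vector space with basis \<open>X\<close> (for finite \<open>X\<close>), whose basis vectors are the
  \<open>single x\<close>.
\<close>

definition scale :: "'k::comm_ring_1 \<Rightarrow> ('x \<Rightarrow> 'k) \<Rightarrow> 'x \<Rightarrow> 'k" where
  "scale c v = (\<lambda>x. c * v x)"

definition single :: "'x \<Rightarrow> 'x \<Rightarrow> 'k::comm_ring_1" where
  "single x = (\<lambda>y. if y = x then 1 else 0)"

definition free :: "'x set \<Rightarrow> ('x \<Rightarrow> 'k::comm_ring_1) set" where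
  "free X = {v. {x. v x \<noteq> 0} \<subseteq> X}"

text \<open>Linear extension of a map given on basis elements.\<close>

definition lin_ext :: "('x \<Rightarrow> 'y \<Rightarrow> 'k) \<Rightarrow> ('x \<Rightarrow> 'k) \<Rightarrow> 'y \<Rightarrow> 'k::comm_ring_1" where
  "lin_ext \<phi> v = (\<Sum>x | v x \<noteq> 0. scale (v x) (\<phi> x))"

definition linear_on_space ::
    "('x \<Rightarrow> 'k::comm_ring_1) set \<Rightarrow> (('x \<Rightarrow> 'k) \<Rightarrow> ('y \<Rightarrow> 'k)) \<Rightarrow> bool" where
  "linear_on_space V f \<longleftrightarrow> (\<forall>u\<in>V. \<forall>v\<in>V. f (u + v) = f u + f v) \<and>
     (\<forall>c. \<forall>v\<in>V. f (scale c v) = scale c (f v))"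

text \<open>
  A quotient space \<open>Z / B\<close> is represented by the pair \<open>(Z, B)\<close>. A set \<open>S\<close> of
  representatives is a \<open>quot_basis\<close> if the classes of its elements form a basis of \<open>Z / B\<close>.
  Dimension and trace are read off from any such basis; a linear map enters through a map on
  representatives that preserves \<open>Z\<close> and \<open>B\<close>.
\<close>

type_synonym ('x, 'k) subquot = "('x \<Rightarrow> 'k) set \<times> ('x \<Rightarrow> 'k) set"

definition is_quot_coords ::
    "('x, 'k::comm_ring_1) subquot \<Rightarrow> ('x \<Rightarrow> 'k) set \<Rightarrow> ('x \<Rightarrow> 'k) \<Rightarrow> (('x \<Rightarrow> 'k) \<Rightarrow> 'k) \<Rightarrow> bool"
  where
  "is_quot_coords V S v c \<longleftrightarrow>
     (\<forall>s. s \<notin> S \<longrightarrow> c s = 0) \<and> v - (\<Sum>s\<in>S. scale (c s) s) \<in> snd V"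

definition quot_basis :: "('x, 'k::comm_ring_1) subquot \<Rightarrow> ('x \<Rightarrow> 'k) set \<Rightarrow> bool" where
  "quot_basis V S \<longleftrightarrow> finite S \<and> S \<subseteq> fst V \<and> (\<forall>v\<in>fst V. \<exists>!c. is_quot_coords V S v c)"

definition quot_dim :: "('x, 'k::comm_ring_1) subquot \<Rightarrow> nat" where
  "quot_dim V = card (SOME S. quot_basis V S)"

definition quot_trace ::
    "('x, 'k::comm_ring_1) subquot \<Rightarrow> (('x \<Rightarrow> 'k) \<Rightarrow> ('x \<Rightarrow> 'k)) \<Rightarrow> 'k" where
  "quot_trace V f =
     (let S = SOME S. quot_basis V S in \<Sum>s\<in>S. (THE c. is_quot_coords V S (f s) c) s)"

definition quot_nonzero :: "('x, 'k) subquot \<Rightarrow> bool" where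
  "quot_nonzero V \<longleftrightarrow> \<not> fst V \<subseteq> snd V"


section \<open>Frobenius characteristic\<close>

text \<open>Permutations of a finite set are functions \<open>f\<close> with \<open>f permutes A\<close>; cycles on \<open>A\<close>, fixed
  points included, are identified with their underlying orbits.\<close>

definition cycles_on :: "nat set \<Rightarrow> (nat \<Rightarrow> nat) \<Rightarrow> nat set set" where
  "cycles_on A \<pi> = orbit \<pi> ` A"

definition psum_cycle_type :: "nat \<Rightarrow> (nat \<Rightarrow> nat) \<Rightarrow> 'a::comm_ring_1 mseries" where
  "psum_cycle_type n w = (\<Prod>Z\<in>cycles_on {1..n} w. psum (card Z))"

definition frob_ch ::
    "nat \<Rightarrow> ((nat \<Rightarrow> nat) \<Rightarrow> ('x \<Rightarrow> 'k) \<Rightarrow> ('x \<Rightarrow> 'k)) \<Rightarrow> ('x, 'k::field_char_0) subquot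
      \<Rightarrow> 'k mseries" where
  "frob_ch n act V =
     mconst (1 / fact n) *
     (\<Sum>w | w permutes {1..n}. mconst (quot_trace V (act w)) * psum_cycle_type n w)"

text \<open>Polynomials in \<open>t\<close> and \<open>q\<close> are of type \<open>_ poly poly\<close>, with \<open>t\<close> the outer variable:
  \<open>tq_monom d e f\<close> is \<open>f t\<^sup>d q\<^sup>e\<close> and \<open>tq_coeff p d e\<close> is the coefficient of \<open>t\<^sup>d q\<^sup>e\<close>.\<close>

definition tq_monom :: "nat \<Rightarrow> nat \<Rightarrow> 'a::zero \<Rightarrow> 'a poly poly" where
  "tq_monom d e f = monom (monom f e) d"

definition tq_coeff :: "'a::zero poly poly \<Rightarrow> nat \<Rightarrow> nat \<Rightarrow> 'a" where
  "tq_coeff p d e = coeff (coeff p d) e"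

definition frob_ch_tq ::
    "nat \<Rightarrow> ((nat \<Rightarrow> nat) \<Rightarrow> ('x \<Rightarrow> 'k) \<Rightarrow> ('x \<Rightarrow> 'k)) \<Rightarrow>
      (nat \<Rightarrow> nat \<Rightarrow> ('x, 'k::field_char_0) subquot) \<Rightarrow> 'k mseries poly poly" where
  "frob_ch_tq n act V =
     (\<Sum>(d, e) | quot_nonzero (V d e). tq_monom d e (frob_ch n act (V d e)))"


section \<open>Homology\<close>

text \<open>A complex is given by its spaces \<open>C k\<close> and a differential \<open>bd\<close>, defined on the common
  ambient space and mapping \<open>C (k + 1)\<close> to \<open>C k\<close>.\<close>

definition cycle_space ::
    "(nat \<Rightarrow> ('x \<Rightarrow> 'k) set) \<Rightarrow> (('x \<Rightarrow> 'k) \<Rightarrow> ('x \<Rightarrow> 'k)) \<Rightarrow> nat \<Rightarrow> ('x \<Rightarrow> 'k::comm_ring_1) set"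
  where
  "cycle_space C bd k = {v \<in> C k. bd v = 0}"

definition boundary_space ::
    "(nat \<Rightarrow> ('x \<Rightarrow> 'k) set) \<Rightarrow> (('x \<Rightarrow> 'k) \<Rightarrow> ('x \<Rightarrow> 'k)) \<Rightarrow> nat \<Rightarrow> ('x \<Rightarrow> 'k::comm_ring_1) set"
  where
  "boundary_space C bd k = bd ` C (k + 1)"

definition homology ::
    "(nat \<Rightarrow> ('x \<Rightarrow> 'k) set) \<Rightarrow> (('x \<Rightarrow> 'k) \<Rightarrow> ('x \<Rightarrow> 'k)) \<Rightarrow> nat \<Rightarrow> ('x, 'k::comm_ring_1) subquot"
  where
  "homology C bd k = (cycle_space C bd k, boundary_space C bd k)"


section \<open>The classical ribbon complex\<close>

definition OSP :: "nat list \<Rightarrow> nat \<Rightarrow> nat set list set" where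
  "OSP \<beta> n = {Bs. map card Bs = \<beta> \<and> \<Union> (set Bs) = {1..n} \<and>
     (\<forall>i j. i < j \<longrightarrow> j < length Bs \<longrightarrow> Bs ! i \<inter> Bs ! j = {})}"

definition rib_basis :: "nat list \<Rightarrow> nat \<Rightarrow> nat set list set" where
  "rib_basis \<alpha> k = (\<Union>\<beta>\<in>{\<beta> \<in> coarsenings \<alpha>. length \<beta> = k}. OSP \<beta> (sum_list \<alpha>))"

definition rib_chains :: "nat list \<Rightarrow> nat \<Rightarrow> (nat set list \<Rightarrow> 'k::comm_ring_1) set" where
  "rib_chains \<alpha> k = free (rib_basis \<alpha> k)"

text \<open>The index \<open>i\<close> of the face maps starts at \<open>1\<close>, list indices start at \<open>0\<close>.\<close>

definition merge_blocks :: "nat \<Rightarrow> nat set list \<Rightarrow> nat set list" where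
  "merge_blocks i Bs = take (i - 1) Bs @ [Bs ! (i - 1) \<union> Bs ! i] @ drop (i + 1) Bs"

definition rib_diff :: "(nat set list \<Rightarrow> 'k) \<Rightarrow> (nat set list \<Rightarrow> 'k::comm_ring_1)" where
  "rib_diff = lin_ext (\<lambda>Bs. \<Sum>i = 1..<length Bs. scale ((- 1) ^ (i - 1)) (single (merge_blocks i Bs)))"

definition relabel :: "(nat \<Rightarrow> nat) \<Rightarrow> nat set list \<Rightarrow> nat set list" where
  "relabel w Bs = map ((`) w) Bs"

definition rib_act ::
    "(nat \<Rightarrow> nat) \<Rightarrow> (nat set list \<Rightarrow> 'k) \<Rightarrow> (nat set list \<Rightarrow> 'k::comm_ring_1)" where
  "rib_act w = lin_ext (\<lambda>Bs. single (relabel w Bs))"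


section \<open>Decorations\<close>

definition upper_half :: "nat \<Rightarrow> nat" where "upper_half m = (m + 1) div 2"
definition lower_half :: "nat \<Rightarrow> nat" where "lower_half m = m div 2"

definition perm_sum :: "nat \<Rightarrow> (nat \<Rightarrow> nat) \<Rightarrow> (nat \<Rightarrow> nat) \<Rightarrow> nat \<Rightarrow> nat" where
  "perm_sum a \<sigma> \<sigma>' i = (if i \<le> a then \<sigma> i else a + \<sigma>' (i - a))"

text \<open>The root \<open>\<ast>\<close> of a rooted permutation is encoded as \<open>0\<close>, so that rooted permutations in
  \<open>\<RR>\<^sub>s\<close> are permutations of \<open>{0..s}\<close>. \<open>root_letters \<tau>\<close> lists \<open>a\<^sub>1, \<dots>, a\<^sub>u\<close> for the root cycle
  \<open>(\<ast>, a\<^sub>1, \<dots>, a\<^sub>u)\<close>, i.e. the iterated images of the root; the library's \<open>support \<tau> 0\<close> is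
  the list \<open>0, \<tau> 0, \<tau> (\<tau> 0), \<dots>\<close> of the letters of the cycle through \<open>0\<close>.\<close>

definition root_letters :: "(nat \<Rightarrow> nat) \<Rightarrow> nat list" where
  "root_letters \<tau> = tl (support \<tau> 0)"

definition rooted_product :: "nat \<Rightarrow> (nat \<Rightarrow> nat) \<Rightarrow> (nat \<Rightarrow> nat) \<Rightarrow> nat \<Rightarrow> nat" where
  "rooted_product a \<tau> \<upsilon> =
     (let L = 0 # root_letters \<tau> @ map (\<lambda>b. a + b) (root_letters \<upsilon>)
      in (\<lambda>x. if x \<in> set L then cycle_of_list L x
              else if x \<le> a then \<tau> x else a + \<upsilon> (x - a)))"

type_synonym decoration = "(nat \<Rightarrow> nat) \<times> (nat \<Rightarrow> nat)"

definition decorations :: "nat \<Rightarrow> decoration set" where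
  "decorations m = {(\<sigma>, \<tau>). \<sigma> permutes {1..upper_half m} \<and> \<tau> permutes {0..lower_half m}}"

definition deg_q :: "nat \<Rightarrow> decoration \<Rightarrow> nat" where
  "deg_q m = (\<lambda>(\<sigma>, \<tau>). upper_half m - card (cycles_on {1..upper_half m} \<sigma>))"

definition deg_t :: "nat \<Rightarrow> decoration \<Rightarrow> nat" where
  "deg_t m = (\<lambda>(\<sigma>, \<tau>).
     card (cycles_on {1..upper_half m} \<sigma>) + card (cycles_on {0..lower_half m} \<tau>) - 1)"

text \<open>The product \<open>\<xi> \<diamond> \<xi>'\<close> for \<open>\<xi>\<close> in \<open>decorations a\<close>. It is only meaningful when the sizes of
  the two factors are not both odd.\<close>

definition diamond :: "nat \<Rightarrow> decoration \<Rightarrow> decoration \<Rightarrow> decoration" where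
  "diamond a = (\<lambda>(\<sigma>, \<tau>) (\<sigma>', \<tau>').
     (perm_sum (upper_half a) \<sigma> \<sigma>', rooted_product (lower_half a) \<tau> \<tau>'))"

text \<open>\<open>\<xi>\<^sub>1 \<diamond> \<dots> \<diamond> \<xi>\<^sub>k\<close> for \<open>\<xi>\<^sub>i\<close> in \<open>decorations \<beta>\<^sub>i\<close> and \<open>k \<ge> 1\<close>; the empty product is a dummy
  value.\<close>

fun diamond_list :: "nat list \<Rightarrow> decoration list \<Rightarrow> decoration" where
  "diamond_list [b] [\<xi>] = \<xi>"
| "diamond_list (b # \<beta>) (\<xi> # \<xi>s) = diamond b \<xi> (diamond_list \<beta> \<xi>s)"
| "diamond_list _ _ = (id, id)"


section \<open>The decorated complex\<close>

type_synonym dec_osp = "nat set list \<times> decoration list"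

definition dec_basis :: "nat list \<Rightarrow> nat \<Rightarrow> dec_osp set" where
  "dec_basis \<alpha> k = (\<Union>\<beta>\<in>{\<beta> \<in> coarsenings \<alpha>. length \<beta> = k}.
     OSP \<beta> (sum_list \<alpha>) \<times> {\<xi>s. length \<xi>s = k \<and> (\<forall>i<k. \<xi>s ! i \<in> decorations (\<beta> ! i))})"

definition dec_deg_t :: "dec_osp \<Rightarrow> nat" where
  "dec_deg_t = (\<lambda>(Bs, \<xi>s). \<Sum>i<length Bs. deg_t (card (Bs ! i)) (\<xi>s ! i))"

definition dec_deg_q :: "dec_osp \<Rightarrow> nat" where
  "dec_deg_q = (\<lambda>(Bs, \<xi>s). \<Sum>i<length Bs. deg_q (card (Bs ! i)) (\<xi>s ! i))"

definition dec_chains :: "nat list \<Rightarrow> nat \<Rightarrow> (dec_osp \<Rightarrow> 'k::comm_ring_1) set" where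
  "dec_chains \<alpha> k = free (dec_basis \<alpha> k)"

definition dec_part :: "nat \<Rightarrow> nat \<Rightarrow> (dec_osp \<Rightarrow> 'k::comm_ring_1) set" where
  "dec_part d e = free {x. dec_deg_t x = d \<and> dec_deg_q x = e}"

definition dec_face :: "nat \<Rightarrow> dec_osp \<Rightarrow> (dec_osp \<Rightarrow> 'k::comm_ring_1)" where
  "dec_face i = (\<lambda>(Bs, \<xi>s).
     if odd (card (Bs ! (i - 1))) \<and> odd (card (Bs ! i)) then 0
     else single (merge_blocks i Bs,
       take (i - 1) \<xi>s @ [diamond (card (Bs ! (i - 1))) (\<xi>s ! (i - 1)) (\<xi>s ! i)] @ drop (i + 1) \<xi>s))"

definition dec_diff :: "(dec_osp \<Rightarrow> 'k) \<Rightarrow> (dec_osp \<Rightarrow> 'k::comm_ring_1)" where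
  "dec_diff = lin_ext (\<lambda>x. \<Sum>i = 1..<length (fst x). scale ((- 1) ^ (i - 1)) (dec_face i x))"

definition dec_act ::
    "(nat \<Rightarrow> nat) \<Rightarrow> (dec_osp \<Rightarrow> 'k) \<Rightarrow> (dec_osp \<Rightarrow> 'k::comm_ring_1)" where
  "dec_act w = lin_ext (\<lambda>(Bs, \<xi>s). single (relabel w Bs, \<xi>s))"

definition dec_homology ::
    "nat list \<Rightarrow> nat \<Rightarrow> nat \<Rightarrow> nat \<Rightarrow> (dec_osp, 'k::comm_ring_1) subquot" where
  "dec_homology \<alpha> k d e =
     (cycle_space (dec_chains \<alpha>) dec_diff k \<inter> dec_part d e,
      boundary_space (dec_chains \<alpha>) dec_diff k \<inter> dec_part d e)"


section \<open>Factorization cuts\<close>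

definition is_factorization_cut :: "nat \<Rightarrow> decoration \<Rightarrow> nat \<Rightarrow> bool" where
  "is_factorization_cut n = (\<lambda>(\<sigma>, \<tau>) c.
     \<sigma> ` {1..upper_half c} = {1..upper_half c} \<and>
     (\<forall>Z\<in>cycles_on {0..lower_half n} \<tau>. 0 \<notin> Z \<longrightarrow>
        Z \<subseteq> {1..lower_half c} \<or> Z \<subseteq> {lower_half c + 1..lower_half n}) \<and>
     (\<forall>i<length (root_letters \<tau>). \<forall>j<length (root_letters \<tau>).
        root_letters \<tau> ! i \<le> lower_half c \<longrightarrow> root_letters \<tau> ! j > lower_half c \<longrightarrow> i < j))"

definition fact_cuts :: "nat list \<Rightarrow> decoration \<Rightarrow> nat set" where
  "fact_cuts \<alpha> \<theta> = {c \<in> cut_set \<alpha>. is_factorization_cut (sum_list \<alpha>) \<theta> c}"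

definition fact_comp :: "nat list \<Rightarrow> decoration \<Rightarrow> nat list" where
  "fact_comp \<alpha> \<theta> = comp_of_cuts (sum_list \<alpha>) (fact_cuts \<alpha> \<theta>)"


section \<open>The direct sum of ribbon complexes\<close>

text \<open>An element \<open>v\<close> of the direct sum over \<open>\<theta>\<close> is a function of pairs \<open>(\<theta>, Bs)\<close> whose component at
  \<open>\<theta>\<close> is \<open>component v \<theta>\<close>. There are only finitely many summands.\<close>

type_synonym sum_osp = "decoration \<times> nat set list"

definition component :: "(sum_osp \<Rightarrow> 'k) \<Rightarrow> decoration \<Rightarrow> nat set list \<Rightarrow> 'k" where
  "component v \<theta> = (\<lambda>Bs. v (\<theta>, Bs))"

definition sum_chains :: "nat list \<Rightarrow> nat \<Rightarrow> (sum_osp \<Rightarrow> 'k::comm_ring_1) set" where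
  "sum_chains \<alpha> k = {v. \<forall>\<theta>.
     if \<theta> \<in> decorations (sum_list \<alpha>) then component v \<theta> \<in> rib_chains (fact_comp \<alpha> \<theta>) k
     else component v \<theta> = 0}"

definition sum_part :: "nat \<Rightarrow> nat \<Rightarrow> nat \<Rightarrow> (sum_osp \<Rightarrow> 'k::comm_ring_1) set" where
  "sum_part n d e = {v. \<forall>\<theta>. component v \<theta> \<noteq> 0 \<longrightarrow> deg_t n \<theta> = d \<and> deg_q n \<theta> = e}"

definition sum_diff :: "(sum_osp \<Rightarrow> 'k) \<Rightarrow> (sum_osp \<Rightarrow> 'k::comm_ring_1)" where
  "sum_diff v = (\<lambda>(\<theta>, Bs). rib_diff (component v \<theta>) Bs)"

definition sum_act ::
    "(nat \<Rightarrow> nat) \<Rightarrow> (sum_osp \<Rightarrow> 'k) \<Rightarrow> (sum_osp \<Rightarrow> 'k::comm_ring_1)" where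
  "sum_act w v = (\<lambda>(\<theta>, Bs). rib_act w (component v \<theta>) Bs)"


text \<open>Bidegree-preserving, \<open>\<SS>\<^sub>n\<close>-equivariant chain isomorphisms from the decorated complex to the
  direct sum, where \<open>\<Phi> k\<close> is the component in homological degree \<open>k\<close>.\<close>

definition is_decomposition_iso ::
    "nat list \<Rightarrow> (nat \<Rightarrow> (dec_osp \<Rightarrow> 'k::comm_ring_1) \<Rightarrow> (sum_osp \<Rightarrow> 'k)) \<Rightarrow> bool" where
  "is_decomposition_iso \<alpha> \<Phi> \<longleftrightarrow>
     (\<forall>k. linear_on_space (dec_chains \<alpha> k) (\<Phi> k) \<and>
          bij_betw (\<Phi> k) (dec_chains \<alpha> k) (sum_chains \<alpha> k)) \<and>
     (\<forall>k. \<forall>v\<in>dec_chains \<alpha> (k + 1). \<Phi> k (dec_diff v) = sum_diff (\<Phi> (k + 1) v)) \<and>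
     (\<forall>k w. w permutes {1..sum_list \<alpha>} \<longrightarrow>
        (\<forall>v\<in>dec_chains \<alpha> k. \<Phi> k (dec_act w v) = sum_act w (\<Phi> k v))) \<and>
     (\<forall>k d e. \<Phi> k ` (dec_chains \<alpha> k \<inter> dec_part d e) =
        sum_chains \<alpha> k \<inter> sum_part (sum_list \<alpha>) d e)"

text \<open>The canonical map sends a decorated ordered set partition to the underlying ordered set
  partition, placed in the summand indexed by the product of its decorations.\<close>

definition is_canonical ::
    "nat list \<Rightarrow> (nat \<Rightarrow> (dec_osp \<Rightarrow> 'k::comm_ring_1) \<Rightarrow> (sum_osp \<Rightarrow> 'k)) \<Rightarrow> bool" where
  "is_canonical \<alpha> \<Phi> \<longleftrightarrow> (\<forall>k. \<forall>(Bs, \<xi>s)\<in>dec_basis \<alpha> k.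
     \<Phi> k (single (Bs, \<xi>s)) = single (diamond_list (map card Bs) \<xi>s, Bs))"

end

theory Submission
  imports Defs
begin

text \<open>
The decorated complex splits because the products on decorations have unique factorization. Both
  components of \<open>\<xi> \<diamond> \<xi>'\<close> are concatenations. For the rooted component this is visible once
  \<open>\<tau> \<star> \<upsilon>\<close> is written as the composition of \<open>\<tau>\<close> with a copy of \<open>\<upsilon>\<close> that lives on the root and on
  the shifted letters (\<open>rooted_product_eq\<close>). A permutation \<open>\<pi>\<close> of \<open>{0..a + b}\<close> has this form exactly
  if every letter above \<open>a\<close> is sent to the root or to a letter above \<open>a\<close>, and then \<open>\<tau>\<close> and \<open>\<upsilon>\<close> are
  determined by \<open>\<pi>\<close>; this local condition is equivalent to the condition on cycles that defines a
  factorization cut. Consequently, for block sizes \<open>\<beta>\<close>, the iterated product is a bijection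
  from the lists of decorations of sizes \<open>\<beta>\<close> to the decorations \<open>\<theta>\<close> for which every cut of \<open>\<beta>\<close>
  is a factorization cut (\<open>diamond_list_bij\<close>). The coarsenings of \<open>\<gamma>\<^sub>\<alpha>(\<theta>)\<close> are the coarsenings of
  \<open>\<alpha>\<close> all of whose cuts are factorization cuts of \<open>\<theta>\<close>. So sending \<open>(B, \<xi>)\<close> to \<open>B\<close> in the summand of
  the product of \<open>\<xi>\<close> is a bijection between the bases of the two complexes. It is compatible with
  the differentials by associativity, since no two adjacent blocks are both odd, and with the
  bidegrees by additivity.

  It remains to understand the ribbon complex of one composition \<open>\<gamma>\<close>. Call a pair of letters that
  stand in the wrong order in different blocks a cross inversion. Merging blocks never creates cross
  inversions. Splitting the \<open>\<gamma>\<^sub>1\<close> smallest letters off the first block, or the corresponding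
  operation further to the right, is a contracting homotopy up to terms with fewer cross inversions
  (\<open>homotopy_modulo_lower\<close>). Hence all cycles below the top degree \<open>\<ell>(\<gamma>)\<close> are boundaries.

  By exactness, the trace of a permutation on the top homology is the alternating sum of its numbers
  of fixed ordered set partitions. Burnside's lemma for pairs of an ordered set partition and a
  colouring of \<open>[n]\<close> shows that the Frobenius characteristic of \<open>M\<^sup>\<beta>\<close> is \<open>h\<^sub>\<beta>\<close>
  (\<open>frob_permutation_module\<close>), so the alternating sum becomes the ribbon Schur function of \<open>\<gamma>\<close>.
  At the identity it counts permutations with descent set \<open>D(\<gamma>)\<close> and gives the dimension, which is
  positive since every subset of \<open>[n - 1]\<close> is a descent set. Transporting traces along the
  decomposition yields the graded Frobenius characteristic.

  For Schur positivity, the coefficient of a monomial in the ribbon Schur function of \<open>\<gamma>\<close> counts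
  words with descent set \<open>D(\<gamma>)\<close>. Under the Robinson-Schensted-Knuth correspondence the descents
  depend on the recording tableau only, so the words with a fixed recording tableau contribute one
  Schur function (\<open>ribbon_schur_expansion\<close>).
\<close>

section \<open>Linear algebra of subquotients\<close>

interpretation fspace: vector_space "scale :: 'k::field \<Rightarrow> ('x \<Rightarrow> 'k) \<Rightarrow> 'x \<Rightarrow> 'k"
  by unfold_locales (auto simp: scale_def fun_eq_iff algebra_simps)

lemma scale_apply [simp]: "scale c v x = c * v x"
  by (simp add: scale_def)

lemma sum_fun_apply: "(\<Sum>i\<in>I. f i) x = (\<Sum>i\<in>I. f i x)"
  by (induction I rule: infinite_finite_induct) auto

lemma single_apply: "single x y = (if y = x then 1 else 0)"
  by (simp add: single_def)

lemma single_neq_0 [simp]: "(single x y :: 'k::comm_ring_1) \<noteq> 0 \<longleftrightarrow> y = x"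
  by (simp add: single_def)

lemma single_in_free: "x \<in> X \<Longrightarrow> single x \<in> free X"
  by (auto simp: free_def)

lemma freeD: "v \<in> free X \<Longrightarrow> x \<notin> X \<Longrightarrow> v x = 0"
  by (auto simp: free_def)

lemma freeI: "(\<And>x. x \<notin> X \<Longrightarrow> v x = 0) \<Longrightarrow> v \<in> free X"
  by (auto simp: free_def)

lemma subspace_free: "fspace.subspace (free X :: ('x \<Rightarrow> 'k::field) set)"
  by (rule fspace.subspaceI) (auto intro!: freeI simp: freeD)

lemma free_empty [simp]: "free {} = {0}"
  by (auto simp: free_def fun_eq_iff)

lemma free_Int: "free X \<inter> free Y = free (X \<inter> Y)"
  by (auto simp: free_def)

lemma lin_ext_superset:
  assumes "finite X" "v \<in> free X"
  shows "lin_ext \<phi> v = (\<Sum>x\<in>X. scale (v x) (\<phi> x))"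
  unfolding lin_ext_def using assms
  by (intro sum.mono_neutral_left) (auto simp: free_def scale_def fun_eq_iff)

lemma lin_ext_single [simp]: "lin_ext \<phi> (single x) = \<phi> x"
  by (simp add: lin_ext_def single_apply scale_def)

lemma linear_lin_ext:
  fixes \<phi> :: "'x \<Rightarrow> 'y \<Rightarrow> 'k::field"
  assumes "finite X"
  shows "linear_on_space (free X) (lin_ext \<phi>)"
proof -
  have "lin_ext \<phi> (u + v) = lin_ext \<phi> u + lin_ext \<phi> v" if "u \<in> free X" "v \<in> free X" for u v
    using that fspace.subspace_add[OF subspace_free that]
    by (simp add: lin_ext_superset[OF assms] fspace.scale_left_distrib sum.distrib)
  moreover have "lin_ext \<phi> (scale c v) = scale c (lin_ext \<phi> v)" if "v \<in> free X" for c v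
    using that fspace.subspace_scale[OF subspace_free that]
    by (simp add: lin_ext_superset[OF assms] fspace.scale_sum_right)
  ultimately show ?thesis by (auto simp: linear_on_space_def)
qed

lemma linear_on_space_subset: "linear_on_space V f \<Longrightarrow> U \<subseteq> V \<Longrightarrow> linear_on_space U f"
  unfolding linear_on_space_def by blast

lemma linear_on_space_add: "linear_on_space V f \<Longrightarrow> u \<in> V \<Longrightarrow> v \<in> V \<Longrightarrow> f (u + v) = f u + f v"
  by (auto simp: linear_on_space_def)

lemma linear_on_space_scale: "linear_on_space V f \<Longrightarrow> v \<in> V \<Longrightarrow> f (scale c v) = scale c (f v)"
  by (auto simp: linear_on_space_def)

lemma linear_on_space_0:
  fixes f :: "('x \<Rightarrow> 'k::field) \<Rightarrow> ('y \<Rightarrow> 'k)"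
  assumes "linear_on_space V f" "fspace.subspace V"
  shows "f 0 = 0"
  using linear_on_space_scale[OF assms(1) fspace.subspace_0[OF assms(2)], of 0]
  by (simp add: scale_def zero_fun_def)

lemma linear_on_space_sum:
  fixes f :: "('x \<Rightarrow> 'k::field) \<Rightarrow> ('y \<Rightarrow> 'k)"
  assumes "linear_on_space V f" "fspace.subspace V" "\<And>i. i \<in> I \<Longrightarrow> v i \<in> V"
  shows "f (\<Sum>i\<in>I. v i) = (\<Sum>i\<in>I. f (v i))"
  using assms(3)
  by (induction I rule: infinite_finite_induct)
     (auto simp: linear_on_space_0[OF assms(1,2)] linear_on_space_add[OF assms(1)]
           fspace.subspace_sum[OF assms(2)])

lemma linear_on_space_sum_scale:
  fixes f :: "('x \<Rightarrow> 'k::field) \<Rightarrow> ('y \<Rightarrow> 'k)"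
  assumes "linear_on_space V f" "fspace.subspace V" "\<And>i. i \<in> I \<Longrightarrow> v i \<in> V"
  shows "f (\<Sum>i\<in>I. scale (a i) (v i)) = (\<Sum>i\<in>I. scale (a i) (f (v i)))"
proof -
  have "f (\<Sum>i\<in>I. scale (a i) (v i)) = (\<Sum>i\<in>I. f (scale (a i) (v i)))"
    by (rule linear_on_space_sum[OF assms(1,2)]) (rule fspace.subspace_scale[OF assms(2,3)])
  also have "\<dots> = (\<Sum>i\<in>I. scale (a i) (f (v i)))"
    by (intro sum.cong refl linear_on_space_scale[OF assms(1)] assms(3))
  finally show ?thesis .
qed

lemma linear_on_space_diff:
  fixes f :: "('x \<Rightarrow> 'k::field) \<Rightarrow> ('y \<Rightarrow> 'k)"
  assumes "linear_on_space V f" "fspace.subspace V" "u \<in> V" "v \<in> V"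
  shows "f (u - v) = f u - f v"
proof -
  have "f (u + scale (-1) v) = f u + scale (-1) (f v)"
    by (subst linear_on_space_add[OF assms(1,3) fspace.subspace_scale[OF assms(2,4)]])
       (subst linear_on_space_scale[OF assms(1,4)], rule refl)
  moreover have "u + scale (-1) v = u - v" "f u + scale (-1) (f v) = f u - f v"
    by (auto simp: fun_eq_iff)
  ultimately show ?thesis by metis
qed

lemma free_expand:
  assumes "finite X" "v \<in> free X"
  shows "v = (\<Sum>x\<in>X. scale (v x) (single x))"
proof
  fix y
  have "(\<Sum>x\<in>X. scale (v x) (single x)) y = (\<Sum>x\<in>X. if x = y then v y else 0)"
    by (auto simp: sum_fun_apply single_apply intro!: sum.cong)
  then show "v y = (\<Sum>x\<in>X. scale (v x) (single x)) y"
    using assms by (auto simp: freeD)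
qed

lemma lin_ext_in_subspace:
  assumes "finite X" "v \<in> free X" "fspace.subspace U" "\<And>x. x \<in> X \<Longrightarrow> \<phi> x \<in> U"
  shows "lin_ext \<phi> v \<in> U"
  by (auto simp: lin_ext_superset[OF assms(1,2)] intro!: fspace.subspace_sum fspace.subspace_scale assms)

lemma lin_ext_relabel_apply:
  assumes "finite X" "inj_on g X" "v \<in> free X" "x \<in> X"
  shows "lin_ext (\<lambda>x. single (g x)) v (g x) = v x"
proof -
  have "v y * single (g y) (g x) = (if y = x then v x else 0)" if "y \<in> X" for y
    using that assms by (auto simp: single_apply inj_on_eq_iff)
  then have "lin_ext (\<lambda>x. single (g x)) v (g x) = (\<Sum>y\<in>X. if y = x then v x else 0)"
    by (simp add: lin_ext_superset[OF assms(1,3)] sum_fun_apply)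
  then show ?thesis using assms by simp
qed

lemma bij_betw_free:
  assumes "finite X" "bij_betw g X Y"
  shows "bij_betw (lin_ext (\<lambda>x. single (g x))) (free X) (free Y :: ('y \<Rightarrow> 'k::field) set)"
proof (rule bij_betw_imageI)
  have inj: "inj_on g X" and Y: "Y = g ` X" using assms(2) by (auto simp: bij_betw_def)
  show "inj_on (lin_ext (\<lambda>x. single (g x))) (free X :: ('a \<Rightarrow> 'k) set)"
  proof (rule inj_onI, rule ext)
    fix u v :: "'a \<Rightarrow> 'k" and x
    assume *: "u \<in> free X" "v \<in> free X"
      "lin_ext (\<lambda>x. single (g x)) u = lin_ext (\<lambda>x. single (g x)) v"
    show "u x = v x"
    proof (cases "x \<in> X")
      case True
      with lin_ext_relabel_apply[OF assms(1) inj *(1) True] lin_ext_relabel_apply[OF assms(1) inj *(2) True]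
      show ?thesis using *(3) by simp
    qed (use * in \<open>simp add: freeD\<close>)
  qed
  show "lin_ext (\<lambda>x. single (g x)) ` free X = (free Y :: ('y \<Rightarrow> 'k) set)"
  proof (intro equalityI subsetI)
    fix w :: "'y \<Rightarrow> 'k" assume w: "w \<in> free Y"
    define v where "v = (\<lambda>x. if x \<in> X then w (g x) else 0)"
    have v: "v \<in> free X" by (auto simp: v_def free_def)
    have *: "lin_ext (\<lambda>x. single (g x)) v \<in> (free Y :: ('y \<Rightarrow> 'k) set)"
      by (rule lin_ext_in_subspace[OF assms(1) v subspace_free]) (auto simp: Y intro!: single_in_free)
    have "lin_ext (\<lambda>x. single (g x)) v y = w y" for y
    proof (cases "y \<in> Y")
      case True
      then obtain x where "x \<in> X" "y = g x" by (auto simp: Y)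
      then show ?thesis using lin_ext_relabel_apply[OF assms(1) inj v] by (auto simp: v_def)
    qed (use * w in \<open>auto simp: freeD\<close>)
    then have "lin_ext (\<lambda>x. single (g x)) v = w" by (rule ext)
    then show "w \<in> lin_ext (\<lambda>x. single (g x)) ` free X" using v by (intro image_eqI[of _ _ v]) simp_all
  next
    fix w :: "'y \<Rightarrow> 'k" assume "w \<in> lin_ext (\<lambda>x. single (g x)) ` free X"
    then obtain v where v: "v \<in> free X" "w = lin_ext (\<lambda>x. single (g x)) v" by auto
    show "w \<in> free Y" unfolding v(2)
      by (rule lin_ext_in_subspace[OF assms(1) v(1) subspace_free]) (auto simp: Y intro!: single_in_free)
  qed
qed

subsection \<open>Coordinates and traces\<close>

text \<open>Pairs \<open>(Z, B)\<close> that really describe a quotient space \<open>Z / B\<close>.\<close>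

definition subquotient :: "('x, 'k::field) subquot \<Rightarrow> bool" where
  "subquotient V \<longleftrightarrow> fspace.subspace (fst V) \<and> fspace.subspace (snd V) \<and> snd V \<subseteq> fst V"

definition endo :: "('x, 'k::field) subquot \<Rightarrow> (('x \<Rightarrow> 'k) \<Rightarrow> ('x \<Rightarrow> 'k)) \<Rightarrow> bool" where
  "endo V f \<longleftrightarrow> linear_on_space (fst V) f \<and> f ` fst V \<subseteq> fst V \<and> f ` snd V \<subseteq> snd V"

definition quot_coords :: "('x, 'k::field) subquot \<Rightarrow> ('x \<Rightarrow> 'k) set \<Rightarrow> ('x \<Rightarrow> 'k) \<Rightarrow> ('x \<Rightarrow> 'k) \<Rightarrow> 'k" where
  "quot_coords V S v = (THE c. is_quot_coords V S v c)"

lemma is_quot_coords_quot_coords: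
  assumes "quot_basis V S" "v \<in> fst V"
  shows "is_quot_coords V S v (quot_coords V S v)"
proof -
  have "\<exists>!c. is_quot_coords V S v c" using assms by (auto simp: quot_basis_def)
  then show ?thesis unfolding quot_coords_def by (rule theI')
qed

lemma quot_coords_eqI:
  assumes "quot_basis V S" "v \<in> fst V" "is_quot_coords V S v c"
  shows "quot_coords V S v = c"
proof -
  have "\<exists>!c. is_quot_coords V S v c" using assms by (auto simp: quot_basis_def)
  with is_quot_coords_quot_coords[OF assms(1,2)] assms(3) show ?thesis by blast
qed

lemma quot_coords_cong:
  assumes V: "subquotient V" and S: "quot_basis V S" and v: "v \<in> fst V" "v - u \<in> snd V"
  shows "quot_coords V S u = quot_coords V S v"
proof (rule quot_coords_eqI[OF S])
  have "fspace.subspace (fst V)" "v - u \<in> fst V" using V v by (auto simp: subquotient_def)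
  then have "v - (v - u) \<in> fst V" using v(1) by (metis fspace.subspace_diff)
  then show "u \<in> fst V" by simp
  let ?c = "quot_coords V S v"
  have c: "is_quot_coords V S v ?c" by (rule is_quot_coords_quot_coords[OF S v(1)])
  then have "(v - (\<Sum>s\<in>S. scale (?c s) s)) - (v - u) \<in> snd V"
    using V v(2) unfolding subquotient_def is_quot_coords_def by (metis fspace.subspace_diff)
  then show "is_quot_coords V S u ?c"
    using c by (simp add: is_quot_coords_def algebra_simps)
qed

lemma quot_coords_sum:
  assumes V: "subquotient V" and S: "quot_basis V S" and v: "\<And>i. i \<in> I \<Longrightarrow> v i \<in> fst V"
  shows "quot_coords V S (\<Sum>i\<in>I. scale (a i) (v i)) s = (\<Sum>i\<in>I. a i * quot_coords V S (v i) s)"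
proof -
  let ?c = "\<lambda>i. quot_coords V S (v i)"
  have c: "is_quot_coords V S (v i) (?c i)" if "i \<in> I" for i
    by (rule is_quot_coords_quot_coords[OF S v[OF that]])
  have "quot_coords V S (\<Sum>i\<in>I. scale (a i) (v i)) = (\<lambda>s. \<Sum>i\<in>I. a i * ?c i s)"
  proof (rule quot_coords_eqI[OF S])
    show "(\<Sum>i\<in>I. scale (a i) (v i)) \<in> fst V"
      using V v by (auto simp: subquotient_def intro!: fspace.subspace_sum fspace.subspace_scale)
    have "(\<Sum>s\<in>S. scale (\<Sum>i\<in>I. a i * ?c i s) s) = (\<Sum>i\<in>I. scale (a i) (\<Sum>s\<in>S. scale (?c i s) s))"
      by (simp add: fspace.scale_sum_left fspace.scale_sum_right)
        (subst sum.swap, simp)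
    then have "(\<Sum>i\<in>I. scale (a i) (v i)) - (\<Sum>s\<in>S. scale (\<Sum>i\<in>I. a i * ?c i s) s)
        = (\<Sum>i\<in>I. scale (a i) (v i - (\<Sum>s\<in>S. scale (?c i s) s)))"
      by (simp add: sum_subtractf fspace.scale_right_diff_distrib)
    also have "\<dots> \<in> snd V"
      using V c by (auto simp: subquotient_def is_quot_coords_def
          intro!: fspace.subspace_sum fspace.subspace_scale)
    finally show "is_quot_coords V S (\<Sum>i\<in>I. scale (a i) (v i)) (\<lambda>s. \<Sum>i\<in>I. a i * ?c i s)"
      using c by (auto simp: is_quot_coords_def intro!: sum.neutral)
  qed
  then show ?thesis by simp
qed

lemma quot_basis_in: "quot_basis V S \<Longrightarrow> s \<in> S \<Longrightarrow> s \<in> fst V"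
  by (auto simp: quot_basis_def)

lemma quot_coords_self:
  assumes "subquotient V" "quot_basis V S" "s \<in> S"
  shows "quot_coords V S s = (\<lambda>r. if r = s then 1 else 0)"
proof (rule quot_coords_eqI[OF assms(2) quot_basis_in[OF assms(2,3)]])
  have "(\<Sum>r\<in>S. scale (if r = s then 1 else 0) r) = (\<Sum>r\<in>S. if r = s then s else 0)"
    by (intro sum.cong refl) simp
  also have "\<dots> = s" using assms(2,3) by (simp add: quot_basis_def)
  finally have "s - (\<Sum>r\<in>S. scale (if r = s then 1 else 0) r) = 0" by simp
  then show "is_quot_coords V S s (\<lambda>r. if r = s then 1 else 0)"
    unfolding is_quot_coords_def using assms(1,3) fspace.subspace_0 by (metis subquotient_def)
qed

lemma quot_basis_notin:
  assumes "subquotient V" "quot_basis V S" "s \<in> S"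
  shows "s \<notin> snd V"
proof
  assume "s \<in> snd V"
  then have "is_quot_coords V S s (\<lambda>_. 0)" by (simp add: is_quot_coords_def)
  then have "quot_coords V S s = (\<lambda>_. 0)"
    by (rule quot_coords_eqI[OF assms(2) quot_basis_in[OF assms(2,3)]])
  with quot_coords_self[OF assms] show False by (metis zero_neq_one)
qed

lemma quot_coords_expand:
  assumes V: "subquotient V" and S: "quot_basis V S" and v: "v \<in> fst V" and f: "endo V f"
    and S': "quot_basis V S'"
  shows "quot_coords V S' (f v) s' = (\<Sum>s\<in>S. quot_coords V S v s * quot_coords V S' (f s) s')"
proof -
  let ?c = "quot_coords V S v"
  have "v - (\<Sum>s\<in>S. scale (?c s) s) \<in> snd V"
    using is_quot_coords_quot_coords[OF S v] by (simp add: is_quot_coords_def)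
  then have "f (v - (\<Sum>s\<in>S. scale (?c s) s)) \<in> snd V" using f by (auto simp: endo_def)
  moreover have Sv: "(\<Sum>s\<in>S. scale (?c s) s) \<in> fst V"
    using V quot_basis_in[OF S]
    by (auto simp: subquotient_def intro!: fspace.subspace_sum fspace.subspace_scale)
  have f': "linear_on_space (fst V) f" "fspace.subspace (fst V)"
    using f V by (auto simp: endo_def subquotient_def)
  have "f (\<Sum>s\<in>S. scale (?c s) s) = (\<Sum>s\<in>S. scale (?c s) (f s))"
    by (rule linear_on_space_sum_scale[OF f']) (rule quot_basis_in[OF S])
  ultimately have "f v - (\<Sum>s\<in>S. scale (?c s) (f s)) \<in> snd V"
    using linear_on_space_diff[OF f' v Sv] by simp
  then have "quot_coords V S' (f v) s' = quot_coords V S' (\<Sum>s\<in>S. scale (?c s) (f s)) s'"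
    using f v quot_coords_cong[OF V S', of "f v"] by (auto simp: endo_def)
  also have "\<dots> = (\<Sum>s\<in>S. ?c s * quot_coords V S' (f s) s')"
    using f quot_basis_in[OF S] by (intro quot_coords_sum[OF V S']) (auto simp: endo_def)
  finally show ?thesis .
qed

text \<open>The usual argument for \<open>tr(PQ) = tr(QP)\<close>: expand \<open>f s\<close> in the other basis and exchange the two
  sums over base change coefficients.\<close>

lemma trace_basis_independent:
  assumes V: "subquotient V" and f: "endo V f" and S: "quot_basis V S" and S': "quot_basis V S'"
  shows "(\<Sum>s\<in>S. quot_coords V S (f s) s) = (\<Sum>s\<in>S'. quot_coords V S' (f s) s)"
proof -
  have id: "endo V (\<lambda>v. v)" by (auto simp: endo_def linear_on_space_def)
  have fs: "f s \<in> fst V" if "s \<in> fst V" for s using f that by (auto simp: endo_def)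
  have "(\<Sum>s\<in>S. quot_coords V S (f s) s)
      = (\<Sum>s\<in>S. \<Sum>r\<in>S'. quot_coords V S' s r * quot_coords V S (f r) s)"
    by (intro sum.cong refl quot_coords_expand[OF V S' _ f S] quot_basis_in[OF S])
  also have "\<dots> = (\<Sum>r\<in>S'. \<Sum>s\<in>S. quot_coords V S (f r) s * quot_coords V S' s r)"
    by (subst sum.swap) (simp add: mult.commute)
  also have "\<dots> = (\<Sum>r\<in>S'. quot_coords V S' (f r) r)"
    by (intro sum.cong refl quot_coords_expand[OF V S _ id S', symmetric] fs quot_basis_in[OF S'])
  finally show ?thesis .
qed

text \<open>The trace operator is defined through an arbitrarily chosen basis of the quotient. This relation
  also records that a basis exists, so that it can be passed through exact sequences.\<close>

definition has_trace :: "('x, 'k::field) subquot \<Rightarrow> (('x \<Rightarrow> 'k) \<Rightarrow> ('x \<Rightarrow> 'k)) \<Rightarrow> 'k \<Rightarrow> bool" where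
  "has_trace V f t \<longleftrightarrow> subquotient V \<and> endo V f \<and>
     (\<exists>S. quot_basis V S \<and> t = (\<Sum>s\<in>S. quot_coords V S (f s) s))"

lemma has_trace_imp_quot_trace:
  assumes "has_trace V f t"
  shows "quot_trace V f = t"
proof -
  obtain S where V: "subquotient V" "endo V f" and S: "quot_basis V S"
    and t: "t = (\<Sum>s\<in>S. quot_coords V S (f s) s)"
    using assms by (auto simp: has_trace_def)
  have "quot_basis V (SOME S. quot_basis V S)" by (rule someI[of _ S]) (rule S)
  from trace_basis_independent[OF V this S] show ?thesis
    by (simp add: quot_trace_def Let_def t quot_coords_def)
qed

lemma has_trace_unique: "has_trace V f t \<Longrightarrow> has_trace V f t' \<Longrightarrow> t = t'"
  by (metis has_trace_imp_quot_trace)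

lemma has_trace_id_imp_quot_dim:
  fixes V :: "('x, 'k::field_char_0) subquot"
  assumes "has_trace V (\<lambda>v. v) (of_nat d)"
  shows "quot_dim V = d"
proof -
  obtain S where V: "subquotient V" and S: "quot_basis V S"
    using assms by (auto simp: has_trace_def)
  define S0 where "S0 = (SOME S. quot_basis V S)"
  have S0: "quot_basis V S0" unfolding S0_def by (rule someI[of _ S]) (rule S)
  have id: "endo V (\<lambda>v. v)" by (auto simp: endo_def linear_on_space_def)
  have "has_trace V (\<lambda>v. v) (\<Sum>s\<in>S0. quot_coords V S0 s s)"
    using V S0 id by (auto simp: has_trace_def)
  then have "of_nat d = (\<Sum>s\<in>S0. quot_coords V S0 s s)" using assms has_trace_unique by blast
  also have "\<dots> = of_nat (card S0)" by (simp add: quot_coords_self[OF V S0])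
  finally show ?thesis by (simp add: quot_dim_def S0_def)
qed

lemma has_trace_zero:
  assumes "subquotient V" "endo V f" "fst V \<subseteq> snd V"
  shows "has_trace V f 0"
proof -
  have "quot_basis V {}" using assms(3)
    by (auto simp: quot_basis_def is_quot_coords_def)
  with assms show ?thesis by (auto simp: has_trace_def intro!: exI[of _ "{}"])
qed

text \<open>Additivity of the trace in the exact sequence \<open>0 \<rightarrow> K/B \<rightarrow> Z/B \<rightarrow> Z'/B' \<rightarrow> 0\<close> induced by \<open>g\<close>. A
  basis of the middle term consists of a basis of \<open>K/B\<close> and lifts of a basis of \<open>Z'/B'\<close>.\<close>

lemma has_trace_extension:
  fixes Z B K :: "('x \<Rightarrow> 'k::field) set" and Z' B' :: "('y \<Rightarrow> 'k) set"
  assumes V: "subquotient (Z, B)" and f: "endo (Z, B) f"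
    and g: "linear_on_space Z g" "g ` Z = Z'" "g ` B \<subseteq> B'"
    and gf: "\<And>z. z \<in> Z \<Longrightarrow> g (f z) = f' (g z)"
    and K: "K = {z \<in> Z. g z \<in> B'}"
    and tK: "has_trace (K, B) f t" and t': "has_trace (Z', B') f' t'"
  shows "has_trace (Z, B) f (t + t')"
proof -
  \<comment> \<open>The basis of \<open>Z / B\<close> will be \<open>S\<close> together with lifts \<open>l s\<close> of the elements \<open>s\<close> of \<open>S'\<close>.\<close>
  obtain S where VK: "subquotient (K, B)" and S: "quot_basis (K, B) S"
    and t: "t = (\<Sum>s\<in>S. quot_coords (K, B) S (f s) s)" and fK: "endo (K, B) f"
    using tK by (auto simp: has_trace_def)
  obtain S' where V': "subquotient (Z', B')" and S': "quot_basis (Z', B') S'"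
    and t'_eq: "t' = (\<Sum>s\<in>S'. quot_coords (Z', B') S' (f' s) s)" and f': "endo (Z', B') f'"
    using t' by (auto simp: has_trace_def)
  have Z: "fspace.subspace Z" and B: "fspace.subspace B" "B \<subseteq> Z" and B': "fspace.subspace B'"
    using V V' by (auto simp: subquotient_def)
  have fin: "finite S" "finite S'" using S S' by (auto simp: quot_basis_def)
  have "\<forall>s\<in>S'. \<exists>z. z \<in> Z \<and> g z = s"
    using quot_basis_in[OF S'] g(2) by auto
  then obtain l where l: "\<And>s. s \<in> S' \<Longrightarrow> l s \<in> Z \<and> g (l s) = s" by metis
  have inj: "inj_on l S'" by (rule inj_onI) (metis l)
  have SK: "s \<in> Z" "g s \<in> B'" if "s \<in> S" for s using quot_basis_in[OF S that] by (auto simp: K)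
  have disj: "S \<inter> l ` S' = {}"
    using l SK quot_basis_notin[OF V' S'] by fastforce
  define W where "W = S \<union> l ` S'"
  have finW: "finite W" and WZ: "W \<subseteq> Z" using fin SK l by (auto simp: W_def)
  have sumW: "(\<Sum>x\<in>W. scale (d x) x) = (\<Sum>s\<in>S. scale (d s) s) + (\<Sum>s\<in>S'. scale (d (l s)) (l s))" for d
    unfolding W_def using fin disj inj by (simp add: sum.union_disjoint sum.reindex)
  \<comment> \<open>The coordinates of \<open>v\<close> at the lifts are those of \<open>g v\<close>; what is left of \<open>v\<close> lies in \<open>K\<close>.\<close>
  let ?c' = "\<lambda>v. quot_coords (Z', B') S' (g v)"
  let ?u = "\<lambda>v. v - (\<Sum>s\<in>S'. scale (?c' v s) (l s))"
  let ?c = "\<lambda>v. quot_coords (K, B) S (?u v)"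
  let ?d = "\<lambda>v x. if x \<in> S then ?c v x else if x \<in> l ` S' then ?c' v (g x) else 0"
  have sumZ: "(\<Sum>s\<in>S'. scale (e s) (l s)) \<in> Z" for e
    using l Z by (auto intro!: fspace.subspace_sum fspace.subspace_scale)
  have sumSZ: "(\<Sum>s\<in>S. scale (e s) s) \<in> Z" for e
    using SK Z by (auto intro!: fspace.subspace_sum fspace.subspace_scale)
  have g_lift: "g (\<Sum>s\<in>S'. scale (e s) (l s)) = (\<Sum>s\<in>S'. scale (e s) s)" for e
    using l by (subst linear_on_space_sum_scale[OF g(1) Z]) auto
  have uK: "?u v \<in> K" if "v \<in> Z" for v
  proof -
    have "g (?u v) = g v - (\<Sum>s\<in>S'. scale (?c' v s) s)"
      by (simp add: linear_on_space_diff[OF g(1) Z that sumZ] g_lift)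
    also have "\<dots> \<in> B'"
      using is_quot_coords_quot_coords[OF S', of "g v"] that g(2) by (auto simp: is_quot_coords_def)
    finally show ?thesis using that Z sumZ by (auto simp: K intro!: fspace.subspace_diff)
  qed
  have coords: "is_quot_coords (Z, B) W v (?d v)" if v: "v \<in> Z" for v
  proof -
    have "(\<Sum>s\<in>S. scale (?d v s) s) = (\<Sum>s\<in>S. scale (?c v s) s)" by simp
    moreover have "(\<Sum>s\<in>S'. scale (?d v (l s)) (l s)) = (\<Sum>s\<in>S'. scale (?c' v s) (l s))"
      using l disj by (intro sum.cong) auto
    ultimately have "v - (\<Sum>x\<in>W. scale (?d v x) x) = ?u v - (\<Sum>s\<in>S. scale (?c v s) s)"
      by (simp add: sumW)
    also have "\<dots> \<in> B"
      using is_quot_coords_quot_coords[OF S, of "?u v"] uK[OF v] by (simp add: is_quot_coords_def)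
    finally show ?thesis by (auto simp: is_quot_coords_def W_def)
  qed
  have unique: "d = ?d v" if v: "v \<in> Z" and d: "is_quot_coords (Z, B) W v d" for v d
  proof -
    have vB: "v - (\<Sum>x\<in>W. scale (d x) x) \<in> B" and d0: "\<And>x. x \<notin> W \<Longrightarrow> d x = 0"
      using d by (auto simp: is_quot_coords_def)
    have gW: "g (v - (\<Sum>x\<in>W. scale (d x) x))
       = g v - ((\<Sum>s\<in>S. scale (d s) (g s)) + (\<Sum>s\<in>S'. scale (d (l s)) s))"
      unfolding sumW
      by (subst linear_on_space_diff[OF g(1) Z v], intro fspace.subspace_add[OF Z] sumSZ sumZ,
          subst linear_on_space_add[OF g(1) sumSZ sumZ], subst g_lift,
          subst linear_on_space_sum_scale[OF g(1) Z]) (auto simp: SK)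
    have gB: "g (v - (\<Sum>x\<in>W. scale (d x) x)) \<in> B'" using vB g(3) by auto
    have gS: "(\<Sum>s\<in>S. scale (d s) (g s)) \<in> B'"
      using SK B' by (auto intro!: fspace.subspace_sum fspace.subspace_scale)
    have cancel: "a - (b + c) + b = a - c" for a b c :: "'y \<Rightarrow> 'k" by simp
    have gB': "g v - (\<Sum>s\<in>S'. scale (d (l s)) s) \<in> B'"
      using fspace.subspace_add[OF B' gB[unfolded gW] gS] unfolding cancel .
    have "?c' v = (\<lambda>s. if s \<in> S' then d (l s) else 0)"
    proof (rule quot_coords_eqI[OF S'])
      show "g v \<in> fst (Z', B')" using v g(2) by auto
      show "is_quot_coords (Z', B') S' (g v) (\<lambda>s. if s \<in> S' then d (l s) else 0)"
        using gB' by (simp add: is_quot_coords_def)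
    qed
    then have c': "?c' v s = d (l s)" if "s \<in> S'" for s using that by simp
    have "?u v - (\<Sum>s\<in>S. scale (d s) s) \<in> B"
      using vB c' by (simp add: sumW algebra_simps)
    then have "is_quot_coords (K, B) S (?u v) (\<lambda>s. if s \<in> S then d s else 0)"
      by (simp add: is_quot_coords_def)
    then have "?c v = (\<lambda>s. if s \<in> S then d s else 0)"
      using uK[OF v] by (intro quot_coords_eqI[OF S]) auto
    then have cS: "?c v s = d s" if "s \<in> S" for s using that by simp
    show ?thesis
    proof
      fix x
      consider "x \<in> S" | s where "x \<notin> S" "s \<in> S'" "x = l s" | "x \<notin> W" by (auto simp: W_def)
      then show "d x = ?d v x"
      proof cases
        case 2
        then show ?thesis using l[OF 2(2)] c'[OF 2(2)] by simp
      qed (use cS d0 in \<open>auto simp: W_def\<close>)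
    qed
  qed
  have W: "quot_basis (Z, B) W"
    unfolding quot_basis_def using finW WZ coords unique by (auto intro!: ex1I)
  have cW: "quot_coords (Z, B) W v = ?d v" if "v \<in> Z" for v
    using quot_coords_eqI[OF W _ coords] that by auto
  have fZ: "f z \<in> Z" if "z \<in> Z" for z using f that by (auto simp: endo_def)
  have "(\<Sum>s\<in>S. quot_coords (Z, B) W (f s) s) = t"
    unfolding t
  proof (rule sum.cong[OF refl])
    fix s assume s: "s \<in> S"
    have fs: "f s \<in> K" using fK quot_basis_in[OF S s] by (auto simp: endo_def)
    then have gB': "g (f s) \<in> B'" by (auto simp: K)
    then have "is_quot_coords (Z', B') S' (g (f s)) (\<lambda>_. 0)"
      by (simp add: is_quot_coords_def)
    then have "?c' (f s) = (\<lambda>_. 0)"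
      using fZ[OF SK(1)[OF s]] g(2) by (intro quot_coords_eqI[OF S']) auto
    then have "?u (f s) = f s" by simp
    then show "quot_coords (Z, B) W (f s) s = quot_coords (K, B) S (f s) s"
      using s cW[OF fZ[OF SK(1)[OF s]]] by simp
  qed
  moreover have "(\<Sum>s\<in>S'. quot_coords (Z, B) W (f (l s)) (l s)) = t'"
    unfolding t'_eq
  proof (rule sum.cong[OF refl])
    fix s assume s: "s \<in> S'"
    have "l s \<notin> S" using s disj by auto
    then show "quot_coords (Z, B) W (f (l s)) (l s) = quot_coords (Z', B') S' (f' s) s"
      using s l[OF s] cW[OF fZ, of "l s"] gf[of "l s"] by simp
  qed
  ultimately have "(\<Sum>x\<in>W. quot_coords (Z, B) W (f x) x) = t + t'"
    unfolding W_def using fin disj inj by (simp add: sum.union_disjoint sum.reindex)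
  with V f W show ?thesis unfolding has_trace_def by metis
qed

lemma has_trace_iso:
  assumes "subquotient (Z, B)" "endo (Z, B) f"
    and g: "linear_on_space Z g" "g ` Z = Z'" "\<And>z. z \<in> Z \<Longrightarrow> z \<in> B \<longleftrightarrow> g z \<in> B'"
    and "\<And>z. z \<in> Z \<Longrightarrow> g (f z) = f' (g z)"
    and "has_trace (Z', B') f' t"
  shows "has_trace (Z, B) f t"
proof -
  have "linear_on_space B f" "f ` B \<subseteq> B" "B \<subseteq> Z"
    using assms(1,2) by (auto simp: endo_def subquotient_def intro: linear_on_space_subset)
  then have "has_trace (B, B) f 0"
    using assms(1) by (intro has_trace_zero) (auto simp: subquotient_def endo_def)
  moreover have "g ` B \<subseteq> B'" "B = {z \<in> Z. g z \<in> B'}" using g(3) \<open>B \<subseteq> Z\<close> by auto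
  ultimately have "has_trace (Z, B) f (0 + t)" using assms by (intro has_trace_extension) auto
  then show ?thesis by simp
qed

text \<open>Rank-nullity for traces; applied to the differential, it expresses the trace on the cycles through
  traces on chains and on boundaries.\<close>

lemma has_trace_kernel_image:
  assumes "fspace.subspace U" "linear_on_space U f" "f ` U \<subseteq> U" and g: "linear_on_space U g"
    and "\<And>u. u \<in> U \<Longrightarrow> g (f u) = f' (g u)"
    and "has_trace ({u \<in> U. g u = 0}, {0}) f t" "has_trace (g ` U, {0}) f' t'"
  shows "has_trace (U, {0}) f (t + t')"
proof (rule has_trace_extension[where g = g])
  show "subquotient (U, {0})" using assms(1)
    by (auto simp: subquotient_def fspace.subspace_0)
  show "endo (U, {0}) f" using assms by (auto simp: endo_def linear_on_space_0)
qed (use assms in \<open>auto simp: linear_on_space_0\<close>)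

lemma has_trace_exists:
  assumes "finite X" "fspace.subspace U" "U \<subseteq> free X" "linear_on_space U f" "f ` U \<subseteq> U"
  shows "\<exists>t. has_trace (U, {0}) f t"
proof -
  obtain S where S: "S \<subseteq> U" "fspace.independent S" "U \<subseteq> fspace.span S"
    using fspace.maximal_independent_subset[of U] by blast
  have "v \<in> fspace.span (single ` X)" if "v \<in> free X" for v
    by (subst free_expand[OF assms(1) that])
      (intro fspace.span_sum fspace.span_scale fspace.span_base imageI)
  then have "S \<subseteq> fspace.span (single ` X)" using S(1) assms(3) by auto
  then have fin: "finite S"
    using fspace.independent_span_bound[of "single ` X" S] S(2) assms(1) by auto
  have "\<exists>!c. is_quot_coords (U, {0}) S v c" if v: "v \<in> U" for v
  proof -
    have "v \<in> fspace.span S" using v S(3) by auto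
    then obtain r where r: "v = (\<Sum>a\<in>S. scale (r a) a)" by (auto simp: fspace.span_finite[OF fin])
    have "(\<Sum>a\<in>S. scale (if a \<in> S then r a else 0) a) = v" unfolding r by (rule sum.cong) auto
    then have ex: "is_quot_coords (U, {0}) S v (\<lambda>a. if a \<in> S then r a else 0)"
      by (auto simp: is_quot_coords_def)
    have "c = c'" if c: "is_quot_coords (U, {0}) S v c" "is_quot_coords (U, {0}) S v c'" for c c'
    proof
      fix s
      have "(\<Sum>a\<in>S. scale (c a) a) = v" "(\<Sum>a\<in>S. scale (c' a) a) = v"
        using c by (auto simp: is_quot_coords_def)
      then have "(\<Sum>a\<in>S. scale (c a - c' a) a) = 0"
        by (simp add: fspace.scale_left_diff_distrib sum_subtractf)
      then have "s \<in> S \<Longrightarrow> c s - c' s = 0"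
        using fspace.independentD[OF S(2) fin subset_refl, of "\<lambda>a. c a - c' a" s] by simp
      then show "c s = c' s" using c by (cases "s \<in> S") (auto simp: is_quot_coords_def)
    qed
    with ex show ?thesis by metis
  qed
  then have "quot_basis (U, {0}) S" using fin S(1) by (auto simp: quot_basis_def)
  moreover have "subquotient (U, {0})" using assms(2) by (auto simp: subquotient_def fspace.subspace_0)
  moreover have "endo (U, {0}) f" using assms by (auto simp: endo_def linear_on_space_0)
  ultimately show ?thesis unfolding has_trace_def by blast
qed

lemma inj_single: "inj (single :: 'x \<Rightarrow> 'x \<Rightarrow> 'k::comm_ring_1)"
  by (rule injI) (metis single_neq_0)

text \<open>In a permutation basis, the diagonal entry at \<open>x\<close> is \<open>1\<close> if \<open>x\<close> is fixed and \<open>0\<close> otherwise.\<close>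

lemma has_trace_free:
  fixes f :: "('x \<Rightarrow> 'k::field) \<Rightarrow> ('x \<Rightarrow> 'k)"
  assumes fin: "finite X" and f: "linear_on_space (free X) f"
    and fx: "\<And>x. x \<in> X \<Longrightarrow> f (single x) = single (p x) \<and> p x \<in> X"
  shows "has_trace (free X, {0}) f (of_nat (card {x \<in> X. p x = x}))"
proof -
  let ?V = "(free X, {0 :: 'x \<Rightarrow> 'k})" and ?S = "single ` X :: ('x \<Rightarrow> 'k) set"
  have inj: "inj_on (single :: 'x \<Rightarrow> 'x \<Rightarrow> 'k) X"
    by (rule inj_on_subset[OF inj_single subset_UNIV])
  have V: "subquotient ?V" by (auto simp: subquotient_def subspace_free fspace.subspace_0)
  have "f v \<in> free X" if "v \<in> free X" for v
  proof -
    have "f v = (\<Sum>x\<in>X. scale (v x) (f (single x)))"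
      by (subst free_expand[OF fin that])
         (rule linear_on_space_sum_scale[OF f subspace_free single_in_free])
    also have "\<dots> \<in> free X"
    proof (intro fspace.subspace_sum fspace.subspace_scale subspace_free)
      show "f (single x) \<in> free X" if "x \<in> X" for x using fx[OF that] by (metis single_in_free)
    qed
    finally show ?thesis .
  qed
  then have endo: "endo ?V f" using f by (auto simp: endo_def linear_on_space_0 subspace_free)
  have sum: "(\<Sum>s\<in>?S. scale (c s) s) y = (if y \<in> X then c (single y) else 0)" for c y
  proof -
    have "(\<Sum>s\<in>?S. scale (c s) s) y = (\<Sum>x\<in>X. c (single x) * single x y)"
      by (simp add: sum.reindex[OF inj] sum_fun_apply o_def)
    also have "\<dots> = (\<Sum>x\<in>X. if x = y then c (single y) else 0)"
      by (rule sum.cong) (auto simp: single_apply)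
    finally have "(\<Sum>s\<in>?S. scale (c s) s) y = (\<Sum>x\<in>X. if x = y then c (single y) else 0)" .
    then show ?thesis using fin by simp
  qed
  have coords: "is_quot_coords ?V ?S v c \<longleftrightarrow> (\<forall>s. s \<notin> ?S \<longrightarrow> c s = 0) \<and> (\<forall>x\<in>X. c (single x) = v x)"
    if v: "v \<in> free X" for v c
  proof -
    have "v - (\<Sum>s\<in>?S. scale (c s) s) = 0 \<longleftrightarrow> (\<forall>y. v y = (if y \<in> X then c (single y) else 0))"
      unfolding fun_eq_iff[of "v - _"] by (simp add: sum)
    also have "\<dots> \<longleftrightarrow> (\<forall>x\<in>X. c (single x) = v x)" using v by (auto simp: freeD)
    finally show ?thesis by (auto simp: is_quot_coords_def)
  qed
  have S: "quot_basis ?V ?S"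
    unfolding quot_basis_def
  proof (intro conjI ballI)
    fix v :: "'x \<Rightarrow> 'k" assume v: "v \<in> fst ?V"
    define c where "c = (\<lambda>s. if s \<in> ?S then v (inv_into X single s) else 0)"
    show "\<exists>!c. is_quot_coords ?V ?S v c"
    proof (rule ex1I[of _ c])
      have v': "v \<in> (free X :: ('x \<Rightarrow> 'k) set)" using v by simp
      have cs: "c (single x) = v x" if "x \<in> X" for x
        using that by (simp add: c_def inv_into_f_f[OF inj])
      then show "is_quot_coords ?V ?S v c"
        unfolding coords[OF v'] by (simp add: c_def)
      show "d = c" if d: "is_quot_coords ?V ?S v d" for d
      proof
        fix s
        show "d s = c s"
        proof (cases "s \<in> ?S")
          case True
          then show ?thesis using d cs unfolding coords[OF v'] by (metis imageE)
        next
          case False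
          then show ?thesis using d unfolding coords[OF v'] by (simp add: c_def)
        qed
      qed
    qed
  qed (use fin in \<open>auto intro: single_in_free\<close>)
  have "(\<Sum>s\<in>?S. quot_coords ?V ?S (f s) s) = (\<Sum>x\<in>X. if p x = x then 1 else 0)"
    unfolding sum.reindex[OF inj] o_def
  proof (rule sum.cong[OF refl])
    fix x assume x: "x \<in> X"
    have fx': "single (p x) \<in> (free X :: ('x \<Rightarrow> 'k) set)"
      by (rule single_in_free) (rule conjunct2[OF fx[OF x]])
    have "is_quot_coords ?V ?S (single (p x)) (quot_coords ?V ?S (single (p x)))"
      by (rule is_quot_coords_quot_coords[OF S]) (simp add: fx')
    then show "quot_coords ?V ?S (f (single x)) (single x) = (if p x = x then 1 else 0)"
      using x unfolding coords[OF fx'] conjunct1[OF fx[OF x]] by (auto simp: single_apply)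
  qed
  also have "\<dots> = of_nat (card {x \<in> X. p x = x})"
    using fin by (simp add: sum.If_cases Int_def)
  finally have "of_nat (card {x \<in> X. p x = x}) = (\<Sum>s\<in>?S. quot_coords ?V ?S (f s) s)" by (rule sym)
  with V endo S show ?thesis unfolding has_trace_def by (intro conjI exI[of _ ?S])
qed

subsection \<open>Direct sums\<close>

text \<open>The outer direct sum, encoded like the direct sum of ribbon complexes as functions on pairs.\<close>

definition dsum :: "'i set \<Rightarrow> ('i \<Rightarrow> ('x \<Rightarrow> 'k::field) set) \<Rightarrow> ('i \<times> 'x \<Rightarrow> 'k) set" where
  "dsum I U = {v. \<forall>i. if i \<in> I then (\<lambda>x. v (i, x)) \<in> U i else (\<lambda>x. v (i, x)) = 0}"

lemma dsumI:
  assumes "\<And>i. i \<in> I \<Longrightarrow> (\<lambda>x. v (i, x)) \<in> U i" "\<And>i. i \<notin> I \<Longrightarrow> (\<lambda>x. v (i, x)) = 0"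
  shows "v \<in> dsum I U"
  using assms unfolding dsum_def by simp

lemma dsum_comp: "v \<in> dsum I U \<Longrightarrow> i \<in> I \<Longrightarrow> (\<lambda>x. v (i, x)) \<in> U i"
  unfolding dsum_def by (drule CollectD, drule spec[of _ i]) simp

lemma dsum_comp_0: "v \<in> dsum I U \<Longrightarrow> i \<notin> I \<Longrightarrow> (\<lambda>x. v (i, x)) = 0"
  unfolding dsum_def by (drule CollectD, drule spec[of _ i]) simp

lemma subspace_dsum:
  assumes "\<And>i. i \<in> I \<Longrightarrow> fspace.subspace (U i)"
  shows "fspace.subspace (dsum I U)"
proof (rule fspace.subspaceI)
  show "0 \<in> dsum I U"
    using fspace.subspace_0[OF assms] by (auto simp: dsum_def zero_fun_def)
next
  fix v w assume "v \<in> dsum I U" "w \<in> dsum I U"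
  moreover have "(\<lambda>x. (v + w) (i, x)) = (\<lambda>x. v (i, x)) + (\<lambda>x. w (i, x))" for i
    by (simp add: plus_fun_def)
  ultimately show "v + w \<in> dsum I U"
    using fspace.subspace_add[OF assms] by (simp add: dsum_def)
next
  fix c v assume "v \<in> dsum I U"
  moreover have "(\<lambda>x. scale c v (i, x)) = scale c (\<lambda>x. v (i, x))" for i
    by (simp add: scale_def)
  ultimately show "scale c v \<in> dsum I U"
    using fspace.subspace_scale[OF assms] by (simp add: dsum_def)
qed

lemma dsum_cong: "(\<And>i. i \<in> I \<Longrightarrow> U i = U' i) \<Longrightarrow> dsum I U = dsum I U'"
  by (simp add: dsum_def)

text \<open>By induction on \<open>J\<close>, the spaces which agree with \<open>Z\<close> on \<open>J\<close> and with \<open>B\<close> elsewhere have the partial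
  sum of the traces; one more summand is an extension whose quotient is \<open>Z\<^sub>i / B\<^sub>i\<close>.\<close>

lemma has_trace_dsum:
  fixes Z B :: "'i \<Rightarrow> ('x \<Rightarrow> 'k::field) set"
  assumes fin: "finite I" and V: "\<And>i. i \<in> I \<Longrightarrow> subquotient (Z i, B i)"
    and f: "\<And>i. i \<in> I \<Longrightarrow> endo (Z i, B i) f"
    and F: "\<And>v i x. F v (i, x) = f (\<lambda>x. v (i, x)) x" and f0: "f 0 = 0"
    and tr: "\<And>i. i \<in> I \<Longrightarrow> has_trace (Z i, B i) f (t i)"
  shows "has_trace (dsum I Z, dsum I B) F (\<Sum>i\<in>I. t i)"
proof -
  \<comment> \<open>\<open>J\<close> collects the summands already treated; elsewhere numerator and denominator coincide.\<close>
  define ZJ where "ZJ J = (\<lambda>i. if i \<in> J then Z i else B i)" for J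
  have comp: "(\<lambda>x. F v (i, x)) = f (\<lambda>x. v (i, x))" for v i by (rule ext) (rule F)
  have BZ: "B i \<subseteq> ZJ J i" "ZJ J i \<subseteq> Z i" if "i \<in> I" for i J
    using V[OF that] by (auto simp: ZJ_def subquotient_def)
  have sub: "subquotient (dsum I (ZJ J), dsum I B)" for J
  proof -
    have "fspace.subspace (ZJ J i)" "fspace.subspace (B i)" if "i \<in> I" for i
      using V[OF that] by (auto simp: ZJ_def subquotient_def)
    moreover have "dsum I B \<subseteq> dsum I (ZJ J)"
    proof
      fix v assume v: "v \<in> dsum I B"
      show "v \<in> dsum I (ZJ J)"
        by (rule dsumI) (rule subsetD[OF BZ(1) dsum_comp[OF v]] dsum_comp_0[OF v], assumption+)+
    qed
    ultimately show ?thesis by (simp add: subquotient_def subspace_dsum)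
  qed
  have endo: "endo (dsum I (ZJ J), dsum I B) F" for J
    unfolding endo_def linear_on_space_def fst_conv snd_conv
  proof (intro conjI ballI allI subsetI)
    have comp_Z: "(\<lambda>x. v (i, x)) \<in> Z i" if "v \<in> dsum I (ZJ J)" "i \<in> I" for v i
      by (rule subsetD[OF BZ(2)[OF that(2)] dsum_comp[OF that]])
    have comp_0: "(\<lambda>x. v (i, x)) = 0" if "v \<in> dsum I (ZJ J)" "i \<notin> I" for v i
      by (rule dsum_comp_0[OF that])
    have lin: "linear_on_space (Z i) f" if "i \<in> I" for i using f[OF that] by (simp add: endo_def)
    {
      fix u v assume uv: "u \<in> dsum I (ZJ J)" "v \<in> dsum I (ZJ J)"
      show "F (u + v) = F u + F v"
      proof
        fix p :: "'i \<times> 'x"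
        obtain i x where p: "p = (i, x)" by force
        have "f ((\<lambda>x. u (i, x)) + (\<lambda>x. v (i, x))) = f (\<lambda>x. u (i, x)) + f (\<lambda>x. v (i, x))"
        proof (cases "i \<in> I")
          case True
          then show ?thesis by (intro linear_on_space_add[OF lin comp_Z[OF uv(1)] comp_Z[OF uv(2)]])
        next
          case False
          show ?thesis unfolding comp_0[OF uv(1) False] comp_0[OF uv(2) False] by (simp add: f0)
        qed
        moreover have "(\<lambda>x. (u + v) (i, x)) = (\<lambda>x. u (i, x)) + (\<lambda>x. v (i, x))"
          by (simp add: plus_fun_def)
        ultimately show "F (u + v) p = (F u + F v) p" by (simp add: p F)
      qed
    }
    {
      fix c v assume v: "v \<in> dsum I (ZJ J)"
      show "F (scale c v) = scale c (F v)"
      proof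
        fix p :: "'i \<times> 'x"
        obtain i x where p: "p = (i, x)" by force
        have "f (scale c (\<lambda>x. v (i, x))) = scale c (f (\<lambda>x. v (i, x)))"
        proof (cases "i \<in> I")
          case True
          then show ?thesis by (intro linear_on_space_scale[OF lin comp_Z[OF v]])
        next
          case False
          show ?thesis unfolding comp_0[OF v False] fspace.scale_zero_right f0 ..
        qed
        moreover have "(\<lambda>x. scale c v (i, x)) = scale c (\<lambda>x. v (i, x))"
          by (simp add: scale_def)
        ultimately show "F (scale c v) p = scale c (F v) p" by (simp add: p F)
      qed
    }
    have pres: "F v \<in> dsum I U" if "v \<in> dsum I U" "\<And>i. i \<in> I \<Longrightarrow> f ` U i \<subseteq> U i" for v U
    proof (rule dsumI)
      show "(\<lambda>x. F v (i, x)) \<in> U i" if "i \<in> I" for i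
        unfolding comp using dsum_comp[OF \<open>v \<in> dsum I U\<close> that] \<open>\<And>i. i \<in> I \<Longrightarrow> f ` U i \<subseteq> U i\<close>[OF that] by blast
      show "(\<lambda>x. F v (i, x)) = 0" if "i \<notin> I" for i
        unfolding comp dsum_comp_0[OF \<open>v \<in> dsum I U\<close> that] by (rule f0)
    qed
    {
      fix w assume "w \<in> F ` dsum I (ZJ J)"
      then obtain v where v: "v \<in> dsum I (ZJ J)" "w = F v" by blast
      show "w \<in> dsum I (ZJ J)" unfolding v(2)
        by (rule pres[OF v(1)]) (use f in \<open>simp add: ZJ_def endo_def\<close>)
    }
    {
      fix w assume "w \<in> F ` dsum I B"
      then obtain v where v: "v \<in> dsum I B" "w = F v" by blast
      show "w \<in> dsum I B" unfolding v(2)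
        by (rule pres[OF v(1)]) (use f in \<open>simp add: endo_def\<close>)
    }
  qed
  have "has_trace (dsum I (ZJ J), dsum I B) F (\<Sum>i\<in>J. t i)" if "finite J" "J \<subseteq> I" for J
    using that
  proof (induction J rule: finite_induct)
    case empty
    show ?case using sub[of "{}"] endo[of "{}"] by (auto simp: ZJ_def intro!: has_trace_zero)
  next
    case (insert j J)
    have j: "j \<in> I" using insert by auto
    have ZJj: "ZJ (insert j J) j = Z j" by (simp add: ZJ_def)
    have ZJ': "ZJ (insert j J) i = ZJ J i" if "i \<noteq> j" for i using that by (simp add: ZJ_def)
    have "has_trace (dsum I (ZJ (insert j J)), dsum I B) F (sum t J + t j)"
    proof (rule has_trace_extension[where g = "\<lambda>v x. v (j, x)"])
      show "linear_on_space (dsum I (ZJ (insert j J))) (\<lambda>v x. v (j, x))"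
        by (auto simp: linear_on_space_def plus_fun_def scale_def)
      show "(\<lambda>v x. v (j, x)) ` dsum I (ZJ (insert j J)) = Z j"
      proof (intro equalityI subsetI)
        fix z assume z: "z \<in> Z j"
        define v where "v = (\<lambda>(i, x). if i = j then z x else 0)"
        have vj: "(\<lambda>x. v (j, x)) = z" by (simp add: v_def)
        have vi: "i \<noteq> j \<Longrightarrow> (\<lambda>x. v (i, x)) = 0" for i by (auto simp: v_def zero_fun_def)
        have zero: "0 \<in> ZJ (insert j J) i" if "i \<in> I" for i
          using V[OF that] by (auto simp: ZJ_def subquotient_def fspace.subspace_0)
        have "v \<in> dsum I (ZJ (insert j J))"
        proof (intro dsumI)
          show "(\<lambda>x. v (i, x)) \<in> ZJ (insert j J) i" if "i \<in> I" for i
            using that z zero vi[of i] unfolding vj[symmetric] by (cases "i = j") (simp_all add: ZJj)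
          show "(\<lambda>x. v (i, x)) = 0" if "i \<notin> I" for i using that j by (intro vi) auto
        qed
        then show "z \<in> (\<lambda>v x. v (j, x)) ` dsum I (ZJ (insert j J))" using vj by force
      next
        fix z assume "z \<in> (\<lambda>v x. v (j, x)) ` dsum I (ZJ (insert j J))"
        then show "z \<in> Z j" using dsum_comp[OF _ j] ZJj by blast
      qed
      show "(\<lambda>v x. v (j, x)) ` dsum I B \<subseteq> B j" using dsum_comp[OF _ j] by blast
      show "dsum I (ZJ J) = {z \<in> dsum I (ZJ (insert j J)). (\<lambda>x. z (j, x)) \<in> B j}"
      proof (intro equalityI subsetI)
        fix v assume v: "v \<in> dsum I (ZJ J)"
        have vj: "(\<lambda>x. v (j, x)) \<in> B j"
          using dsum_comp[OF v j] insert.hyps by (simp add: ZJ_def)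
        moreover have "v \<in> dsum I (ZJ (insert j J))"
        proof (rule dsumI)
          show "(\<lambda>x. v (i, x)) \<in> ZJ (insert j J) i" if "i \<in> I" for i
            using dsum_comp[OF v that] vj BZ(1)[OF j, of "insert j J"] ZJ'[of i]
            by (cases "i = j") auto
        qed (rule dsum_comp_0[OF v])
        ultimately show "v \<in> {z \<in> dsum I (ZJ (insert j J)). (\<lambda>x. z (j, x)) \<in> B j}" by simp
      next
        fix v assume "v \<in> {z \<in> dsum I (ZJ (insert j J)). (\<lambda>x. z (j, x)) \<in> B j}"
        then have v: "v \<in> dsum I (ZJ (insert j J))" and vj: "(\<lambda>x. v (j, x)) \<in> B j" by auto
        show "v \<in> dsum I (ZJ J)"
        proof (rule dsumI)
          show "(\<lambda>x. v (i, x)) \<in> ZJ J i" if "i \<in> I" for i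
            using dsum_comp[OF v that] vj BZ(1)[OF j, of J] ZJ'[of i]
            by (cases "i = j") auto
        qed (rule dsum_comp_0[OF v])
      qed
      show "has_trace (dsum I (ZJ J), dsum I B) F (sum t J)" using insert by simp
      show "has_trace (Z j, B j) f (t j)" by (rule tr[OF j])
      show "(\<lambda>x. F z (j, x)) = f (\<lambda>x. z (j, x))" for z by (rule comp)
    qed (rule sub endo)+
    then show ?case using insert by (simp add: add.commute)
  qed
  from this[OF fin subset_refl] have "has_trace (dsum I (ZJ I), dsum I B) F (sum t I)" .
  moreover have "dsum I (ZJ I) = dsum I Z" by (rule dsum_cong) (simp add: ZJ_def)
  ultimately show ?thesis by simp
qed

subsection \<open>Traces and preimages\<close>

lemma subspace_preimage:
  assumes U: "fspace.subspace U" and g: "linear_on_space U g" and V: "fspace.subspace V"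
  shows "fspace.subspace {u \<in> U. g u \<in> V}"
proof (rule fspace.subspaceI)
  show "0 \<in> {u \<in> U. g u \<in> V}"
    unfolding mem_Collect_eq linear_on_space_0[OF g U]
    by (intro conjI fspace.subspace_0[OF U] fspace.subspace_0[OF V])
next
  fix u v assume "u \<in> {u \<in> U. g u \<in> V}" "v \<in> {u \<in> U. g u \<in> V}"
  then have *: "u \<in> U" "v \<in> U" "g u \<in> V" "g v \<in> V" by blast+
  show "u + v \<in> {u \<in> U. g u \<in> V}"
    unfolding mem_Collect_eq linear_on_space_add[OF g *(1,2)]
    by (intro conjI fspace.subspace_add[OF U] fspace.subspace_add[OF V] *)
next
  fix c v assume "v \<in> {u \<in> U. g u \<in> V}"
  then have *: "v \<in> U" "g v \<in> V" by blast+
  show "scale c v \<in> {u \<in> U. g u \<in> V}"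
    unfolding mem_Collect_eq linear_on_space_scale[OF g *(1)]
    by (intro conjI fspace.subspace_scale[OF U] fspace.subspace_scale[OF V] *)
qed

text \<open>Describing the cycles and boundaries upstairs as preimages of a subquotient downstairs makes all
  closure properties automatic and transports the trace in one step.\<close>

lemma has_trace_pullback:
  assumes U: "fspace.subspace U" and f: "linear_on_space U f" "\<And>u. u \<in> U \<Longrightarrow> f u \<in> U"
    and g: "linear_on_space U g" "Z' \<subseteq> g ` U" and gf: "\<And>u. u \<in> U \<Longrightarrow> g (f u) = f' (g u)"
    and tr: "has_trace (Z', B') f' t"
  shows "has_trace ({u \<in> U. g u \<in> Z'}, {u \<in> U. g u \<in> B'}) f t"
proof -
  let ?Z = "{u \<in> U. g u \<in> Z'}" and ?B = "{u \<in> U. g u \<in> B'}"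
  have Z': "fspace.subspace Z'" "fspace.subspace B'" "B' \<subseteq> Z'" and f': "f' ` Z' \<subseteq> Z'" "f' ` B' \<subseteq> B'"
    using tr unfolding has_trace_def subquotient_def endo_def fst_conv snd_conv by blast+
  have inv: "f ` ?Z \<subseteq> ?Z" "f ` ?B \<subseteq> ?B"
  proof -
    show "f ` ?Z \<subseteq> ?Z"
    proof (rule image_subsetI)
      fix u assume "u \<in> ?Z"
      then have u: "u \<in> U" "g u \<in> Z'" by blast+
      show "f u \<in> ?Z" unfolding mem_Collect_eq gf[OF u(1)] using f(2)[OF u(1)] f'(1) u(2) by blast
    qed
    show "f ` ?B \<subseteq> ?B"
    proof (rule image_subsetI)
      fix u assume "u \<in> ?B"
      then have u: "u \<in> U" "g u \<in> B'" by blast+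
      show "f u \<in> ?B" unfolding mem_Collect_eq gf[OF u(1)] using f(2)[OF u(1)] f'(2) u(2) by blast
    qed
  qed
  show ?thesis
  proof (rule has_trace_iso[OF _ _ _ _ _ _ tr])
    show "subquotient (?Z, ?B)"
      unfolding subquotient_def fst_conv snd_conv
      using subspace_preimage[OF U g(1) Z'(1)] subspace_preimage[OF U g(1) Z'(2)] Z'(3) by blast
    show "endo (?Z, ?B) f"
      unfolding endo_def fst_conv snd_conv using inv linear_on_space_subset[OF f(1), of ?Z] by blast
    show "linear_on_space ?Z g" by (rule linear_on_space_subset[OF g(1)]) blast
    show "g ` ?Z = Z'" using g(2) by blast
    show "z \<in> ?B \<longleftrightarrow> g z \<in> B'" if "z \<in> ?Z" for z using that by blast
    show "g (f z) = f' (g z)" if "z \<in> ?Z" for z using that gf by blast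
  qed
qed

section \<open>Compositions and cut sets\<close>

lemma cut_set_Nil [simp]: "cut_set [] = {}"
  by (simp add: cut_set_def)

text \<open>The cuts of the tail, shifted by the first part, together with the first cut: the recursion behind all inductions over parts.\<close>

lemma cut_set_Cons: "cut_set (b # \<beta>) = (if \<beta> = [] then {} else insert b ((+) b ` cut_set \<beta>))"
proof (cases "\<beta> = []")
  case False
  have "x \<in> cut_set (b # \<beta>) \<longleftrightarrow> x = b \<or> x \<in> (+) b ` cut_set \<beta>" for x
  proof
    assume "x \<in> cut_set (b # \<beta>)"
    then obtain i where i: "x = sum_list (take i (b # \<beta>))" "1 \<le> i" "i < length (b # \<beta>)"
      by (auto simp: cut_set_def)
    then obtain j where j: "i = Suc j" by (cases i) auto
    show "x = b \<or> x \<in> (+) b ` cut_set \<beta>"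
    proof (cases j)
      case (Suc k)
      have "sum_list (take j \<beta>) \<in> cut_set \<beta>"
        unfolding cut_set_def using i j Suc by (intro CollectI exI[of _ j]) simp
      then show ?thesis using i j by auto
    qed (use i j in auto)
  next
    assume "x = b \<or> x \<in> (+) b ` cut_set \<beta>"
    then show "x \<in> cut_set (b # \<beta>)"
    proof
      assume "x = b"
      then show ?thesis unfolding cut_set_def using False by (intro CollectI exI[of _ 1]) auto
    next
      assume "x \<in> (+) b ` cut_set \<beta>"
      then obtain i where "x = b + sum_list (take i \<beta>)" "1 \<le> i" "i < length \<beta>"
        by (auto simp: cut_set_def)
      then show ?thesis unfolding cut_set_def by (intro CollectI exI[of _ "Suc i"]) auto
    qed
  qed
  then show ?thesis using False by auto
qed (auto simp: cut_set_def)

lemma is_composition_Cons [simp]: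
  "is_composition n (b # \<beta>) \<longleftrightarrow> 0 < b \<and> b \<le> n \<and> is_composition (n - b) \<beta>"
  by (auto simp: is_composition_def)

lemma is_composition_Nil [simp]: "is_composition n [] \<longleftrightarrow> n = 0"
  by (auto simp: is_composition_def)

lemma is_composition_0 [simp]: "is_composition 0 \<beta> \<longleftrightarrow> \<beta> = []"
  by (cases \<beta>) auto

lemma cut_set_subset: "is_composition n \<beta> \<Longrightarrow> cut_set \<beta> \<subseteq> {1..<n}"
proof (induction \<beta> arbitrary: n)
  case (Cons b \<beta>)
  show ?case
  proof (cases "\<beta> = []")
    case False
    then have "0 < n - b" using Cons.prems by (cases \<beta>) auto
    then have "(+) b ` cut_set \<beta> \<subseteq> (+) b ` {1..<n - b}"
      using Cons.IH[of "n - b"] Cons.prems by (intro image_mono) simp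
    also have "\<dots> \<subseteq> {1..<n}" by auto
    finally show ?thesis using False Cons.prems \<open>0 < n - b\<close> by (simp add: cut_set_Cons)
  qed (simp add: cut_set_Cons)
qed simp

lemma finite_cut_set: "is_composition n \<beta> \<Longrightarrow> finite (cut_set \<beta>)"
  using cut_set_subset finite_subset by blast

lemma card_cut_set:
  assumes "is_composition n \<beta>" "1 \<le> n"
  shows "length \<beta> = card (cut_set \<beta>) + 1"
  using assms
proof (induction \<beta> arbitrary: n)
  case (Cons b \<beta>)
  show ?case
  proof (cases "\<beta> = []")
    case False
    then have n: "1 \<le> n - b" using Cons.prems by (cases \<beta>) auto
    have c: "is_composition (n - b) \<beta>" using Cons.prems by simp
    have "b \<notin> (+) b ` cut_set \<beta>" using cut_set_subset[OF c] by auto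
    moreover have "card ((+) b ` cut_set \<beta>) = card (cut_set \<beta>)" by (rule card_image) simp
    ultimately show ?thesis using Cons.IH[OF c n] False finite_cut_set[OF c]
      by (simp add: cut_set_Cons)
  qed (simp add: cut_set_Cons)
qed simp

lemma cut_set_inj:
  assumes "is_composition n \<beta>" "is_composition n \<gamma>" "cut_set \<beta> = cut_set \<gamma>"
  shows "\<beta> = \<gamma>"
  using assms
proof (induction \<beta> arbitrary: n \<gamma>)
  case Nil
  then show ?case by simp
next
  case (Cons b \<beta>)
  from Cons.prems obtain c \<delta> where \<gamma>: "\<gamma> = c # \<delta>" by (cases \<gamma>) auto
  have \<beta>': "is_composition (n - b) \<beta>" "b \<le> n" and \<delta>': "is_composition (n - c) \<delta>" "c \<le> n"
    using Cons.prems \<gamma> by auto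
  have eq: "cut_set (b # \<beta>) = cut_set (c # \<delta>)" using Cons.prems \<gamma> by simp
  have empty: "\<beta> = [] \<longleftrightarrow> \<delta> = []"
    using eq by (auto simp: cut_set_Cons split: if_splits)
  show ?case
  proof (cases "\<beta> = []")
    case True
    then have "n - b = 0" "n - c = 0" using empty \<beta>' \<delta>' by auto
    then show ?thesis using True empty \<gamma> \<beta>' \<delta>' by simp
  next
    case False
    have eq': "insert b ((+) b ` cut_set \<beta>) = insert c ((+) c ` cut_set \<delta>)"
      using eq False empty by (simp add: cut_set_Cons)
    have "c \<in> insert b ((+) b ` cut_set \<beta>)" "b \<in> insert c ((+) c ` cut_set \<delta>)"
      using eq' by auto
    then have "b \<le> c" "c \<le> b" by auto
    then have bc: "b = c" by simp
    have "b \<notin> (+) b ` cut_set \<beta>" "c \<notin> (+) c ` cut_set \<delta>"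
      using cut_set_subset[OF \<beta>'(1)] cut_set_subset[OF \<delta>'(1)] by auto
    then have "(+) b ` cut_set \<beta> = (+) b ` cut_set \<delta>"
      using eq' bc by (metis insert_ident)
    then have "cut_set \<beta> = cut_set \<delta>" by (simp add: inj_image_eq_iff)
    then show ?thesis using Cons.IH[of "n - b" \<delta>] \<beta>' \<delta>' \<gamma> bc by simp
  qed
qed

lemma cut_set_surj:
  assumes "S \<subseteq> {1..<n}"
  shows "\<exists>\<gamma>. is_composition n \<gamma> \<and> cut_set \<gamma> = S"
  using assms
proof (induction n arbitrary: S rule: less_induct)
  case (less n)
  have fin: "finite S" using less.prems finite_subset by blast
  consider "n = 0" | "n \<noteq> 0" "S = {}" | "S \<noteq> {}" by blast
  then show ?case
  proof cases
    case 1
    then show ?thesis using less.prems by (auto intro!: exI[of _ "[]"])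
  next
    case 2
    then show ?thesis by (intro exI[of _ "[n]"]) (auto simp: cut_set_Cons)
  next
    case 3
    define b where "b = Min S"
    have b: "b \<in> S" "\<And>x. x \<in> S \<Longrightarrow> b \<le> x" using fin 3 by (auto simp: b_def)
    then have bn: "1 \<le> b" "b < n" using less.prems by auto
    define T where "T = (\<lambda>x. x - b) ` (S - {b})"
    have "b < x" if "x \<in> S - {b}" for x using b(2)[of x] that by auto
    then have T: "T \<subseteq> {1..<n - b}" using less.prems unfolding T_def by fastforce
    obtain \<delta> where \<delta>: "is_composition (n - b) \<delta>" "cut_set \<delta> = T"
      using less.IH[OF _ T] bn by auto
    have "(+) b ` T = (\<lambda>x. b + (x - b)) ` (S - {b})" by (auto simp: T_def)
    also have "\<dots> = (\<lambda>x. x) ` (S - {b})" by (rule image_cong) (auto dest: b(2))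
    finally have "insert b ((+) b ` T) = S" using b(1) by auto
    moreover have "\<delta> \<noteq> []" using \<delta> bn by auto
    ultimately show ?thesis using \<delta> bn by (intro exI[of _ "b # \<delta>"]) (auto simp: cut_set_Cons)
  qed
qed

lemma comp_of_cuts:
  assumes "S \<subseteq> {1..<n}"
  shows "is_composition n (comp_of_cuts n S)" "cut_set (comp_of_cuts n S) = S"
proof -
  have "\<exists>!\<gamma>. is_composition n \<gamma> \<and> cut_set \<gamma> = S"
    using cut_set_surj[OF assms] cut_set_inj by blast
  from theI'[OF this] show "is_composition n (comp_of_cuts n S)" "cut_set (comp_of_cuts n S) = S"
    by (simp_all add: comp_of_cuts_def)
qed

text \<open>Coarsenings of \<open>\<gamma>\<close> form a Boolean lattice, which makes inclusion-exclusion available.\<close>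

lemma coarsenings_bij:
  assumes "is_composition n \<gamma>"
  shows "bij_betw cut_set (coarsenings \<gamma>) (Pow (cut_set \<gamma>))"
proof (rule bij_betwI')
  have sum: "sum_list \<gamma> = n" using assms by (simp add: is_composition_def)
  fix \<beta> \<beta>' assume "\<beta> \<in> coarsenings \<gamma>" "\<beta>' \<in> coarsenings \<gamma>"
  then show "cut_set \<beta> = cut_set \<beta>' \<longleftrightarrow> \<beta> = \<beta>'"
    using cut_set_inj by (auto simp: coarsenings_def)
next
  fix S assume S: "S \<in> Pow (cut_set \<gamma>)"
  then have "S \<subseteq> {1..<n}" using cut_set_subset[OF assms] by auto
  with S show "\<exists>\<beta>\<in>coarsenings \<gamma>. S = cut_set \<beta>"
    using comp_of_cuts[of S n] assms
    by (intro bexI[of _ "comp_of_cuts n S"]) (auto simp: coarsenings_def is_composition_def)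
qed (auto simp: coarsenings_def)

lemma finite_coarsenings: "is_composition n \<gamma> \<Longrightarrow> finite (coarsenings \<gamma>)"
  using coarsenings_bij bij_betw_finite finite_cut_set by blast

lemma coarsening_composition:
  "is_composition n \<gamma> \<Longrightarrow> \<beta> \<in> coarsenings \<gamma> \<Longrightarrow> is_composition n \<beta>"
  by (auto simp: coarsenings_def is_composition_def)

text \<open>Moebius inversion in the Boolean lattice of subsets of \<open>D\<close>, in the form of an expanded product of zeros.\<close>

lemma alternating_sum_interval:
  assumes "finite D" "A \<subseteq> D"
  shows "(\<Sum>T | A \<subseteq> T \<and> T \<subseteq> D. (- 1) ^ (card D - card T)) = (if A = D then 1 else 0 :: 'a::comm_ring_1)"
proof -
  have fin: "finite (D - A)" "finite A" using assms finite_subset by auto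
  have "(\<Sum>T | A \<subseteq> T \<and> T \<subseteq> D. (- 1 :: 'a) ^ (card D - card T))
      = (\<Sum>X\<in>Pow (D - A). (- 1) ^ card X)"
  proof (rule sum.reindex_bij_witness[where i = "\<lambda>X. D - X" and j = "\<lambda>T. D - T"])
    fix T assume "T \<in> {T. A \<subseteq> T \<and> T \<subseteq> D}"
    then show "(- 1 :: 'a) ^ card (D - T) = (- 1) ^ (card D - card T)"
      using finite_subset[OF _ assms(1), of T] by (simp add: card_Diff_subset)
  qed (use assms in auto)
  also have "\<dots> = (\<Prod>x\<in>D - A. 1 - 1)"
    by (subst prod_diff_conv_sum[OF fin(1)]) simp
  also have "\<dots> = (if A = D then 1 else 0)"
    using fin(1) assms(2) by (auto simp: power_0_left card_eq_0_iff)
  finally show ?thesis .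
qed

lemma coarsenings_singleton: "0 < g \<Longrightarrow> coarsenings [g] = {[g]}"
  using cut_set_inj[of g "[g]"] by (auto simp: coarsenings_def cut_set_Cons)

text \<open>A coarsening either keeps the first part, or merges it into a longer first block; removing \<open>g\<close> from
  that block leaves a coarsening of the remaining parts.\<close>

lemma coarsenings_Cons:
  assumes "0 < g" "is_composition m \<gamma>" "\<gamma> \<noteq> []"
  shows "b # \<beta> \<in> coarsenings (g # \<gamma>) \<longleftrightarrow>
    b = g \<and> \<beta> \<in> coarsenings \<gamma> \<or> g < b \<and> (b - g) # \<beta> \<in> coarsenings \<gamma>"
proof -
  have sum: "sum_list \<gamma> = m" and m: "0 < m" using assms by (auto simp: is_composition_def)
      (metis assms(2,3) is_composition_0 is_composition_def neq0_conv)
  have in\<gamma>: "\<delta> \<in> coarsenings \<gamma> \<longleftrightarrow> is_composition m \<delta> \<and> cut_set \<delta> \<subseteq> cut_set \<gamma>" for \<delta>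
    by (auto simp: coarsenings_def sum)
  have in\<beta>: "b # \<beta> \<in> coarsenings (g # \<gamma>) \<longleftrightarrow>
      is_composition (g + m) (b # \<beta>) \<and> cut_set (b # \<beta>) \<subseteq> insert g ((+) g ` cut_set \<gamma>)"
    using assms(3) by (auto simp: coarsenings_def sum cut_set_Cons)
  have shift: "(+) g ` S \<subseteq> insert g ((+) g ` T) \<longleftrightarrow> S \<subseteq> T" if "S \<subseteq> {1..<m}" for S T
  proof
    assume sub: "(+) g ` S \<subseteq> insert g ((+) g ` T)"
    show "S \<subseteq> T"
    proof
      fix x assume x: "x \<in> S"
      then have "g + x \<in> insert g ((+) g ` T)" "1 \<le> x" using sub that by auto
      then show "x \<in> T" by auto
    qed
  qed auto
  consider "b < g" | "b = g" | "g < b" by linarith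
  then show ?thesis
  proof cases
    case 1
    have "b # \<beta> \<notin> coarsenings (g # \<gamma>)"
    proof
      assume b: "b # \<beta> \<in> coarsenings (g # \<gamma>)"
      then have "\<beta> \<noteq> []" using 1 in\<beta> by auto
      then have "b \<in> insert g ((+) g ` cut_set \<gamma>)" using b in\<beta> by (auto simp: cut_set_Cons)
      then show False using 1 by auto
    qed
    then show ?thesis using 1 by auto
  next
    case 2
    have "cut_set \<beta> \<subseteq> {1..<m}" if "is_composition m \<beta>" by (rule cut_set_subset[OF that])
    moreover note shift
    moreover have "\<beta> \<noteq> []" if "is_composition m \<beta>" using that m by auto
    ultimately show ?thesis
      using 2 assms(1) unfolding in\<beta> in\<gamma> by (auto simp: cut_set_Cons)
  next
    case 3
    have "cut_set (b # \<beta>) = (+) g ` cut_set ((b - g) # \<beta>)"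
      using 3 by (simp add: cut_set_Cons image_image)
    moreover note shift
    moreover have "is_composition (g + m) (b # \<beta>) \<longleftrightarrow> is_composition m ((b - g) # \<beta>)"
      using 3 by (auto simp: algebra_simps)
    moreover have "cut_set ((b - g) # \<beta>) \<subseteq> {1..<m}" if "is_composition m ((b - g) # \<beta>)"
      by (rule cut_set_subset[OF that])
    ultimately show ?thesis
      using 3 unfolding in\<beta> in\<gamma> by auto
  qed
qed

section \<open>Decorations\<close>

subsection \<open>Orbits\<close>

lemma finite_inj_permutes:
  assumes "finite S" "inj_on f S" "\<And>x. x \<in> S \<Longrightarrow> f x \<in> S" "\<And>x. x \<notin> S \<Longrightarrow> f x = x"
  shows "f permutes S"
proof (rule bij_imp_permutes)
  have "f ` S = S" using assms by (intro endo_inj_surj) auto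
  then show "bij_betw f S S" using assms(2) by (simp add: bij_betw_def)
qed (use assms in auto)

lemma permutation_on: "finite S \<Longrightarrow> p permutes S \<Longrightarrow> permutation p"
  using permutation_permutes by blast

text \<open>Used for \<open>h\<close> a shift of letters, this identifies the cycles of the second factor inside a product.\<close>

lemma orbit_semiconj:
  assumes "\<And>y. y \<in> insert x (orbit f x) \<Longrightarrow> g (h y) = h (f y)"
  shows "orbit g (h x) = h ` orbit f x"
proof (intro equalityI subsetI)
  fix z assume "z \<in> orbit g (h x)"
  then show "z \<in> h ` orbit f x"
  proof induction
    case base
    then show ?case using assms[of x] orbit.base[of f x] by auto
  next
    case (step z)
    then obtain y where "y \<in> orbit f x" "z = h y" by auto
    then show ?case using assms[of y] orbit.step[of y f x] by auto
  qed
next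
  fix z assume "z \<in> h ` orbit f x"
  then obtain y where "y \<in> orbit f x" "z = h y" by auto
  from this(1) have "h y \<in> orbit g (h x)"
  proof induction
    case base
    show ?case using assms[of x] orbit.base[of g "h x"] by simp
  next
    case (step y)
    then show ?case using assms[of y] orbit.step[of "h y" g "h x"] by simp
  qed
  then show "z \<in> orbit g (h x)" using \<open>z = h y\<close> by simp
qed

lemma orbit_eq_on:
  assumes "\<And>y. y \<in> insert x (orbit f x) \<Longrightarrow> g y = f y"
  shows "orbit g x = orbit f x"
  using orbit_semiconj[of x f g "\<lambda>y. y"] assms by simp

context
  fixes p :: "'a \<Rightarrow> 'a" and S
  assumes p: "p permutes S" and S: "finite S"
begin

lemma self_in_orbit: "x \<in> orbit p x"
  by (rule permutation_self_in_orbit[OF permutation_on[OF S p]])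

lemma orbit_eq: "y \<in> orbit p x \<Longrightarrow> orbit p y = orbit p x"
  using orbit_cyclic_eq3 cyclic_on_orbit[OF p S] by metis

lemma orbit_sym: "y \<in> orbit p x \<Longrightarrow> x \<in> orbit p y"
  using orbit_eq self_in_orbit by metis

lemma orbit_subset_carrier: "x \<in> S \<Longrightarrow> orbit p x \<subseteq> S"
  using permutes_orbit_subset[OF p] .

lemma set_support: "set (support p x) = orbit p x"
  using support_set[OF permutation_on[OF S p]] orbit_altdef_permutation[OF permutation_on[OF S p]]
  by auto

text \<open>A cycle, listed from one of its letters, is rotated by one step under the permutation.\<close>

lemma map_support: "map p (support p x) = rotate1 (support p x)"
proof (rule nth_equalityI)
  note lp = least_power_of_permutation[OF permutation_on[OF S p], of x]
  fix i assume "i < length (map p (support p x))"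
  then have i: "i < least_power p x" by simp
  show "map p (support p x) ! i = rotate1 (support p x) ! i"
  proof (cases "Suc i < least_power p x")
    case True
    then show ?thesis using i by (simp add: nth_rotate1)
  next
    case False
    then have "Suc i = least_power p x" using i by simp
    then show ?thesis using i lp by (simp add: nth_rotate1) (metis funpow.simps(2) o_apply)
  qed
qed simp

lemma support_Cons: "support p x = x # tl (support p x)"
proof -
  note lp = least_power_of_permutation[OF permutation_on[OF S p], of x]
  show ?thesis using lp(2) by (cases "least_power p x") (simp_all add: upt_conv_Cons del: upt_Suc)
qed

end

subsection \<open>The product of rooted permutations as a composition\<close>

text \<open>The position of the letter \<open>y\<close> of the second factor in a product; both factors share the root \<open>0\<close>.\<close>

definition shift_letter :: "nat \<Rightarrow> nat \<Rightarrow> nat" where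
  "shift_letter a y = (if y = 0 then 0 else a + y)"

text \<open>A copy of \<open>\<upsilon>\<close> on the root and the letters above \<open>a\<close>; the letters in \<open>{1..a}\<close> are fixed.\<close>

definition shift_rooted :: "nat \<Rightarrow> (nat \<Rightarrow> nat) \<Rightarrow> nat \<Rightarrow> nat" where
  "shift_rooted a \<upsilon> x = (if x = 0 then shift_letter a (\<upsilon> 0)
     else if x \<le> a then x else shift_letter a (\<upsilon> (x - a)))"

lemma shift_letter_0 [simp]: "shift_letter a 0 = 0"
  by (simp add: shift_letter_def)

lemma inj_shift_letter: "inj (shift_letter a)"
  by (rule injI) (auto simp: shift_letter_def split: if_splits)

lemma shift_letter_eq_iff [simp]: "shift_letter a x = shift_letter a y \<longleftrightarrow> x = y"
  using inj_shift_letter[of a] by (auto dest: injD)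

lemma shift_letter_eq_0 [simp]: "shift_letter a x = 0 \<longleftrightarrow> x = 0"
  by (simp add: shift_letter_def)

lemma shift_rooted_shift_letter [simp]: "shift_rooted a \<upsilon> (shift_letter a y) = shift_letter a (\<upsilon> y)"
  by (simp add: shift_rooted_def shift_letter_def)

lemma shift_rooted_0 [simp]: "shift_rooted a \<upsilon> 0 = shift_letter a (\<upsilon> 0)"
  by (simp add: shift_rooted_def)

lemma shift_rooted_low [simp]: "1 \<le> x \<Longrightarrow> x \<le> a \<Longrightarrow> shift_rooted a \<upsilon> x = x"
  by (simp add: shift_rooted_def)

lemma low_or_shift:
  obtains "1 \<le> x" "x \<le> a" | y where "x = shift_letter a y"
proof (cases "1 \<le> x \<and> x \<le> a")
  case False
  then have "x = shift_letter a (x - a)" by (auto simp: shift_letter_def)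
  then show ?thesis using that by blast
qed (use that in blast)

lemma low_neq_shift: "1 \<le> x \<Longrightarrow> x \<le> a \<Longrightarrow> x \<noteq> shift_letter a y"
  by (simp add: shift_letter_def)

lemma shift_letter_bound: "y \<le> b \<Longrightarrow> shift_letter a y \<le> a + b"
  by (simp add: shift_letter_def)

lemma shift_rooted_permutes:
  assumes "\<upsilon> permutes {0..b}"
  shows "shift_rooted a \<upsilon> permutes {0..a + b}"
proof (rule finite_inj_permutes)
  have \<upsilon>: "y \<le> b \<Longrightarrow> \<upsilon> y \<le> b" for y using permutes_in_image[OF assms, of y] by simp
  have inj: "\<upsilon> x = \<upsilon> y \<longleftrightarrow> x = y" for x y using permutes_inj[OF assms] by (auto dest: injD)
  show "inj_on (shift_rooted a \<upsilon>) {0..a + b}"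
  proof (rule inj_onI)
    fix x y assume eq: "shift_rooted a \<upsilon> x = shift_rooted a \<upsilon> y"
    show "x = y"
    proof (rule low_or_shift[of x a]; rule low_or_shift[of y a])
      fix y' assume "1 \<le> x" "x \<le> a" "y = shift_letter a y'"
      then show ?thesis using eq low_neq_shift[of x a "\<upsilon> y'"] by simp
    next
      fix x' assume "1 \<le> y" "y \<le> a" "x = shift_letter a x'"
      then show ?thesis using eq low_neq_shift[of y a "\<upsilon> x'"] by simp
    qed (use eq in \<open>simp_all add: inj\<close>)
  qed
  fix x
  show "shift_rooted a \<upsilon> x \<in> {0..a + b}" if x: "x \<in> {0..a + b}"
  proof (rule low_or_shift[of x a])
    fix y assume y: "x = shift_letter a y"
    then have "y \<le> b" using x by (auto simp: shift_letter_def split: if_splits)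
    then show ?thesis using \<upsilon>[of y] shift_letter_bound[of "\<upsilon> y" b a] y by simp
  qed simp
  show "shift_rooted a \<upsilon> x = x" if "x \<notin> {0..a + b}"
    using that permutes_not_in[OF assms, of "x - a"] by (auto simp: shift_rooted_def shift_letter_def)
qed simp

lemma shift_rooted_comp: "shift_rooted a (\<upsilon> \<circ> \<upsilon>') = shift_rooted a \<upsilon> \<circ> shift_rooted a \<upsilon>'"
proof
  fix x
  show "shift_rooted a (\<upsilon> \<circ> \<upsilon>') x = (shift_rooted a \<upsilon> \<circ> shift_rooted a \<upsilon>') x"
    by (rule low_or_shift[of x a]) simp_all
qed

lemma shift_rooted_add:
  assumes "\<upsilon> permutes {0..c}"
  shows "shift_rooted a (shift_rooted b \<upsilon>) = shift_rooted (a + b) \<upsilon>"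
proof
  fix x
  consider "x = 0" | "x \<noteq> 0" "x \<le> a" | "a < x" "x \<le> a + b" | "a + b < x" by linarith
  then show "shift_rooted a (shift_rooted b \<upsilon>) x = shift_rooted (a + b) \<upsilon> x"
    by cases (auto simp: shift_rooted_def shift_letter_def)
qed

lemma root_letters_facts:
  assumes \<tau>: "\<tau> permutes {0..a}"
  shows "support \<tau> 0 = 0 # root_letters \<tau>" "map \<tau> (0 # root_letters \<tau>) = root_letters \<tau> @ [0]"
    "distinct (0 # root_letters \<tau>)" "set (0 # root_letters \<tau>) = orbit \<tau> 0"
    "set (root_letters \<tau>) \<subseteq> {1..a}"
proof -
  show 1: "support \<tau> 0 = 0 # root_letters \<tau>"
    unfolding root_letters_def using support_Cons[OF \<tau>, of 0] by simp
  show "map \<tau> (0 # root_letters \<tau>) = root_letters \<tau> @ [0]"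
    using map_support[OF \<tau>, of 0] unfolding 1 by simp
  show 2: "distinct (0 # root_letters \<tau>)"
    using cycle_of_permutation[OF permutation_on[OF _ \<tau>], of 0] unfolding 1 by simp
  show 3: "set (0 # root_letters \<tau>) = orbit \<tau> 0"
    using set_support[OF \<tau>, of 0] unfolding 1 by simp
  have "orbit \<tau> 0 \<subseteq> {0..a}" by (rule orbit_subset_carrier[OF \<tau>]) simp_all
  then show "set (root_letters \<tau>) \<subseteq> {1..a}" using 2 3[symmetric] by (auto simp: Suc_le_eq intro!: gr0I)
qed

text \<open>The root cycle of a composition of two permutations that share only the root is the
  concatenation of their root cycles, and the other cycles are unchanged. As a composition, the
  product is associative and cancellable for formal reasons.\<close>

lemma rooted_product_eq:
  assumes \<tau>: "\<tau> permutes {0..a}" and \<upsilon>: "\<upsilon> permutes {0..b}"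
  shows "rooted_product a \<tau> \<upsilon> = shift_rooted a \<upsilon> \<circ> \<tau>"
proof
  fix x
  let ?A = "root_letters \<tau>" and ?R = "root_letters \<upsilon>"
  let ?C = "map (\<lambda>b. a + b) ?R"
  define L where "L = 0 # ?A @ ?C"
  note A = root_letters_facts[OF \<tau>] and R = root_letters_facts[OF \<upsilon>]
  have C: "?C = map (shift_letter a) ?R" using R(3) by (auto simp: shift_letter_def)
  have fixC: "map \<tau> ?C = ?C"
    using R(5) by (intro map_idI permutes_not_in[OF \<tau>]) auto
  have fixA: "map (shift_rooted a \<upsilon>) ?A = ?A"
    using A(5) by (intro map_idI shift_rooted_low) auto
  have "map (shift_rooted a \<upsilon>) (0 # ?C) = map (shift_rooted a \<upsilon>) (map (shift_letter a) (0 # ?R))"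
    by (simp add: C)
  also have "\<dots> = map (shift_letter a) (map \<upsilon> (0 # ?R))" by (simp add: o_def)
  also have "\<dots> = ?C @ [0]" unfolding R(2) by (simp add: C)
  finally have rotC: "map (shift_rooted a \<upsilon>) (0 # ?C) = ?C @ [0]" .
  have "map (shift_rooted a \<upsilon> \<circ> \<tau>) L = map (shift_rooted a \<upsilon>) (map \<tau> (0 # ?A) @ map \<tau> ?C)"
    by (simp add: L_def)
  also have "\<dots> = map (shift_rooted a \<upsilon>) ?A @ map (shift_rooted a \<upsilon>) (0 # ?C)"
    unfolding A(2) fixC by simp
  also have "\<dots> = rotate1 L" unfolding fixA rotC by (simp add: L_def)
  finally have 1: "map (shift_rooted a \<upsilon> \<circ> \<tau>) L = rotate1 L" .
  have "distinct L" using A(3,5) R(3,5) by (auto simp: L_def distinct_map)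
  from cyclic_rotation[OF this, of 1] have 2: "map (cycle_of_list L) L = rotate1 L" by simp
  have rp: "rooted_product a \<tau> \<upsilon> x = (if x \<in> set L then cycle_of_list L x
              else if x \<le> a then \<tau> x else a + \<upsilon> (x - a))"
    by (simp add: rooted_product_def L_def Let_def)
  show "rooted_product a \<tau> \<upsilon> x = (shift_rooted a \<upsilon> \<circ> \<tau>) x"
  proof (cases "x \<in> set L")
    case True
    then show ?thesis using 1 2 rp by (metis map_eq_conv)
  next
    case False
    show ?thesis
    proof (cases "x \<le> a")
      case True
      have "x \<notin> orbit \<tau> 0" using False unfolding A(4)[symmetric] by (simp add: L_def)
      moreover have "0 \<in> orbit \<tau> x \<Longrightarrow> x \<in> orbit \<tau> 0" by (rule orbit_sym[OF \<tau>]) auto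
      ultimately have "\<tau> x \<noteq> 0" using orbit.base[of \<tau> x] by metis
      moreover have "\<tau> x \<le> a" using permutes_in_image[OF \<tau>, of x] True by simp
      ultimately show ?thesis using False True rp by simp
    next
      case x: False
      have "x = shift_letter a (x - a)" using x by (simp add: shift_letter_def)
      moreover have "\<tau> x = x" using x by (intro permutes_not_in[OF \<tau>]) simp
      moreover have "x - a \<notin> orbit \<upsilon> 0"
        using False x unfolding R(4)[symmetric] by (force simp: L_def image_iff)
      moreover have "0 \<in> orbit \<upsilon> (x - a) \<Longrightarrow> x - a \<in> orbit \<upsilon> 0" by (rule orbit_sym[OF \<upsilon>]) auto
      ultimately have "(shift_rooted a \<upsilon> \<circ> \<tau>) x = shift_letter a (\<upsilon> (x - a))" "\<upsilon> (x - a) \<noteq> 0"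
        using orbit.base[of \<upsilon> "x - a"] by (metis comp_apply shift_rooted_shift_letter, metis)
      then show ?thesis using False x rp by (simp add: shift_letter_def)
    qed
  qed
qed

subsection \<open>Factorization cuts\<close>

text \<open>The pointwise form of condition (b) of a factorization cut; it only looks at one application of \<open>\<tau>\<close>.\<close>

definition root_cut :: "nat \<Rightarrow> (nat \<Rightarrow> nat) \<Rightarrow> nat \<Rightarrow> bool" where
  "root_cut c \<tau> N \<longleftrightarrow> (\<forall>x\<in>{c + 1..N}. \<tau> x = 0 \<or> c < \<tau> x)"

text \<open>If letters above \<open>c\<close> are sent to the root or above \<open>c\<close>, then a cycle avoiding the root can never come
  back to small letters, and the root cycle can do so only by passing through the root, that is, at
  its end. Conversely, a violation at one letter is two adjacent letters of a cycle in the wrong order.\<close>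

lemma root_cut_iff:
  assumes \<tau>: "\<tau> permutes {0..N}" and c: "c \<le> N"
  shows "root_cut c \<tau> N \<longleftrightarrow>
     (\<forall>Z\<in>cycles_on {0..N} \<tau>. 0 \<notin> Z \<longrightarrow> Z \<subseteq> {1..c} \<or> Z \<subseteq> {c + 1..N}) \<and>
     (\<forall>i<length (root_letters \<tau>). \<forall>j<length (root_letters \<tau>).
        root_letters \<tau> ! i \<le> c \<longrightarrow> root_letters \<tau> ! j > c \<longrightarrow> i < j)"
    (is "_ \<longleftrightarrow> ?cyc \<and> ?root")
proof -
  let ?A = "root_letters \<tau>"
  note A = root_letters_facts[OF \<tau>]
  have next_letter: "\<tau> (?A ! i) = (if Suc i < length ?A then ?A ! Suc i else 0)" if "i < length ?A" for i
  proof -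
    have "\<tau> (?A ! i) = map \<tau> (0 # ?A) ! Suc i" using that by simp
    also have "\<dots> = (if Suc i < length ?A then ?A ! Suc i else 0)"
      unfolding A(2) using that by (auto simp: nth_append)
    finally show ?thesis .
  qed
  have A0: "?A ! i \<noteq> 0" if "i < length ?A" for i using A(3) that by (metis distinct.simps(2) nth_mem)
  show ?thesis
  proof
    assume rc: "root_cut c \<tau> N"
    have ?cyc
    proof (intro ballI impI)
      fix Z assume Z: "Z \<in> cycles_on {0..N} \<tau>" and Z0: "0 \<notin> Z"
      then obtain x where x: "x \<le> N" "Z = orbit \<tau> x" by (auto simp: cycles_on_def)
      have ZN: "Z \<subseteq> {0..N}" using x orbit_subset_carrier[OF \<tau>, of x] by simp
      show "Z \<subseteq> {1..c} \<or> Z \<subseteq> {c + 1..N}"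
      proof (cases "\<exists>y\<in>Z. c < y")
        case True
        then obtain y where y: "y \<in> Z" "c < y" by auto
        have Zy: "orbit \<tau> y = Z" using orbit_eq[OF \<tau>, of y x] y x by simp
        have "z \<in> {c + 1..N}" if "z \<in> orbit \<tau> y" for z
          using that
        proof induction
          case base
          have "\<tau> y \<in> Z" using orbit.base[of \<tau> y] Zy by simp
          moreover have "y \<in> {c + 1..N}" using y ZN by auto
          then have "\<tau> y = 0 \<or> c < \<tau> y" using rc by (auto simp: root_cut_def)
          ultimately show ?case using ZN Z0 by force
        next
          case (step z)
          have "\<tau> z \<in> Z" using orbit.step[OF step.hyps] Zy by simp
          moreover have "\<tau> z = 0 \<or> c < \<tau> z" using rc step.IH by (auto simp: root_cut_def)
          ultimately show ?case using ZN Z0 by force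
        qed
        then show ?thesis using Zy by auto
      next
        case False
        have "x \<in> {1..c}" if "x \<in> Z" for x
          using that False Z0 by (cases x) (auto simp: not_less)
        then show ?thesis by blast
      qed
    qed
    moreover have ?root
    proof (intro allI impI)
      fix i j assume ij: "i < length ?A" "j < length ?A" "?A ! i \<le> c" "c < ?A ! j"
      have high: "c < ?A ! k" if "j \<le> k" "k < length ?A" for k
        using that
      proof (induction k rule: dec_induct)
        case base
        then show ?case using ij by simp
      next
        case (step k)
        then have "?A ! k \<in> {c + 1..N}" using A(5) nth_mem[of k ?A] by force
        then have "\<tau> (?A ! k) = 0 \<or> c < \<tau> (?A ! k)" using rc by (auto simp: root_cut_def)
        then show ?case using next_letter[of k] step A0[of "Suc k"] by auto
      qed
      show "i < j" using high[of i] ij by (meson leD not_le)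
    qed
    ultimately show "?cyc \<and> ?root" by blast
  next
    assume *: "?cyc \<and> ?root"
    show "root_cut c \<tau> N"
      unfolding root_cut_def
    proof
      fix x assume x: "x \<in> {c + 1..N}"
      show "\<tau> x = 0 \<or> c < \<tau> x"
      proof (cases "0 \<in> orbit \<tau> x")
        case False
        have "orbit \<tau> x \<in> cycles_on {0..N} \<tau>" using x by (auto simp: cycles_on_def)
        then have "orbit \<tau> x \<subseteq> {1..c} \<or> orbit \<tau> x \<subseteq> {c + 1..N}" using * False by blast
        moreover have "x \<in> orbit \<tau> x" "\<tau> x \<in> orbit \<tau> x"
          using self_in_orbit[OF \<tau>] orbit.base by auto
        ultimately have "\<tau> x \<in> {c + 1..N}" using x by auto
        then show ?thesis by simp
      next
        case True
        then have "x \<in> set (0 # ?A)" unfolding A(4) by (rule orbit_sym[OF \<tau>, rotated]) simp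
        then obtain i where i: "i < length ?A" "x = ?A ! i" using x by (auto simp: in_set_conv_nth)
        show ?thesis
        proof (cases "Suc i < length ?A")
          case True
          have "\<not> ?A ! Suc i \<le> c"
          proof
            assume "?A ! Suc i \<le> c"
            moreover have "c < ?A ! i" using x i by simp
            ultimately have "Suc i < i" using * True i(1) by blast
            then show False by simp
          qed
          then show ?thesis using next_letter[OF i(1)] i True by simp
        qed (use next_letter[OF i(1)] i in simp)
      qed
    qed
  qed
qed

lemma lower_half_mono: "c \<le> n \<Longrightarrow> lower_half c \<le> lower_half n"
  by (simp add: lower_half_def div_le_mono)

text \<open>Cuts become conditions on intervals of letters, to which the two factors of a decoration can be restricted.\<close>

lemma is_factorization_cut_iff:
  assumes "(\<sigma>, \<tau>) \<in> decorations n" "c \<le> n"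
  shows "is_factorization_cut n (\<sigma>, \<tau>) c \<longleftrightarrow>
     \<sigma> ` {1..upper_half c} = {1..upper_half c} \<and> root_cut (lower_half c) \<tau> (lower_half n)"
  using assms root_cut_iff[of \<tau> "lower_half n" "lower_half c"] lower_half_mono[of c n]
  by (auto simp: is_factorization_cut_def decorations_def)

text \<open>The reason for excluding two odd sizes: only then do the rounded halves add up.\<close>

lemma half_add:
  assumes "\<not> (odd a \<and> odd b)"
  shows "upper_half (a + b) = upper_half a + upper_half b" "lower_half (a + b) = lower_half a + lower_half b"
  using assms by (auto simp: upper_half_def lower_half_def elim!: evenE oddE)

subsection \<open>Unique factorization at a cut\<close>

lemma perm_sum_permutes:
  assumes "\<sigma> permutes {1..p}" "\<sigma>' permutes {1..q}"
  shows "perm_sum p \<sigma> \<sigma>' permutes {1..p + q}"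
proof (rule finite_inj_permutes)
  have s: "x \<in> {1..p} \<Longrightarrow> \<sigma> x \<in> {1..p}" for x using permutes_in_image[OF assms(1)] by blast
  have s': "x \<in> {1..q} \<Longrightarrow> \<sigma>' x \<in> {1..q}" for x using permutes_in_image[OF assms(2)] by blast
  have inj: "\<sigma> x = \<sigma> y \<longleftrightarrow> x = y" "\<sigma>' x = \<sigma>' y \<longleftrightarrow> x = y" for x y
    using permutes_inj[OF assms(1)] permutes_inj[OF assms(2)] by (auto dest: injD)
  show "inj_on (perm_sum p \<sigma> \<sigma>') {1..p + q}"
  proof (rule inj_onI)
    fix x y assume xy: "x \<in> {1..p + q}" "y \<in> {1..p + q}" "perm_sum p \<sigma> \<sigma>' x = perm_sum p \<sigma> \<sigma>' y"
    have "\<not> p < \<sigma> z" if "z \<in> {1..p}" for z using s[OF that] by simp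
    moreover have "0 < \<sigma>' (z - p)" if "z \<in> {1..p + q}" "\<not> z \<le> p" for z
    proof -
      have "z - p \<in> {1..q}" using that by auto
      then show ?thesis using s'[of "z - p"] by simp
    qed
    ultimately show "x = y" using xy
      by (cases "x \<le> p"; cases "y \<le> p")
         (auto simp: perm_sum_def inj, metis less_add_same_cancel1 atLeastAtMost_iff One_nat_def,
          metis less_add_same_cancel1 atLeastAtMost_iff One_nat_def)
  qed
  fix x
  show "perm_sum p \<sigma> \<sigma>' x \<in> {1..p + q}" if "x \<in> {1..p + q}"
  proof (cases "x \<le> p")
    case False
    then have "x - p \<in> {1..q}" using that by auto
    from s'[OF this] False show ?thesis by (simp add: perm_sum_def)
  qed (use s[of x] that in \<open>simp add: perm_sum_def\<close>)
  show "perm_sum p \<sigma> \<sigma>' x = x" if "x \<notin> {1..p + q}"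
  proof (cases "x = 0")
    case True
    then show ?thesis using permutes_not_in[OF assms(1), of 0] by (simp add: perm_sum_def)
  next
    case False
    then have x: "p + q < x" using that by auto
    then have "\<sigma>' (x - p) = x - p" by (intro permutes_not_in[OF assms(2)]) auto
    then show ?thesis using x by (simp add: perm_sum_def)
  qed
qed simp

lemma interval_split: "{1..p + k} = {1..p} \<union> (+) p ` {1..k :: nat}"
proof (intro equalityI subsetI)
  fix x assume "x \<in> {1..p + k}"
  then show "x \<in> {1..p} \<union> (+) p ` {1..k}"
    by (cases "x \<le> p") (auto intro!: image_eqI[of _ _ "x - p"])
qed auto

lemma perm_sum_image:
  assumes "\<sigma> permutes {1..p}" "\<sigma>' permutes {1..q}"
  shows "perm_sum p \<sigma> \<sigma>' ` {1..p + k} = {1..p} \<union> (+) p ` \<sigma>' ` {1..k}"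
proof -
  have "perm_sum p \<sigma> \<sigma>' ` {1..p + k} = perm_sum p \<sigma> \<sigma>' ` {1..p} \<union> perm_sum p \<sigma> \<sigma>' ` (+) p ` {1..k}"
    unfolding interval_split[of p k] by (simp add: image_Un)
  also have "perm_sum p \<sigma> \<sigma>' ` {1..p} = \<sigma> ` {1..p}"
    by (rule image_cong) (auto simp: perm_sum_def)
  also have "\<dots> = {1..p}" by (rule permutes_image[OF assms(1)])
  also have "perm_sum p \<sigma> \<sigma>' ` (+) p ` {1..k} = (+) p ` \<sigma>' ` {1..k}"
    unfolding image_image by (rule image_cong) (auto simp: perm_sum_def)
  finally show ?thesis .
qed

lemma perm_sum_image_iff:
  assumes "\<sigma> permutes {1..p}" "\<sigma>' permutes {1..q}"
  shows "perm_sum p \<sigma> \<sigma>' ` {1..p + k} = {1..p + k} \<longleftrightarrow> \<sigma>' ` {1..k} = {1..k}"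
proof -
  have pos: "0 < \<sigma>' x" if "1 \<le> x" for x
    using that permutes_in_image[OF assms(2), of 0] permutes_inj[OF assms(2)]
      permutes_not_in[OF assms(2), of 0] by (metis atLeastAtMost_iff gr0I injD not_one_le_zero)
  have "{1..p} \<union> (+) p ` \<sigma>' ` {1..k} = {1..p} \<union> (+) p ` {1..k} \<longleftrightarrow> (+) p ` \<sigma>' ` {1..k} = (+) p ` {1..k}"
  proof -
    have "{1..p} \<inter> (+) p ` \<sigma>' ` {1..k} = {}" using pos by force
    moreover have "{1..p} \<inter> (+) p ` {1..k} = {}" by auto
    ultimately show ?thesis by blast
  qed
  also have "\<dots> \<longleftrightarrow> \<sigma>' ` {1..k} = {1..k}" by (rule inj_image_eq_iff) simp
  finally show ?thesis by (simp only: perm_sum_image[OF assms]) (simp only: interval_split[of p k])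
qed

text \<open>A permutation that preserves an initial interval restricts to it and to its complement.\<close>

lemma perm_sum_bij:
  "bij_betw (\<lambda>(\<sigma>, \<sigma>'). perm_sum p \<sigma> \<sigma>')
     ({\<sigma>. \<sigma> permutes {1..p}} \<times> {\<sigma>'. \<sigma>' permutes {1..q}})
     {\<pi>. \<pi> permutes {1..p + q} \<and> \<pi> ` {1..p} = {1..p}}"
proof (rule bij_betw_imageI)
  show "inj_on (\<lambda>(\<sigma>, \<sigma>'). perm_sum p \<sigma> \<sigma>') ({\<sigma>. \<sigma> permutes {1..p}} \<times> {\<sigma>'. \<sigma>' permutes {1..q}})"
  proof (rule inj_onI, clarsimp)
    fix \<sigma> \<sigma>' \<rho> \<rho>'
    assume *: "\<sigma> permutes {Suc 0..p}" "\<sigma>' permutes {Suc 0..q}" "\<rho> permutes {Suc 0..p}" "\<rho>' permutes {Suc 0..q}"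
      and eq: "perm_sum p \<sigma> \<sigma>' = perm_sum p \<rho> \<rho>'"
    have "\<sigma> x = \<rho> x" for x
      using fun_cong[OF eq, of x] permutes_not_in[OF *(1), of x] permutes_not_in[OF *(3), of x]
      by (cases "x \<le> p") (auto simp: perm_sum_def)
    moreover have "\<sigma>' x = \<rho>' x" for x
      using fun_cong[OF eq, of "p + x"] permutes_not_in[OF *(2), of 0] permutes_not_in[OF *(4), of 0]
      by (cases x) (auto simp: perm_sum_def)
    ultimately show "\<sigma> = \<rho> \<and> \<sigma>' = \<rho>'" by auto
  qed
  show "(\<lambda>(\<sigma>, \<sigma>'). perm_sum p \<sigma> \<sigma>') ` ({\<sigma>. \<sigma> permutes {1..p}} \<times> {\<sigma>'. \<sigma>' permutes {1..q}})
      = {\<pi>. \<pi> permutes {1..p + q} \<and> \<pi> ` {1..p} = {1..p}}"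
  proof (intro equalityI subsetI)
    fix \<pi> assume "\<pi> \<in> (\<lambda>(\<sigma>, \<sigma>'). perm_sum p \<sigma> \<sigma>') ` ({\<sigma>. \<sigma> permutes {1..p}} \<times> {\<sigma>'. \<sigma>' permutes {1..q}})"
    then obtain \<sigma> \<sigma>' where *: "\<pi> = perm_sum p \<sigma> \<sigma>'" "\<sigma> permutes {1..p}" "\<sigma>' permutes {1..q}" by auto
    show "\<pi> \<in> {\<pi>. \<pi> permutes {1..p + q} \<and> \<pi> ` {1..p} = {1..p}}"
      using perm_sum_permutes[OF *(2,3)] perm_sum_image[OF *(2,3), of 0] *(1) by simp
  next
    fix \<pi> assume "\<pi> \<in> {\<pi>. \<pi> permutes {1..p + q} \<and> \<pi> ` {1..p} = {1..p}}"
    then have \<pi>: "\<pi> permutes {1..p + q}" and im: "\<pi> ` {1..p} = {1..p}" by auto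
    have inj: "\<pi> x = \<pi> y \<longleftrightarrow> x = y" for x y using permutes_inj[OF \<pi>] by (auto dest: injD)
    have high: "p < \<pi> x \<and> \<pi> x \<le> p + q" if "p < x" "x \<le> p + q" for x
    proof -
      have "\<pi> x \<notin> \<pi> ` {1..p}" using that by (auto simp: inj)
      moreover have "\<pi> x \<in> {1..p + q}" using that permutes_in_image[OF \<pi>, of x] by auto
      ultimately show ?thesis unfolding im by auto
    qed
    define \<sigma> where "\<sigma> = (\<lambda>x. if x \<in> {1..p} then \<pi> x else x)"
    define \<sigma>' where "\<sigma>' = (\<lambda>x. if x \<in> {1..q} then \<pi> (p + x) - p else x)"
    have "\<sigma> permutes {1..p}"
      by (rule finite_inj_permutes) (use im in \<open>auto simp: \<sigma>_def inj inj_on_def\<close>)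
    moreover have "\<sigma>' permutes {1..q}"
    proof (rule finite_inj_permutes)
      show "inj_on \<sigma>' {1..q}"
      proof (rule inj_onI)
        fix x y assume "x \<in> {1..q}" "y \<in> {1..q}" "\<sigma>' x = \<sigma>' y"
        then have "\<pi> (p + x) = \<pi> (p + y)"
          using high[of "p + x"] high[of "p + y"] by (auto simp: \<sigma>'_def)
        then show "x = y" by (simp add: inj)
      qed
      show "\<sigma>' x \<in> {1..q}" if "x \<in> {1..q}" for x
        using that high[of "p + x"] by (auto simp: \<sigma>'_def)
    qed (auto simp: \<sigma>'_def)
    moreover have "perm_sum p \<sigma> \<sigma>' = \<pi>"
    proof
      fix x
      consider "x = 0" | "x \<in> {1..p}" | "p < x" "x \<le> p + q" | "p + q < x" by fastforce
      then show "perm_sum p \<sigma> \<sigma>' x = \<pi> x"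
      proof cases
        case 3
        then show ?thesis using high[of x] by (auto simp: perm_sum_def \<sigma>'_def)
      qed (use permutes_not_in[OF \<pi>, of x] in \<open>auto simp: perm_sum_def \<sigma>_def \<sigma>'_def\<close>)
    qed
    ultimately show "\<pi> \<in> (\<lambda>(\<sigma>, \<sigma>'). perm_sum p \<sigma> \<sigma>') ` ({\<sigma>. \<sigma> permutes {1..p}} \<times> {\<sigma>'. \<sigma>' permutes {1..q}})"
      by (intro image_eqI[of _ _ "(\<sigma>, \<sigma>')"]) auto
  qed
qed

lemma rooted_comp_permutes:
  assumes "\<tau> permutes {0..a}" "\<upsilon> permutes {0..b}"
  shows "shift_rooted a \<upsilon> \<circ> \<tau> permutes {0..a + b}"
proof (rule permutes_compose)
  show "\<tau> permutes {0..a + b}" by (rule permutes_subset[OF assms(1)]) auto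
qed (rule shift_rooted_permutes[OF assms(2)])

lemma rooted_comp_high:
  assumes "\<tau> permutes {0..a}" "a < x"
  shows "(shift_rooted a \<upsilon> \<circ> \<tau>) x = shift_letter a (\<upsilon> (x - a))"
  using permutes_not_in[OF assms(1), of x] assms(2) by (simp add: shift_rooted_def)

lemma rooted_comp_low:
  assumes "\<tau> permutes {0..a}" "x \<le> a"
  shows "(shift_rooted a \<upsilon> \<circ> \<tau>) x = (if \<tau> x = 0 then shift_letter a (\<upsilon> 0) else \<tau> x)"
  using permutes_in_image[OF assms(1), of x] assms(2) by (simp add: shift_rooted_def)

lemma root_cut_shift:
  assumes "\<tau> permutes {0..a}"
  shows "root_cut (a + c) (shift_rooted a \<upsilon> \<circ> \<tau>) (a + b) \<longleftrightarrow> root_cut c \<upsilon> b"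
proof
  assume *: "root_cut (a + c) (shift_rooted a \<upsilon> \<circ> \<tau>) (a + b)"
  show "root_cut c \<upsilon> b"
    unfolding root_cut_def
  proof
    fix x assume "x \<in> {c + 1..b}"
    then have "a + x \<in> {a + c + 1..a + b}" "a < a + x" by auto
    then have "shift_letter a (\<upsilon> x) = 0 \<or> a + c < shift_letter a (\<upsilon> x)"
      using * rooted_comp_high[OF assms, of "a + x" \<upsilon>] unfolding root_cut_def by (metis add_diff_cancel_left')
    then show "\<upsilon> x = 0 \<or> c < \<upsilon> x" by (auto simp: shift_letter_def split: if_splits)
  qed
next
  assume *: "root_cut c \<upsilon> b"
  show "root_cut (a + c) (shift_rooted a \<upsilon> \<circ> \<tau>) (a + b)"
    unfolding root_cut_def
  proof
    fix x assume x: "x \<in> {a + c + 1..a + b}"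
    then have "x - a \<in> {c + 1..b}" by auto
    then have "\<upsilon> (x - a) = 0 \<or> c < \<upsilon> (x - a)" using * by (auto simp: root_cut_def)
    then show "(shift_rooted a \<upsilon> \<circ> \<tau>) x = 0 \<or> a + c < (shift_rooted a \<upsilon> \<circ> \<tau>) x"
      using x rooted_comp_high[OF assms, of x \<upsilon>] by (auto simp: shift_letter_def)
  qed
qed

lemma root_cut_0: "root_cut 0 \<upsilon> b"
  by (auto simp: root_cut_def)

text \<open>Cancellation gives uniqueness. For existence, exactly one letter \<open>x\<close> in \<open>{0..a}\<close> leaves \<open>{1..a}\<close>;
  redirecting it to the root defines \<open>\<tau>\<close>, and the remaining factor fixes \<open>{1..a}\<close>.\<close>

lemma rooted_comp_bij:
  "bij_betw (\<lambda>(\<tau>, \<upsilon>). shift_rooted a \<upsilon> \<circ> \<tau>)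
     ({\<tau>. \<tau> permutes {0..a}} \<times> {\<upsilon>. \<upsilon> permutes {0..b}})
     {\<pi>. \<pi> permutes {0..a + b} \<and> root_cut a \<pi> (a + b)}"
proof (rule bij_betw_imageI)
  show "inj_on (\<lambda>(\<tau>, \<upsilon>). shift_rooted a \<upsilon> \<circ> \<tau>) ({\<tau>. \<tau> permutes {0..a}} \<times> {\<upsilon>. \<upsilon> permutes {0..b}})"
  proof (rule inj_onI, clarsimp)
    fix \<tau> \<upsilon> \<tau>' \<upsilon>'
    assume *: "\<tau> permutes {0..a}" "\<upsilon> permutes {0..b}" "\<tau>' permutes {0..a}" "\<upsilon>' permutes {0..b}"
      and eq: "shift_rooted a \<upsilon> \<circ> \<tau> = shift_rooted a \<upsilon>' \<circ> \<tau>'"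
    have "\<tau> x = \<tau>' x" for x
    proof (cases "x \<le> a")
      case True
      then have "\<tau> x \<le> a" "\<tau>' x \<le> a" using permutes_in_image[OF *(1), of x] permutes_in_image[OF *(3), of x] by auto
      moreover have "(if \<tau> x = 0 then shift_letter a (\<upsilon> 0) else \<tau> x) = (if \<tau>' x = 0 then shift_letter a (\<upsilon>' 0) else \<tau>' x)"
        using rooted_comp_low[OF *(1) True, of \<upsilon>] rooted_comp_low[OF *(3) True, of \<upsilon>'] eq by simp
      ultimately show ?thesis by (auto simp: shift_letter_def split: if_splits)
    qed (use permutes_not_in[OF *(1), of x] permutes_not_in[OF *(3), of x] in auto)
    then have \<tau>: "\<tau> = \<tau>'" by (rule ext)
    have "shift_rooted a \<upsilon> = shift_rooted a \<upsilon>'"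
    proof
      fix x
      obtain y where "\<tau> y = x" using permutes_surj[OF *(1)] by (metis surjD)
      then show "shift_rooted a \<upsilon> x = shift_rooted a \<upsilon>' x" using fun_cong[OF eq, of y] \<tau> by simp
    qed
    then have "\<upsilon> y = \<upsilon>' y" for y
      by (metis shift_rooted_shift_letter shift_letter_eq_iff)
    then show "\<tau> = \<tau>' \<and> \<upsilon> = \<upsilon>'" using \<tau> by auto
  qed
  show "(\<lambda>(\<tau>, \<upsilon>). shift_rooted a \<upsilon> \<circ> \<tau>) ` ({\<tau>. \<tau> permutes {0..a}} \<times> {\<upsilon>. \<upsilon> permutes {0..b}})
      = {\<pi>. \<pi> permutes {0..a + b} \<and> root_cut a \<pi> (a + b)}"
  proof (intro equalityI subsetI)
    fix \<pi> assume "\<pi> \<in> (\<lambda>(\<tau>, \<upsilon>). shift_rooted a \<upsilon> \<circ> \<tau>) ` ({\<tau>. \<tau> permutes {0..a}} \<times> {\<upsilon>. \<upsilon> permutes {0..b}})"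
    then obtain \<tau> \<upsilon> where *: "\<pi> = shift_rooted a \<upsilon> \<circ> \<tau>" "\<tau> permutes {0..a}" "\<upsilon> permutes {0..b}" by auto
    show "\<pi> \<in> {\<pi>. \<pi> permutes {0..a + b} \<and> root_cut a \<pi> (a + b)}"
      using rooted_comp_permutes[OF *(2,3)] root_cut_shift[OF *(2), of 0 \<upsilon> b] root_cut_0 *(1) by simp
  next
    fix \<pi> assume "\<pi> \<in> {\<pi>. \<pi> permutes {0..a + b} \<and> root_cut a \<pi> (a + b)}"
    then have \<pi>: "\<pi> permutes {0..a + b}" and rc: "root_cut a \<pi> (a + b)" by auto
    have inj: "\<pi> x = \<pi> y \<longleftrightarrow> x = y" for x y using permutes_inj[OF \<pi>] by (auto dest: injD)
    let ?low = "\<lambda>x. 1 \<le> \<pi> x \<and> \<pi> x \<le> a"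
    \<comment> \<open>\<open>\<pi>\<close> sends the \<open>b\<close> letters above \<open>a\<close> to the \<open>b + 1\<close> letters that are \<open>0\<close> or above \<open>a\<close>, so exactly
      one letter in \<open>{0..a}\<close> leaves \<open>{1..a}\<close>.\<close>
    have unique: "x = y" if xy: "x \<le> a" "y \<le> a" "\<not> ?low x" "\<not> ?low y" for x y
    proof (rule ccontr)
      assume "x \<noteq> y"
      define W where "W = insert x (insert y {a + 1..a + b})"
      have "card W = b + 2" using \<open>x \<noteq> y\<close> xy by (simp add: W_def)
      moreover have "\<pi> ` W \<subseteq> insert 0 {a + 1..a + b}"
      proof
        fix z assume "z \<in> \<pi> ` W"
        then obtain w where w: "w \<in> W" "z = \<pi> w" by auto
        have "w \<le> a + b" using w xy by (auto simp: W_def)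
        then have "\<pi> w \<le> a + b" using permutes_in_image[OF \<pi>, of w] by simp
        moreover have "\<not> ?low w" if "w \<in> {a + 1..a + b}"
          using rc that by (auto simp: root_cut_def dest!: bspec[of _ _ w])
        then have "\<not> ?low w" using w(1) xy(3,4) by (auto simp: W_def)
        ultimately show "z \<in> insert 0 {a + 1..a + b}" using w by auto
      qed
      then have "card (\<pi> ` W) \<le> b + 1" using card_mono[of "insert 0 {a + 1..a + b}" "\<pi> ` W"] by simp
      moreover have "card (\<pi> ` W) = card W" by (rule card_image) (auto simp: inj_on_def inj)
      ultimately show False by simp
    qed
    define \<tau> where "\<tau> = (\<lambda>x. if x \<le> a then (if ?low x then \<pi> x else 0) else x)"
    have \<tau>: "\<tau> permutes {0..a}"
    proof (rule finite_inj_permutes)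
      show "inj_on \<tau> {0..a}"
      proof (rule inj_onI)
        fix x y assume "x \<in> {0..a}" "y \<in> {0..a}" "\<tau> x = \<tau> y"
        then show "x = y" using unique[of x y] inj[of x y] by (auto simp: \<tau>_def split: if_splits)
      qed
    qed (auto simp: \<tau>_def)
    define \<rho> where "\<rho> = \<pi> \<circ> inv \<tau>"
    have \<rho>\<tau>: "\<rho> \<circ> \<tau> = \<pi>" unfolding \<rho>_def using permutes_inv_o(2)[OF \<tau>] by (simp add: o_assoc[symmetric])
    have \<rho>: "\<rho> permutes {0..a + b}"
      unfolding \<rho>_def by (rule permutes_compose[OF permutes_subset[OF permutes_inv[OF \<tau>]] \<pi>]) simp
    have \<rho>inj: "\<rho> x = \<rho> y \<longleftrightarrow> x = y" for x y using permutes_inj[OF \<rho>] by (auto dest: injD)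
    have \<rho>low: "\<rho> x = x" if "1 \<le> x" "x \<le> a" for x
    proof -
      have "x \<in> \<tau> ` {0..a}" using that permutes_image[OF \<tau>] by simp
      then obtain z where z: "z \<le> a" "\<tau> z = x" by auto
      then have "\<pi> z = x" using that by (auto simp: \<tau>_def split: if_splits)
      then show ?thesis using \<rho>\<tau> z by (metis comp_apply)
    qed
    have \<rho>high: "\<exists>z. z \<le> b \<and> \<rho> (shift_letter a y) = shift_letter a z" if "y \<le> b" for y
    proof -
      have "\<rho> (shift_letter a y) \<le> a + b"
        using permutes_in_image[OF \<rho>, of "shift_letter a y"] shift_letter_bound[OF that, of a] by simp
      moreover have "\<not> (1 \<le> \<rho> (shift_letter a y) \<and> \<rho> (shift_letter a y) \<le> a)"
      proof
        assume *: "1 \<le> \<rho> (shift_letter a y) \<and> \<rho> (shift_letter a y) \<le> a"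
        then have "\<rho> (\<rho> (shift_letter a y)) = \<rho> (shift_letter a y)" using \<rho>low by blast
        then show False using * low_neq_shift[of "shift_letter a y" a y] by (simp add: \<rho>inj)
      qed
      ultimately show ?thesis
        by (intro exI[of _ "\<rho> (shift_letter a y) - a"]) (auto simp: shift_letter_def)
    qed
    define \<upsilon> where "\<upsilon> = (\<lambda>y. if y \<le> b then \<rho> (shift_letter a y) - a else y)"
    have \<upsilon>sh: "shift_letter a (\<upsilon> y) = \<rho> (shift_letter a y)" "\<upsilon> y \<le> b" if "y \<le> b" for y
    proof -
      obtain z where z: "z \<le> b" "\<rho> (shift_letter a y) = shift_letter a z" using \<rho>high[OF \<open>y \<le> b\<close>] by blast
      then have "\<upsilon> y = z" using that by (simp add: \<upsilon>_def shift_letter_def)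
      then show "shift_letter a (\<upsilon> y) = \<rho> (shift_letter a y)" "\<upsilon> y \<le> b" using z by auto
    qed
    have \<upsilon>: "\<upsilon> permutes {0..b}"
    proof (rule finite_inj_permutes)
      show "inj_on \<upsilon> {0..b}"
      proof (rule inj_onI)
        fix x y assume "x \<in> {0..b}" "y \<in> {0..b}" "\<upsilon> x = \<upsilon> y"
        then have "\<rho> (shift_letter a x) = \<rho> (shift_letter a y)" using \<upsilon>sh(1)[of x] \<upsilon>sh(1)[of y] by simp
        then show "x = y" by (simp add: \<rho>inj)
      qed
    qed (use \<upsilon>sh in \<open>auto simp: \<upsilon>_def\<close>)
    have "shift_rooted a \<upsilon> = \<rho>"
    proof
      fix x
      show "shift_rooted a \<upsilon> x = \<rho> x"
      proof (rule low_or_shift[of x a])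
        fix y assume y: "x = shift_letter a y"
        show ?thesis
        proof (cases "y \<le> b")
          case False
          then have "\<rho> x = x" using y by (intro permutes_not_in[OF \<rho>]) (simp add: shift_letter_def)
          then show ?thesis using False y by (simp add: \<upsilon>_def)
        qed (use \<upsilon>sh y in simp)
      qed (simp add: \<rho>low)
    qed
    then have "\<pi> = shift_rooted a \<upsilon> \<circ> \<tau>" using \<rho>\<tau> by simp
    then show "\<pi> \<in> (\<lambda>(\<tau>, \<upsilon>). shift_rooted a \<upsilon> \<circ> \<tau>) ` ({\<tau>. \<tau> permutes {0..a}} \<times> {\<upsilon>. \<upsilon> permutes {0..b}})"
      using \<tau> \<upsilon> by (intro image_eqI[of _ _ "(\<tau>, \<upsilon>)"]) auto
  qed
qed

lemma diamond_eq:
  assumes "(\<sigma>, \<tau>) \<in> decorations a" "(\<sigma>', \<tau>') \<in> decorations b"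
  shows "diamond a (\<sigma>, \<tau>) (\<sigma>', \<tau>') =
    (perm_sum (upper_half a) \<sigma> \<sigma>', shift_rooted (lower_half a) \<tau>' \<circ> \<tau>)"
  using assms rooted_product_eq[of \<tau> "lower_half a" \<tau>' "lower_half b"]
  by (simp add: diamond_def decorations_def)

lemma diamond_in_decorations:
  assumes "\<xi> \<in> decorations a" "\<xi>' \<in> decorations b" "\<not> (odd a \<and> odd b)"
  shows "diamond a \<xi> \<xi>' \<in> decorations (a + b)"
  using assms
  by (cases \<xi>; cases \<xi>') (auto simp: diamond_eq half_add decorations_def perm_sum_permutes rooted_comp_permutes
      simp del: One_nat_def)

lemma diamond_assoc:
  assumes "\<xi> \<in> decorations a" "\<xi>' \<in> decorations b" "\<xi>'' \<in> decorations c"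
    and "\<not> (odd a \<and> odd b)" "\<not> (odd b \<and> odd c)" "\<not> (odd a \<and> odd c)"
  shows "diamond (a + b) (diamond a \<xi> \<xi>') \<xi>'' = diamond a \<xi> (diamond b \<xi>' \<xi>'')"
proof -
  obtain \<sigma> \<tau> \<sigma>' \<tau>' \<sigma>'' \<tau>'' where \<xi>: "\<xi> = (\<sigma>, \<tau>)" "\<xi>' = (\<sigma>', \<tau>')" "\<xi>'' = (\<sigma>'', \<tau>'')"
    by (cases \<xi>; cases \<xi>'; cases \<xi>'') auto
  have 1: "diamond a (\<sigma>, \<tau>) (\<sigma>', \<tau>') \<in> decorations (a + b)"
    "diamond b (\<sigma>', \<tau>') (\<sigma>'', \<tau>'') \<in> decorations (b + c)"
    using assms diamond_in_decorations unfolding \<xi> by blast+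
  have d: "(\<sigma>, \<tau>) \<in> decorations a" "(\<sigma>', \<tau>') \<in> decorations b" "(\<sigma>'', \<tau>'') \<in> decorations c"
    using assms \<xi> by auto
  have \<tau>'': "\<tau>'' permutes {0..lower_half c}" using d by (simp add: decorations_def)
  have "perm_sum (upper_half a + upper_half b) (perm_sum (upper_half a) \<sigma> \<sigma>') \<sigma>''
      = perm_sum (upper_half a) \<sigma> (perm_sum (upper_half b) \<sigma>' \<sigma>'')"
    by (rule ext) (auto simp: perm_sum_def)
  moreover have "shift_rooted (lower_half a + lower_half b) \<tau>'' \<circ> (shift_rooted (lower_half a) \<tau>' \<circ> \<tau>)
      = shift_rooted (lower_half a) (shift_rooted (lower_half b) \<tau>'' \<circ> \<tau>') \<circ> \<tau>"
    by (simp add: shift_rooted_comp shift_rooted_add[OF \<tau>''] o_assoc)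
  ultimately show ?thesis
    using 1 d unfolding \<xi> diamond_eq[OF d(1,2)] diamond_eq[OF d(2,3)]
    by (simp add: diamond_eq half_add[OF assms(4)])
qed

lemma diamond_bij:
  assumes "\<not> (odd a \<and> odd b)"
  shows "bij_betw (\<lambda>(\<xi>, \<xi>'). diamond a \<xi> \<xi>') (decorations a \<times> decorations b)
    {\<theta> \<in> decorations (a + b). is_factorization_cut (a + b) \<theta> a}"
proof (rule bij_betw_imageI)
  note P = perm_sum_bij[of "upper_half a" "upper_half b"]
  note R = rooted_comp_bij[of "lower_half a" "lower_half b"]
  show "inj_on (\<lambda>(\<xi>, \<xi>'). diamond a \<xi> \<xi>') (decorations a \<times> decorations b)"
  proof (rule inj_onI)
    fix p p' assume pp: "p \<in> decorations a \<times> decorations b" "p' \<in> decorations a \<times> decorations b"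
      and eq: "(\<lambda>(\<xi>, \<xi>'). diamond a \<xi> \<xi>') p = (\<lambda>(\<xi>, \<xi>'). diamond a \<xi> \<xi>') p'"
    obtain \<sigma> \<tau> \<sigma>' \<tau>' where p: "p = ((\<sigma>, \<tau>), (\<sigma>', \<tau>'))" by (metis surj_pair)
    obtain \<rho> \<upsilon> \<rho>' \<upsilon>' where p': "p' = ((\<rho>, \<upsilon>), (\<rho>', \<upsilon>'))" by (metis surj_pair)
    have d: "(\<sigma>, \<tau>) \<in> decorations a" "(\<sigma>', \<tau>') \<in> decorations b" "(\<rho>, \<upsilon>) \<in> decorations a" "(\<rho>', \<upsilon>') \<in> decorations b"
      using pp p p' by auto
    have eqs: "perm_sum (upper_half a) \<sigma> \<sigma>' = perm_sum (upper_half a) \<rho> \<rho>'"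
      "shift_rooted (lower_half a) \<tau>' \<circ> \<tau> = shift_rooted (lower_half a) \<upsilon>' \<circ> \<upsilon>"
      using eq unfolding p p' by (simp_all add: diamond_eq[OF d(1,2)] diamond_eq[OF d(3,4)])
    have "(\<sigma>, \<sigma>') = (\<rho>, \<rho>')"
      using inj_onD[OF bij_betw_imp_inj_on[OF P], of "(\<sigma>, \<sigma>')" "(\<rho>, \<rho>')"] eqs d by (simp add: decorations_def)
    moreover have "(\<tau>, \<tau>') = (\<upsilon>, \<upsilon>')"
      using inj_onD[OF bij_betw_imp_inj_on[OF R], of "(\<tau>, \<tau>')" "(\<upsilon>, \<upsilon>')"] eqs d by (simp add: decorations_def)
    ultimately show "p = p'" using p p' by simp
  qed
  show "(\<lambda>(\<xi>, \<xi>'). diamond a \<xi> \<xi>') ` (decorations a \<times> decorations b)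
      = {\<theta> \<in> decorations (a + b). is_factorization_cut (a + b) \<theta> a}"
  proof (intro equalityI subsetI)
    fix \<theta> assume "\<theta> \<in> (\<lambda>(\<xi>, \<xi>'). diamond a \<xi> \<xi>') ` (decorations a \<times> decorations b)"
    then obtain \<sigma> \<tau> \<sigma>' \<tau>' where d: "(\<sigma>, \<tau>) \<in> decorations a" "(\<sigma>', \<tau>') \<in> decorations b"
      and \<theta>: "\<theta> = diamond a (\<sigma>, \<tau>) (\<sigma>', \<tau>')" by auto
    have \<theta>D: "\<theta> \<in> decorations (a + b)" unfolding \<theta> by (rule diamond_in_decorations[OF d assms])
    have "perm_sum (upper_half a) \<sigma> \<sigma>' \<in> {\<pi>. \<pi> permutes {1..upper_half a + upper_half b} \<and> \<pi> ` {1..upper_half a} = {1..upper_half a}}"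
      using bij_betwE[OF P] d by (fastforce simp: decorations_def)
    moreover have "shift_rooted (lower_half a) \<tau>' \<circ> \<tau> \<in> {\<pi>. \<pi> permutes {0..lower_half a + lower_half b} \<and> root_cut (lower_half a) \<pi> (lower_half a + lower_half b)}"
      using bij_betwE[OF R] d by (fastforce simp: decorations_def)
    ultimately have "is_factorization_cut (a + b) \<theta> a"
      using \<theta>D unfolding \<theta> diamond_eq[OF d] by (simp add: is_factorization_cut_iff half_add[OF assms])
    then show "\<theta> \<in> {\<theta> \<in> decorations (a + b). is_factorization_cut (a + b) \<theta> a}" using \<theta>D by simp
  next
    fix \<theta> assume "\<theta> \<in> {\<theta> \<in> decorations (a + b). is_factorization_cut (a + b) \<theta> a}"
    then obtain \<pi> \<rho> where \<theta>: "\<theta> = (\<pi>, \<rho>)" "(\<pi>, \<rho>) \<in> decorations (a + b)"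
      and cut: "is_factorization_cut (a + b) (\<pi>, \<rho>) a" by (cases \<theta>) auto
    have "\<pi> \<in> {\<pi>. \<pi> permutes {1..upper_half a + upper_half b} \<and> \<pi> ` {1..upper_half a} = {1..upper_half a}}"
      "\<rho> \<in> {\<pi>. \<pi> permutes {0..lower_half a + lower_half b} \<and> root_cut (lower_half a) \<pi> (lower_half a + lower_half b)}"
      using cut \<theta>(2) is_factorization_cut_iff[OF \<theta>(2), of a]
      by (auto simp: decorations_def half_add[OF assms])
    then obtain \<sigma> \<sigma>' \<tau> \<tau>' where
      "\<sigma> permutes {1..upper_half a}" "\<sigma>' permutes {1..upper_half b}" "\<pi> = perm_sum (upper_half a) \<sigma> \<sigma>'"
      "\<tau> permutes {0..lower_half a}" "\<tau>' permutes {0..lower_half b}" "\<rho> = shift_rooted (lower_half a) \<tau>' \<circ> \<tau>"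
      unfolding bij_betw_imp_surj_on[OF P, symmetric] bij_betw_imp_surj_on[OF R, symmetric] by auto
    then show "\<theta> \<in> (\<lambda>(\<xi>, \<xi>'). diamond a \<xi> \<xi>') ` (decorations a \<times> decorations b)"
      unfolding \<theta>(1)
      by (intro image_eqI[of _ _ "((\<sigma>, \<tau>), (\<sigma>', \<tau>'))"])
         (auto simp: decorations_def diamond_eq[of \<sigma> \<tau> a \<sigma>' \<tau>' b])
  qed
qed

text \<open>Cuts behind the first factor are cuts of the second factor. This lets unique factorization at one cut
  be iterated.\<close>

lemma factorization_cut_shift:
  assumes "\<xi> \<in> decorations a" "\<xi>' \<in> decorations b" "\<not> (odd a \<and> odd b)" "\<not> (odd a \<and> odd c)" "c \<le> b"
  shows "is_factorization_cut (a + b) (diamond a \<xi> \<xi>') (a + c) \<longleftrightarrow> is_factorization_cut b \<xi>' c"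
proof -
  obtain \<sigma> \<tau> \<sigma>' \<tau>' where \<xi>: "\<xi> = (\<sigma>, \<tau>)" "\<xi>' = (\<sigma>', \<tau>')" by (cases \<xi>; cases \<xi>') auto
  have d: "(\<sigma>, \<tau>) \<in> decorations a" "(\<sigma>', \<tau>') \<in> decorations b" using assms \<xi> by auto
  have D: "(perm_sum (upper_half a) \<sigma> \<sigma>', shift_rooted (lower_half a) \<tau>' \<circ> \<tau>) \<in> decorations (a + b)"
    using diamond_in_decorations[OF d assms(3)] by (simp add: diamond_eq[OF d])
  have p: "\<sigma> permutes {1..upper_half a}" "\<sigma>' permutes {1..upper_half b}" "\<tau> permutes {0..lower_half a}"
    using d by (auto simp: decorations_def)
  show ?thesis
    using assms(5) unfolding \<xi> diamond_eq[OF d]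
    by (simp add: is_factorization_cut_iff[OF D] is_factorization_cut_iff[OF d(2)] half_add[OF assms(3)]
        half_add[OF assms(4)] perm_sum_image_iff[OF p(1,2)] root_cut_shift[OF p(3)] del: One_nat_def)
qed

subsection \<open>Iterated products\<close>

definition dec_lists :: "nat list \<Rightarrow> decoration list set" where
  "dec_lists \<beta> = {\<xi>s. list_all2 (\<lambda>\<xi> b. \<xi> \<in> decorations b) \<xi>s \<beta>}"

lemma dec_lists_Cons: "dec_lists (b # \<beta>) = (\<lambda>(\<xi>, \<xi>s). \<xi> # \<xi>s) ` (decorations b \<times> dec_lists \<beta>)"
  by (auto simp: dec_lists_def list_all2_Cons2)

lemma dec_lists_Nil: "dec_lists [] = {[]}"
  by (auto simp: dec_lists_def)

lemma diamond_list_Cons: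
  "\<xi>s \<in> dec_lists \<beta> \<Longrightarrow> \<beta> \<noteq> [] \<Longrightarrow> diamond_list (b # \<beta>) (\<xi> # \<xi>s) = diamond b \<xi> (diamond_list \<beta> \<xi>s)"
  by (cases \<beta>; cases \<xi>s) (auto simp: dec_lists_def)

definition few_odd :: "nat list \<Rightarrow> bool" where
  "few_odd \<beta> \<longleftrightarrow> length (filter odd \<beta>) \<le> 1"

lemma few_odd_Cons: "few_odd (b # \<beta>) \<longleftrightarrow> (if odd b then \<forall>x\<in>set \<beta>. even x else few_odd \<beta>)"
  by (auto simp: few_odd_def filter_empty_conv)

lemma few_odd_tl: "few_odd (b # \<beta>) \<Longrightarrow> few_odd \<beta>"
  by (auto simp: few_odd_def split: if_splits)

lemma even_sum_list: "\<forall>x\<in>set \<beta>. even x \<Longrightarrow> even (sum_list \<beta> :: nat)"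
  by (induction \<beta>) auto

lemma few_odd_sum: "few_odd (b # \<beta>) \<Longrightarrow> \<not> (odd b \<and> odd (sum_list \<beta>))"
  using even_sum_list by (auto simp: few_odd_Cons split: if_splits)

lemma few_odd_cut: "few_odd (b # \<beta>) \<Longrightarrow> c \<in> cut_set \<beta> \<Longrightarrow> \<not> (odd b \<and> odd c)"
  using even_sum_list by (fastforce simp: few_odd_Cons cut_set_def dest: in_set_takeD split: if_splits)

text \<open>Unique factorization at all cuts of \<open>\<beta>\<close>: split at the first cut and apply the induction hypothesis
  to the second factor, whose remaining cuts are those of the product, shifted.\<close>

lemma diamond_list_bij:
  assumes "is_composition n \<beta>" "1 \<le> n" "few_odd \<beta>"
  shows "bij_betw (diamond_list \<beta>) (dec_lists \<beta>)
    {\<theta> \<in> decorations n. \<forall>c\<in>cut_set \<beta>. is_factorization_cut n \<theta> c}"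
  using assms
proof (induction \<beta> arbitrary: n)
  case Nil
  then show ?case by simp
next
  case (Cons b \<beta>)
  show ?case
  proof (cases "\<beta> = []")
    case True
    then have n: "n = b" using Cons.prems by simp
    have "dec_lists [b] = (\<lambda>\<xi>. [\<xi>]) ` decorations b" by (auto simp: dec_lists_Cons dec_lists_Nil)
    then show ?thesis
      by (intro bij_betw_imageI) (simp_all add: n True cut_set_Cons image_image inj_on_def)
  next
    case False
    define m where "m = n - b"
    have m: "is_composition m \<beta>" "n = b + m" using Cons.prems by (auto simp: m_def)
    have "1 \<le> m" using m(1) False by (cases m) auto
    have sum: "sum_list \<beta> = m" using m(1) by (simp add: is_composition_def)
    have par: "\<not> (odd b \<and> odd m)" using few_odd_sum[OF Cons.prems(3)] sum by simp
    let ?D = "{\<theta> \<in> decorations m. \<forall>c\<in>cut_set \<beta>. is_factorization_cut m \<theta> c}"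
    have IH: "bij_betw (diamond_list \<beta>) (dec_lists \<beta>) ?D"
      using Cons.IH[OF m(1) \<open>1 \<le> m\<close> few_odd_tl[OF Cons.prems(3)]] .
    note B = diamond_bij[OF par]
    have cutm: "c \<le> m" if "c \<in> cut_set \<beta>" for c using that cut_set_subset[OF m(1)] by auto
    have sub: "bij_betw (\<lambda>(\<xi>, \<xi>'). diamond b \<xi> \<xi>') (decorations b \<times> ?D)
        {\<theta> \<in> decorations n. \<forall>c\<in>cut_set (b # \<beta>). is_factorization_cut n \<theta> c}"
    proof (rule bij_betw_subset[OF B])
      show "(\<lambda>(\<xi>, \<xi>'). diamond b \<xi> \<xi>') ` (decorations b \<times> ?D)
          = {\<theta> \<in> decorations n. \<forall>c\<in>cut_set (b # \<beta>). is_factorization_cut n \<theta> c}" (is "?L = ?R")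
      proof (intro equalityI subsetI)
        fix \<theta> assume "\<theta> \<in> ?L"
        then obtain \<xi> \<xi>' where x: "\<xi> \<in> decorations b" "\<xi>' \<in> ?D" "\<theta> = diamond b \<xi> \<xi>'" by auto
        have "\<theta> \<in> {\<theta> \<in> decorations (b + m). is_factorization_cut (b + m) \<theta> b}"
          using bij_betwE[OF B] x by auto
        moreover have "is_factorization_cut (b + m) \<theta> (b + c)" if "c \<in> cut_set \<beta>" for c
          using factorization_cut_shift[OF x(1) _ par few_odd_cut[OF Cons.prems(3) that] cutm[OF that], of \<xi>'] x that
          by auto
        ultimately show "\<theta> \<in> ?R" using False m(2) by (auto simp: cut_set_Cons)
      next
        fix \<theta> assume "\<theta> \<in> ?R"
        then have \<theta>: "\<theta> \<in> decorations (b + m)" "is_factorization_cut (b + m) \<theta> b"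
          "\<And>c. c \<in> cut_set \<beta> \<Longrightarrow> is_factorization_cut (b + m) \<theta> (b + c)"
          using False m(2) by (auto simp: cut_set_Cons)
        then have "\<theta> \<in> (\<lambda>(\<xi>, \<xi>'). diamond b \<xi> \<xi>') ` (decorations b \<times> decorations m)"
          unfolding bij_betw_imp_surj_on[OF B] by simp
        then obtain \<xi> \<xi>' where x: "\<xi> \<in> decorations b" "\<xi>' \<in> decorations m" "\<theta> = diamond b \<xi> \<xi>'" by auto
        have "is_factorization_cut m \<xi>' c" if "c \<in> cut_set \<beta>" for c
          using factorization_cut_shift[OF x(1,2) par few_odd_cut[OF Cons.prems(3) that] cutm[OF that]] x \<theta>(3)[OF that]
          by simp
        then show "\<theta> \<in> ?L" using x by (intro image_eqI[of _ _ "(\<xi>, \<xi>')"]) auto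
      qed
    qed auto
    have "bij_betw (\<lambda>(\<xi>, \<xi>s). \<xi> # \<xi>s) (decorations b \<times> dec_lists \<beta>) (dec_lists (b # \<beta>))"
      by (rule bij_betw_imageI) (auto simp: dec_lists_Cons inj_on_def)
    from bij_betw_inv_into[OF this]
    have 1: "bij_betw (\<lambda>\<xi>s. (hd \<xi>s, tl \<xi>s)) (dec_lists (b # \<beta>)) (decorations b \<times> dec_lists \<beta>)"
      by (intro bij_betw_byWitness[where f' = "\<lambda>(\<xi>, \<xi>s). \<xi> # \<xi>s"]) (auto simp: dec_lists_Cons)
    have 2: "bij_betw (map_prod id (diamond_list \<beta>)) (decorations b \<times> dec_lists \<beta>) (decorations b \<times> ?D)"
      by (rule bij_betw_map_prod[OF bij_betw_id IH])
    have "bij_betw ((\<lambda>(\<xi>, \<xi>'). diamond b \<xi> \<xi>') \<circ> map_prod id (diamond_list \<beta>) \<circ> (\<lambda>\<xi>s. (hd \<xi>s, tl \<xi>s)))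
        (dec_lists (b # \<beta>)) {\<theta> \<in> decorations n. \<forall>c\<in>cut_set (b # \<beta>). is_factorization_cut n \<theta> c}"
      using bij_betw_trans[OF 1 bij_betw_trans[OF 2 sub]] by (simp add: o_assoc)
    moreover have "diamond_list (b # \<beta>) \<xi>s
        = ((\<lambda>(\<xi>, \<xi>'). diamond b \<xi> \<xi>') \<circ> map_prod id (diamond_list \<beta>) \<circ> (\<lambda>\<xi>s. (hd \<xi>s, tl \<xi>s))) \<xi>s"
      if "\<xi>s \<in> dec_lists (b # \<beta>)" for \<xi>s
      using that False by (auto simp: dec_lists_Cons diamond_list_Cons)
    ultimately show ?thesis by (simp cong: bij_betw_cong)
  qed
qed

lemma diamond_list_in_decorations:
  assumes "is_composition n \<beta>" "1 \<le> n" "few_odd \<beta>" "\<xi>s \<in> dec_lists \<beta>"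
  shows "diamond_list \<beta> \<xi>s \<in> decorations n"
  using bij_betwE[OF diamond_list_bij[OF assms(1-3)]] assms(4) by auto

lemma dec_lists_append:
  "\<xi>s @ \<xi>s' \<in> dec_lists (\<beta> @ \<beta>') \<longleftrightarrow> \<xi>s \<in> dec_lists \<beta> \<and> \<xi>s' \<in> dec_lists \<beta>'" if "length \<xi>s = length \<beta>"
  using that by (auto simp: dec_lists_def list_all2_append)

lemma dec_lists_Cons_iff: "\<xi> # \<xi>s \<in> dec_lists (b # \<beta>) \<longleftrightarrow> \<xi> \<in> decorations b \<and> \<xi>s \<in> dec_lists \<beta>"
  by (auto simp: dec_lists_def)

text \<open>Associativity in the form needed for the differential: multiplying two adjacent decorations first does not change the total product.\<close>

lemma diamond_list_merge:
  assumes "is_composition n (\<beta> @ a # b # \<beta>')" "few_odd (\<beta> @ a # b # \<beta>')"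
    and "\<xi>s \<in> dec_lists \<beta>" "x # y # \<xi>s' \<in> dec_lists (a # b # \<beta>')"
  shows "diamond_list (\<beta> @ (a + b) # \<beta>') (\<xi>s @ diamond a x y # \<xi>s')
       = diamond_list (\<beta> @ a # b # \<beta>') (\<xi>s @ x # y # \<xi>s')
    \<and> \<xi>s @ diamond a x y # \<xi>s' \<in> dec_lists (\<beta> @ (a + b) # \<beta>')"
  using assms
proof (induction \<beta> arbitrary: n \<xi>s)
  case Nil
  then have \<xi>s: "\<xi>s = []" by (simp add: dec_lists_Nil)
  have x: "x \<in> decorations a" "y \<in> decorations b" "\<xi>s' \<in> dec_lists \<beta>'"
    using Nil by (auto simp: dec_lists_Cons_iff)
  have par: "\<not> (odd a \<and> odd b)" using Nil.prems(2) by (auto simp: few_odd_Cons split: if_splits)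
  note xy = diamond_in_decorations[OF x(1,2) par]
  show ?case
  proof (cases "\<beta>' = []")
    case True
    then show ?thesis using x \<xi>s xy by (simp add: dec_lists_Nil dec_lists_Cons_iff)
  next
    case False
    let ?z = "diamond_list \<beta>' \<xi>s'" and ?m = "sum_list \<beta>'"
    have m: "is_composition ?m \<beta>'" using Nil.prems(1) by (auto simp: is_composition_def)
    then have "1 \<le> ?m" using False by (cases ?m) auto
    have fo: "few_odd (b # \<beta>')" using few_odd_tl Nil.prems(2) by simp
    have z: "?z \<in> decorations ?m"
      by (rule diamond_list_in_decorations[OF m \<open>1 \<le> ?m\<close> few_odd_tl[OF fo] x(3)])
    have "\<not> (odd b \<and> odd ?m)" by (rule few_odd_sum[OF fo])
    moreover have "\<not> (odd a \<and> odd ?m)"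
      using Nil.prems(2) even_sum_list[of \<beta>'] by (auto simp: few_odd_Cons split: if_splits)
    ultimately have "diamond (a + b) (diamond a x y) ?z = diamond a x (diamond b y ?z)"
      by (intro diamond_assoc[OF x(1,2) z par])
    then show ?thesis using x False xy \<xi>s
      by (simp add: diamond_list_Cons[of "y # \<xi>s'" "b # \<beta>'"] diamond_list_Cons[of \<xi>s' \<beta>'] dec_lists_Cons_iff)
  qed
next
  case (Cons c \<beta>)
  obtain z zs where \<xi>s: "\<xi>s = z # zs" "z \<in> decorations c" "zs \<in> dec_lists \<beta>"
    using Cons.prems(3) by (auto simp: dec_lists_Cons)
  have "is_composition (n - c) (\<beta> @ a # b # \<beta>')" "few_odd (\<beta> @ a # b # \<beta>')"
    using Cons.prems(1,2) few_odd_tl by auto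
  note IH = Cons.IH[OF this \<xi>s(3) Cons.prems(4)]
  have "length zs = length \<beta>" using \<xi>s(3) by (auto simp: dec_lists_def dest: list_all2_lengthD)
  then have "zs @ x # y # \<xi>s' \<in> dec_lists (\<beta> @ a # b # \<beta>')"
    using \<xi>s(3) Cons.prems(4) by (subst dec_lists_append) auto
  then show ?case
    using IH \<xi>s by (simp add: diamond_list_Cons[of "zs @ x # y # \<xi>s'"] diamond_list_Cons[of "zs @ diamond a x y # \<xi>s'"]
        dec_lists_Cons_iff)
qed

subsection \<open>Bidegrees\<close>

lemma orbit_ne: "orbit f x \<noteq> {}"
  using orbit.base by fastforce

lemma cycles_perm_sum:
  assumes \<sigma>: "\<sigma> permutes {1..p}" and \<sigma>': "\<sigma>' permutes {1..q}"
  shows "card (cycles_on {1..p + q} (perm_sum p \<sigma> \<sigma>'))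
    = card (cycles_on {1..p} \<sigma>) + card (cycles_on {1..q} \<sigma>')"
proof -
  let ?\<pi> = "perm_sum p \<sigma> \<sigma>'"
  have 1: "orbit ?\<pi> x = orbit \<sigma> x" if "x \<in> {1..p}" for x
  proof (rule orbit_eq_on)
    fix y assume "y \<in> insert x (orbit \<sigma> x)"
    then have "y \<in> {1..p}" using orbit_subset_carrier[OF \<sigma> _ that] that by auto
    then show "?\<pi> y = \<sigma> y" by (simp add: perm_sum_def)
  qed
  have 2: "orbit ?\<pi> (p + x) = (+) p ` orbit \<sigma>' x" if "x \<in> {1..q}" for x
  proof (rule orbit_semiconj)
    fix y assume "y \<in> insert x (orbit \<sigma>' x)"
    then have "y \<in> {1..q}" using orbit_subset_carrier[OF \<sigma>' _ that] that by auto
    then show "?\<pi> (p + y) = p + \<sigma>' y" by (simp add: perm_sum_def)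
  qed
  have "cycles_on {1..p + q} ?\<pi> = cycles_on {1..p} \<sigma> \<union> (`) ((+) p) ` cycles_on {1..q} \<sigma>'"
    unfolding cycles_on_def interval_split[of p q] image_Un image_image using 1 2 by simp
  moreover have "cycles_on {1..p} \<sigma> \<inter> (`) ((+) p) ` cycles_on {1..q} \<sigma>' = {}"
  proof -
    have "orbit \<sigma> x \<noteq> (+) p ` orbit \<sigma>' y" if "x \<in> {1..p}" "y \<in> {1..q}" for x y
    proof
      assume eq: "orbit \<sigma> x = (+) p ` orbit \<sigma>' y"
      have "orbit \<sigma> x \<subseteq> {1..p}" "orbit \<sigma>' y \<subseteq> {1..q}"
        using orbit_subset_carrier[OF \<sigma> _ that(1)] orbit_subset_carrier[OF \<sigma>' _ that(2)] by auto
      moreover obtain z where "z \<in> orbit \<sigma>' y" using orbit_ne[of \<sigma>' y] by blast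
      ultimately show False using eq by force
    qed
    then show ?thesis by (auto simp: cycles_on_def)
  qed
  moreover have "card ((`) ((+) p) ` cycles_on {1..q} \<sigma>') = card (cycles_on {1..q} \<sigma>')"
    by (rule card_image) (auto simp: inj_on_def inj_image_eq_iff)
  moreover have "finite (cycles_on A f)" if "finite A" for A f using that by (simp add: cycles_on_def)
  ultimately show ?thesis by (simp add: card_Un_disjoint)
qed

lemma cycles_nonroot:
  assumes "\<tau> permutes {0..a}"
  shows "cycles_on {0..a} \<tau> = insert (orbit \<tau> 0) (orbit \<tau> ` ({1..a} - orbit \<tau> 0))"
    "card (cycles_on {0..a} \<tau>) = Suc (card (orbit \<tau> ` ({1..a} - orbit \<tau> 0)))"
proof -
  have "orbit \<tau> x \<in> insert (orbit \<tau> 0) (orbit \<tau> ` ({1..a} - orbit \<tau> 0))" if "x \<in> {0..a}" for x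
    using that orbit_eq[OF assms, of x 0] by (cases "x \<in> orbit \<tau> 0"; cases "x = 0") auto
  then have "cycles_on {0..a} \<tau> \<subseteq> insert (orbit \<tau> 0) (orbit \<tau> ` ({1..a} - orbit \<tau> 0))"
    unfolding cycles_on_def by (rule image_subsetI)
  moreover have "insert (orbit \<tau> 0) (orbit \<tau> ` ({1..a} - orbit \<tau> 0)) \<subseteq> cycles_on {0..a} \<tau>"
    by (auto simp: cycles_on_def)
  ultimately show 1: "cycles_on {0..a} \<tau> = insert (orbit \<tau> 0) (orbit \<tau> ` ({1..a} - orbit \<tau> 0))"
    by (rule equalityI)
  have "orbit \<tau> 0 \<noteq> orbit \<tau> x" if "x \<notin> orbit \<tau> 0" for x
    using self_in_orbit[OF assms, of x] that by auto
  then show "card (cycles_on {0..a} \<tau>) = Suc (card (orbit \<tau> ` ({1..a} - orbit \<tau> 0)))"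
    unfolding 1 by (subst card_insert_disjoint) auto
qed

text \<open>The two root cycles are joined into one and all other cycles survive, so one cycle is lost; this is
  the reason for the \<open>- 1\<close> in the \<open>t\<close>-degree.\<close>

lemma cycles_rooted_comp:
  assumes \<tau>: "\<tau> permutes {0..a}" and \<upsilon>: "\<upsilon> permutes {0..b}"
  shows "card (cycles_on {0..a + b} (shift_rooted a \<upsilon> \<circ> \<tau>)) + 1
    = card (cycles_on {0..a} \<tau>) + card (cycles_on {0..b} \<upsilon>)"
proof -
  let ?\<pi> = "shift_rooted a \<upsilon> \<circ> \<tau>"
  note \<pi> = rooted_comp_permutes[OF \<tau> \<upsilon>]
  have \<tau>_sh: "\<tau> (shift_letter a y) = shift_letter a y" if "y \<noteq> 0" for y
    using that by (intro permutes_not_in[OF \<tau>]) (simp add: shift_letter_def)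
  have step_\<tau>: "?\<pi> x = \<tau> x" if "x \<le> a" "\<tau> x \<noteq> 0" for x
    using rooted_comp_low[OF \<tau> that(1), of \<upsilon>] that by simp
  have step_\<upsilon>: "?\<pi> (shift_letter a y) = shift_letter a (\<upsilon> y)" if "y \<noteq> 0" for y
    using \<tau>_sh[OF that] by simp
  have root0: "0 \<in> orbit f x \<Longrightarrow> x \<in> orbit f 0" if "f permutes {0..N}" for f :: "nat \<Rightarrow> nat" and x N
    by (rule orbit_sym[OF that]) auto
  have low: "orbit ?\<pi> x = orbit \<tau> x" if x: "x \<in> {1..a}" "x \<notin> orbit \<tau> 0" for x
  proof (rule orbit_eq_on)
    fix y assume y: "y \<in> insert x (orbit \<tau> x)"
    then have "y \<in> orbit \<tau> x" using self_in_orbit[OF \<tau>] by auto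
    moreover from this have "\<tau> y \<in> orbit \<tau> x" by (rule orbit.step)
    moreover have "0 \<notin> orbit \<tau> x" using root0[OF \<tau>] x by blast
    moreover have "orbit \<tau> x \<subseteq> {0..a}" using x by (intro orbit_subset_carrier[OF \<tau>]) auto
    ultimately show "?\<pi> y = \<tau> y" by (intro step_\<tau>) (auto intro: gr0I)
  qed
  have high: "orbit ?\<pi> (shift_letter a x) = shift_letter a ` orbit \<upsilon> x"
    if x: "x \<in> {1..b}" "x \<notin> orbit \<upsilon> 0" for x
  proof (rule orbit_semiconj)
    fix y assume y: "y \<in> insert x (orbit \<upsilon> x)"
    then have "y \<in> orbit \<upsilon> x" using self_in_orbit[OF \<upsilon>] by auto
    moreover have "0 \<notin> orbit \<upsilon> x" using root0[OF \<upsilon>] x by blast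
    ultimately show "?\<pi> (shift_letter a y) = shift_letter a (\<upsilon> y)" by (intro step_\<upsilon>) metis
  qed
  have zero: "0 \<in> orbit ?\<pi> 0" by (rule self_in_orbit[OF \<pi>]) simp
  have root_low: "y \<in> orbit ?\<pi> 0" if "y \<in> orbit \<tau> 0" for y
    using that
  proof induction
    case base
    show ?case
    proof (cases "\<tau> 0 = 0")
      case True
      then show ?thesis using zero by metis
    next
      case False
      then have "?\<pi> 0 = \<tau> 0" by (intro step_\<tau>) auto
      then show ?thesis using orbit.base[of ?\<pi> 0] by metis
    qed
  next
    case (step y)
    have "y \<le> a" using orbit_subset_carrier[OF \<tau>, of 0] step.hyps by auto
    show ?case
    proof (cases "\<tau> y = 0")
      case True
      then show ?thesis using zero by metis
    next
      case False
      then have "?\<pi> y = \<tau> y" using \<open>y \<le> a\<close> by (intro step_\<tau>) auto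
      then show ?thesis using orbit.step[OF step.IH] by metis
    qed
  qed
  have root_high: "shift_letter a y \<in> orbit ?\<pi> 0" if "y \<in> orbit \<upsilon> 0" for y
    using that
  proof induction
    case base
    obtain z where z: "\<tau> z = 0" using permutes_surj[OF \<tau>] by (metis surjD)
    then have "0 \<in> orbit \<tau> z" using orbit.base[of \<tau> z] by simp
    then have "z \<in> orbit ?\<pi> 0" using root0[OF \<tau>] root_low by blast
    moreover have "?\<pi> z = shift_letter a (\<upsilon> 0)" using z by simp
    ultimately show ?case using orbit.step[of z ?\<pi> 0] by metis
  next
    case (step y)
    show ?case
    proof (cases "y = 0")
      case False
      then show ?thesis using orbit.step[OF step.IH] step_\<upsilon>[OF False] by metis
    next
      case True
      obtain z where z: "\<tau> z = 0" using permutes_surj[OF \<tau>] by (metis surjD)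
      then have "0 \<in> orbit \<tau> z" using orbit.base[of \<tau> z] by simp
      then have "z \<in> orbit ?\<pi> 0" using root0[OF \<tau>] root_low by blast
      moreover have "?\<pi> z = shift_letter a (\<upsilon> y)" using z True by simp
      ultimately show ?thesis using orbit.step[of z ?\<pi> 0] by metis
    qed
  qed
  define P where "P = orbit \<tau> ` ({1..a} - orbit \<tau> 0)"
  define Q where "Q = orbit \<upsilon> ` ({1..b} - orbit \<upsilon> 0)"
  have "cycles_on {0..a + b} ?\<pi> = insert (orbit ?\<pi> 0) (P \<union> (`) (shift_letter a) ` Q)"
  proof (intro equalityI subsetI)
    fix Z assume "Z \<in> cycles_on {0..a + b} ?\<pi>"
    then obtain x where x: "x \<le> a + b" "Z = orbit ?\<pi> x" by (auto simp: cycles_on_def)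
    show "Z \<in> insert (orbit ?\<pi> 0) (P \<union> (`) (shift_letter a) ` Q)"
    proof (rule low_or_shift[of x a])
      assume "1 \<le> x" "x \<le> a"
      then show ?thesis
        using x low[of x] root_low[of x] orbit_eq[OF \<pi>, of x 0]
        by (cases "x \<in> orbit \<tau> 0") (auto simp: P_def)
    next
      fix y assume y: "x = shift_letter a y"
      show ?thesis
      proof (cases "y \<in> orbit \<upsilon> 0")
        case True
        then show ?thesis using x y root_high[of y] orbit_eq[OF \<pi>, of x 0] by auto
      next
        case False
        have "0 \<in> orbit \<upsilon> 0" by (rule self_in_orbit[OF \<upsilon>]) simp
        then have "y \<noteq> 0" using False by metis
        then have "y \<in> {1..b}" using x y by (auto simp: shift_letter_def)
        then show ?thesis using x y high[OF _ False] False by (auto simp: Q_def)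
      qed
    qed
  next
    fix Z assume "Z \<in> insert (orbit ?\<pi> 0) (P \<union> (`) (shift_letter a) ` Q)"
    then consider "Z = orbit ?\<pi> 0" | x where "x \<in> {1..a}" "x \<notin> orbit \<tau> 0" "Z = orbit \<tau> x"
      | y where "y \<in> {1..b}" "y \<notin> orbit \<upsilon> 0" "Z = shift_letter a ` orbit \<upsilon> y"
      by (auto simp: P_def Q_def)
    then show "Z \<in> cycles_on {0..a + b} ?\<pi>"
    proof cases
      case 2
      then show ?thesis using low[of x] by (auto simp: cycles_on_def)
    next
      case 3
      then have "Z = orbit ?\<pi> (shift_letter a y)" using high by simp
      moreover have "shift_letter a y \<in> {0..a + b}" using 3 by (auto intro: shift_letter_bound)
      ultimately show ?thesis unfolding cycles_on_def by blast
    qed (auto simp: cycles_on_def)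
  qed
  moreover have "orbit ?\<pi> 0 \<notin> P \<union> (`) (shift_letter a) ` Q"
  proof
    assume "orbit ?\<pi> 0 \<in> P \<union> (`) (shift_letter a) ` Q"
    then consider x where "x \<notin> orbit \<tau> 0" "orbit ?\<pi> 0 = orbit \<tau> x"
      | y where "y \<notin> orbit \<upsilon> 0" "orbit ?\<pi> 0 = shift_letter a ` orbit \<upsilon> y"
      by (auto simp: P_def Q_def)
    then show False
    proof cases
      case 1
      then show ?thesis using zero root0[OF \<tau>, of x] by blast
    next
      case 2
      then have "0 \<in> orbit \<upsilon> y" using zero by auto
      then show ?thesis using 2 root0[OF \<upsilon>, of y] by blast
    qed
  qed
  moreover have "P \<inter> (`) (shift_letter a) ` Q = {}"
  proof -
    have "orbit \<tau> x \<noteq> shift_letter a ` orbit \<upsilon> y" if "x \<in> {1..a}" "x \<notin> orbit \<tau> 0" for x y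
    proof
      assume eq: "orbit \<tau> x = shift_letter a ` orbit \<upsilon> y"
      have "x \<in> orbit \<tau> x" by (rule self_in_orbit[OF \<tau>]) simp
      then obtain z where "x = shift_letter a z" using eq by auto
      then show False using that low_neq_shift[of x a z] by simp
    qed
    then show ?thesis by (auto simp: P_def Q_def)
  qed
  moreover have "card ((`) (shift_letter a) ` Q) = card Q"
    by (rule card_image) (auto simp: inj_on_def inj_image_eq_iff[OF inj_shift_letter])
  moreover have "finite P" "finite Q" by (auto simp: P_def Q_def)
  ultimately have "card (cycles_on {0..a + b} ?\<pi>) = Suc (card P + card Q)"
    by (simp add: card_Un_disjoint)
  then show ?thesis using cycles_nonroot(2)[OF \<tau>] cycles_nonroot(2)[OF \<upsilon>] by (simp add: P_def Q_def)
qed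

lemma card_cycles_le: "finite A \<Longrightarrow> card (cycles_on A f) \<le> card A"
  unfolding cycles_on_def by (rule card_image_le)

lemma deg_diamond:
  assumes "\<xi> \<in> decorations a" "\<xi>' \<in> decorations b" "\<not> (odd a \<and> odd b)"
  shows "deg_t (a + b) (diamond a \<xi> \<xi>') = deg_t a \<xi> + deg_t b \<xi>'"
    "deg_q (a + b) (diamond a \<xi> \<xi>') = deg_q a \<xi> + deg_q b \<xi>'"
proof -
  obtain \<sigma> \<tau> \<sigma>' \<tau>' where \<xi>: "\<xi> = (\<sigma>, \<tau>)" "\<xi>' = (\<sigma>', \<tau>')" by (cases \<xi>; cases \<xi>') auto
  have d: "(\<sigma>, \<tau>) \<in> decorations a" "(\<sigma>', \<tau>') \<in> decorations b" using assms \<xi> by auto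
  have p: "\<sigma> permutes {1..upper_half a}" "\<sigma>' permutes {1..upper_half b}"
    "\<tau> permutes {0..lower_half a}" "\<tau>' permutes {0..lower_half b}"
    using d by (auto simp: decorations_def)
  have "card (cycles_on {0..lower_half a} \<tau>) \<noteq> 0" "card (cycles_on {0..lower_half b} \<tau>') \<noteq> 0"
    using cycles_nonroot(2) p by auto
  then show "deg_t (a + b) (diamond a \<xi> \<xi>') = deg_t a \<xi> + deg_t b \<xi>'"
    using cycles_perm_sum[OF p(1,2)] cycles_rooted_comp[OF p(3,4)]
    unfolding \<xi> diamond_eq[OF d] deg_t_def by (simp add: half_add[OF assms(3)])
  show "deg_q (a + b) (diamond a \<xi> \<xi>') = deg_q a \<xi> + deg_q b \<xi>'"
    using cycles_perm_sum[OF p(1,2)] card_cycles_le[of "{1..upper_half a}" \<sigma>] card_cycles_le[of "{1..upper_half b}" \<sigma>']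
    unfolding \<xi> diamond_eq[OF d] deg_q_def by (simp add: half_add[OF assms(3)])
qed

lemma deg_diamond_list:
  assumes "is_composition n \<beta>" "1 \<le> n" "few_odd \<beta>" "\<xi>s \<in> dec_lists \<beta>"
  shows "(\<Sum>i<length \<beta>. deg_t (\<beta> ! i) (\<xi>s ! i)) = deg_t n (diamond_list \<beta> \<xi>s) \<and>
    (\<Sum>i<length \<beta>. deg_q (\<beta> ! i) (\<xi>s ! i)) = deg_q n (diamond_list \<beta> \<xi>s)"
  using assms
proof (induction \<beta> arbitrary: n \<xi>s)
  case (Cons b \<beta>)
  obtain \<xi> \<xi>s' where \<xi>s: "\<xi>s = \<xi> # \<xi>s'" "\<xi> \<in> decorations b" "\<xi>s' \<in> dec_lists \<beta>"
    using Cons.prems(4) by (auto simp: dec_lists_Cons)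
  show ?case
  proof (cases "\<beta> = []")
    case True
    then have "n = b" using Cons.prems(1) by simp
    then show ?thesis using True \<xi>s by (simp add: dec_lists_Nil)
  next
    case False
    define m where "m = n - b"
    have m: "is_composition m \<beta>" "n = b + m" using Cons.prems by (auto simp: m_def)
    have m1: "1 \<le> m" using m(1) False by (cases m) auto
    have fo: "few_odd \<beta>" using few_odd_tl Cons.prems(3) by blast
    have "\<not> (odd b \<and> odd m)" using few_odd_sum[OF Cons.prems(3)] m(1) by (simp add: is_composition_def)
    note deg = deg_diamond[OF \<xi>s(2) diamond_list_in_decorations[OF m(1) m1 fo \<xi>s(3)] this]
    show ?thesis
      using Cons.IH[OF m(1) m1 fo \<xi>s(3)] deg
      by (simp add: \<xi>s(1) m(2) sum.lessThan_Suc_shift diamond_list_Cons[OF \<xi>s(3) False] del: sum.lessThan_Suc)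
  qed
qed simp

lemma finite_decorations: "finite (decorations n)"
proof -
  have "decorations n = {\<sigma>. \<sigma> permutes {1..upper_half n}} \<times> {\<tau>. \<tau> permutes {0..lower_half n}}"
    by (auto simp: decorations_def)
  then show ?thesis by (simp add: finite_permutations)
qed

section \<open>Coefficients of symmetric functions\<close>

lemma mcoeff_simps [simp]:
  "mcoeff (f + g) M = mcoeff f M + mcoeff g M"
  "mcoeff (f - g) M = mcoeff f M - mcoeff g M"
  "mcoeff (- f) M = - mcoeff f M"
  "mcoeff 0 M = 0"
  "mcoeff 1 M = (if M = {#} then 1 else 0)"
  by (simp_all add: plus_mseries_def minus_mseries_def uminus_mseries_def zero_mseries_def one_mseries_def)

lemma mcoeff_times: "mcoeff (f * g) M = (\<Sum>(A, B) | A + B = M. mcoeff f A * mcoeff g B)"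
  by (simp add: times_mseries_def)

lemma mcoeff_sum: "mcoeff (\<Sum>i\<in>I. f i) M = (\<Sum>i\<in>I. mcoeff (f i) M)"
  by (induction I rule: infinite_finite_induct) auto

lemma mcoeff_minus_one_power: "mcoeff ((- 1) ^ k * f) M = (- 1) ^ k * mcoeff f M"
  by (induction k) (simp_all add: mult.assoc)

lemma mcoeff_mconst_mult: "mcoeff (mconst c * f) M = c * mcoeff f M"
proof -
  have "mcoeff (mconst c * f) M = (\<Sum>(A, B) | A + B = M. (if A = {#} then c else 0) * mcoeff f B)"
    by (simp add: mcoeff_times mconst_def)
  also have "\<dots> = (\<Sum>(A, B) \<in> {({#} :: nat multiset, M)}. (if A = {#} then c else 0) * mcoeff f B)"
    by (rule sum.mono_neutral_right) (auto simp: finite_mset_splits split: if_splits)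
  finally show ?thesis by simp
qed

lemma mconst_add: "mconst (a + b) = (mconst a + mconst b :: 'a::comm_ring_1 mseries)"
  by (rule mseries_eqI) (simp add: mconst_def)

lemma mconst_0 [simp]: "mconst 0 = 0"
  by (rule mseries_eqI) (simp add: mconst_def)

lemma mconst_sum: "mconst (\<Sum>i\<in>I. f i) = (\<Sum>i\<in>I. mconst (f i) :: 'a::comm_ring_1 mseries)"
  by (induction I rule: infinite_finite_induct) (auto simp: mconst_add)

lemma mconst_mult: "mconst (a * b) = (mconst a * mconst b :: 'a::comm_ring_1 mseries)"
  by (rule mseries_eqI) (simp add: mcoeff_mconst_mult, simp add: mconst_def)

lemma mconst_minus_one_power: "mconst ((- 1) ^ k) = ((- 1) ^ k :: 'a::comm_ring_1 mseries)"
proof (induction k)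
  case 0
  show ?case by (rule mseries_eqI) (simp add: mconst_def)
next
  case (Suc k)
  have "mconst (- 1 :: 'a) = - 1" by (rule mseries_eqI) (simp add: mconst_def)
  then show ?case using Suc by (simp only: power_Suc mconst_mult)
qed

subsection \<open>Complete homogeneous functions\<close>

definition msplits :: "nat list \<Rightarrow> 'b multiset \<Rightarrow> 'b multiset list set" where
  "msplits \<beta> M = {Ms. map size Ms = \<beta> \<and> sum_list Ms = M}"

lemma msplits_Nil: "msplits [] M = (if M = {#} then {[]} else {})"
  by (auto simp: msplits_def)

lemma msplits_Cons:
  "msplits (b # \<beta>) M = (\<lambda>((A, B), Ms). A # Ms) ` (SIGMA p:{(A, B). A + B = M \<and> size A = b}. msplits \<beta> (snd p))"
  (is "_ = ?f ` ?S")
proof (intro equalityI subsetI)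
  fix Ms assume "Ms \<in> msplits (b # \<beta>) M"
  then obtain A Ms' where Ms: "Ms = A # Ms'" "size A = b" "map size Ms' = \<beta>" "A + sum_list Ms' = M"
    by (auto simp: msplits_def)
  then have "((A, sum_list Ms'), Ms') \<in> ?S" by (auto simp: msplits_def)
  then show "Ms \<in> ?f ` ?S" unfolding Ms(1) by (rule image_eqI[rotated]) simp
qed (auto simp: msplits_def)

lemma finite_mset_splits': "finite {(A, B). A + B = (M :: 'b multiset) \<and> size A = b}"
  by (rule finite_subset[OF _ finite_mset_splits[of M]]) auto

lemma finite_msplits: "finite (msplits \<beta> M)"
proof (induction \<beta> arbitrary: M)
  case (Cons b \<beta>)
  then show ?case unfolding msplits_Cons
    by (intro finite_imageI finite_SigmaI finite_mset_splits') auto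
qed (simp add: msplits_Nil)

lemma card_msplits_Cons:
  "card (msplits (b # \<beta>) M) = (\<Sum>(A, B) | A + B = M \<and> size A = b. card (msplits \<beta> B))"
proof -
  have "inj_on (\<lambda>((A, B), Ms). A # Ms) (SIGMA p:{(A, B). A + B = M \<and> size A = b}. msplits \<beta> (snd p))"
    by (rule inj_onI) (auto simp: msplits_def)
  then have "card (msplits (b # \<beta>) M) = card (SIGMA p:{(A, B). A + B = M \<and> size A = b}. msplits \<beta> (snd p))"
    unfolding msplits_Cons by (rule card_image)
  also have "\<dots> = (\<Sum>p | fst p + snd p = M \<and> size (fst p) = b. card (msplits \<beta> (snd p)))"
    using finite_mset_splits'[of M b] finite_msplits
    by (subst card_SigmaI) (auto simp: case_prod_unfold)
  finally show ?thesis by (simp add: case_prod_unfold)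
qed

text \<open>A monomial of \<open>h\<^sub>\<beta>\<close> picks a multiset of size \<open>\<beta>\<^sub>i\<close> from each factor.\<close>

lemma mcoeff_hcomp: "mcoeff (hcomp \<beta> :: 'a::comm_ring_1 mseries) M = of_nat (card (msplits \<beta> M))"
proof (induction \<beta> arbitrary: M)
  case Nil
  show ?case by (simp add: hcomp_def msplits_Nil)
next
  case (Cons b \<beta>)
  have "mcoeff (hcomp (b # \<beta>)) M = (\<Sum>(A, B) | A + B = M. mcoeff (hsym b) A * mcoeff (hcomp \<beta>) B :: 'a)"
    by (simp add: hcomp_def mcoeff_times)
  also have "\<dots> = (\<Sum>(A, B) | A + B = M. if size A = b then of_nat (card (msplits \<beta> B)) else 0)"
    by (intro sum.cong refl) (auto simp: hsym_def Cons.IH)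
  also have "\<dots> = (\<Sum>p | p \<in> {(A, B). A + B = M} \<and> size (fst p) = b. of_nat (card (msplits \<beta> (snd p))))"
    unfolding case_prod_unfold
    by (subst sum.inter_filter[symmetric]) (use finite_mset_splits[of M] in \<open>auto simp: case_prod_unfold\<close>)
  also have "\<dots> = of_nat (card (msplits (b # \<beta>) M))"
    by (simp add: card_msplits_Cons case_prod_unfold)
  finally show ?case .
qed

subsection \<open>Words and their descents\<close>

definition word_des :: "nat list \<Rightarrow> nat set" where
  "word_des w = {i. 1 \<le> i \<and> i < length w \<and> w ! (i - 1) > w ! i}"

lemma word_des_append:
  "word_des (u @ v) = word_des u \<union> (+) (length u) ` word_des v \<union>
     (if u \<noteq> [] \<and> v \<noteq> [] \<and> last u > hd v then {length u} else {})"
proof -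
  have pos: "0 < k" if "k \<in> word_des x" for k x using that by (simp add: word_des_def)
  have "i \<in> word_des (u @ v) \<longleftrightarrow> i \<in> word_des u \<or> i \<in> (+) (length u) ` word_des v \<or>
      i = length u \<and> u \<noteq> [] \<and> v \<noteq> [] \<and> last u > hd v" for i
  proof -
    consider "i < length u" | "i = length u" | k where "i = length u + k" "0 < k"
      by (metis less_imp_add_positive linorder_neqE_nat)
    then show ?thesis
    proof cases
      case 1
      then show ?thesis by (auto simp: word_des_def nth_append)
    next
      case 2
      have "i \<notin> word_des u" using 2 by (simp add: word_des_def)
      moreover have "i \<notin> (+) (length u) ` word_des v" using 2 pos by fastforce
      moreover have "i \<in> word_des (u @ v) \<longleftrightarrow> u \<noteq> [] \<and> v \<noteq> [] \<and> last u > hd v"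
        using 2 by (auto simp: word_des_def nth_append last_conv_nth hd_conv_nth Suc_le_eq)
      ultimately show ?thesis using 2 by simp
    next
      case 3
      have "i \<notin> word_des u" using 3 by (simp add: word_des_def)
      moreover have "i \<in> (+) (length u) ` word_des v \<longleftrightarrow> k \<in> word_des v" using 3 by auto
      moreover have "i \<in> word_des (u @ v) \<longleftrightarrow> k \<in> word_des v"
        using 3 by (auto simp: word_des_def nth_append)
      ultimately show ?thesis using 3 by simp
    qed
  qed
  then show ?thesis by (intro set_eqI) simp
qed

lemma word_des_empty_iff: "word_des w = {} \<longleftrightarrow> sorted w"
proof -
  have "i \<in> word_des w \<longleftrightarrow> (\<exists>k. i = Suc k \<and> Suc k < length w \<and> w ! Suc k < w ! k)" for i
    by (cases i) (auto simp: word_des_def)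
  then have "word_des w = {} \<longleftrightarrow> (\<forall>i. Suc i < length w \<longrightarrow> w ! i \<le> w ! Suc i)"
    by (auto simp: not_less[symmetric])
  then show ?thesis by (simp add: sorted_iff_nth_Suc)
qed

lemma word_des_subset: "word_des w \<subseteq> {1..<length w}"
  by (auto simp: word_des_def)

definition words :: "nat \<Rightarrow> nat multiset \<Rightarrow> nat list set" where
  "words n M = {w. mset w = M \<and> length w = n}"

lemma finite_words: "finite (words n M)"
proof (rule finite_subset)
  show "words n M \<subseteq> {w. set w \<subseteq> set_mset M \<and> length w = n}" by (auto simp: words_def)
qed (simp add: finite_lists_length_eq)

text \<open>A word whose descents lie in the cuts of \<open>\<beta>\<close> is a concatenation of weakly increasing words with
  lengths \<open>\<beta>\<close>, and these are given by their contents.\<close>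

lemma card_words_des_subset:
  assumes "is_composition n \<beta>"
  shows "card {w \<in> words n M. word_des w \<subseteq> cut_set \<beta>} = card (msplits \<beta> M)"
  using assms
proof (induction \<beta> arbitrary: n M)
  case Nil
  then have "{w \<in> words n M. word_des w \<subseteq> cut_set []} = (if M = {#} then {[]} else {})"
    by (auto simp: words_def word_des_def)
  then show ?case by (simp add: msplits_Nil)
next
  case (Cons b \<beta>)
  have b: "0 < b" "b \<le> n" and \<beta>: "is_composition (n - b) \<beta>" using Cons.prems by auto
  let ?W = "\<lambda>B. {w \<in> words (n - b) B. word_des w \<subseteq> cut_set \<beta>}"
  let ?f = "\<lambda>(p, v). sorted_list_of_multiset (fst p) @ v"
  let ?S = "SIGMA p:{(A, B). A + B = M \<and> size A = b}. ?W (snd p)"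
  have desI: "word_des (u @ v) \<subseteq> cut_set (b # \<beta>) \<longleftrightarrow> sorted u \<and> word_des v \<subseteq> cut_set \<beta>"
    if "length u = b" "length v = n - b" for u v
  proof (cases "\<beta> = []")
    case True
    then have "v = []" using \<beta> that by simp
    then show ?thesis using True by (simp add: cut_set_Cons word_des_empty_iff word_des_def[of "[]"])
  next
    case False
    have "word_des u \<inter> insert b ((+) b ` cut_set \<beta>) = {}"
      using word_des_subset[of u] that by force
    moreover have "(+) b ` word_des v \<subseteq> insert b ((+) b ` cut_set \<beta>) \<longleftrightarrow> word_des v \<subseteq> cut_set \<beta>"
    proof
      assume sub: "(+) b ` word_des v \<subseteq> insert b ((+) b ` cut_set \<beta>)"
      show "word_des v \<subseteq> cut_set \<beta>"
      proof
        fix x assume "x \<in> word_des v"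
        then have "b + x \<in> insert b ((+) b ` cut_set \<beta>)" "1 \<le> x"
          using sub word_des_subset[of v] by auto
        then show "x \<in> cut_set \<beta>" by auto
      qed
    qed auto
    ultimately show ?thesis
      using False that unfolding word_des_append word_des_empty_iff[symmetric]
      by (auto simp: cut_set_Cons)
  qed
  have "bij_betw ?f ?S {w \<in> words n M. word_des w \<subseteq> cut_set (b # \<beta>)}"
  proof (rule bij_betw_imageI)
    show "inj_on ?f ?S"
    proof (rule inj_onI)
      fix x y assume "x \<in> ?S" "y \<in> ?S" and eq: "?f x = ?f y"
      then obtain A B v A' B' v' where x: "x = ((A, B), v)" "A + B = M" "size A = b"
        and y: "y = ((A', B'), v')" "A' + B' = M" "size A' = b" by auto
      have "sorted_list_of_multiset A @ v = sorted_list_of_multiset A' @ v'" using eq x y by simp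
      moreover have "length (sorted_list_of_multiset A) = length (sorted_list_of_multiset A')"
        using x(3) y(3) by (metis mset_sorted_list_of_multiset size_mset)
      ultimately have "sorted_list_of_multiset A = sorted_list_of_multiset A'" "v = v'" by simp_all
      then have "A = A'" "v = v'" by (metis mset_sorted_list_of_multiset, simp)
      then show "x = y" using x y by auto
    qed
    show "?f ` ?S = {w \<in> words n M. word_des w \<subseteq> cut_set (b # \<beta>)}"
    proof (intro equalityI subsetI)
      fix w assume "w \<in> ?f ` ?S"
      then obtain A B v where *: "A + B = M" "size A = b" "v \<in> ?W B" "w = sorted_list_of_multiset A @ v"
        by auto
      have len: "length (sorted_list_of_multiset A) = b"
        using *(2) by (metis mset_sorted_list_of_multiset size_mset)
      then show "w \<in> {w \<in> words n M. word_des w \<subseteq> cut_set (b # \<beta>)}"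
        using * b desI[OF len, of v] by (auto simp: words_def)
    next
      fix w assume w: "w \<in> {w \<in> words n M. word_des w \<subseteq> cut_set (b # \<beta>)}"
      define u v where "u = take b w" and "v = drop b w"
      have uv: "w = u @ v" "length u = b" "length v = n - b" using w b by (auto simp: u_def v_def words_def)
      have "sorted u" "word_des v \<subseteq> cut_set \<beta>" using desI[OF uv(2,3)] w uv(1) by auto
      moreover from this have "sorted_list_of_multiset (mset u) = u" by (simp add: sorted_list_of_multiset_mset sort_key_id_if_sorted)
      moreover have "mset u + mset v = M" using w uv(1) by (simp add: words_def)
      ultimately have "((mset u, mset v), v) \<in> ?S" "w = ?f ((mset u, mset v), v)"
        using uv by (simp_all add: words_def)
      then show "w \<in> ?f ` ?S" by (rule image_eqI[rotated])
    qed
  qed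
  then have "card {w \<in> words n M. word_des w \<subseteq> cut_set (b # \<beta>)} = card ?S"
    by (rule bij_betw_same_card[symmetric])
  also have "\<dots> = (\<Sum>p | fst p + snd p = M \<and> size (fst p) = b. card (?W (snd p)))"
    using finite_mset_splits'[of M b] finite_words
    by (subst card_SigmaI) (auto simp: case_prod_unfold)
  also have "\<dots> = card (msplits (b # \<beta>) M)"
    by (simp add: card_msplits_Cons Cons.IH[OF \<beta>] case_prod_unfold)
  finally show ?case .
qed

text \<open>Inclusion-exclusion from ``descents inside the cuts'' to ``descents equal to the cuts''. It is applied
  to descents of words.\<close>

lemma alternating_sum_coarsenings:
  assumes \<gamma>: "is_composition n \<gamma>" "1 \<le> n" and W: "finite W"
  shows "(\<Sum>\<beta>\<in>coarsenings \<gamma>. (- 1) ^ (length \<gamma> - length \<beta>) * of_nat (card {w \<in> W. d w \<subseteq> cut_set \<beta>}))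
    = (of_nat (card {w \<in> W. d w = cut_set \<gamma>}) :: 'a::comm_ring_1)"
proof -
  let ?D = "cut_set \<gamma>"
  have fin: "finite ?D" by (rule finite_cut_set[OF \<gamma>(1)])
  have "(\<Sum>\<beta>\<in>coarsenings \<gamma>. (- 1) ^ (length \<gamma> - length \<beta>) * of_nat (card {w \<in> W. d w \<subseteq> cut_set \<beta>}))
      = (\<Sum>\<beta>\<in>coarsenings \<gamma>. (- 1) ^ (card ?D - card (cut_set \<beta>)) * of_nat (card {w \<in> W. d w \<subseteq> cut_set \<beta>}) :: 'a)"
    by (intro sum.cong refl)
       (simp add: card_cut_set[OF \<gamma>] card_cut_set[OF coarsening_composition[OF \<gamma>(1)] \<gamma>(2)])
  also have "\<dots> = (\<Sum>T\<in>Pow ?D. (- 1) ^ (card ?D - card T) * of_nat (card {w \<in> W. d w \<subseteq> T}))"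
    by (rule sum.reindex_bij_betw[OF coarsenings_bij[OF \<gamma>(1)]])
  also have "\<dots> = (\<Sum>T\<in>Pow ?D. \<Sum>w\<in>W. if d w \<subseteq> T then (- 1) ^ (card ?D - card T) else 0)"
  proof (rule sum.cong[OF refl])
    fix T
    have "of_nat (card {w \<in> W. d w \<subseteq> T}) = (\<Sum>w\<in>W. if d w \<subseteq> T then 1 else 0 :: 'a)"
      using W by (simp add: sum.If_cases Int_def)
    then show "(- 1) ^ (card ?D - card T) * of_nat (card {w \<in> W. d w \<subseteq> T})
        = (\<Sum>w\<in>W. if d w \<subseteq> T then (- 1) ^ (card ?D - card T) else 0 :: 'a)"
      by (simp add: sum_distrib_left if_distrib cong: if_cong)
  qed
  also have "\<dots> = (\<Sum>w\<in>W. \<Sum>T\<in>Pow ?D. if d w \<subseteq> T then (- 1) ^ (card ?D - card T) else 0)"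
    by (rule sum.swap)
  also have "\<dots> = (\<Sum>w\<in>W. if d w = ?D then 1 else 0)"
  proof (rule sum.cong[OF refl])
    fix w
    have "(\<Sum>T\<in>Pow ?D. if d w \<subseteq> T then (- 1) ^ (card ?D - card T) else 0 :: 'a)
        = (\<Sum>T | d w \<subseteq> T \<and> T \<subseteq> ?D. (- 1) ^ (card ?D - card T))"
      using fin by (subst sum.inter_filter[symmetric]) (auto intro!: sum.cong)
    also have "\<dots> = (if d w = ?D then 1 else 0)"
    proof (cases "d w \<subseteq> ?D")
      case False
      then have empty: "{T. d w \<subseteq> T \<and> T \<subseteq> ?D} = {}" by auto
      show ?thesis using False unfolding empty by auto
    qed (rule alternating_sum_interval[OF fin])
    finally show "(\<Sum>T\<in>Pow ?D. if d w \<subseteq> T then (- 1) ^ (card ?D - card T) else 0 :: 'a)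
      = (if d w = ?D then 1 else 0)" .
  qed
  also have "\<dots> = of_nat (card {w \<in> W. d w = ?D})" using W by (simp add: sum.If_cases Int_def)
  finally show ?thesis .
qed

lemma mcoeff_ribbon:
  assumes "is_composition n \<gamma>" "1 \<le> n"
  shows "mcoeff (ribbon \<gamma> :: 'a::comm_ring_1 mseries) M = of_nat (card {w \<in> words n M. word_des w = cut_set \<gamma>})"
proof -
  have "mcoeff (ribbon \<gamma> :: 'a mseries) M
      = (\<Sum>\<beta>\<in>coarsenings \<gamma>. (- 1) ^ (length \<gamma> - length \<beta>) * of_nat (card (msplits \<beta> M)))"
    by (simp add: ribbon_def mcoeff_sum mcoeff_minus_one_power mcoeff_hcomp)
  also have "\<dots> = (\<Sum>\<beta>\<in>coarsenings \<gamma>. (- 1) ^ (length \<gamma> - length \<beta>)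
      * of_nat (card {w \<in> words n M. word_des w \<subseteq> cut_set \<beta>}))"
    by (intro sum.cong refl)
       (simp add: card_words_des_subset[OF coarsening_composition[OF assms(1)]])
  also have "\<dots> = of_nat (card {w \<in> words n M. word_des w = cut_set \<gamma>})"
    by (rule alternating_sum_coarsenings[OF assms finite_words])
  finally show ?thesis .
qed

section \<open>The Frobenius characteristic of a permutation module\<close>

subsection \<open>Disjoint families as lists\<close>

fun disj_list :: "'b set list \<Rightarrow> bool" where
  "disj_list [] \<longleftrightarrow> True"
| "disj_list (B # Bs) \<longleftrightarrow> B \<inter> \<Union> (set Bs) = {} \<and> disj_list Bs"

lemma disj_list_iff:
  "disj_list Bs \<longleftrightarrow> (\<forall>i j. i < j \<longrightarrow> j < length Bs \<longrightarrow> Bs ! i \<inter> Bs ! j = {})"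
proof (induction Bs)
  case (Cons B Bs)
  have "(\<forall>i j. i < j \<longrightarrow> j < length (B # Bs) \<longrightarrow> (B # Bs) ! i \<inter> (B # Bs) ! j = {}) \<longleftrightarrow>
      (\<forall>j<length Bs. B \<inter> Bs ! j = {}) \<and> (\<forall>i j. i < j \<longrightarrow> j < length Bs \<longrightarrow> Bs ! i \<inter> Bs ! j = {})" (is "?L \<longleftrightarrow> ?R")
  proof
    assume L: ?L
    show ?R
    proof (intro conjI allI impI)
      show "B \<inter> Bs ! j = {}" if "j < length Bs" for j using L[rule_format, of 0 "Suc j"] that by simp
      show "Bs ! i \<inter> Bs ! j = {}" if "i < j" "j < length Bs" for i j
        using L[rule_format, of "Suc i" "Suc j"] that by simp
    qed
  next
    assume R: ?R
    show ?L
    proof (intro allI impI)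
      fix i j assume "i < j" "j < length (B # Bs)"
      then show "(B # Bs) ! i \<inter> (B # Bs) ! j = {}" using R by (cases i; cases j) auto
    qed
  qed
  moreover have "B \<inter> \<Union> (set Bs) = {} \<longleftrightarrow> (\<forall>j<length Bs. B \<inter> Bs ! j = {})"
    by (auto simp: set_conv_nth)
  ultimately show ?case using Cons.IH by simp
qed simp

lemma OSP_iff: "Bs \<in> OSP \<beta> n \<longleftrightarrow> map card Bs = \<beta> \<and> \<Union> (set Bs) = {1..n} \<and> disj_list Bs"
  by (auto simp: OSP_def disj_list_iff)

lemma finite_OSP: "finite (OSP \<beta> n)"
proof (rule finite_subset)
  show "OSP \<beta> n \<subseteq> {Bs. set Bs \<subseteq> Pow {1..n} \<and> length Bs = length \<beta>}"
  proof
    fix Bs assume "Bs \<in> OSP \<beta> n"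
    then have "map card Bs = \<beta>" "\<Union> (set Bs) = {1..n}" by (simp_all only: OSP_iff)
    then show "Bs \<in> {Bs. set Bs \<subseteq> Pow {1..n} \<and> length Bs = length \<beta>}" by force
  qed
qed (simp add: finite_lists_length_eq)

lemma OSP_msplits:
  assumes "finite A"
  shows "bij_betw (map mset_set) {Bs. map card Bs = \<beta> \<and> \<Union> (set Bs) = A \<and> disj_list Bs} (msplits \<beta> (mset_set A))"
proof (rule bij_betw_imageI)
  let ?O = "{Bs. map card Bs = \<beta> \<and> \<Union> (set Bs) = A \<and> disj_list Bs}"
  show "inj_on (map mset_set) ?O"
  proof (rule inj_onI)
    fix Bs Cs assume *: "Bs \<in> ?O" "Cs \<in> ?O" "map mset_set Bs = map mset_set Cs"
    have "inj_on (mset_set :: 'a set \<Rightarrow> 'a multiset) (set Bs \<union> set Cs)"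
    proof (rule inj_onI)
      fix X Y :: "'a set" assume XY: "X \<in> set Bs \<union> set Cs" "Y \<in> set Bs \<union> set Cs" "mset_set X = mset_set Y"
      have "X \<subseteq> A" "Y \<subseteq> A" using * XY(1,2) by blast+
      then have "finite X" "finite Y" using assms finite_subset by blast+
      then show "X = Y" using XY(3) by (metis finite_set_mset_mset_set)
    qed
    then show "Bs = Cs" using *(3) by (rule map_inj_on[rotated])
  qed
  show "map mset_set ` ?O = msplits \<beta> (mset_set A)"
    using assms
  proof (induction \<beta> arbitrary: A)
    case Nil
    then show ?case by (auto simp: msplits_Nil mset_set_empty_iff)
  next
    case (Cons b \<beta>)
    show ?case
    proof (intro equalityI subsetI)
      fix Ms assume "Ms \<in> map mset_set ` {Bs. map card Bs = b # \<beta> \<and> \<Union> (set Bs) = A \<and> disj_list Bs}"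
      then obtain B Bs where B: "Ms = mset_set B # map mset_set Bs" "card B = b" "map card Bs = \<beta>"
        "B \<union> \<Union> (set Bs) = A" "B \<inter> \<Union> (set Bs) = {}" "disj_list Bs" by auto
      have fin: "finite B" "finite (\<Union> (set Bs))" using B(4) Cons.prems by (metis finite_Un)+
      have "map mset_set Bs \<in> msplits \<beta> (mset_set (\<Union> (set Bs)))"
        unfolding Cons.IH[OF fin(2), symmetric] using B by (intro imageI) simp
      then show "Ms \<in> msplits (b # \<beta>) (mset_set A)"
        using B fin by (auto simp: msplits_def mset_set_Union)
    next
      fix Ms assume "Ms \<in> msplits (b # \<beta>) (mset_set A)"
      then obtain M Ms' where M: "Ms = M # Ms'" "size M = b" "map size Ms' = \<beta>" "M + sum_list Ms' = mset_set A"
        by (auto simp: msplits_def)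
      define B where "B = set_mset M"
      have sub: "M \<subseteq># mset_set A" using M(4) by (metis mset_subset_eq_add_left)
      then have BA: "B \<subseteq> A" using set_mset_mono[OF sub] Cons.prems by (simp add: B_def)
      have MB: "M = mset_set B"
      proof (rule multiset_eqI)
        fix x
        have "count M x \<le> 1"
          using mset_subset_eq_count[OF sub, of x] by (simp add: count_mset_set' split: if_splits)
        then show "count M x = count (mset_set B) x"
          using Cons.prems BA finite_subset[of B A]
          by (auto simp: B_def count_mset_set' not_in_iff count_greater_zero_iff[symmetric] simp del: count_greater_zero_iff)
      qed
      have "sum_list Ms' = mset_set A - mset_set B" using M(4) MB by (metis add_diff_cancel_left')
      also have "\<dots> = mset_set (A - B)" using BA Cons.prems by (simp add: mset_set_Diff)
      finally have "Ms' \<in> msplits \<beta> (mset_set (A - B))" using M by (simp add: msplits_def)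
      then obtain Bs where Bs: "Ms' = map mset_set Bs" "map card Bs = \<beta>" "\<Union> (set Bs) = A - B" "disj_list Bs"
        unfolding Cons.IH[OF finite_Diff[OF Cons.prems], symmetric] by auto
      have "card B = b" using M(2) MB by simp
      then show "Ms \<in> map mset_set ` {Bs. map card Bs = b # \<beta> \<and> \<Union> (set Bs) = A \<and> disj_list Bs}"
        using Bs M(1) MB BA by (intro image_eqI[of _ _ "B # Bs"]) auto
    qed
  qed
qed

text \<open>An ordered set partition is a splitting of the multiset in which every letter of \<open>{1..n}\<close> occurs once, so its
  count is a coefficient of \<open>h\<^sub>\<beta>\<close>.\<close>

lemma card_OSP: "card (OSP \<beta> n) = card (msplits \<beta> (mset_set {1..n}))"
proof -
  have "OSP \<beta> n = {Bs. map card Bs = \<beta> \<and> \<Union> (set Bs) = {1..n} \<and> disj_list Bs}"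
    by (rule set_eqI) (simp only: OSP_iff mem_Collect_eq)
  then show ?thesis using bij_betw_same_card[OF OSP_msplits[of "{1..n}" \<beta>]] by simp
qed

subsection \<open>Power sums\<close>

lemma orbit_const:
  assumes "\<And>y. f (w y) = f y" "y \<in> orbit w x"
  shows "f y = f x"
  using assms(2) by induction (simp_all add: assms(1))

text \<open>Maps that are constant on each set of \<open>F\<close> and take each value \<open>i\<close> as often as \<open>M\<close> contains it.\<close>

definition colourings :: "nat set set \<Rightarrow> nat multiset \<Rightarrow> (nat \<Rightarrow> nat) set" where
  "colourings F M = {f. f \<in> extensional (\<Union>F) \<and> (\<forall>Z\<in>F. \<forall>x\<in>Z. \<forall>y\<in>Z. f x = f y) \<and>
     image_mset f (mset_set (\<Union>F)) = M}"

lemma finite_colourings: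
  assumes "finite (\<Union>F)"
  shows "finite (colourings F M)"
proof (rule finite_subset)
  show "colourings F M \<subseteq> (\<Union>F) \<rightarrow>\<^sub>E set_mset M"
  proof
    fix f assume "f \<in> colourings F M"
    then have f: "f \<in> extensional (\<Union>F)" "image_mset f (mset_set (\<Union>F)) = M"
      by (simp_all add: colourings_def)
    have "set_mset M = f ` \<Union>F" unfolding f(2)[symmetric] using assms by simp
    then show "f \<in> (\<Union>F) \<rightarrow>\<^sub>E set_mset M" using f(1) by (auto simp: PiE_def)
  qed
qed (use assms in \<open>simp add: finite_PiE\<close>)

text \<open>A monomial of a product of power sums chooses one variable for each factor, that is, one colour for each set.\<close>

lemma mcoeff_prod_psum:
  assumes "finite F" "\<And>Z. Z \<in> F \<Longrightarrow> finite Z \<and> Z \<noteq> {}" "disjoint F"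
  shows "mcoeff (\<Prod>Z\<in>F. psum (card Z) :: 'a::comm_ring_1 mseries) M = of_nat (card (colourings F M))"
  using assms
proof (induction F arbitrary: M rule: finite_induct)
  case empty
  have "colourings {} M = (if M = {#} then {\<lambda>_. undefined} else {})"
    by (auto simp: colourings_def)
  then show ?case by simp
next
  case (insert Z F)
  have Z: "finite Z" "Z \<noteq> {}" using insert.prems by auto
  have dF: "disjoint F" using insert.prems(2) by (simp add: disjoint_def)
  have "Z \<inter> Y = {}" if "Y \<in> F" for Y
    by (rule disjointD[OF insert.prems(2)]) (use that insert.hyps(2) in auto)
  then have disj: "Z \<inter> \<Union>F = {}" by blast
  have finF: "finite (\<Union>F)" using insert by auto
  let ?S = "SIGMA p:{(A, B). A + B = M \<and> (\<exists>i. A = replicate_mset (card Z) i)}. colourings F (snd p)"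
  let ?f = "\<lambda>((A, B), g) x. if x \<in> Z then THE i. A = replicate_mset (card Z) i else g x"
  have cZ: "card Z \<noteq> 0" using Z by simp
  have the: "(THE i. replicate_mset (card Z) k = replicate_mset (card Z) i) = k" for k :: nat
    using cZ by (intro the_equality) (auto simp: replicate_mset_eq_iff)
  have union: "mset_set (\<Union> (insert Z F)) = mset_set Z + mset_set (\<Union>F)"
    using disj Z finF by (simp add: mset_set_Union)
  have "bij_betw ?f ?S (colourings (insert Z F) M)"
  proof (rule bij_betwI[where g = "\<lambda>f. ((image_mset f (mset_set Z), image_mset f (mset_set (\<Union>F))), restrict f (\<Union>F))"])
    show "?f \<in> ?S \<rightarrow> colourings (insert Z F) M"
    proof
      fix p assume "p \<in> ?S"
      then obtain B g k where p: "p = ((replicate_mset (card Z) k, B), g)" "replicate_mset (card Z) k + B = M"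
        "g \<in> colourings F B" by auto
      have fp: "?f p = (\<lambda>x. if x \<in> Z then k else g x)" unfolding p(1) by (simp only: prod.case the)
      let ?h = "\<lambda>x. if x \<in> Z then k else g x"
      have c1: "image_mset ?h (mset_set Z) = replicate_mset (card Z) k"
        using Z by (subst image_mset_cong[where g = "\<lambda>_. k"]) (simp_all add: image_mset_const_eq)
      have c2: "image_mset ?h (mset_set (\<Union>F)) = image_mset g (mset_set (\<Union>F))"
      proof (rule image_mset_cong)
        fix x assume "x \<in># mset_set (\<Union>F)"
        then have "x \<notin> Z" using finF disj by auto
        then show "?h x = g x" by simp
      qed
      have c3: "?h x = ?h y" if "Y \<in> insert Z F" "x \<in> Y" "y \<in> Y" for x y Y
      proof (cases "Y = Z")
        case False
        then have "x \<notin> Z" "y \<notin> Z" "Y \<in> F" using that disj by auto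
        moreover have "g x = g y" using p(3) that \<open>Y \<in> F\<close> unfolding colourings_def by blast
        ultimately show ?thesis by simp
      qed (use that in simp)
      have c4: "?h \<in> extensional (\<Union> (insert Z F))"
        using p(3) by (simp add: colourings_def extensional_def)
      have c5: "image_mset g (mset_set (\<Union>F)) = B" using p(3) by (simp add: colourings_def)
      show "?f p \<in> colourings (insert Z F) M"
        unfolding fp colourings_def mem_Collect_eq union image_mset_union
      proof (intro conjI ballI)
        show "?h x = ?h y" if "Y \<in> insert Z F" "x \<in> Y" "y \<in> Y" for x y Y by (rule c3[OF that])
      qed (rule c4, simp only: c1 c2 c5 p(2))
    qed
    show "(\<lambda>f. ((image_mset f (mset_set Z), image_mset f (mset_set (\<Union>F))), restrict f (\<Union>F))) \<in> colourings (insert Z F) M \<rightarrow> ?S"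
    proof
      fix f assume f: "f \<in> colourings (insert Z F) M"
      obtain z where z: "z \<in> Z" using Z by auto
      have "image_mset f (mset_set Z) = image_mset (\<lambda>_. f z) (mset_set Z)"
      proof (rule image_mset_cong)
        fix y assume "y \<in># mset_set Z"
        then have "y \<in> Z" using Z by simp
        then show "f y = f z" using f z unfolding colourings_def by blast
      qed
      then have "image_mset f (mset_set Z) = replicate_mset (card Z) (f z)" using Z by (simp add: image_mset_const_eq)
      moreover have "image_mset f (mset_set Z) + image_mset f (mset_set (\<Union>F)) = M"
        using f by (simp only: colourings_def mem_Collect_eq union image_mset_union)
      ultimately have 1: "image_mset f (mset_set Z) = replicate_mset (card Z) (f z)"
        "image_mset f (mset_set Z) + image_mset f (mset_set (\<Union>F)) = M" by blast+
      have r1: "image_mset (restrict f (\<Union>F)) (mset_set (\<Union>F)) = image_mset f (mset_set (\<Union>F))"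
        using finF by (intro image_mset_cong) auto
      have r2: "restrict f (\<Union>F) x = restrict f (\<Union>F) y" if "Y \<in> F" "x \<in> Y" "y \<in> Y" for x y Y
      proof -
        have "x \<in> \<Union>F" "y \<in> \<Union>F" using that by auto
        moreover have "f x = f y" using f that unfolding colourings_def by blast
        ultimately show ?thesis by simp
      qed
      have "restrict f (\<Union>F) \<in> colourings F (image_mset f (mset_set (\<Union>F)))"
        unfolding colourings_def mem_Collect_eq
        by (intro conjI ballI) (rule restrict_extensional, rule r2, assumption+, rule r1)
      with 1 show "((image_mset f (mset_set Z), image_mset f (mset_set (\<Union>F))), restrict f (\<Union>F)) \<in> ?S"
        by auto
    qed
    fix p assume "p \<in> ?S"
    then obtain B g k where p: "p = ((replicate_mset (card Z) k, B), g)" "replicate_mset (card Z) k + B = M"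
      "g \<in> colourings F B" by auto
    have fp: "?f p = (\<lambda>x. if x \<in> Z then k else g x)" unfolding p(1) by (simp only: prod.case the)
    let ?h = "\<lambda>x. if x \<in> Z then k else g x"
    have c1: "image_mset ?h (mset_set Z) = replicate_mset (card Z) k"
      using Z by (subst image_mset_cong[where g = "\<lambda>_. k"]) (simp_all add: image_mset_const_eq)
    have c2: "image_mset ?h (mset_set (\<Union>F)) = image_mset g (mset_set (\<Union>F))"
    proof (rule image_mset_cong)
      fix x assume "x \<in># mset_set (\<Union>F)"
      then have "x \<notin> Z" using finF disj by auto
      then show "?h x = g x" by simp
    qed
    have c3: "image_mset g (mset_set (\<Union>F)) = B" using p(3) by (simp add: colourings_def)
    have c4: "restrict ?h (\<Union>F) = g"
    proof
      fix x
      have g: "g \<in> extensional (\<Union>F)" using p(3) unfolding colourings_def by blast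
      show "restrict ?h (\<Union>F) x = g x"
      proof (cases "x \<in> \<Union>F")
        case True
        then have "x \<notin> Z" using disj by blast
        then show ?thesis unfolding restrict_apply using True by (simp only: if_True if_False)
      next
        case False
        then show ?thesis unfolding restrict_apply using extensional_arb[OF g False] by (simp only: if_False)
      qed
    qed
    show "((image_mset (?f p) (mset_set Z), image_mset (?f p) (mset_set (\<Union>F))), restrict (?f p) (\<Union>F)) = p"
      by (simp only: fp c1 c2 c3 c4) (simp only: p(1))
  next
    fix f assume f: "f \<in> colourings (insert Z F) M"
    have "image_mset f (mset_set Z) = replicate_mset (card Z) (f z)" if z: "z \<in> Z" for z
    proof -
      have "image_mset f (mset_set Z) = image_mset (\<lambda>_. f z) (mset_set Z)"
      proof (rule image_mset_cong)
        fix y assume "y \<in># mset_set Z"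
        then have "y \<in> Z" using Z by simp
        then show "f y = f z" using f z unfolding colourings_def by blast
      qed
      then show ?thesis using Z by (simp add: image_mset_const_eq)
    qed
    then have fZ: "(THE i. image_mset f (mset_set Z) = replicate_mset (card Z) i) = f z" if "z \<in> Z" for z
      using that by (simp only: the)
    have f_ext: "f \<in> extensional (\<Union> (insert Z F))" using f unfolding colourings_def by blast
    show "?f ((image_mset f (mset_set Z), image_mset f (mset_set (\<Union>F))), restrict f (\<Union>F)) = f"
    proof
      fix x
      consider "x \<in> Z" | "x \<notin> Z" "x \<in> \<Union>F" | "x \<notin> Z" "x \<notin> \<Union>F" by blast
      then show "?f ((image_mset f (mset_set Z), image_mset f (mset_set (\<Union>F))), restrict f (\<Union>F)) x = f x"
      proof cases
        case 3
        then have "x \<notin> \<Union> (insert Z F)" by blast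
        from extensional_arb[OF f_ext this] show ?thesis
          using 3 by (simp only: prod.case restrict_apply if_False)
      qed (simp_all only: prod.case restrict_apply if_True if_False fZ)
    qed
  qed
  note card_eq = bij_betw_same_card[OF this, symmetric]
  have fin: "finite {(A, B). A + B = M \<and> (\<exists>i. A = replicate_mset (card Z) i)}"
    by (rule finite_subset[OF _ finite_mset_splits[of M]]) auto
  have "mcoeff (\<Prod>Z\<in>insert Z F. psum (card Z) :: 'a mseries) M
     = (\<Sum>(A, B) | A + B = M. mcoeff (psum (card Z)) A * mcoeff (\<Prod>Z\<in>F. psum (card Z)) B)"
    using insert.hyps by (simp add: mcoeff_times)
  also have "\<dots> = (\<Sum>(A, B) | A + B = M. if \<exists>i. A = replicate_mset (card Z) i then of_nat (card (colourings F B)) else 0)"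
    using insert dF by (intro sum.cong refl) (auto simp: psum_def)
  also have "\<dots> = (\<Sum>p | p \<in> {(A, B). A + B = M} \<and> (\<exists>i. fst p = replicate_mset (card Z) i). of_nat (card (colourings F (snd p))))"
    unfolding case_prod_unfold
    by (subst sum.inter_filter[symmetric]) (use finite_mset_splits[of M] in \<open>auto simp: case_prod_unfold\<close>)
  also have "\<dots> = of_nat (\<Sum>p\<in>{(A, B). A + B = M \<and> (\<exists>i. A = replicate_mset (card Z) i)}. card (colourings F (snd p)))"
    unfolding of_nat_sum by (rule sum.cong) auto
  also have "\<dots> = of_nat (card ?S)" using fin finite_colourings[OF finF] by (subst card_SigmaI) auto
  finally show ?case using card_eq by simp
qed

lemma mcoeff_psum_cycle_type:
  assumes w: "w permutes {1..n}"
  shows "mcoeff (psum_cycle_type n w :: 'a::comm_ring_1 mseries) M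
    = of_nat (card {f \<in> extensional {1..n}. f \<circ> w = f \<and> image_mset f (mset_set {1..n}) = M})"
proof -
  let ?F = "cycles_on {1..n} w"
  have perm: "permutation w" using w permutation_permutes by blast
  have self: "x \<in> orbit w x" for x using permutation_self_in_orbit[OF perm] .
  have sub: "orbit w x \<subseteq> {1..n}" if "x \<in> {1..n}" for x by (rule permutes_orbit_subset[OF w that])
  have Un: "\<Union>?F = {1..n}" using self sub by (fastforce simp: cycles_on_def)
  have "disjoint ?F"
  proof (rule disjointI)
    fix X Y assume "X \<in> ?F" "Y \<in> ?F" "X \<noteq> Y"
    then obtain x y where xy: "X = orbit w x" "Y = orbit w y" by (auto simp: cycles_on_def)
    have eq: "orbit w z = orbit w x" if "z \<in> orbit w x" for z x
      using orbit_cyclic_eq3 cyclic_on_orbit[OF w] that by (metis finite_atLeastAtMost)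
    show "X \<inter> Y = {}"
    proof (rule ccontr)
      assume "X \<inter> Y \<noteq> {}"
      then obtain z where "z \<in> orbit w x" "z \<in> orbit w y" using xy by auto
      then show False using eq xy \<open>X \<noteq> Y\<close> by metis
    qed
  qed
  moreover have "finite Z \<and> Z \<noteq> {}" if "Z \<in> ?F" for Z
    using that sub self finite_subset[OF _ finite_atLeastAtMost] unfolding cycles_on_def by blast
  moreover have "finite ?F" by (simp add: cycles_on_def)
  ultimately have "mcoeff (psum_cycle_type n w :: 'a mseries) M = of_nat (card (colourings ?F M))"
    unfolding psum_cycle_type_def by (intro mcoeff_prod_psum) auto
  moreover have "(\<forall>Z\<in>?F. \<forall>x\<in>Z. \<forall>y\<in>Z. f x = f y) \<longleftrightarrow> f \<circ> w = f" if "f \<in> extensional {1..n}" for f :: "nat \<Rightarrow> nat"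
  proof
    assume *: "\<forall>Z\<in>?F. \<forall>x\<in>Z. \<forall>y\<in>Z. f x = f y"
    show "f \<circ> w = f"
    proof
      fix x
      show "(f \<circ> w) x = f x"
      proof (cases "x \<in> {1..n}")
        case True
        then have "orbit w x \<in> ?F" by (simp add: cycles_on_def)
        from *[THEN bspec, OF this, THEN bspec, OF orbit.base, THEN bspec, OF self]
        show ?thesis by (simp only: comp_apply)
      qed (simp add: permutes_not_in[OF w])
    qed
  next
    assume fw: "f \<circ> w = f"
    have inv: "f (w y) = f y" for y using fun_cong[OF fw, of y] by (simp only: comp_apply)
    show "\<forall>Z\<in>?F. \<forall>x\<in>Z. \<forall>y\<in>Z. f x = f y"
    proof (intro ballI)
      fix Z x y assume "Z \<in> ?F" "x \<in> Z" "y \<in> Z"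
      then obtain z where "x \<in> orbit w z" "y \<in> orbit w z" by (auto simp: cycles_on_def)
      from this[THEN orbit_const[of f w, OF inv]] show "f x = f y" by (simp only:)
    qed
  qed
  then have "colourings ?F M = {f \<in> extensional {1..n}. f \<circ> w = f \<and> image_mset f (mset_set {1..n}) = M}"
    unfolding colourings_def Un by blast
  ultimately show ?thesis by simp
qed

subsection \<open>Orbit counting\<close>

lemma orbit_counting_transitive:
  assumes S: "finite S" and X: "finite X" "X \<noteq> {}"
    and act: "\<And>w x. w permutes S \<Longrightarrow> x \<in> X \<Longrightarrow> act w x \<in> X"
    and id: "\<And>x. x \<in> X \<Longrightarrow> act id x = x"
    and comp: "\<And>w v x. w permutes S \<Longrightarrow> v permutes S \<Longrightarrow> x \<in> X \<Longrightarrow> act (w \<circ> v) x = act w (act v x)"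
    and trans: "\<And>x y. x \<in> X \<Longrightarrow> y \<in> X \<Longrightarrow> \<exists>w. w permutes S \<and> act w x = y"
  shows "(\<Sum>w | w permutes S. card {x \<in> X. act w x = x}) = card {w. w permutes S}"
proof -
  let ?G = "{w. w permutes S}"
  have finG: "finite ?G" by (rule finite_permutations[OF S])
  obtain x0 where x0: "x0 \<in> X" using X by auto
  have count: "(\<Sum>w\<in>?G. card {x \<in> X. R w x}) = (\<Sum>x\<in>X. card {w \<in> ?G. R w x})" for R
    by (rule sum_multicount_gen) (use finG X in auto)
  have stab: "card {w \<in> ?G. act w x = x} = card {w \<in> ?G. act w x0 = x}" if x: "x \<in> X" for x
  proof -
    obtain g where g: "g permutes S" "act g x0 = x" using trans[OF x0 x] by blast
    have gi: "inv g permutes S" by (rule permutes_inv[OF g(1)])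
    have "act (inv g) x = x0"
      using comp[OF gi g(1) x0] g id[OF x0] permutes_inv_o(2)[OF g(1)] by simp
    then have "bij_betw (\<lambda>w. w \<circ> g) {w \<in> ?G. act w x = x} {w \<in> ?G. act w x0 = x}"
      using g gi comp[OF _ g(1) x0] comp[OF _ gi x] permutes_inv_o[OF g(1)]
      by (intro bij_betwI[where g = "\<lambda>w. w \<circ> inv g"])
         (auto simp: o_assoc[symmetric] permutes_compose)
    then show ?thesis by (rule bij_betw_same_card)
  qed
  have "(\<Sum>w\<in>?G. card {x \<in> X. act w x = x}) = (\<Sum>x\<in>X. card {w \<in> ?G. act w x0 = x})"
    unfolding count by (rule sum.cong[OF refl]) (rule stab)
  also have "\<dots> = (\<Sum>w\<in>?G. card {x \<in> X. act w x0 = x})" by (rule count[symmetric])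
  also have "\<dots> = (\<Sum>w\<in>?G. 1)"
  proof (rule sum.cong[OF refl])
    fix w assume "w \<in> ?G"
    then have "{x \<in> X. act w x0 = x} = {act w x0}" using act[of w x0] x0 by auto
    then show "card {x \<in> X. act w x0 = x} = 1" by simp
  qed
  finally show ?thesis by simp
qed

text \<open>Burnside's lemma with the set of orbits given by a complete invariant \<open>J\<close>.\<close>

lemma orbit_counting:
  assumes S: "finite S" and X: "finite X"
    and act: "\<And>w x. w permutes S \<Longrightarrow> x \<in> X \<Longrightarrow> act w x \<in> X \<and> J (act w x) = J x"
    and id: "\<And>x. x \<in> X \<Longrightarrow> act id x = x"
    and comp: "\<And>w v x. w permutes S \<Longrightarrow> v permutes S \<Longrightarrow> x \<in> X \<Longrightarrow> act (w \<circ> v) x = act w (act v x)"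
    and trans: "\<And>x y. x \<in> X \<Longrightarrow> y \<in> X \<Longrightarrow> J x = J y \<Longrightarrow> \<exists>w. w permutes S \<and> act w x = y"
  shows "(\<Sum>w | w permutes S. card {x \<in> X. act w x = x}) = card {w. w permutes S} * card (J ` X)"
proof -
  let ?G = "{w. w permutes S}"
  have "card {x \<in> X. act w x = x} = (\<Sum>t\<in>J ` X. card {x \<in> {x \<in> X. J x = t}. act w x = x})" for w
  proof -
    have "{x \<in> X. act w x = x} = (\<Union>t\<in>J ` X. {x \<in> {x \<in> X. J x = t}. act w x = x})" by auto
    then show ?thesis using X by (simp only:) (rule card_UN_disjoint, auto)
  qed
  then have "(\<Sum>w\<in>?G. card {x \<in> X. act w x = x})
      = (\<Sum>t\<in>J ` X. \<Sum>w\<in>?G. card {x \<in> {x \<in> X. J x = t}. act w x = x})"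
    by (simp only:) (rule sum.swap)
  also have "\<dots> = (\<Sum>t\<in>J ` X. card ?G)"
  proof (rule sum.cong[OF refl])
    fix t assume "t \<in> J ` X"
    then show "(\<Sum>w\<in>?G. card {x \<in> {x \<in> X. J x = t}. act w x = x}) = card ?G"
      using S X act id comp trans
      by (intro orbit_counting_transitive) auto
  qed
  finally show ?thesis by simp
qed

subsection \<open>Permutation modules of ordered set partitions\<close>

text \<open>Ordered set partitions together with a word of content \<open>M\<close>, that is, a function on \<open>{1..n}\<close>.\<close>

definition coloured_OSP :: "nat list \<Rightarrow> nat \<Rightarrow> nat multiset \<Rightarrow> (nat set list \<times> (nat \<Rightarrow> nat)) set" where
  "coloured_OSP \<beta> n M = OSP \<beta> n \<times> {f \<in> extensional {1..n}. image_mset f (mset_set {1..n}) = M}"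

definition block_contents :: "nat set list \<times> (nat \<Rightarrow> nat) \<Rightarrow> nat multiset list" where
  "block_contents = (\<lambda>(Bs, f). map (\<lambda>B. image_mset f (mset_set B)) Bs)"

lemma mset_set_disj_list:
  "disj_list Bs \<Longrightarrow> finite (\<Union> (set Bs)) \<Longrightarrow> mset_set (\<Union> (set Bs)) = sum_list (map mset_set Bs)"
  by (induction Bs) (auto simp: mset_set_Union)

lemma image_mset_sum_list: "image_mset f (sum_list Ms) = sum_list (map (image_mset f) Ms)"
  by (induction Ms) auto

lemma block_contents_in: "x \<in> coloured_OSP \<beta> n M \<Longrightarrow> block_contents x \<in> msplits \<beta> M"
proof -
  assume "x \<in> coloured_OSP \<beta> n M"
  then obtain Bs f where x: "x = (Bs, f)" "Bs \<in> OSP \<beta> n" "image_mset f (mset_set {1..n}) = M"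
    by (auto simp: coloured_OSP_def)
  have Bs: "map card Bs = \<beta>" "\<Union> (set Bs) = {1..n}" "disj_list Bs" using x(2) by (simp_all only: OSP_iff)
  have "mset_set {1..n} = sum_list (map mset_set Bs)"
    using mset_set_disj_list[OF Bs(3)] unfolding Bs(2) by simp
  then have "M = sum_list (block_contents x)"
    using x(1,3) by (simp add: block_contents_def image_mset_sum_list o_def)
  moreover have "map size (block_contents x) = \<beta>"
    using Bs(1) x(1) by (simp add: block_contents_def o_def)
  ultimately show ?thesis by (simp add: msplits_def)
qed

lemma ex_image_mset:
  assumes "finite B" "card B = size M"
  shows "\<exists>f. image_mset f (mset_set B) = M"
  using assms
proof (induction M arbitrary: B)
  case empty
  then show ?case by simp
next
  case (add x M)
  then obtain b where b: "b \<in> B" by (metis card.empty equals0I nat.distinct(1) size_add_mset)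
  have "card (B - {b}) = size M" using add.prems b by simp
  then obtain f where f: "image_mset f (mset_set (B - {b})) = M" using add.IH add.prems by blast
  have "image_mset (f(b := x)) (mset_set (B - {b})) = image_mset f (mset_set (B - {b}))"
    using add.prems by (intro image_mset_cong) auto
  moreover have "mset_set B = add_mset b (mset_set (B - {b}))"
    using b add.prems by (metis mset_set.remove)
  ultimately have "image_mset (f(b := x)) (mset_set B) = add_mset x M"
    using f by (simp only: image_mset_add_mset fun_upd_same)
  then show ?case by blast
qed

lemma ex_blocks:
  assumes "finite A" "card A = size (sum_list Ms)"
  shows "\<exists>Bs f. map card Bs = map size Ms \<and> \<Union> (set Bs) = A \<and> disj_list Bs \<and>
    map (\<lambda>B. image_mset f (mset_set B)) Bs = Ms"
  using assms
proof (induction Ms arbitrary: A)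
  case Nil
  then show ?case by (intro exI[of _ "[]"]) simp
next
  case (Cons M Ms)
  obtain B where B: "B \<subseteq> A" "card B = size M"
    using obtain_subset_with_card_n[of "size M" A] Cons.prems by auto
  have finB: "finite B" using B(1) Cons.prems finite_subset by blast
  have "card (A - B) = size (sum_list Ms)" using B Cons.prems finB by (simp add: card_Diff_subset)
  then obtain Bs f where Bs: "map card Bs = map size Ms" "\<Union> (set Bs) = A - B" "disj_list Bs"
    "map (\<lambda>B. image_mset f (mset_set B)) Bs = Ms" using Cons.IH[of "A - B"] Cons.prems by auto
  obtain g where g: "image_mset g (mset_set B) = M" using ex_image_mset[OF finB B(2)] by blast
  let ?h = "\<lambda>x. if x \<in> B then g x else f x"
  have "image_mset ?h (mset_set C) = image_mset f (mset_set C)" if "C \<in> set Bs" for C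
  proof -
    have "C \<subseteq> A - B" using that Bs(2) by blast
    moreover from this have "finite C" using Cons.prems finite_subset by blast
    ultimately show ?thesis by (intro image_mset_cong) auto
  qed
  then have "map (\<lambda>B. image_mset ?h (mset_set B)) Bs = map (\<lambda>B. image_mset f (mset_set B)) Bs"
    by (intro map_cong refl) simp
  moreover have "image_mset ?h (mset_set B) = M"
    unfolding g[symmetric] using finB by (intro image_mset_cong) auto
  ultimately have "map (\<lambda>B. image_mset ?h (mset_set B)) (B # Bs) = M # Ms" using Bs(4) by simp
  moreover have "\<Union> (set (B # Bs)) = A" "disj_list (B # Bs)" using Bs B(1) by auto
  moreover have "map card (B # Bs) = map size (M # Ms)" using Bs B(2) by simp
  ultimately show ?case by (intro exI[of _ "B # Bs"] exI[of _ ?h] conjI)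
qed

lemma block_contents_image:
  assumes "sum_list \<beta> = n"
  shows "block_contents ` coloured_OSP \<beta> n M = msplits \<beta> M"
proof (intro equalityI subsetI)
  fix Ms assume Ms: "Ms \<in> msplits \<beta> M"
  have "size (sum_list Ms) = sum_list (map size Ms)" by (induction Ms) auto
  then have "card {1..n} = size (sum_list Ms)" using Ms assms by (simp add: msplits_def)
  from ex_blocks[OF finite_atLeastAtMost this] obtain Bs f where Bs: "map card Bs = map size Ms"
    "\<Union> (set Bs) = {1..n}" "disj_list Bs" "map (\<lambda>B. image_mset f (mset_set B)) Bs = Ms" by blast
  let ?f = "restrict f {1..n}"
  have OSP: "Bs \<in> OSP \<beta> n" unfolding OSP_iff using Bs Ms by (simp add: msplits_def)
  have "image_mset ?f (mset_set B) = image_mset f (mset_set B)" if "B \<in> set Bs" for B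
  proof -
    have "B \<subseteq> {1..n}" using that Bs(2) by blast
    moreover from this have "finite B" by (rule finite_subset) simp
    ultimately show ?thesis by (intro image_mset_cong) auto
  qed
  then have "map (\<lambda>B. image_mset ?f (mset_set B)) Bs = map (\<lambda>B. image_mset f (mset_set B)) Bs"
    by (intro map_cong refl) simp
  then have bc: "block_contents (Bs, ?f) = Ms" using Bs(4) by (simp add: block_contents_def)
  have "mset_set {1..n} = sum_list (map mset_set Bs)"
    using mset_set_disj_list[OF Bs(3)] unfolding Bs(2) by simp
  then have "image_mset ?f (mset_set {1..n}) = sum_list (block_contents (Bs, ?f))"
    by (simp add: block_contents_def image_mset_sum_list o_def)
  also have "\<dots> = M" using bc Ms by (simp add: msplits_def)
  finally have "(Bs, ?f) \<in> coloured_OSP \<beta> n M" using OSP by (simp add: coloured_OSP_def)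
  then show "Ms \<in> block_contents ` coloured_OSP \<beta> n M" using bc by (metis imageI)
qed (use block_contents_in in blast)

lemma relabel_OSP:
  assumes "w permutes {1..n}" "Bs \<in> OSP \<beta> n"
  shows "relabel w Bs \<in> OSP \<beta> n"
proof -
  have inj: "inj w" by (rule permutes_inj[OF assms(1)])
  have Bs: "map card Bs = \<beta>" "\<Union> (set Bs) = {1..n}" "disj_list Bs" using assms(2) by (simp_all only: OSP_iff)
  have "\<Union> (set (relabel w Bs)) = w ` \<Union> (set Bs)" by (auto simp: relabel_def)
  then have "\<Union> (set (relabel w Bs)) = {1..n}" using permutes_image[OF assms(1)] Bs(2) by simp
  moreover have "map card (relabel w Bs) = \<beta>"
    unfolding Bs(1)[symmetric] relabel_def by (simp add: card_image inj_on_subset[OF inj])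
  moreover have "disj_list (relabel w Bs)"
    using Bs(3) unfolding disj_list_iff relabel_def by (simp add: image_Int[OF inj, symmetric])
  ultimately show ?thesis by (simp only: OSP_iff)
qed

lemma relabel_id [simp]: "relabel id Bs = Bs" "relabel (\<lambda>x. x) Bs = Bs"
  by (simp_all add: relabel_def map_idI)

lemma relabel_comp: "relabel (w \<circ> v) Bs = relabel w (relabel v Bs)"
  by (simp add: relabel_def image_comp)

text \<open>If the colour contents of corresponding blocks agree, a bijection can be chosen block by block and
  colour by colour; so block contents are a complete invariant of the orbits.\<close>

lemma same_blocks_transitive:
  assumes x: "(Bs, f) \<in> coloured_OSP \<beta> n M" and y: "(Cs, g) \<in> coloured_OSP \<beta> n M"
    and eq: "block_contents (Bs, f) = block_contents (Cs, g)"
  shows "\<exists>w. w permutes {1..n} \<and> relabel w Bs = Cs \<and> f \<circ> inv w = g"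
proof -
  let ?A = "{1..n}"
  have Bs: "map card Bs = \<beta>" "\<Union> (set Bs) = ?A" "disj_list Bs" and f: "f \<in> extensional ?A"
    using x by (auto simp only: coloured_OSP_def OSP_iff mem_Sigma_iff mem_Collect_eq)
  have Cs: "map card Cs = \<beta>" "\<Union> (set Cs) = ?A" "disj_list Cs" and g: "g \<in> extensional ?A"
    using y by (auto simp only: coloured_OSP_def OSP_iff mem_Sigma_iff mem_Collect_eq)
  have len: "length Bs = length Cs" using Bs(1) Cs(1) by (metis length_map)
  define ind where "ind Ds x = (THE i. i < length Ds \<and> x \<in> Ds ! i)" for Ds :: "nat set list" and x
  have ind: "ind Ds x = i" if "disj_list Ds" "i < length Ds" "x \<in> Ds ! i" for Ds x i
    unfolding ind_def
  proof (rule the_equality)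
    fix j assume j: "j < length Ds \<and> x \<in> Ds ! j"
    show "j = i"
    proof (rule ccontr)
      assume "j \<noteq> i"
      then consider "i < j" | "j < i" by linarith
      then show False using that j unfolding disj_list_iff by cases blast+
    qed
  qed (use that in simp)
  have in_block: "\<exists>i<length Ds. x \<in> Ds ! i" if "\<Union> (set Ds) = ?A" "x \<in> ?A" for Ds x
    using that by (metis UnionE in_set_conv_nth)
  have count: "count (image_mset (\<lambda>x. (ind Ds x, h x)) (mset_set ?A)) (i, c)
      = (if i < length Ds then count (block_contents (Ds, h) ! i) c else 0)"
    if Ds: "disj_list Ds" "\<Union> (set Ds) = ?A" for Ds i c and h :: "nat \<Rightarrow> nat"
  proof -
    have "count (image_mset (\<lambda>x. (ind Ds x, h x)) (mset_set ?A)) (i, c)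
        = card {x \<in> ?A. ind Ds x = i \<and> h x = c}"
      by (subst count_image_mset) (simp add: vimage_def Int_def conj_commute conj_left_commute)
    also have "{x \<in> ?A. ind Ds x = i \<and> h x = c} = (if i < length Ds then {x \<in> Ds ! i. h x = c} else {})"
    proof -
      have "x \<in> ?A \<and> ind Ds x = i \<longleftrightarrow> i < length Ds \<and> x \<in> Ds ! i" for x
      proof
        assume "x \<in> ?A \<and> ind Ds x = i"
        then show "i < length Ds \<and> x \<in> Ds ! i" using in_block[OF Ds(2)] ind[OF Ds(1)] by blast
      next
        assume "i < length Ds \<and> x \<in> Ds ! i"
        then show "x \<in> ?A \<and> ind Ds x = i" using ind[OF Ds(1)] Ds(2) nth_mem by blast
      qed
      then show ?thesis by (auto simp del: atLeastAtMost_iff)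
    qed
    also have "card \<dots> = (if i < length Ds then count (block_contents (Ds, h) ! i) c else 0)"
    proof (cases "i < length Ds")
      case True
      have "Ds ! i \<subseteq> ?A" using True Ds(2) nth_mem by blast
      then have "finite (Ds ! i)" by (rule finite_subset) simp
      then show ?thesis using True
        by (simp add: block_contents_def count_image_mset vimage_def Int_def conj_commute)
    qed simp
    finally show ?thesis .
  qed
  have "image_mset (\<lambda>x. (ind Bs x, f x)) (mset_set ?A) = image_mset (\<lambda>x. (ind Cs x, g x)) (mset_set ?A)"
  proof (rule multiset_eqI)
    fix p :: "nat \<times> nat"
    obtain i c where p: "p = (i, c)" by force
    show "count (image_mset (\<lambda>x. (ind Bs x, f x)) (mset_set ?A)) p = count (image_mset (\<lambda>x. (ind Cs x, g x)) (mset_set ?A)) p"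
      unfolding p count[OF Bs(3,2)] count[OF Cs(3,2)] eq len ..
  qed
  from image_mset_eq_implies_permutes[OF finite_atLeastAtMost this]
  obtain w where w0: "w permutes ?A" "\<forall>x\<in>?A. (ind Bs x, f x) = (ind Cs (w x), g (w x))" .
  have w: "w permutes ?A" "x \<in> ?A \<Longrightarrow> ind Bs x = ind Cs (w x) \<and> f x = g (w x)" for x
    using w0(1) bspec[OF w0(2), of x] by (simp_all only: prod.inject)
  have "w ` (Bs ! i) = Cs ! i" if i: "i < length Bs" for i
  proof (intro equalityI subsetI)
    fix y assume "y \<in> w ` (Bs ! i)"
    then obtain x where x: "x \<in> Bs ! i" "y = w x" by auto
    then have xA: "x \<in> ?A" using i Bs(2) nth_mem by blast
    then have "w x \<in> ?A" using permutes_in_image[OF w(1)] by blast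
    then obtain j where j: "j < length Cs" "w x \<in> Cs ! j" using in_block[OF Cs(2)] by blast
    have "i = j" using ind[OF Bs(3) i x(1)] ind[OF Cs(3) j] w(2)[OF xA] by simp
    then show "y \<in> Cs ! i" using j x by simp
  next
    fix y assume y: "y \<in> Cs ! i"
    then have "y \<in> ?A" using i len Cs(2) nth_mem by (metis Union_iff)
    then obtain x where x: "x \<in> ?A" "y = w x" using permutes_image[OF w(1)] by blast
    obtain j where j: "j < length Bs" "x \<in> Bs ! j" using in_block[OF Bs(2) x(1)] by blast
    have "j = i" using ind[OF Bs(3) j] ind[OF Cs(3), of i y] i len y w(2)[OF x(1)] x(2) by simp
    then show "y \<in> w ` (Bs ! i)" using j x by simp
  qed
  then have "relabel w Bs = Cs" using len by (intro nth_equalityI) (simp_all add: relabel_def)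
  moreover have "f \<circ> inv w = g"
  proof
    fix y
    have "w (inv w y) = y" using permutes_inverses(1)[OF w(1)] .
    moreover have "inv w y \<in> ?A \<longleftrightarrow> y \<in> ?A" by (rule permutes_in_image[OF permutes_inv[OF w(1)]])
    ultimately show "(f \<circ> inv w) y = g y"
      using w(2)[of "inv w y"] extensional_arb[OF f, of "inv w y"] extensional_arb[OF g, of y]
      by (cases "y \<in> ?A") (simp_all del: atLeastAtMost_iff)
  qed
  ultimately show ?thesis using w(1) by blast
qed

text \<open>The permutations act on pairs of an ordered set partition and a colouring, the fixed points of
  \<open>w\<close> are pairs of fixed points, and the orbits are the lists of block contents.\<close>

lemma count_fixed_coloured_OSP:
  fixes M :: "nat multiset"
  assumes "sum_list \<beta> = n"
  shows "(\<Sum>w | w permutes {1..n}. card {Bs \<in> OSP \<beta> n. relabel w Bs = Bs} *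
      card {f \<in> extensional {1..n}. f \<circ> w = f \<and> image_mset f (mset_set {1..n}) = M})
    = fact n * card (msplits \<beta> M)"
proof -
  let ?A = "{1..n}" and ?X = "coloured_OSP \<beta> n M"
  let ?W = "{f \<in> extensional ?A. image_mset f (mset_set ?A) = M}"
  define act where "act w = (\<lambda>(Bs, f). (relabel w Bs, f \<circ> inv w :: nat \<Rightarrow> nat))" for w
  have act_W: "f \<circ> inv w \<in> ?W" if w: "w permutes ?A" and f: "f \<in> ?W" for w f
  proof -
    have "f (inv w x) = undefined" if "x \<notin> ?A" for x
      using permutes_not_in[OF permutes_inv[OF w] that] f that extensional_arb[of f ?A x] by simp
    then have "f \<circ> inv w \<in> extensional ?A" by (simp add: extensional_def)
    moreover have "image_mset (f \<circ> inv w) (mset_set ?A) = image_mset f (image_mset (inv w) (mset_set ?A))"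
      by (simp add: multiset.map_comp)
    moreover have "image_mset (inv w) (mset_set ?A) = mset_set (inv w ` ?A)"
      by (rule image_mset_mset_set) (rule inj_on_subset[OF permutes_inj[OF permutes_inv[OF w]] subset_UNIV])
    moreover have "inv w ` ?A = ?A" by (rule permutes_image[OF permutes_inv[OF w]])
    ultimately show ?thesis using f by simp
  qed
  have inv_fix: "f \<circ> inv w = f \<longleftrightarrow> f \<circ> w = f" if w: "w permutes ?A" for f :: "nat \<Rightarrow> nat" and w
  proof
    assume "f \<circ> inv w = f"
    then have "f \<circ> w = f \<circ> (inv w \<circ> w)" by (simp add: o_assoc)
    then show "f \<circ> w = f" using permutes_inv_o(2)[OF w] by simp
  next
    assume "f \<circ> w = f"
    then have "f \<circ> inv w = f \<circ> (w \<circ> inv w)" by (simp add: o_assoc)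
    then show "f \<circ> inv w = f" using permutes_inv_o(1)[OF w] by simp
  qed
  have fix_eq: "{x \<in> ?X. act w x = x} = {Bs \<in> OSP \<beta> n. relabel w Bs = Bs} \<times>
      {f \<in> extensional ?A. f \<circ> w = f \<and> image_mset f (mset_set ?A) = M}" if "w permutes ?A" for w
    using inv_fix[OF that] by (auto simp: coloured_OSP_def act_def)
  have "finite ?W"
  proof (rule finite_subset)
    show "?W \<subseteq> ?A \<rightarrow>\<^sub>E set_mset M" by (auto simp: PiE_def)
  qed (simp add: finite_PiE)
  then have finX: "finite ?X" by (simp add: coloured_OSP_def finite_OSP)
  have "(\<Sum>w | w permutes ?A. card {x \<in> ?X. act w x = x}) = card {w. w permutes ?A} * card (block_contents ` ?X)"
  proof (rule orbit_counting[OF _ finX])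
    fix w x assume w: "w permutes ?A" and "x \<in> ?X"
    then obtain Bs f where x: "x = (Bs, f)" "Bs \<in> OSP \<beta> n" "f \<in> ?W" by (auto simp: coloured_OSP_def)
    have "act w x \<in> ?X"
      using relabel_OSP[OF w x(2)] act_W[OF w x(3)] by (simp add: x(1) act_def coloured_OSP_def)
    moreover have "image_mset (f \<circ> inv w) (mset_set (w ` B)) = image_mset f (mset_set B)" for B
    proof -
      have "mset_set (w ` B) = image_mset w (mset_set B)"
        by (rule image_mset_mset_set[symmetric]) (rule inj_on_subset[OF permutes_inj[OF w] subset_UNIV])
      then show ?thesis by (simp add: multiset.map_comp o_assoc[symmetric] permutes_inv_o(2)[OF w])
    qed
    then have "block_contents (act w x) = block_contents x"
      by (simp add: x(1) act_def block_contents_def relabel_def)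
    ultimately show "act w x \<in> ?X \<and> block_contents (act w x) = block_contents x" by blast
  next
    fix x show "act id x = x" by (cases x) (simp add: act_def)
  next
    fix w v x assume wv: "w permutes ?A" "v permutes ?A"
    have "bij w" "bij v" using wv permutes_bij by auto
    then show "act (w \<circ> v) x = act w (act v x)"
      by (cases x) (simp add: act_def relabel_comp o_inv_distrib o_assoc)
  next
    fix x y assume *: "x \<in> ?X" "y \<in> ?X" "block_contents x = block_contents y"
    obtain Bs f Cs g where xy: "x = (Bs, f)" "y = (Cs, g)" by (cases x; cases y) auto
    show "\<exists>w. w permutes ?A \<and> act w x = y"
      using same_blocks_transitive[of Bs f \<beta> n M Cs g] * xy by (auto simp: act_def)
  qed simp
  moreover have "card {w. w permutes ?A} = fact n" by (rule card_permutations) simp_all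
  moreover have "card {x \<in> ?X. act w x = x} = card {Bs \<in> OSP \<beta> n. relabel w Bs = Bs} *
      card {f \<in> extensional ?A. f \<circ> w = f \<and> image_mset f (mset_set ?A) = M}" if "w permutes ?A" for w
    unfolding fix_eq[OF that] by (rule card_cartesian_product)
  ultimately show ?thesis by (simp add: block_contents_image[OF assms])
qed

text \<open>Compare the coefficients of a monomial \<open>M\<close>: the fixed ordered set partitions are counted by the
  character, and the fixed colourings of content \<open>M\<close> by the product of power sums.\<close>

lemma frob_permutation_module:
  assumes "sum_list \<beta> = n"
  shows "mconst (1 / fact n) * (\<Sum>w | w permutes {1..n}.
      mconst (of_nat (card {Bs \<in> OSP \<beta> n. relabel w Bs = Bs})) * psum_cycle_type n w)
    = (hcomp \<beta> :: 'k::field_char_0 mseries)"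
proof (rule mseries_eqI)
  fix M
  have "mcoeff (\<Sum>w | w permutes {1..n}.
      mconst (of_nat (card {Bs \<in> OSP \<beta> n. relabel w Bs = Bs})) * psum_cycle_type n w :: 'k mseries) M
    = of_nat (\<Sum>w | w permutes {1..n}. card {Bs \<in> OSP \<beta> n. relabel w Bs = Bs} *
      card {f \<in> extensional {1..n}. f \<circ> w = f \<and> image_mset f (mset_set {1..n}) = M})"
    unfolding mcoeff_sum of_nat_sum
    by (rule sum.cong) (simp_all add: mcoeff_mconst_mult mcoeff_psum_cycle_type)
  then show "mcoeff (mconst (1 / fact n) * (\<Sum>w | w permutes {1..n}.
      mconst (of_nat (card {Bs \<in> OSP \<beta> n. relabel w Bs = Bs})) * psum_cycle_type n w)) M
    = mcoeff (hcomp \<beta> :: 'k mseries) M"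
    unfolding mcoeff_mconst_mult mcoeff_hcomp count_fixed_coloured_OSP[OF assms] by simp
qed

section \<open>Row insertion and Schur positivity\<close>

definition ins_pos :: "nat \<Rightarrow> nat list \<Rightarrow> nat" where
  "ins_pos x r = length (takeWhile (\<lambda>y. y \<le> x) r)"

definition ins_row :: "nat \<Rightarrow> nat list \<Rightarrow> nat list" where
  "ins_row x r = (if ins_pos x r = length r then r @ [x] else r[ins_pos x r := x])"

text \<open>Schensted row insertion: the letter replaced in a row is inserted into the next one.\<close>

fun insert_tab :: "nat \<Rightarrow> nat list list \<Rightarrow> nat list list" where
  "insert_tab x [] = [[x]]"
| "insert_tab x (r # rs) = ins_row x r #
     (if ins_pos x r = length r then rs else insert_tab (r ! ins_pos x r) rs)"

text \<open>The row in which the insertion ends.\<close>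

fun insert_row :: "nat \<Rightarrow> nat list list \<Rightarrow> nat" where
  "insert_row x [] = 0"
| "insert_row x (r # rs) = (if ins_pos x r = length r then 0 else Suc (insert_row (r ! ins_pos x r) rs))"

definition top_row :: "nat list list \<Rightarrow> nat list" where
  "top_row T = (if T = [] then [] else hd T)"

definition below :: "nat list \<Rightarrow> nat list \<Rightarrow> bool" where
  "below r s \<longleftrightarrow> length s \<le> length r \<and> (\<forall>j<length s. r ! j < s ! j)"

text \<open>A recursive form of semistandardness. Each row is compared with the next one only, which suits
  induction along the bumping path.\<close>

fun tableau :: "nat list list \<Rightarrow> bool" where
  "tableau [] \<longleftrightarrow> True"
| "tableau (r # rs) \<longleftrightarrow> r \<noteq> [] \<and> sorted r \<and> below r (top_row rs) \<and> tableau rs"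

lemma ins_pos_le: "ins_pos x r \<le> length r"
  by (simp add: ins_pos_def length_takeWhile_le)

lemma ins_pos_before: "j < ins_pos x r \<Longrightarrow> r ! j \<le> x"
  unfolding ins_pos_def by (metis nth_mem set_takeWhileD takeWhile_nth)

lemma ins_pos_at: "ins_pos x r < length r \<Longrightarrow> x < r ! ins_pos x r"
  unfolding ins_pos_def using nth_length_takeWhile[of "\<lambda>y. y \<le> x" r] by simp

lemma ins_pos_after: "sorted r \<Longrightarrow> ins_pos x r \<le> j \<Longrightarrow> j < length r \<Longrightarrow> x < r ! j"
  using ins_pos_at[of x r] sorted_nth_mono[of r "ins_pos x r" j] by fastforce

lemma ins_pos_leI: "j < length r \<Longrightarrow> x < r ! j \<Longrightarrow> ins_pos x r \<le> j"
  using ins_pos_before[of j x r] by (meson leD leI)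

lemma ins_pos_geI: "p \<le> length r \<Longrightarrow> (\<And>j. j < p \<Longrightarrow> r ! j \<le> x) \<Longrightarrow> p \<le> ins_pos x r"
  using ins_pos_at[of x r] by (meson leD leI less_le_trans)

lemma ins_pos_eqI:
  assumes "p \<le> length r" "\<And>j. j < p \<Longrightarrow> r ! j \<le> x" "p < length r \<Longrightarrow> x < r ! p"
  shows "ins_pos x r = p"
  using ins_pos_geI[OF assms(1,2)] ins_pos_leI[of p r x] assms ins_pos_le[of x r]
  by (cases "p = length r") auto

lemma length_ins_row: "length (ins_row x r) = (if ins_pos x r = length r then Suc (length r) else length r)"
  by (simp add: ins_row_def)

lemma nth_ins_row:
  "j < length (ins_row x r) \<Longrightarrow> ins_row x r ! j = (if j = ins_pos x r then x else r ! j)"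
  using ins_pos_le[of x r] by (auto simp: ins_row_def nth_append nth_list_update)

lemma ins_pos_less_ins_row: "ins_pos x r < length (ins_row x r)"
  using ins_pos_le[of x r] by (auto simp: length_ins_row)

lemma sorted_ins_row:
  assumes "sorted r"
  shows "sorted (ins_row x r)"
  unfolding sorted_iff_nth_mono_less
proof (intro allI impI)
  fix i j assume ij: "i < j" "j < length (ins_row x r)"
  then have i: "i < length (ins_row x r)" by simp
  have jr: "j < length r" if "j \<noteq> ins_pos x r"
    using that ij by (auto simp: length_ins_row split: if_splits)
  show "ins_row x r ! i \<le> ins_row x r ! j"
    unfolding nth_ins_row[OF i] nth_ins_row[OF ij(2)]
    using ij(1) ins_pos_before[of i x r] ins_pos_after[OF assms, of x j] jr
      sorted_nth_mono[OF assms, of i j]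
    by auto
qed

text \<open>The bumped letter moves weakly to the left from one row to the next. This keeps columns strictly
  increasing.\<close>

lemma below_ins_row:
  assumes r: "sorted r" and p: "ins_pos x r < length r" and bel: "below r s"
  shows "below (r[ins_pos x r := x]) (ins_row (r ! ins_pos x r) s)"
proof -
  let ?p = "ins_pos x r"
  let ?y = "r ! ?p"
  let ?q = "ins_pos ?y s"
  have len: "length s \<le> length r" and less: "\<And>j. j < length s \<Longrightarrow> r ! j < s ! j"
    using bel by (auto simp: below_def)
  have q: "?q \<le> ?p"
  proof (cases "?p < length s")
    case True
    then show ?thesis using less[OF True] by (intro ins_pos_leI)
  next
    case False
    then show ?thesis using ins_pos_le[of ?y s] by simp
  qed
  have xy: "x < ?y" by (rule ins_pos_at[OF p])
  have upd: "r[?p := x] ! j \<le> r ! j" if "j < length r" for j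
    using that xy by (cases "j = ?p") auto
  show ?thesis
    unfolding below_def
  proof (intro conjI allI impI)
    show "length (ins_row ?y s) \<le> length (r[?p := x])"
      using len q p by (auto simp: length_ins_row)
    fix j assume j: "j < length (ins_row ?y s)"
    show "r[?p := x] ! j < ins_row ?y s ! j"
    proof (cases "j = ?q")
      case True
      have "r[?p := x] ! ?q < ?y"
        using q p xy ins_pos_before[of ?q x r] by (cases "?q = ?p") (auto simp: nth_list_update)
      moreover have "ins_row ?y s ! j = ?y" using nth_ins_row[OF j] True by simp
      ultimately show ?thesis using True by simp
    next
      case False
      then have js: "j < length s" using j by (auto simp: length_ins_row split: if_splits)
      then show ?thesis
        using less[OF js] upd[of j] len False by (simp add: nth_ins_row[OF j])
    qed
  qed
qed

lemma below_append: "below r s \<Longrightarrow> below (r @ [x]) s"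
  by (auto simp: below_def nth_append)

lemma top_row_insert_tab: "top_row (insert_tab x T) = ins_row x (top_row T)"
  by (cases T) (simp_all add: top_row_def ins_row_def ins_pos_def)

lemma tableau_insert: "tableau T \<Longrightarrow> tableau (insert_tab x T)"
proof (induction T arbitrary: x)
  case Nil
  show ?case by (simp add: below_def top_row_def)
next
  case (Cons r rs)
  show ?case
  proof (cases "ins_pos x r = length r")
    case True
    then show ?thesis using Cons.prems sorted_ins_row[of r x]
      by (simp add: ins_row_def below_append)
  next
    case False
    then have "ins_pos x r < length r" using ins_pos_le[of x r] by simp
    then show ?thesis
      using False Cons sorted_ins_row[of r x] below_ins_row[of r x "top_row rs"]
      by (simp add: top_row_insert_tab ins_row_def)
  qed
qed

lemma mset_insert_tab: "mset (concat (insert_tab x T)) = add_mset x (mset (concat T))"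
proof (induction T arbitrary: x)
  case (Cons r rs)
  show ?case
  proof (cases "ins_pos x r = length r")
    case False
    then have "ins_pos x r < length r" using ins_pos_le[of x r] by simp
    then have "add_mset (r ! ins_pos x r) (mset (r[ins_pos x r := x])) = add_mset x (mset r)"
      by (simp add: mset_update)
    then show ?thesis using False Cons.IH[of "r ! ins_pos x r"]
      by (simp add: ins_row_def)
  qed (simp add: ins_row_def)
qed simp

definition add_box :: "nat \<Rightarrow> nat list \<Rightarrow> nat list" where
  "add_box i \<mu> = (if i < length \<mu> then \<mu>[i := Suc (\<mu> ! i)] else \<mu> @ [1])"

lemma add_box_neq_Nil [simp]: "add_box i \<mu> \<noteq> []"
  by (auto simp: add_box_def)

lemma shape_insert_tab: "map length (insert_tab x T) = add_box (insert_row x T) (map length T)"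
  by (induction T arbitrary: x)
     (auto simp: add_box_def length_ins_row Let_def)

lemma insert_row_le: "insert_row x T \<le> length T"
  by (induction T arbitrary: x) auto

text \<open>Successive insertions of a weakly increasing pair give bumping paths moving strictly to the right, hence ending weakly higher; for a descent the path ends strictly lower.\<close>

lemma row_bumping:
  assumes "tableau T"
  shows "(x \<le> y \<longrightarrow> insert_row y (insert_tab x T) \<le> insert_row x T) \<and>
    (y < x \<longrightarrow> insert_row x T < insert_row y (insert_tab x T))"
  using assms
proof (induction T arbitrary: x y)
  case Nil
  then show ?case by (auto simp: ins_pos_def)
next
  case (Cons r rs)
  have r: "sorted r" and rs: "tableau rs" using Cons.prems by auto
  let ?p = "ins_pos x r" and ?r = "ins_row x r"
  let ?q = "ins_pos y ?r"
  have p_r: "?p < length ?r" by (rule ins_pos_less_ins_row)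
  have r_p: "?r ! ?p = x" using nth_ins_row[OF p_r] by simp
  have sr: "sorted ?r" by (rule sorted_ins_row[OF r])
  have q_gt: "?p < ?q" if "x \<le> y"
  proof -
    have "?r ! j \<le> y" if "j < Suc ?p" for j
      using sorted_nth_mono[OF sr, of j ?p] p_r r_p that \<open>x \<le> y\<close> by simp
    then have "Suc ?p \<le> ?q" using p_r by (intro ins_pos_geI) auto
    then show ?thesis by simp
  qed
  have q_le: "?q \<le> ?p" if "y < x"
    by (rule ins_pos_leI[OF p_r]) (simp add: r_p that)
  show ?case
  proof (cases "?p = length r")
    case True
    then have len: "length ?r = Suc (length r)" by (simp add: length_ins_row)
    have "?q = length ?r" if "x \<le> y" using q_gt[OF that] True len ins_pos_le[of y ?r] by simp
    moreover have "?q \<noteq> length ?r" if "y < x" using q_le[OF that] True len by simp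
    ultimately show ?thesis using True by auto
  next
    case False
    then have pl: "?p < length r" using ins_pos_le[of x r] by simp
    have len: "length ?r = length r" using False by (simp add: length_ins_row)
    let ?z = "r ! ?p" and ?z' = "?r ! ?q"
    note IH = Cons.IH[OF rs, of ?z ?z']
    show ?thesis
    proof (intro conjI impI)
      assume xy: "x \<le> y"
      show "insert_row y (insert_tab x (r # rs)) \<le> insert_row x (r # rs)"
      proof (cases "?q = length ?r")
        case q: False
        then have ql: "?q < length ?r" using ins_pos_le[of y ?r] by simp
        have "?z' = r ! ?q" using nth_ins_row[OF ql] q_gt[OF xy] by simp
        then have "?z \<le> ?z'" using sorted_nth_mono[OF r, of ?p ?q] q_gt[OF xy] ql len by simp
        then show ?thesis using IH False q by simp
      qed simp
    next
      assume xy: "y < x"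
      have ql: "?q < length ?r" using q_le[OF xy] p_r by simp
      have "?z' \<le> x" using sorted_nth_mono[OF sr q_le[OF xy] p_r] r_p by simp
      also have "x < ?z" by (rule ins_pos_at[OF pl])
      finally show "insert_row x (r # rs) < insert_row y (insert_tab x (r # rs))"
        using IH False ql by simp
    qed
  qed
qed

text \<open>Reverse bumping is deterministic: the row where the insertion ended tells where to start it.\<close>

lemma insert_tab_inj:
  assumes "tableau T" "tableau S" "insert_tab x T = insert_tab y S" "insert_row x T = insert_row y S"
  shows "x = y \<and> T = S"
  using assms
proof (induction T arbitrary: S x y)
  case Nil
  show ?case
  proof (cases S)
    case (Cons s ss)
    then have "s \<noteq> []" "ins_pos y s = length s" using Nil by (auto split: if_splits)
    then show ?thesis using Nil Cons by (auto simp: ins_row_def)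
  qed (use Nil in auto)
next
  case (Cons r rs)
  have r: "sorted r" "r \<noteq> []" "tableau rs" using Cons.prems by auto
  show ?case
  proof (cases S)
    case Nil
    then have "ins_pos x r = length r" using Cons.prems by (auto split: if_splits)
    then show ?thesis using Nil Cons.prems r by (auto simp: ins_row_def)
  next
    case S: (Cons s ss)
    have s: "sorted s" "tableau ss" using Cons.prems S by auto
    let ?p = "ins_pos x r" and ?q = "ins_pos y s"
    have row: "ins_row x r = ins_row y s" using Cons.prems S by simp
    show ?thesis
    proof (cases "?p = length r")
      case True
      then have "?q = length s" using Cons.prems S by (auto split: if_splits)
      then show ?thesis using True Cons.prems S by (auto simp: ins_row_def)
    next
      case False
      then have q: "?q \<noteq> length s" using Cons.prems S by (auto split: if_splits)
      have pl: "?p < length r" and ql: "?q < length s" using False q ins_pos_le[of x r] ins_pos_le[of y s] by auto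
      have zs: "r ! ?p = s ! ?q \<and> rs = ss"
        using Cons.prems S False q r s by (intro Cons.IH) auto
      have upd: "r[?p := x] = s[?q := y]" using row False q by (simp add: ins_row_def)
      have len: "length r = length s" using arg_cong[OF upd, of length] by simp
      \<comment> \<open>The bumped letter \<open>z\<close> determines its position: it is the last one with a letter below \<open>z\<close>.\<close>
      have pos: "k \<le> ins_pos x' t \<longleftrightarrow> t[ins_pos x' t := x'] ! k < t ! ins_pos x' t"
        if t: "sorted t" "ins_pos x' t < length t" "k < length t" for t x' k
      proof (cases "k \<le> ins_pos x' t")
        case True
        have "t[ins_pos x' t := x'] ! k \<le> x'"
          using True t ins_pos_before[of k x' t] by (cases "k = ins_pos x' t") (auto simp: nth_list_update)
        then show ?thesis using True ins_pos_at[OF t(2)] by simp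
      next
        case False
        then have "t ! ins_pos x' t \<le> t ! k" using t by (intro sorted_nth_mono) auto
        then show ?thesis using False by (simp add: nth_list_update)
      qed
      have "k \<le> ?p \<longleftrightarrow> k \<le> ?q" if "k < length r" for k
        using pos[OF r(1) pl, of k] pos[OF s(1) ql, of k] that len zs upd by simp
      from this[of ?p] this[of ?q] have pq: "?p = ?q" using pl ql len by simp
      have "r = (r[?p := x])[?p := r ! ?p]" by simp
      also have "\<dots> = (s[?q := y])[?q := s ! ?q]" using upd pq zs by simp
      finally have "r = s" by simp
      moreover have "x = y" using arg_cong[OF upd, of "\<lambda>l. l ! ?p"] pl ql pq by simp
      ultimately show ?thesis using S zs by simp
    qed
  qed
qed

text \<open>Reverse bumping from an arbitrary removable corner, by recursion on its row.\<close>

lemma insert_tab_surj: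
  assumes "tableau T'" "map length T' = add_box i \<mu>" "i \<le> length \<mu>" "is_partition \<mu>"
  shows "\<exists>x T. tableau T \<and> map length T = \<mu> \<and> insert_tab x T = T' \<and> insert_row x T = i"
  using assms
proof (induction i arbitrary: T' \<mu>)
  case 0
  obtain r' rs' where T': "T' = r' # rs'" using 0 add_box_neq_Nil[of 0 \<mu>] by (cases T') auto
  have t: "r' \<noteq> []" "sorted r'" "below r' (top_row rs')" "tableau rs'" using 0 T' by auto
  show ?case
  proof (cases \<mu>)
    case Nil
    then have "length r' = 1" "rs' = []" using 0 T' by (auto simp: add_box_def)
    then obtain x where "T' = [[x]]" using T' by (auto simp: length_Suc_conv)
    then show ?thesis using Nil by (intro exI[of _ x] exI[of _ "[]"]) simp
  next
    case (Cons m ms)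
    have len: "length r' = Suc m" "map length rs' = ms" using 0 T' Cons by (auto simp: add_box_def)
    have m: "0 < m" "\<forall>k\<in>set ms. k \<le> m" using 0 Cons by (auto simp: is_partition_def)
    define x r where "x = last r'" and "r = butlast r'"
    have r': "r' = r @ [x]" using t by (simp add: x_def r_def)
    have "ins_pos x r = length r"
      using t(2) r' by (intro ins_pos_eqI) (auto simp: sorted_append)
    moreover have "length (top_row rs') \<le> m" using m(2) len(2) by (cases rs') (auto simp: top_row_def)
    then have "below r (top_row rs')" using t(3) len(1) r' by (auto simp: below_def nth_append)
    moreover have "r \<noteq> []" "sorted r" using len r' m t(2) by (auto simp: sorted_append)
    ultimately show ?thesis
      using T' r' t len Cons
      by (intro exI[of _ x] exI[of _ "r # rs'"]) (auto simp: ins_row_def)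
  qed
next
  case (Suc i)
  obtain m ms where \<mu>: "\<mu> = m # ms" using Suc.prems by (cases \<mu>) auto
  obtain r' rs' where T': "T' = r' # rs'" using Suc.prems(2) add_box_neq_Nil[of "Suc i" \<mu>] by (cases T') auto
  have t: "r' \<noteq> []" "sorted r'" "below r' (top_row rs')" "tableau rs'" using Suc.prems T' by auto
  have len: "length r' = m" "map length rs' = add_box i ms"
    using Suc.prems T' \<mu> by (auto simp: add_box_def split: if_splits)
  have "i \<le> length ms" "is_partition ms" using Suc.prems \<mu> by (auto simp: is_partition_def)
  from Suc.IH[OF t(4) len(2) this] obtain z T where
    T: "tableau T" "map length T = ms" "insert_tab z T = rs'" "insert_row z T = i" by blast
  have top: "top_row rs' = ins_row z (top_row T)" using top_row_insert_tab[of z T] T by simp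
  let ?s = "top_row T"
  let ?q = "ins_pos z ?s"
  have q: "?q < length r'" "r' ! ?q < z"
    using t(3) ins_pos_less_ins_row[of z ?s] nth_ins_row[OF ins_pos_less_ins_row, of z ?s]
    unfolding below_def top by (metis less_le_trans, metis)
  \<comment> \<open>The letter \<open>z\<close> was bumped from the last position of \<open>r'\<close> with a letter smaller than \<open>z\<close>.\<close>
  define p where "p = Max {j. j < length r' \<and> r' ! j < z}"
  have fin: "finite {j. j < length r' \<and> r' ! j < z}" by simp
  have "p \<in> {j. j < length r' \<and> r' ! j < z}" unfolding p_def by (rule Max_in) (use q in auto)
  then have p: "p < length r'" "r' ! p < z" by auto
  have p_max: "j \<le> p" if "j < length r'" "r' ! j < z" for j
    unfolding p_def by (rule Max_ge[OF fin]) (use that in simp)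
  define x r where "x = r' ! p" and "r = r'[p := z]"
  have qp: "?q \<le> p" by (rule p_max[OF q])
  have "ins_pos x r = p"
  proof (rule ins_pos_eqI)
    show "r ! j \<le> x" if "j < p" for j
      using that p sorted_nth_mono[OF t(2), of j p] by (simp add: r_def x_def)
  qed (use p in \<open>auto simp: r_def x_def\<close>)
  moreover have "sorted r"
    unfolding sorted_iff_nth_mono_less
  proof (intro allI impI)
    fix j k assume jk: "j < k" "k < length r"
    have "z \<le> r' ! k" if "p < k" using that p_max[of k] jk by (force simp: r_def)
    moreover have "r' ! j < z" if "k = p" using that jk p sorted_nth_mono[OF t(2), of j p] by simp
    ultimately show "r ! j \<le> r ! k"
      using jk p sorted_nth_mono[OF t(2), of j k] by (auto simp: r_def nth_list_update)
  qed
  moreover have "below r ?s"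
    unfolding below_def
  proof (intro conjI allI impI)
    have bel: "below r' (ins_row z ?s)" using t(3) top by simp
    show "length ?s \<le> length r" using bel by (auto simp: below_def r_def length_ins_row split: if_splits)
    fix j assume j: "j < length ?s"
    then have j': "j < length (ins_row z ?s)" by (simp add: length_ins_row)
    have sorted_s: "sorted ?s" using T(1) by (cases T) (auto simp: top_row_def)
    have less: "r' ! j < ins_row z ?s ! j" using bel j' by (simp add: below_def)
    have jr: "j < length r'" using bel j' by (simp add: below_def)
    show "r ! j < ?s ! j"
    proof (cases "j = p")
      case True
      then show ?thesis using ins_pos_after[OF sorted_s, of z j] qp j jr by (simp add: r_def)
    next
      case False
      have "r' ! j < ?s ! j"
        using less nth_ins_row[OF j'] ins_pos_at[of z ?s] j by (cases "j = ?q") auto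
      then show ?thesis using False by (simp add: r_def)
    qed
  qed
  moreover have "r \<noteq> []" "r ! p = z" "p \<noteq> length r" "r[p := x] = r'" "length r = m"
    using p len by (auto simp: r_def x_def)
  ultimately show ?case
    using T T' \<mu> by (intro exI[of _ x] exI[of _ "r # T"]) (simp add: ins_row_def)
qed

subsection \<open>Recording tableaux\<close>

text \<open>The recording word of \<open>w\<close> lists, letter by letter, the row in which the insertion ends; it
  encodes the usual recording tableau.\<close>

definition P_tab :: "nat list \<Rightarrow> nat list list" where
  "P_tab w = foldl (\<lambda>T x. insert_tab x T) [] w"

definition Q_word :: "nat list \<Rightarrow> nat list" where
  "Q_word w = map (\<lambda>k. insert_row (w ! k) (P_tab (take k w))) [0..<length w]"

definition Q_shape :: "nat list \<Rightarrow> nat list" where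
  "Q_shape Q = foldl (\<lambda>\<mu> i. add_box i \<mu>) [] Q"

lemma P_tab_snoc [simp]: "P_tab [] = []" "P_tab (w @ [x]) = insert_tab x (P_tab w)"
  by (simp_all add: P_tab_def)

lemma Q_word_snoc [simp]: "Q_word [] = []" "Q_word (w @ [x]) = Q_word w @ [insert_row x (P_tab w)]"
  by (auto simp: Q_word_def nth_append)

lemma Q_shape_snoc [simp]: "Q_shape [] = []" "Q_shape (Q @ [i]) = add_box i (Q_shape Q)"
  by (simp_all add: Q_shape_def)

lemma length_Q_word [simp]: "length (Q_word w) = length w"
  by (simp add: Q_word_def)

lemma tableau_P_tab: "tableau (P_tab w)"
  by (induction w rule: rev_induct) (simp_all add: tableau_insert)

lemma mset_P_tab: "mset (concat (P_tab w)) = mset w"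
  by (induction w rule: rev_induct) (simp_all add: mset_insert_tab)

lemma shape_P_tab: "map length (P_tab w) = Q_shape (Q_word w)"
  by (induction w rule: rev_induct) (simp_all add: shape_insert_tab)

lemma is_partition_shape: "tableau T \<Longrightarrow> is_partition (map length T)"
proof (induction T)
  case (Cons r rs)
  then have IH: "is_partition (map length rs)" by simp
  have "length s \<le> length r" if s: "s \<in> set rs" for s
  proof -
    obtain s0 ss where rs: "rs = s0 # ss" using s by (cases rs) auto
    have "length s0 \<le> length r" using Cons.prems rs by (simp add: below_def top_row_def)
    moreover have "length s \<le> length s0" using IH s by (auto simp: rs is_partition_def)
    ultimately show ?thesis by simp
  qed
  then show ?case using IH Cons.prems by (auto simp: is_partition_def)
qed (simp add: is_partition_def)

lemma set_Q_word: "set (Q_word w) \<subseteq> {..length w}"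
proof (induction w rule: rev_induct)
  case (snoc x w)
  have "length (P_tab v) \<le> length v" for v
  proof (induction v rule: rev_induct)
    case (snoc y v)
    have "length (insert_tab y T) \<le> Suc (length T)" for T
      by (induction T arbitrary: y) auto
    then show ?case using snoc le_trans by fastforce
  qed simp
  then have "insert_row x (P_tab w) \<le> length w" using insert_row_le le_trans by blast
  then show ?case using snoc by auto
qed simp

lemma word_des_snoc: "word_des (w @ [x]) = word_des w \<union> (if w \<noteq> [] \<and> last w > x then {length w} else {})"
proof -
  have "word_des [x] = {}" by (auto simp: word_des_def)
  then show ?thesis unfolding word_des_append by simp
qed

text \<open>By the row bumping lemma, a descent of the word is an ascent of the recording word; so the descents are determined by the recording word.\<close>

lemma word_des_Q_word: "word_des w = {i. 1 \<le> i \<and> i < length w \<and> Q_word w ! (i - 1) < Q_word w ! i}"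
proof (induction w rule: rev_induct)
  case Nil
  show ?case by (simp add: word_des_def)
next
  case (snoc x w)
  have old: "Q_word (w @ [x]) ! i = Q_word w ! i" if "i < length w" for i
    using that by (simp add: nth_append)
  have new: "Q_word (w @ [x]) ! length w = insert_row x (P_tab w)"
    by (simp add: nth_append)
  have last: "last w > x \<longleftrightarrow> Q_word w ! (length w - 1) < insert_row x (P_tab w)" if w0: "w \<noteq> []"
  proof -
    obtain v y where w: "w = v @ [y]" using w0 by (cases w rule: rev_cases) auto
    have 1: "Q_word w ! (length w - 1) = insert_row y (P_tab v)" by (simp add: w nth_append)
    have 2: "P_tab w = insert_tab y (P_tab v)" "last w = y" by (simp_all add: w)
    show ?thesis unfolding 1 2 using row_bumping[OF tableau_P_tab, of y x v] by (meson not_le)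
  qed
  have "i \<in> word_des (w @ [x]) \<longleftrightarrow> 1 \<le> i \<and> i < length (w @ [x]) \<and> Q_word (w @ [x]) ! (i - 1) < Q_word (w @ [x]) ! i" for i
  proof -
    consider "i < length w" | "i = length w" | "length w < i" by linarith
    then show ?thesis
    proof cases
      case 1
      have "i \<in> word_des w \<longleftrightarrow> 1 \<le> i \<and> Q_word w ! (i - 1) < Q_word w ! i"
        by (subst snoc.IH) (use 1 in simp)
      moreover have "Q_word (w @ [x]) ! i = Q_word w ! i" "Q_word (w @ [x]) ! (i - 1) = Q_word w ! (i - 1)"
        by (intro old; use 1 in simp)+
      ultimately show ?thesis unfolding word_des_snoc using 1 by simp
    next
      case 2
      then have "i \<notin> word_des w" by (simp add: word_des_def)
      show ?thesis
      proof (cases "w = []")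
        case True
        then show ?thesis using 2 \<open>i \<notin> word_des w\<close> unfolding word_des_snoc by simp
      next
        case False
        then have "Q_word (w @ [x]) ! (i - 1) = Q_word w ! (length w - 1)" using 2 by (subst old) auto
        moreover have "Q_word (w @ [x]) ! i = insert_row x (P_tab w)" using new 2 by simp
        moreover have "1 \<le> i" using 2 False by (simp add: Suc_le_eq)
        ultimately show ?thesis unfolding word_des_snoc using 2 False last[OF False] \<open>i \<notin> word_des w\<close> by simp
      qed
    next
      case 3
      then have "i \<notin> word_des w" by (simp add: word_des_def)
      then show ?thesis unfolding word_des_snoc using 3 by auto
    qed
  qed
  then show ?case by blast
qed

lemma rsk_inj: "P_tab w = P_tab w' \<Longrightarrow> Q_word w = Q_word w' \<Longrightarrow> w = w'"
proof (induction w arbitrary: w' rule: rev_induct)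
  case Nil
  then show ?case using length_Q_word[of w'] by simp
next
  case (snoc x w)
  have "length w' = Suc (length w)" using snoc.prems(2) length_Q_word by (metis length_append_singleton)
  then obtain v y where w': "w' = v @ [y]" by (cases w' rule: rev_cases) auto
  have "Q_word w = Q_word v" "insert_row x (P_tab w) = insert_row y (P_tab v)"
    "insert_tab x (P_tab w) = insert_tab y (P_tab v)" using snoc.prems w' by auto
  then show ?case
    using insert_tab_inj[OF tableau_P_tab tableau_P_tab] snoc.IH w' by metis
qed

lemma rsk_surj:
  "tableau T \<Longrightarrow> map length T = Q_shape (Q_word w) \<Longrightarrow> \<exists>w'. P_tab w' = T \<and> Q_word w' = Q_word w"
proof (induction w arbitrary: T rule: rev_induct)
  case (snoc x w)
  have part: "is_partition (Q_shape (Q_word w))"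
    using is_partition_shape[OF tableau_P_tab, of w] by (simp add: shape_P_tab)
  have "insert_row x (P_tab w) \<le> length (Q_shape (Q_word w))"
    using insert_row_le[of x "P_tab w"] by (metis shape_P_tab length_map)
  then obtain y S where S: "tableau S" "map length S = Q_shape (Q_word w)" "insert_tab y S = T"
    "insert_row y S = insert_row x (P_tab w)"
    using insert_tab_surj[OF snoc.prems(1) _ _ part] snoc.prems(2) by (metis Q_shape_snoc(2) Q_word_snoc(2))
  from snoc.IH[OF S(1,2)] obtain v where "P_tab v = S" "Q_word v = Q_word w" by blast
  then show ?case using S by (intro exI[of _ "v @ [y]"]) simp
qed (auto intro: exI[of _ "[]"])

subsection \<open>Ribbon Schur functions are Schur positive\<close>

lemma tableau_iff_ssyt:
  assumes "is_partition \<mu>"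
  shows "T \<in> ssyt \<mu> \<longleftrightarrow> tableau T \<and> map length T = \<mu>"
proof -
  have "(\<forall>row\<in>set T. sorted row) \<and>
      (\<forall>i j. i + 1 < length T \<longrightarrow> j < length (T ! (i + 1)) \<longrightarrow> T ! i ! j < T ! (i + 1) ! j) \<longleftrightarrow> tableau T"
    if "is_partition (map length T)"
    using that
  proof (induction T)
    case (Cons r rs)
    have part: "is_partition (map length rs)" using Cons.prems by (simp add: is_partition_def)
    have r: "r \<noteq> []" "length (top_row rs) \<le> length r"
      using Cons.prems by (cases rs; auto simp: is_partition_def top_row_def)+
    have "(\<forall>i j. i + 1 < length (r # rs) \<longrightarrow> j < length ((r # rs) ! (i + 1)) \<longrightarrow> (r # rs) ! i ! j < (r # rs) ! (i + 1) ! j)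
      \<longleftrightarrow> (\<forall>j<length (top_row rs). r ! j < top_row rs ! j) \<and>
        (\<forall>i j. i + 1 < length rs \<longrightarrow> j < length (rs ! (i + 1)) \<longrightarrow> rs ! i ! j < rs ! (i + 1) ! j)" (is "?L \<longleftrightarrow> ?R")
    proof
      assume L: ?L
      show ?R
      proof (intro conjI allI impI)
        fix j assume "j < length (top_row rs)"
        then show "r ! j < top_row rs ! j"
          using L[rule_format, of 0 j] by (cases rs) (auto simp: top_row_def)
      next
        fix i j assume "i + 1 < length rs" "j < length (rs ! (i + 1))"
        then show "rs ! i ! j < rs ! (i + 1) ! j" using L[rule_format, of "Suc i" j] by simp
      qed
    next
      assume R: ?R
      show ?L
      proof (intro allI impI)
        fix i j assume ij: "i + 1 < length (r # rs)" "j < length ((r # rs) ! (i + 1))"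
        show "(r # rs) ! i ! j < (r # rs) ! (i + 1) ! j"
        proof (cases i)
          case 0
          then show ?thesis using R ij by (cases rs) (auto simp: top_row_def)
        next
          case (Suc k)
          then show ?thesis using R ij by simp
        qed
      qed
    qed
    then show ?case using Cons.IH[OF part] r by (auto simp: below_def)
  qed simp
  then show ?thesis using assms by (auto simp: ssyt_def)
qed

lemma mcoeff_schur: "mcoeff (schur \<mu> :: 'a::comm_ring_1 mseries) M = of_nat (card {T \<in> ssyt \<mu>. mset (concat T) = M})"
  by (simp add: schur_def)

text \<open>RSK matches the words of content \<open>M\<close> and descent set \<open>D(\<gamma>)\<close> with pairs of a recording word having
  the right ascents and a semistandard tableau of its shape and of content \<open>M\<close>.\<close>

lemma ribbon_schur_expansion:
  assumes \<gamma>: "is_composition n \<gamma>" "1 \<le> n"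
  shows "(ribbon \<gamma> :: 'a::comm_ring_1 mseries) = (\<Sum>Q\<in>Q_word ` {w. length w = n \<and> word_des w = cut_set \<gamma>}. schur (Q_shape Q))"
proof (rule mseries_eqI)
  fix M
  define QS where "QS = Q_word ` {w. length w = n \<and> word_des w = cut_set \<gamma>}"
  define S where "S Q = {T \<in> ssyt (Q_shape Q). mset (concat T) = M}" for Q
  have finQ: "finite QS"
  proof (rule finite_subset)
    show "QS \<subseteq> {Q. set Q \<subseteq> {..n} \<and> length Q = n}" using set_Q_word by (auto simp: QS_def)
  qed (simp add: finite_lists_length_eq)
  have part: "is_partition (Q_shape (Q_word w))" for w
    using is_partition_shape[OF tableau_P_tab, of w] by (simp add: shape_P_tab)
  have bij: "bij_betw (\<lambda>w. (Q_word w, P_tab w)) {w \<in> words n M. word_des w = cut_set \<gamma>} (SIGMA Q:QS. S Q)"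
  proof (rule bij_betw_imageI)
    show "inj_on (\<lambda>w. (Q_word w, P_tab w)) {w \<in> words n M. word_des w = cut_set \<gamma>}"
      by (rule inj_onI) (use rsk_inj in auto)
    show "(\<lambda>w. (Q_word w, P_tab w)) ` {w \<in> words n M. word_des w = cut_set \<gamma>} = (SIGMA Q:QS. S Q)"
    proof (intro equalityI subsetI)
      fix p assume "p \<in> (\<lambda>w. (Q_word w, P_tab w)) ` {w \<in> words n M. word_des w = cut_set \<gamma>}"
      then obtain w where w: "w \<in> words n M" "word_des w = cut_set \<gamma>" "p = (Q_word w, P_tab w)" by auto
      have "P_tab w \<in> S (Q_word w)"
        using w(1) by (simp add: S_def tableau_iff_ssyt[OF part] tableau_P_tab shape_P_tab mset_P_tab words_def)
      moreover have "Q_word w \<in> QS" using w by (auto simp: QS_def words_def)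
      ultimately show "p \<in> (SIGMA Q:QS. S Q)" using w by simp
    next
      fix p assume "p \<in> (SIGMA Q:QS. S Q)"
      then obtain w T where w: "length w = n" "word_des w = cut_set \<gamma>" and p: "p = (Q_word w, T)"
        and T: "T \<in> S (Q_word w)" by (auto simp: QS_def)
      have "tableau T" "map length T = Q_shape (Q_word w)" "mset (concat T) = M"
        using T by (auto simp: S_def tableau_iff_ssyt[OF part])
      then obtain w' where w': "P_tab w' = T" "Q_word w' = Q_word w" using rsk_surj by blast
      have "length w' = n" using w'(2) w(1) length_Q_word by metis
      moreover have "word_des w' = cut_set \<gamma>"
        using w(2) w'(2) \<open>length w' = n\<close> w(1) unfolding word_des_Q_word by simp
      moreover have "mset w' = M" using mset_P_tab[of w'] w'(1) \<open>mset (concat T) = M\<close> by simp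
      ultimately show "p \<in> (\<lambda>w. (Q_word w, P_tab w)) ` {w \<in> words n M. word_des w = cut_set \<gamma>}"
        using p w' by (intro image_eqI[of _ _ w']) (auto simp: words_def)
    qed
  qed
  have finS: "finite (S Q)" if "Q \<in> QS" for Q
  proof -
    have "finite ((\<lambda>w. (Q_word w, P_tab w)) ` {w \<in> words n M. word_des w = cut_set \<gamma>})"
      using finite_words by (intro finite_imageI) simp
    then have "finite (SIGMA Q:QS. S Q)" unfolding bij_betw_imp_surj_on[OF bij] .
    moreover have "S Q \<subseteq> snd ` (SIGMA Q:QS. S Q)" using that by force
    ultimately show ?thesis by (metis finite_imageI finite_subset)
  qed
  have "card {w \<in> words n M. word_des w = cut_set \<gamma>} = (\<Sum>Q\<in>QS. card (S Q))"
    unfolding bij_betw_same_card[OF bij] by (rule card_SigmaI[OF finQ]) (use finS in blast)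
  then show "mcoeff (ribbon \<gamma> :: 'a mseries) M
      = mcoeff (\<Sum>Q\<in>Q_word ` {w. length w = n \<and> word_des w = cut_set \<gamma>}. schur (Q_shape Q)) M"
    unfolding mcoeff_ribbon[OF \<gamma>] QS_def[symmetric] mcoeff_sum mcoeff_schur S_def by simp
qed

lemma schur_positive_0: "schur_positive 0"
  unfolding schur_positive_def by (intro exI[of _ "{}"]) simp

lemma schur_positive_schur: "is_partition \<mu> \<Longrightarrow> schur_positive (schur \<mu>)"
  unfolding schur_positive_def by (intro exI[of _ "{\<mu>}"] exI[of _ "\<lambda>_. 1"]) simp

lemma schur_positive_add:
  assumes "schur_positive f" "schur_positive g"
  shows "schur_positive (f + g)"
proof -
  obtain P c where P: "finite P" "\<forall>\<mu>\<in>P. is_partition \<mu>" "f = (\<Sum>\<mu>\<in>P. of_nat (c \<mu>) * schur \<mu>)"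
    using assms(1) by (auto simp: schur_positive_def)
  obtain R d where R: "finite R" "\<forall>\<mu>\<in>R. is_partition \<mu>" "g = (\<Sum>\<mu>\<in>R. of_nat (d \<mu>) * schur \<mu>)"
    using assms(2) by (auto simp: schur_positive_def)
  let ?e = "\<lambda>\<mu>. (if \<mu> \<in> P then c \<mu> else 0) + (if \<mu> \<in> R then d \<mu> else 0)"
  have "f = (\<Sum>\<mu>\<in>P \<union> R. of_nat (if \<mu> \<in> P then c \<mu> else 0) * schur \<mu>)"
    unfolding P(3) using P(1) R(1) by (intro sum.mono_neutral_cong_left) auto
  moreover have "g = (\<Sum>\<mu>\<in>P \<union> R. of_nat (if \<mu> \<in> R then d \<mu> else 0) * schur \<mu>)"
    unfolding R(3) using P(1) R(1) by (intro sum.mono_neutral_cong_left) auto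
  ultimately have "f + g = (\<Sum>\<mu>\<in>P \<union> R. of_nat (?e \<mu>) * schur \<mu>)"
    by (simp add: sum.distrib distrib_right)
  then show ?thesis unfolding schur_positive_def
    using P R by (intro exI[of _ "P \<union> R"] exI[of _ ?e]) auto
qed

lemma schur_positive_sum: "(\<And>i. i \<in> I \<Longrightarrow> schur_positive (f i)) \<Longrightarrow> schur_positive (\<Sum>i\<in>I. f i)"
  by (induction I rule: infinite_finite_induct) (auto simp: schur_positive_0 schur_positive_add)

lemma schur_positive_ribbon:
  assumes "is_composition n \<gamma>" "1 \<le> n"
  shows "schur_positive (ribbon \<gamma> :: 'a::comm_ring_1 mseries)"
  unfolding ribbon_schur_expansion[OF assms]
proof (intro schur_positive_sum schur_positive_schur)
  fix Q assume "Q \<in> Q_word ` {w. length w = n \<and> word_des w = cut_set \<gamma>}"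
  then show "is_partition (Q_shape Q)"
    using is_partition_shape[OF tableau_P_tab] by (auto simp: shape_P_tab)
qed

section \<open>Acyclicity of the ribbon complex below the top degree\<close>

type_synonym 'k chain = "nat set list \<Rightarrow> 'k"

subsection \<open>Finitely supported vectors\<close>

text \<open>Linear extensions are additive on finitely supported vectors only; a single carrier for all maps
  avoids tracking the degrees.\<close>

definition fin_supp :: "('x \<Rightarrow> 'k::field) set" where
  "fin_supp = {v. finite {x. v x \<noteq> 0}}"

lemma subspace_fin_supp: "fspace.subspace (fin_supp :: ('x \<Rightarrow> 'k::field) set)"
proof (rule fspace.subspaceI)
  show "0 \<in> (fin_supp :: ('x \<Rightarrow> 'k) set)" by (simp add: fin_supp_def)
next
  fix u v :: "'x \<Rightarrow> 'k" assume "u \<in> fin_supp" "v \<in> fin_supp"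
  then have fin: "finite ({x. u x \<noteq> 0} \<union> {x. v x \<noteq> 0})" by (simp add: fin_supp_def)
  have "{x. (u + v) x \<noteq> 0} \<subseteq> {x. u x \<noteq> 0} \<union> {x. v x \<noteq> 0}" by auto
  from finite_subset[OF this fin] show "u + v \<in> fin_supp" by (simp only: fin_supp_def mem_Collect_eq)
next
  fix c and v :: "'x \<Rightarrow> 'k" assume "v \<in> fin_supp"
  then have fin: "finite {x. v x \<noteq> 0}" by (simp add: fin_supp_def)
  have "{x. scale c v x \<noteq> 0} \<subseteq> {x. v x \<noteq> 0}" by auto
  from finite_subset[OF this fin] show "scale c v \<in> fin_supp" by (simp only: fin_supp_def mem_Collect_eq)
qed

lemma fin_supp_intros [intro, simp]:
  "single x \<in> fin_supp" "0 \<in> fin_supp"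
  "u \<in> fin_supp \<Longrightarrow> v \<in> fin_supp \<Longrightarrow> u + v \<in> fin_supp"
  "u \<in> fin_supp \<Longrightarrow> v \<in> fin_supp \<Longrightarrow> u - v \<in> fin_supp"
  "u \<in> fin_supp \<Longrightarrow> - u \<in> fin_supp"
  "u \<in> fin_supp \<Longrightarrow> scale c u \<in> fin_supp"
  by (simp add: fin_supp_def,
      rule fspace.subspace_0[OF subspace_fin_supp],
      erule (1) fspace.subspace_add[OF subspace_fin_supp],
      erule (1) fspace.subspace_diff[OF subspace_fin_supp],
      erule fspace.subspace_neg[OF subspace_fin_supp],
      erule fspace.subspace_scale[OF subspace_fin_supp])

lemma fin_supp_free: "finite X \<Longrightarrow> v \<in> free X \<Longrightarrow> v \<in> fin_supp"
  by (auto simp: fin_supp_def free_def intro: finite_subset)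

lemma fin_supp_lin_ext: "(\<And>x. \<phi> x \<in> fin_supp) \<Longrightarrow> lin_ext \<phi> v \<in> fin_supp"
  unfolding lin_ext_def by (rule fspace.subspace_sum[OF subspace_fin_supp]) simp

lemma linear_lin_ext_fin: "linear_on_space fin_supp (lin_ext \<phi> :: ('x \<Rightarrow> 'k::field) \<Rightarrow> ('y \<Rightarrow> 'k))"
  unfolding linear_on_space_def
proof (intro conjI ballI allI)
  fix u v :: "'x \<Rightarrow> 'k" assume uv: "u \<in> fin_supp" "v \<in> fin_supp"
  let ?X = "{x. u x \<noteq> 0} \<union> {x. v x \<noteq> 0}"
  have fin: "finite ?X" using uv by (simp add: fin_supp_def)
  have "u \<in> free ?X" "v \<in> free ?X" by (auto simp: free_def)
  then show "lin_ext \<phi> (u + v) = lin_ext \<phi> u + lin_ext \<phi> v"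
    by (rule linear_on_space_add[OF linear_lin_ext[OF fin]])
next
  fix c and v :: "'x \<Rightarrow> 'k" assume v: "v \<in> fin_supp"
  let ?X = "{x. v x \<noteq> 0}"
  have fin: "finite ?X" using v by (simp add: fin_supp_def)
  have "v \<in> free ?X" by (auto simp: free_def)
  then show "lin_ext \<phi> (scale c v) = scale c (lin_ext \<phi> v)"
    by (rule linear_on_space_scale[OF linear_lin_ext[OF fin]])
qed

lemma lin_ext_0 [simp]: "lin_ext \<phi> 0 = 0"
  by (simp add: lin_ext_def)

lemma lin_ext_add: "u \<in> fin_supp \<Longrightarrow> v \<in> fin_supp \<Longrightarrow> lin_ext \<phi> (u + v) = lin_ext \<phi> u + lin_ext \<phi> v"
  by (rule linear_on_space_add[OF linear_lin_ext_fin])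

lemma lin_ext_diff: "u \<in> fin_supp \<Longrightarrow> v \<in> fin_supp \<Longrightarrow> lin_ext \<phi> (u - v) = lin_ext \<phi> u - lin_ext \<phi> v"
  by (rule linear_on_space_diff[OF linear_lin_ext_fin subspace_fin_supp])

lemma lin_ext_uminus: "v \<in> fin_supp \<Longrightarrow> lin_ext \<phi> (- v) = - lin_ext \<phi> v"
  using lin_ext_diff[of 0 v \<phi>] by simp

lemma lin_ext_cong: "(\<And>x. v x \<noteq> 0 \<Longrightarrow> \<phi> x = \<psi> x) \<Longrightarrow> lin_ext \<phi> v = lin_ext \<psi> v"
  unfolding lin_ext_def by (rule sum.cong) auto

lemma lin_ext_cong_free: "v \<in> free X \<Longrightarrow> (\<And>x. x \<in> X \<Longrightarrow> \<phi> x = \<psi> x) \<Longrightarrow> lin_ext \<phi> v = lin_ext \<psi> v"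
  by (rule lin_ext_cong) (auto simp: free_def)

lemma lin_ext_comp:
  fixes \<psi> :: "'y \<Rightarrow> 'z \<Rightarrow> 'k::field"
  assumes "\<And>x. \<phi> x \<in> fin_supp"
  shows "lin_ext \<psi> (lin_ext \<phi> v) = lin_ext (\<lambda>x. lin_ext \<psi> (\<phi> x)) v"
  unfolding lin_ext_def[of \<phi>] lin_ext_def[of "\<lambda>x. lin_ext \<psi> (\<phi> x)"]
  by (rule linear_on_space_sum_scale[OF linear_lin_ext_fin subspace_fin_supp]) (rule assms)

lemma lin_ext_fun_add: "lin_ext (\<lambda>x. \<phi> x + \<psi> x) v = lin_ext \<phi> v + lin_ext \<psi> (v :: 'x \<Rightarrow> 'k::field)"
  by (simp add: lin_ext_def fspace.scale_right_distrib sum.distrib)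

lemma lin_ext_fun_diff: "lin_ext (\<lambda>x. \<phi> x - \<psi> x) v = lin_ext \<phi> v - lin_ext \<psi> (v :: 'x \<Rightarrow> 'k::field)"
  by (simp add: lin_ext_def fspace.scale_right_diff_distrib sum_subtractf)

lemma lin_ext_fun_uminus: "lin_ext (\<lambda>x. - \<phi> x) v = - lin_ext \<phi> (v :: 'x \<Rightarrow> 'k::field)"
  by (simp add: lin_ext_def sum_negf)

lemma lin_ext_fun_0: "lin_ext (\<lambda>x. 0) v = (0 :: 'y \<Rightarrow> 'k::field)"
  by (simp add: lin_ext_def)

lemma lin_ext_id: "v \<in> fin_supp \<Longrightarrow> lin_ext single v = v"
  using free_expand[of "{x. v x \<noteq> 0}" v] by (simp add: lin_ext_def fin_supp_def free_def)

lemma lin_ext_in_free: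
  assumes "v \<in> free X" "\<And>x. x \<in> X \<Longrightarrow> \<phi> x \<in> free Y"
  shows "lin_ext \<phi> v \<in> (free Y :: ('y \<Rightarrow> 'k::field) set)"
  unfolding lin_ext_def using assms
  by (intro fspace.subspace_sum fspace.subspace_scale subspace_free) (auto simp: free_def)

lemma free_mono: "v \<in> free X \<Longrightarrow> X \<subseteq> Y \<Longrightarrow> v \<in> free Y"
  by (auto simp: free_def)

lemma free_add: "u \<in> free X \<Longrightarrow> v \<in> free X \<Longrightarrow> u + v \<in> (free X :: ('x \<Rightarrow> 'k::field) set)"
  by (rule fspace.subspace_add[OF subspace_free])

lemma free_diff: "u \<in> free X \<Longrightarrow> v \<in> free X \<Longrightarrow> u - v \<in> (free X :: ('x \<Rightarrow> 'k::field) set)"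
  by (rule fspace.subspace_diff[OF subspace_free])

lemma free_uminus: "u \<in> free X \<Longrightarrow> - u \<in> (free X :: ('x \<Rightarrow> 'k::field) set)"
  by (rule fspace.subspace_neg[OF subspace_free])

lemma free_0: "0 \<in> free X"
  by (simp add: free_def)

subsection \<open>The boundary of a list of blocks\<close>

definition bdry :: "nat set list \<Rightarrow> nat set list \<Rightarrow> 'k::field" where
  "bdry Bs = (\<Sum>i = 1..<length Bs. scale ((- 1) ^ (i - 1)) (single (merge_blocks i Bs)))"

lemma rib_diff_eq: "rib_diff = lin_ext bdry"
  by (simp add: rib_diff_def bdry_def[abs_def])

text \<open>Prepending a block, linearly extended.\<close>

definition cons_map :: "nat set \<Rightarrow> (nat set list \<Rightarrow> 'k::field) \<Rightarrow> nat set list \<Rightarrow> 'k" where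
  "cons_map B = lin_ext (\<lambda>Bs. single (B # Bs))"

text \<open>Merging \<open>B\<close> into the first block; on the empty list the value is irrelevant, as it is only applied to nonempty lists.\<close>

definition merge_map :: "nat set \<Rightarrow> (nat set list \<Rightarrow> 'k::field) \<Rightarrow> nat set list \<Rightarrow> 'k" where
  "merge_map B = lin_ext (\<lambda>Bs. single ((B \<union> hd Bs) # tl Bs))"

lemma fin_supp_bdry [simp]: "bdry Bs \<in> fin_supp"
  unfolding bdry_def by (intro fspace.subspace_sum[OF subspace_fin_supp]) simp

lemma fin_supp_maps [simp]: "cons_map B v \<in> fin_supp" "merge_map B v \<in> fin_supp" "rib_diff v \<in> fin_supp"
  unfolding cons_map_def merge_map_def rib_diff_eq by (intro fin_supp_lin_ext; simp)+

lemma cons_map_single [simp]: "cons_map B (single Bs) = single (B # Bs)"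
  by (simp add: cons_map_def)

lemma merge_map_single [simp]: "merge_map B (single (C # Cs)) = single ((B \<union> C) # Cs)"
  by (simp add: merge_map_def)

lemma rib_diff_single [simp]: "rib_diff (single Bs) = bdry Bs"
  by (simp add: rib_diff_eq)

lemma bdry_short: "bdry [] = 0" "bdry [B] = 0"
  unfolding bdry_def by (rule sum.neutral, simp)+

declare bdry_short [simp]

text \<open>The recursion for the boundary: the first face merges \<open>B\<close> and \<open>C\<close>, and the other faces are those of
  the tail with the opposite sign.\<close>

lemma bdry_Cons: "bdry (B # C # Cs) = single ((B \<union> C) # Cs) - cons_map B (bdry (C # Cs) :: ('k::field) chain)"
proof -
  let ?n = "length (C # Cs)"
  let ?t = "\<lambda>i. scale ((- 1) ^ (i - 1)) (single (merge_blocks i (B # C # Cs))) :: nat set list \<Rightarrow> 'k"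
  have set: "{1..<length (B # C # Cs)} = insert 1 (Suc ` {1..<?n})" by (auto simp: image_Suc_atLeastLessThan)
  have "bdry (B # C # Cs) = ?t 1 + (\<Sum>i\<in>Suc ` {1..<?n}. ?t i)"
    unfolding bdry_def set by (rule sum.insert) auto
  also have "(\<Sum>i\<in>Suc ` {1..<?n}. ?t i) = (\<Sum>i = 1..<?n. ?t (Suc i))"
    by (rule sum.reindex_cong[of Suc]) simp_all
  also have "\<dots> = (\<Sum>i = 1..<?n. scale (- 1) (scale ((- 1) ^ (i - 1)) (cons_map B (single (merge_blocks i (C # Cs))))))"
  proof (rule sum.cong[OF refl])
    fix i assume "i \<in> {1..<?n}"
    then obtain j where "i = Suc j" by (cases i) auto
    then show "?t (Suc i) = scale (- 1) (scale ((- 1) ^ (i - 1)) (cons_map B (single (merge_blocks i (C # Cs)))))"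
      by (simp add: merge_blocks_def)
  qed
  also have "\<dots> = scale (- 1) (\<Sum>i = 1..<?n. scale ((- 1) ^ (i - 1)) (cons_map B (single (merge_blocks i (C # Cs)))))"
    by (rule fspace.scale_sum_right[symmetric])
  also have "(\<Sum>i = 1..<?n. scale ((- 1) ^ (i - 1)) (cons_map B (single (merge_blocks i (C # Cs)))))
      = cons_map B (bdry (C # Cs))"
    unfolding bdry_def cons_map_def
    by (rule linear_on_space_sum_scale[OF linear_lin_ext_fin subspace_fin_supp, symmetric]) simp
  finally show ?thesis by (intro ext) (simp add: merge_blocks_def)
qed

text \<open>The linear form of the recursion for the boundary; it turns signs and face indices into an identity between three operators.\<close>

lemma rib_diff_cons_map:
  assumes "v \<in> free {Bs. Bs \<noteq> []}"
  shows "rib_diff (cons_map B v) = merge_map B v - cons_map B (rib_diff v :: ('k::field) chain)"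
proof -
  have "rib_diff (cons_map B v) = lin_ext (\<lambda>Bs. bdry (B # Bs)) v"
    unfolding rib_diff_eq cons_map_def by (subst lin_ext_comp) simp_all
  also have "\<dots> = lin_ext (\<lambda>Bs. single ((B \<union> hd Bs) # tl Bs) - cons_map B (bdry Bs)) v"
  proof (rule lin_ext_cong_free[OF assms])
    fix Bs :: "nat set list" assume "Bs \<in> {Bs. Bs \<noteq> []}"
    then obtain C Cs where "Bs = C # Cs" by (cases Bs) auto
    then show "(bdry (B # Bs) :: 'k chain) = single ((B \<union> hd Bs) # tl Bs) - cons_map B (bdry Bs)"
      by (simp add: bdry_Cons)
  qed
  also have "\<dots> = merge_map B v - lin_ext (\<lambda>Bs. cons_map B (bdry Bs)) v"
    by (simp add: lin_ext_fun_diff merge_map_def)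
  also have "lin_ext (\<lambda>Bs. cons_map B (bdry Bs)) v = cons_map B (rib_diff v)"
    unfolding rib_diff_eq cons_map_def by (subst lin_ext_comp) simp_all
  finally show ?thesis .
qed

lemma bdry_nonempty: "bdry Bs \<in> free {Cs. Cs \<noteq> []}"
  unfolding bdry_def
  by (intro fspace.subspace_sum[OF subspace_free] fspace.subspace_scale[OF subspace_free] single_in_free)
     (simp add: merge_blocks_def)

lemma merge_map_cons_map: "merge_map B (cons_map C v) = cons_map (B \<union> C) (v :: ('k::field) chain)"
  unfolding merge_map_def cons_map_def by (subst lin_ext_comp) simp_all

lemma merge_map_bdry: "merge_map B (bdry (C # Cs)) = (bdry ((B \<union> C) # Cs) :: ('k::field) chain)"
proof (cases Cs)
  case Nil
  then show ?thesis by (simp add: merge_map_def)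
next
  case (Cons D Ds)
  have "merge_map B (bdry (C # D # Ds)) = merge_map B (single ((C \<union> D) # Ds)) - merge_map B (cons_map C (bdry (D # Ds)) :: 'k chain)"
    unfolding bdry_Cons[of C] by (subst merge_map_def, subst lin_ext_diff) (simp_all add: merge_map_def)
  also have "\<dots> = bdry ((B \<union> C) # D # Ds)"
    unfolding bdry_Cons[of "B \<union> C"] merge_map_cons_map by (simp add: Un_assoc)
  finally show ?thesis using Cons by simp
qed

lemma rib_diff_bdry: "rib_diff (bdry Bs) = (0 :: ('k::field) chain)"
proof (induction Bs)
  case Nil
  show ?case unfolding rib_diff_eq bdry_short lin_ext_0 ..
next
  case (Cons B Bs)
  show ?case
  proof (cases Bs)
    case Nil
    show ?thesis unfolding Nil rib_diff_eq bdry_short lin_ext_0 ..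
  next
    case C: (Cons C Cs)
    have "rib_diff (bdry (B # Bs)) = bdry ((B \<union> C) # Cs) - rib_diff (cons_map B (bdry Bs) :: 'k chain)"
      unfolding C bdry_Cons[of B] by (subst rib_diff_eq, subst lin_ext_diff) (simp_all add: rib_diff_eq)
    also have "\<dots> = 0"
      unfolding rib_diff_cons_map[OF bdry_nonempty] Cons.IH unfolding C merge_map_bdry
      by (simp add: cons_map_def)
    finally show ?thesis .
  qed
qed

lemma rib_diff_rib_diff: "rib_diff (rib_diff v) = (0 :: ('k::field) chain)"
proof -
  have "rib_diff (rib_diff v) = lin_ext (\<lambda>Bs. rib_diff (bdry Bs)) v"
    unfolding rib_diff_eq by (subst lin_ext_comp) simp_all
  then show ?thesis by (simp add: rib_diff_bdry lin_ext_fun_0)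
qed

subsection \<open>Cross inversions\<close>

definition ascending :: "nat set \<Rightarrow> nat set \<Rightarrow> bool" where
  "ascending B C \<longleftrightarrow> (\<forall>x\<in>B. \<forall>y\<in>C. x < y)"

definition cross :: "nat set \<Rightarrow> nat set \<Rightarrow> nat" where
  "cross B C = card {(x, y). x \<in> B \<and> y \<in> C \<and> y < x}"

text \<open>Pairs of letters in different blocks whose order disagrees with the order of the blocks. They are
  counted by the position of the left block.\<close>

fun inversions :: "nat set list \<Rightarrow> nat" where
  "inversions [] = 0"
| "inversions (B # Bs) = cross B (\<Union> (set Bs)) + inversions Bs"

lemma finite_cross: "finite B \<Longrightarrow> finite C \<Longrightarrow> finite {(x, y). x \<in> B \<and> y \<in> C \<and> y < x}"
  by (rule finite_subset[of _ "B \<times> C"]) auto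

lemma cross_Un_left:
  assumes "finite B" "finite C" "finite D" "B \<inter> C = {}"
  shows "cross (B \<union> C) D = cross B D + cross C D"
proof -
  have "{(x, y). x \<in> B \<union> C \<and> y \<in> D \<and> y < x}
      = {(x, y). x \<in> B \<and> y \<in> D \<and> y < x} \<union> {(x, y). x \<in> C \<and> y \<in> D \<and> y < x}" by auto
  then show ?thesis unfolding cross_def
    using assms by (simp only:) (rule card_Un_disjoint, auto simp: finite_cross)
qed

lemma cross_Un_right:
  assumes "finite B" "finite C" "finite D" "C \<inter> D = {}"
  shows "cross B (C \<union> D) = cross B C + cross B D"
proof -
  have "{(x, y). x \<in> B \<and> y \<in> C \<union> D \<and> y < x}
      = {(x, y). x \<in> B \<and> y \<in> C \<and> y < x} \<union> {(x, y). x \<in> B \<and> y \<in> D \<and> y < x}" by auto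
  then show ?thesis unfolding cross_def
    using assms by (simp only:) (rule card_Un_disjoint, auto simp: finite_cross)
qed

lemma cross_eq_0_iff:
  assumes "finite B" "finite C" "B \<inter> C = {}"
  shows "cross B C = 0 \<longleftrightarrow> ascending B C"
proof -
  have "cross B C = 0 \<longleftrightarrow> {(x, y). x \<in> B \<and> y \<in> C \<and> y < x} = {}"
    unfolding cross_def using finite_cross[OF assms(1,2)] by simp
  also have "\<dots> \<longleftrightarrow> (\<forall>x\<in>B. \<forall>y\<in>C. \<not> y < x)" by auto
  also have "\<dots> \<longleftrightarrow> ascending B C"
    using assms(3) unfolding ascending_def by (metis disjoint_iff linorder_less_linear order_less_asym)
  finally show ?thesis .
qed

definition block_list :: "nat set list \<Rightarrow> bool" where
  "block_list Bs \<longleftrightarrow> disj_list Bs \<and> (\<forall>B\<in>set Bs. finite B \<and> B \<noteq> {})"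

lemma block_list_Cons:
  "block_list (B # Bs) \<longleftrightarrow> finite B \<and> B \<noteq> {} \<and> B \<inter> \<Union> (set Bs) = {} \<and> block_list Bs"
  by (auto simp: block_list_def)

text \<open>Merging removes the inversions between the two blocks and keeps all others, so the count filters the complex.\<close>

lemma inversions_merge:
  assumes "block_list (B # C # Cs)"
  shows "inversions (B # C # Cs) = cross B C + inversions ((B \<union> C) # Cs)"
proof -
  have fin: "finite B" "finite C" "finite (\<Union> (set Cs))" and disj: "B \<inter> C = {}" "C \<inter> \<Union> (set Cs) = {}"
    using assms by (auto simp: block_list_def)
  show ?thesis using cross_Un_left[OF fin(1,2,3) disj(1)] cross_Un_right[OF fin(1,2,3) disj(2)] by simp
qed

subsection \<open>Ordered set partitions refined by a composition\<close>

definition coarse_blocks :: "nat list \<Rightarrow> nat set \<Rightarrow> nat set list set" where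
  "coarse_blocks \<gamma> A = {Bs. disj_list Bs \<and> \<Union> (set Bs) = A \<and> map card Bs \<in> coarsenings \<gamma>}"

lemma coarsenings_refl: "is_composition n \<gamma> \<Longrightarrow> \<gamma> \<in> coarsenings \<gamma>"
  by (auto simp: coarsenings_def is_composition_def)

lemma coarsenings_trans: "\<beta> \<in> coarsenings \<gamma> \<Longrightarrow> \<delta> \<in> coarsenings \<beta> \<Longrightarrow> \<delta> \<in> coarsenings \<gamma>"
  by (auto simp: coarsenings_def is_composition_def)

lemma coarsenings_merge:
  assumes "b # c # \<beta> \<in> coarsenings \<gamma>"
  shows "(b + c) # \<beta> \<in> coarsenings \<gamma>"
proof -
  have "cut_set ((b + c) # \<beta>) \<subseteq> cut_set (b # c # \<beta>)"
    by (auto simp: cut_set_Cons image_image add.assoc)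
  then show ?thesis using assms by (auto simp: coarsenings_def)
qed

lemma coarse_blocks_block_list: "Bs \<in> coarse_blocks \<gamma> A \<Longrightarrow> block_list Bs"
  unfolding coarse_blocks_def block_list_def coarsenings_def is_composition_def
  by (auto simp: card_gt_0_iff)

lemma block_list_self:
  assumes "block_list Bs"
  shows "Bs \<in> coarse_blocks (map card Bs) (\<Union> (set Bs))"
  using assms coarsenings_refl[of "sum_list (map card Bs)" "map card Bs"]
  by (auto simp: block_list_def coarse_blocks_def is_composition_def card_gt_0_iff)

lemma coarse_blocks_trans:
  "map card Bs \<in> coarsenings \<gamma> \<Longrightarrow> y \<in> coarse_blocks (map card Bs) A \<Longrightarrow> y \<in> coarse_blocks \<gamma> A"
  using coarsenings_trans by (auto simp: coarse_blocks_def)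

lemma coarse_blocks_merge:
  assumes "B # C # Cs \<in> coarse_blocks \<gamma> A"
  shows "(B \<union> C) # Cs \<in> coarse_blocks \<gamma> A"
proof -
  have "card (B \<union> C) = card B + card C"
    using coarse_blocks_block_list[OF assms] by (intro card_Un_disjoint) (auto simp: block_list_def)
  then show ?thesis using assms coarsenings_merge by (auto simp: coarse_blocks_def)
qed

lemma coarse_blocks_Cons_eq:
  assumes "0 < g" "is_composition m \<gamma>" "\<gamma> \<noteq> []" "card B = g" "B \<inter> A = {}"
  shows "B # Bs \<in> coarse_blocks (g # \<gamma>) (B \<union> A) \<longleftrightarrow> Bs \<in> coarse_blocks \<gamma> A"
  using assms coarsenings_Cons[OF assms(1-3), of g "map card Bs"]
  by (auto simp: coarse_blocks_def)

lemma coarse_blocks_tl: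
  assumes "0 < g" "is_composition m \<gamma>" "\<gamma> \<noteq> []" "card B = g" "B # Bs \<in> coarse_blocks (g # \<gamma>) A"
  shows "Bs \<in> coarse_blocks \<gamma> (\<Union> (set Bs))" "B \<inter> \<Union> (set Bs) = {}" "A = B \<union> \<Union> (set Bs)"
proof -
  show *: "B \<inter> \<Union> (set Bs) = {}" "A = B \<union> \<Union> (set Bs)" using assms(5) by (auto simp: coarse_blocks_def)
  then show "Bs \<in> coarse_blocks \<gamma> (\<Union> (set Bs))"
    using coarse_blocks_Cons_eq[OF assms(1-4) *(1), of Bs] assms(5) by simp
qed

text \<open>The terms of the boundary have no more inversions. The last condition describes the first block: either a
  merge elsewhere kept the first block, or a merge into it lost an inversion, or no new minimum appeared
  in it. It is what allows the homotopy to pass the first block.\<close>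

lemma bdry_in:
  assumes "block_list Bs"
  shows "bdry Bs \<in> (free {y \<in> coarse_blocks (map card Bs) (\<Union> (set Bs)). Suc (length y) = length Bs \<and>
    inversions y \<le> inversions Bs \<and>
    (\<exists>D Ds. y = D # Ds \<and> hd Bs \<subseteq> D \<and> (inversions y < inversions Bs \<or> (\<forall>d\<in>D. \<exists>c\<in>hd Bs. c \<le> d)))}
      :: ('k::field) chain set)"
  using assms
proof (induction Bs)
  case Nil
  show ?case unfolding bdry_short by (rule free_0)
next
  case (Cons B Bs)
  show ?case
  proof (cases Bs)
    case Nil
    show ?thesis unfolding Nil bdry_short by (rule free_0)
  next
    case C: (Cons C Cs)
    let ?F = "\<lambda>Bs. {y \<in> coarse_blocks (map card Bs) (\<Union> (set Bs)). Suc (length y) = length Bs \<and>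
      inversions y \<le> inversions Bs \<and>
      (\<exists>D Ds. y = D # Ds \<and> hd Bs \<subseteq> D \<and> (inversions y < inversions Bs \<or> (\<forall>d\<in>D. \<exists>c\<in>hd Bs. c \<le> d)))}"
    have bl: "block_list (B # C # Cs)" using Cons.prems C by simp
    have fin: "finite B" "finite C" "B \<noteq> {}" "B \<inter> C = {}" using bl by (auto simp: block_list_Cons)
    have inv: "inversions (B # C # Cs) = cross B C + inversions ((B \<union> C) # Cs)" by (rule inversions_merge[OF bl])
    have "(B \<union> C) # Cs \<in> ?F (B # C # Cs)"
    proof -
      have "inversions ((B \<union> C) # Cs) < inversions (B # C # Cs) \<or> (\<forall>d\<in>B \<union> C. \<exists>c\<in>B. c \<le> d)"
      proof (cases "ascending B C")
        case True
        obtain b where "b \<in> B" using fin by auto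
        then have "\<forall>d\<in>B \<union> C. \<exists>c\<in>B. c \<le> d" using True unfolding ascending_def by (metis Un_iff less_imp_le order_refl)
        then show ?thesis by simp
      next
        case False
        then show ?thesis using inv cross_eq_0_iff[OF fin(1,2,4)] by simp
      qed
      then show ?thesis using coarse_blocks_merge[OF block_list_self[OF bl]] inv by auto
    qed
    moreover have "cons_map B (bdry Bs :: 'k chain) \<in> free (?F (B # Bs))"
      unfolding cons_map_def
    proof (rule lin_ext_in_free[OF Cons.IH])
      show "block_list Bs" using Cons.prems by (simp add: block_list_Cons)
      fix y assume y: "y \<in> ?F Bs"
      have ne: "map card Bs \<noteq> []" using C by simp
      have comp: "is_composition (sum_list (map card Bs)) (map card Bs)" "0 < card B"
        using Cons.prems by (auto simp: block_list_def is_composition_def card_gt_0_iff)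
      have disj: "B \<inter> \<Union> (set Bs) = {}" using Cons.prems by (simp add: block_list_Cons)
      have "B # y \<in> coarse_blocks (card B # map card Bs) (B \<union> \<Union> (set Bs))"
        using coarse_blocks_Cons_eq[OF comp(2,1) ne refl disj, of y] y by blast
      moreover have "\<Union> (set y) = \<Union> (set Bs)" using y by (auto simp: coarse_blocks_def)
      ultimately have "B # y \<in> ?F (B # Bs)" using y by auto
      then show "single (B # y) \<in> (free (?F (B # Bs)) :: 'k chain set)" by (rule single_in_free)
    qed
    ultimately show ?thesis
      unfolding C bdry_Cons by (intro free_diff single_in_free)
  qed
qed

subsection \<open>A homotopy modulo cross inversions\<close>

definition first_part :: "nat \<Rightarrow> nat set \<Rightarrow> nat set" where
  "first_part g B = set (take g (sorted_list_of_set B))"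

lemma first_part:
  assumes "finite B" "g \<le> card B"
  shows "first_part g B \<subseteq> B" "card (first_part g B) = g" "ascending (first_part g B) (B - first_part g B)"
proof -
  let ?L = "sorted_list_of_set B"
  have L: "set ?L = B" "distinct ?L" "sorted ?L" "length ?L = card B" using assms(1) by simp_all
  have app: "take g ?L @ drop g ?L = ?L" by simp
  show "first_part g B \<subseteq> B" unfolding first_part_def using L(1) set_take_subset by metis
  show "card (first_part g B) = g"
    unfolding first_part_def using L(2,4) assms(2) by (simp add: distinct_card)
  have "B - first_part g B \<subseteq> set (drop g ?L)"
    unfolding first_part_def using L(1) app by (metis Diff_subset_conv set_append subset_refl)
  moreover have "x < y" if "x \<in> set (take g ?L)" "y \<in> set (drop g ?L)" for x y
  proof -
    have "x \<le> y" using L(3) that by (metis app sorted_append)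
    moreover have "x \<noteq> y" using L(2) that by (metis app distinct_append disjoint_iff)
    ultimately show ?thesis by simp
  qed
  ultimately show "ascending (first_part g B) (B - first_part g B)"
    unfolding ascending_def first_part_def by blast
qed

lemma first_part_eqI:
  assumes "finite I" "finite R" "ascending I R" "card I = g"
  shows "first_part g (I \<union> R) = I"
proof -
  have disj: "I \<inter> R = {}" using assms(3) by (force simp: ascending_def)
  have "sorted_list_of_set (I \<union> R) = sorted_list_of_set I @ sorted_list_of_set R"
  proof (rule sorted_distinct_set_unique)
    show "sorted (sorted_list_of_set I @ sorted_list_of_set R)"
      using assms(1-3) by (auto simp: sorted_append ascending_def intro: less_imp_le)
  qed (use assms disj in simp_all)
  then show ?thesis using assms by (simp add: first_part_def)
qed

text \<open>A candidate for a contracting homotopy. If the first block is longer than the first part of \<open>\<gamma>\<close>, its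
  smallest letters are split off. Otherwise the first block already equals a part; if it lies entirely
  below the next block, the list is in the image of the splitting and is sent to zero, and if not, the
  homotopy is applied behind the first block, with a sign.\<close>

fun hsplit :: "nat list \<Rightarrow> nat set list \<Rightarrow> nat set list \<Rightarrow> 'k::field" where
  "hsplit (g # \<gamma>) (B # Bs) =
     (if g < card B then single (first_part g B # (B - first_part g B) # Bs)
      else if Bs = [] \<or> ascending B (hd Bs) then 0
      else - cons_map B (hsplit \<gamma> Bs))"
| "hsplit _ _ = 0"

lemma hsplit_split:
  "g < card B \<Longrightarrow> hsplit (g # \<gamma>) (B # Bs) = single (first_part g B # (B - first_part g B) # Bs)"
  unfolding hsplit.simps by (simp only: if_True)

lemma hsplit_stop:
  "\<not> g < card B \<Longrightarrow> Bs = [] \<or> ascending B (hd Bs) \<Longrightarrow> hsplit (g # \<gamma>) (B # Bs) = 0"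
  unfolding hsplit.simps by (simp only: if_True if_False)

lemma hsplit_step:
  "\<not> g < card B \<Longrightarrow> \<not> (Bs = [] \<or> ascending B (hd Bs)) \<Longrightarrow> hsplit (g # \<gamma>) (B # Bs) = - cons_map B (hsplit \<gamma> Bs)"
  unfolding hsplit.simps by (simp only: if_False)

declare hsplit.simps [simp del]

lemma fin_supp_hsplit [simp]: "hsplit \<gamma> Bs \<in> fin_supp"
proof (induction \<gamma> Bs rule: hsplit.induct)
  case (1 g \<gamma> B Bs)
  consider "g < card B" | "\<not> g < card B" "Bs = [] \<or> ascending B (hd Bs)"
    | "\<not> g < card B" "\<not> (Bs = [] \<or> ascending B (hd Bs))" by blast
  then show ?case
  proof cases
    case 1
    show ?thesis unfolding hsplit_split[OF 1] by (rule fin_supp_intros)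
  next
    case 2
    show ?thesis unfolding hsplit_stop[OF 2] by (rule fin_supp_intros)
  next
    case 3
    show ?thesis unfolding hsplit_step[OF 3] by (intro fin_supp_intros(5) fin_supp_maps)
  qed
qed (simp_all only: hsplit.simps fin_supp_intros)

lemma cons_map_add: "u \<in> fin_supp \<Longrightarrow> v \<in> fin_supp \<Longrightarrow> cons_map B (u + v) = cons_map B u + cons_map B v"
  and cons_map_diff: "u \<in> fin_supp \<Longrightarrow> v \<in> fin_supp \<Longrightarrow> cons_map B (u - v) = cons_map B u - cons_map B v"
  and cons_map_uminus: "u \<in> fin_supp \<Longrightarrow> cons_map B (- u) = - cons_map B u"
  unfolding cons_map_def by (rule lin_ext_add lin_ext_diff lin_ext_uminus; assumption)+

lemma coarse_blocks_Cons_cases: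
  assumes "0 < g" "is_composition m \<gamma>" "\<gamma> \<noteq> []" "B # Bs \<in> coarse_blocks (g # \<gamma>) A"
  shows "card B = g \<or> g < card B"
  using assms(4) coarsenings_Cons[OF assms(1-3), of "card B" "map card Bs"]
  by (auto simp: coarse_blocks_def)

lemma coarse_blocks_split:
  assumes g: "0 < g" "is_composition m \<gamma>" "\<gamma> \<noteq> []" and x: "B # Bs \<in> coarse_blocks (g # \<gamma>) A" and gB: "g < card B"
  defines "I \<equiv> first_part g B" and "R \<equiv> B - first_part g B"
  shows "I # R # Bs \<in> coarse_blocks (g # \<gamma>) A" "inversions (I # R # Bs) = inversions (B # Bs)"
    "I \<union> R = B" "ascending I R" "card I = g" "finite I" "finite R" "I \<noteq> {}" "R \<noteq> {}" "I \<inter> R = {}"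
proof -
  have bl: "block_list (B # Bs)" by (rule coarse_blocks_block_list[OF x])
  have finB: "finite B" using bl by (simp add: block_list_Cons)
  note fp = first_part[OF finB, of g]
  show IR: "I \<union> R = B" "ascending I R" "card I = g" "finite I" "finite R" "I \<inter> R = {}"
    using fp gB finB finite_subset[OF fp(1)] by (auto simp: I_def R_def)
  have cR: "card R = card B - g" using fp gB finB by (simp add: R_def card_Diff_subset finite_subset)
  show "I \<noteq> {}" "R \<noteq> {}" using IR(3) cR g(1) gB by auto
  then have blI: "block_list (I # R # Bs)"
    using bl IR by (auto simp: block_list_Cons)
  have "disj_list (R # Bs)" using blI by (simp add: block_list_def)
  moreover have "map card (R # Bs) \<in> coarsenings \<gamma>"
    using x gB coarsenings_Cons[OF g, of "card B" "map card Bs"] cR by (simp add: coarse_blocks_def)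
  ultimately have "R # Bs \<in> coarse_blocks \<gamma> (\<Union> (set (R # Bs)))" by (simp add: coarse_blocks_def)
  moreover have "I \<inter> \<Union> (set (R # Bs)) = {}" using blI by (simp add: block_list_Cons)
  ultimately have "I # R # Bs \<in> coarse_blocks (g # \<gamma>) (I \<union> \<Union> (set (R # Bs)))"
    using coarse_blocks_Cons_eq[OF g IR(3)] by blast
  moreover have "I \<union> \<Union> (set (R # Bs)) = A" using x IR(1) by (auto simp: coarse_blocks_def)
  ultimately show "I # R # Bs \<in> coarse_blocks (g # \<gamma>) A" by simp
  show "inversions (I # R # Bs) = inversions (B # Bs)"
    using inversions_merge[OF blI] cross_eq_0_iff[OF IR(4,5,6)] IR(1,2) by simp
qed

lemma coarse_blocks_single:
  assumes "0 < g" "B # Bs \<in> coarse_blocks [g] A"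
  shows "card B = g \<and> Bs = []"
  using assms by (auto simp: coarse_blocks_def coarsenings_singleton)

text \<open>Splitting is inverse to a merge without inversions, so the number of inversions does not grow. The
  first block is kept or replaced by its lower part, which still contains a smallest letter.\<close>

lemma hsplit_in:
  assumes "is_composition m \<gamma>" "Bs \<in> coarse_blocks \<gamma> A"
  shows "hsplit \<gamma> Bs \<in> (free {y \<in> coarse_blocks \<gamma> A. length y = Suc (length Bs) \<and>
    inversions y \<le> inversions Bs \<and> (\<exists>D Ds. y = D # Ds \<and> D \<subseteq> hd Bs \<and> (\<forall>c\<in>hd Bs. \<exists>d\<in>D. d \<le> c))}
      :: ('k::field) chain set)"
  using assms
proof (induction \<gamma> arbitrary: m Bs A)
  case Nil
  show ?case unfolding hsplit.simps by (rule free_0)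
next
  case (Cons g \<gamma>)
  let ?F = "\<lambda>\<gamma> A Bs. {y \<in> coarse_blocks \<gamma> A. length y = Suc (length Bs) \<and>
    inversions y \<le> inversions Bs \<and> (\<exists>D Ds. y = D # Ds \<and> D \<subseteq> hd Bs \<and> (\<forall>c\<in>hd Bs. \<exists>d\<in>D. d \<le> c))}"
  show ?case
  proof (cases Bs)
    case Nil
    show ?thesis unfolding Nil hsplit.simps by (rule free_0)
  next
    case Bs: (Cons B Bs')
    have g: "0 < g" "is_composition (m - g) \<gamma>" using Cons.prems by simp_all
    show ?thesis
    proof (cases "\<gamma> = []")
      case True
      then have "card B = g \<and> Bs' = []" using coarse_blocks_single[OF g(1)] Cons.prems(2) Bs by simp
      then have "hsplit (g # \<gamma>) Bs = (0 :: 'k chain)" unfolding Bs by (intro hsplit_stop) simp_all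
      then show ?thesis by (simp only: free_0)
    next
      case False
      note g = g False
      have x: "B # Bs' \<in> coarse_blocks (g # \<gamma>) A" using Cons.prems(2) Bs by simp
      show ?thesis
      proof (cases "g < card B")
        case True
        note sp = coarse_blocks_split[OF g x True]
        let ?I = "first_part g B" and ?R = "B - first_part g B"
        have "\<exists>d\<in>?I. d \<le> c" if "c \<in> B" for c
        proof (cases "c \<in> ?I")
          case False
          obtain d where "d \<in> ?I" using sp(8) by blast
          then show ?thesis using sp(4) False that by (metis DiffI ascending_def less_imp_le)
        qed auto
        then have "?I # ?R # Bs' \<in> ?F (g # \<gamma>) A Bs" using sp(1,2,3) Bs by auto
        then show ?thesis unfolding Bs hsplit_split[OF True] by (intro single_in_free) simp
      next
        case nsplit: False
        then have cB: "card B = g" using coarse_blocks_Cons_cases[OF g x] by simp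
        show ?thesis
        proof (cases "Bs' = [] \<or> ascending B (hd Bs')")
          case True
          show ?thesis unfolding Bs hsplit_stop[OF nsplit True] by (rule free_0)
        next
          case desc: False
          note tl = coarse_blocks_tl[OF g cB x]
          have "cons_map B (hsplit \<gamma> Bs' :: 'k chain) \<in> free (?F (g # \<gamma>) A Bs)"
            unfolding cons_map_def
          proof (rule lin_ext_in_free[OF Cons.IH[OF g(2) tl(1)]])
            fix y assume y: "y \<in> ?F \<gamma> (\<Union> (set Bs')) Bs'"
            have "B # y \<in> coarse_blocks (g # \<gamma>) A"
              unfolding tl(3) using coarse_blocks_Cons_eq[OF g cB tl(2)] y by blast
            moreover have "\<Union> (set y) = \<Union> (set Bs')" using y by (auto simp: coarse_blocks_def)
            ultimately have "B # y \<in> ?F (g # \<gamma>) A Bs" using y Bs by auto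
            then show "single (B # y) \<in> (free (?F (g # \<gamma>) A Bs) :: 'k chain set)"
              by (rule single_in_free)
          qed
          then show ?thesis unfolding Bs hsplit_step[OF nsplit desc] by (rule free_uminus)
        qed
      qed
    qed
  qed
qed

definition lower :: "nat list \<Rightarrow> nat set \<Rightarrow> nat set list \<Rightarrow> nat set list set" where
  "lower \<gamma> A Bs = {y \<in> coarse_blocks \<gamma> A. length y = length Bs \<and> inversions y < inversions Bs}"

lemma cons_map_lower:
  assumes g: "0 < g" "is_composition m \<gamma>" "\<gamma> \<noteq> []" and cB: "card B = g" and disj: "B \<inter> \<Union> (set Bs) = {}"
    and v: "v \<in> free (lower \<gamma> (\<Union> (set Bs)) Bs)"
  shows "cons_map B v \<in> (free (lower (g # \<gamma>) (B \<union> \<Union> (set Bs)) (B # Bs)) :: ('k::field) chain set)"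
  unfolding cons_map_def
proof (rule lin_ext_in_free[OF v])
  fix y assume y: "y \<in> lower \<gamma> (\<Union> (set Bs)) Bs"
  then have "B # y \<in> coarse_blocks (g # \<gamma>) (B \<union> \<Union> (set Bs))"
    using coarse_blocks_Cons_eq[OF g cB disj] by (simp add: lower_def)
  moreover have "\<Union> (set y) = \<Union> (set Bs)" using y by (auto simp: lower_def coarse_blocks_def)
  ultimately have "B # y \<in> lower (g # \<gamma>) (B \<union> \<Union> (set Bs)) (B # Bs)" using y by (simp add: lower_def)
  then show "single (B # y) \<in> (free (lower (g # \<gamma>) (B \<union> \<Union> (set Bs)) (B # Bs)) :: 'k chain set)"
    by (rule single_in_free)
qed

text \<open>The homotopy identity \<open>h \<partial> + \<partial> h = 1\<close> modulo lists with fewer inversions. If the first block \<open>B\<close> is split,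
  merging the two halves again gives back the list, and the remaining terms cancel in pairs, except for the
  splitting of \<open>B \<union> C\<close>, which agrees with the splitting of \<open>B\<close> unless there are inversions between \<open>B\<close> and
  the next block \<open>C\<close>. If \<open>B\<close> is a part and lies below \<open>C\<close>, the list is recovered by splitting
  \<open>B \<union> C\<close>. In the remaining case, induction behind the first block applies.\<close>

lemma homotopy_modulo_lower:
  assumes "is_composition m \<gamma>" "Bs \<in> coarse_blocks \<gamma> A" "length Bs < length \<gamma>"
  shows "lin_ext (hsplit \<gamma>) (bdry Bs) + rib_diff (hsplit \<gamma> Bs) - single Bs
    \<in> (free (lower \<gamma> A Bs) :: ('k::field) chain set)"
  using assms
proof (induction \<gamma> arbitrary: m Bs A)
  case Nil
  then show ?case by simp
next
  case (Cons g \<gamma>)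
  have g: "0 < g" "is_composition (m - g) \<gamma>" using Cons.prems by simp_all
  have "Bs \<noteq> []"
    using Cons.prems g(1) by (auto simp: coarse_blocks_def coarsenings_def is_composition_def)
  then obtain B Bs' where Bs: "Bs = B # Bs'" by (cases Bs) auto
  have x: "B # Bs' \<in> coarse_blocks (g # \<gamma>) A" using Cons.prems(2) Bs by simp
  have \<gamma>: "\<gamma> \<noteq> []" using Cons.prems(3) Bs by auto
  note g = g \<gamma>
  have bl: "block_list (B # Bs')" by (rule coarse_blocks_block_list[OF x])
  have finB: "finite B" "B \<noteq> {}" using bl by (simp_all add: block_list_Cons)
  let ?H = "hsplit (g # \<gamma>) :: nat set list \<Rightarrow> nat set list \<Rightarrow> 'k"
  let ?low = "free (lower (g # \<gamma>) A Bs) :: 'k chain set"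
  show ?case
  proof (cases "g < card B")
    case split: True
    let ?I = "first_part g B" and ?R = "B - first_part g B"
    note sp = coarse_blocks_split[OF g x split]
    have Hx: "?H Bs = single (?I # ?R # Bs')" unfolding Bs by (rule hsplit_split[OF split])
    show ?thesis
    proof (cases Bs')
      case Nil
      have 0: "cons_map ?I (0 :: 'k chain) = 0" unfolding cons_map_def by (rule lin_ext_0)
      have "rib_diff (?H Bs) = single Bs"
        unfolding Hx rib_diff_single unfolding Bs Nil bdry_Cons sp(3) bdry_short 0 by (rule diff_0_right)
      moreover have "lin_ext ?H (bdry Bs) = 0" unfolding Bs Nil bdry_short by (rule lin_ext_0)
      ultimately have "lin_ext ?H (bdry Bs) + rib_diff (?H Bs) - single Bs = 0" by (simp only: add_0 diff_self)
      then show ?thesis by (simp only: free_0)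
    next
      case (Cons C Cs)
      define b where "b = (bdry (C # Cs) :: 'k chain)"
      have b_fin [simp]: "b \<in> fin_supp" by (simp add: b_def)
      have finC: "finite C" "B \<inter> C = {}" "C \<noteq> {}" using bl Cons by (auto simp: block_list_Cons)
      have 1: "rib_diff (?H Bs) = single Bs - single (?I # (?R \<union> C) # Cs) + cons_map ?I (cons_map ?R b)"
        unfolding Hx rib_diff_single unfolding Cons bdry_Cons[of ?I] bdry_Cons[of ?R] b_def[symmetric] sp(3)
        using Bs Cons by (simp add: cons_map_diff)
      have "lin_ext ?H (cons_map B b) = lin_ext (\<lambda>y. single (?I # ?R # y)) b"
        unfolding cons_map_def by (subst lin_ext_comp) (simp_all add: hsplit_split[OF split])
      also have "\<dots> = cons_map ?I (cons_map ?R b)"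
        unfolding cons_map_def by (subst lin_ext_comp) simp_all
      finally have 2: "lin_ext ?H (bdry Bs) = ?H ((B \<union> C) # Cs) - cons_map ?I (cons_map ?R b)"
        unfolding Bs Cons bdry_Cons[of B] b_def[symmetric] by (simp add: lin_ext_diff)
      let ?I' = "first_part g (B \<union> C)" and ?R' = "(B \<union> C) - first_part g (B \<union> C)"
      have gBC: "g < card (B \<union> C)"
        using split card_mono[of "B \<union> C" B] finB finC by simp
      have 3: "?H ((B \<union> C) # Cs) = single (?I' # ?R' # Cs)" by (rule hsplit_split[OF gBC])
      have total: "lin_ext ?H (bdry Bs) + rib_diff (?H Bs) - single Bs = single (?I' # ?R' # Cs) - single (?I # (?R \<union> C) # Cs)"
        unfolding 1 2 3 by simp
      have xm: "(B \<union> C) # Cs \<in> coarse_blocks (g # \<gamma>) A" using coarse_blocks_merge x Cons by blast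
      note sp' = coarse_blocks_split[OF g xm gBC]
      \<comment> \<open>Without inversions between \<open>B\<close> and \<open>C\<close>, both splittings have the same lower part.\<close>
      show ?thesis
      proof (cases "ascending B C")
        case True
        have "ascending ?I (?R \<union> C)" using sp(3,4) True unfolding ascending_def by blast
        moreover have "B \<union> C = ?I \<union> (?R \<union> C)" using sp(3) by blast
        ultimately have "?I' = ?I" using first_part_eqI[of ?I "?R \<union> C" g] sp finC by simp
        moreover from this have "?R' = ?R \<union> C"
          using sp(3) finC(2) by blast
        ultimately show ?thesis unfolding total by (simp only: diff_self free_0)
      next
        case False
        have invBC: "inversions Bs = cross B C + inversions ((B \<union> C) # Cs)"
          using inversions_merge[of B C Cs] bl Bs Cons by simp
        have "?I' # ?R' # Cs \<in> lower (g # \<gamma>) A Bs"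
          using sp'(1,2) invBC cross_eq_0_iff[OF finB(1) finC(1,2)] False Bs Cons by (simp add: lower_def)
        moreover have "?I # (?R \<union> C) # Cs \<in> lower (g # \<gamma>) A Bs"
        proof -
          have y: "?I # ?R # C # Cs \<in> coarse_blocks (g # \<gamma>) A" using sp(1) Cons by simp
          have cI: "?R # C # Cs \<in> coarse_blocks \<gamma> (\<Union> (set (?R # C # Cs)))"
            "?I \<inter> \<Union> (set (?R # C # Cs)) = {}" "A = ?I \<union> \<Union> (set (?R # C # Cs))"
            using coarse_blocks_tl[OF g sp(5) y] by blast+
          have "(?R \<union> C) # Cs \<in> coarse_blocks \<gamma> (\<Union> (set (?R # C # Cs)))" by (rule coarse_blocks_merge[OF cI(1)])
          then have mem: "?I # (?R \<union> C) # Cs \<in> coarse_blocks (g # \<gamma>) A"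
            using coarse_blocks_Cons_eq[OF g sp(5) cI(2)] cI(3) by metis
          have blR: "block_list (?R # C # Cs)" by (rule coarse_blocks_block_list[OF cI(1)])
          have RC: "?R \<inter> C = {}" using finC(2) by blast
          \<comment> \<open>All of the lower part of \<open>B\<close> is below the upper part, so some inversion with \<open>C\<close> involves the latter.\<close>
          have "\<not> ascending ?R C"
          proof
            assume asc: "ascending ?R C"
            obtain r where r: "r \<in> ?R" using sp(9) by blast
            have "ascending B C"
              unfolding ascending_def
            proof (intro ballI)
              fix p q assume pq: "p \<in> B" "q \<in> C"
              show "p < q"
              proof (cases "p \<in> ?R")
                case False
                then have "p < r" using pq(1) r sp(3,4) unfolding ascending_def by blast
                also have "r < q" using asc r pq(2) unfolding ascending_def by blast
                finally show ?thesis .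
              qed (use asc pq in \<open>auto simp: ascending_def\<close>)
            qed
            then show False using False by blast
          qed
          then have "inversions ((?R \<union> C) # Cs) < inversions (?R # C # Cs)"
            using inversions_merge[OF blR] cross_eq_0_iff[OF sp(7) finC(1) RC] by simp
          moreover have "\<Union> (set ((?R \<union> C) # Cs)) = \<Union> (set (?R # C # Cs))" by auto
          ultimately have "inversions (?I # (?R \<union> C) # Cs) < inversions (?I # ?R # C # Cs)"
            unfolding inversions.simps(2)[of ?I] by (metis add_strict_left_mono)
          also have "\<dots> = inversions Bs" using sp(2) Bs Cons by simp
          finally show ?thesis using mem Bs Cons by (simp add: lower_def)
        qed
        ultimately show ?thesis unfolding total by (intro free_diff single_in_free)
      qed
    qed
  next
    case nsplit: False
    then have cB: "card B = g" using coarse_blocks_Cons_cases[OF g x] by simp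
    note tl = coarse_blocks_tl[OF g cB x]
    have "Bs' \<noteq> []"
    proof
      assume "Bs' = []"
      then have "sum_list \<gamma> = 0" using tl(1) by (simp add: coarse_blocks_def coarsenings_def)
      then have "is_composition 0 \<gamma>" using g(2) unfolding is_composition_def by blast
      then show False using g(3) by simp
    qed
    then obtain C Cs where Bs': "Bs' = C # Cs" by (cases Bs') auto
    define b where "b = (bdry Bs' :: 'k chain)"
    have b_fin [simp]: "b \<in> fin_supp" by (simp add: b_def)
    have blBs': "block_list Bs'" using bl by (simp add: block_list_Cons)
    have finC: "finite C" "B \<inter> C = {}" "C \<noteq> {}" using bl Bs' by (auto simp: block_list_Cons)
    have bd: "bdry Bs = single ((B \<union> C) # Cs) - cons_map B b"
      unfolding b_def Bs Bs' bdry_Cons[of B] ..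
    have 1: "lin_ext ?H (bdry Bs) = ?H ((B \<union> C) # Cs) - lin_ext (\<lambda>y. ?H (B # y)) b"
    proof -
      have "lin_ext ?H (cons_map B b) = lin_ext (\<lambda>y. ?H (B # y)) b"
        unfolding cons_map_def by (subst lin_ext_comp) simp_all
      then show ?thesis unfolding bd by (subst lin_ext_diff) simp_all
    qed
    have gBC: "g < card (B \<union> C)"
    proof -
      have "card (B \<union> C) = g + card C" using finB finC cB by (simp add: card_Un_disjoint)
      then show ?thesis using finC by (simp add: card_gt_0_iff)
    qed
    have xm: "(B \<union> C) # Cs \<in> coarse_blocks (g # \<gamma>) A" using coarse_blocks_merge x Bs' by blast
    note sp = coarse_blocks_split[OF g xm gBC]
    let ?I' = "first_part g (B \<union> C)" and ?R' = "(B \<union> C) - first_part g (B \<union> C)"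
    have HBC: "?H ((B \<union> C) # Cs) = single (?I' # ?R' # Cs)" by (rule hsplit_split[OF gBC])
    have invBC: "inversions Bs = cross B C + inversions ((B \<union> C) # Cs)"
      using inversions_merge[of B C Cs] bl Bs Bs' by simp
    note bd_in = bdry_in[OF blBs', where 'k = 'k]
    have sub: "map card Bs' \<in> coarsenings \<gamma>" using tl(1) by (simp add: coarse_blocks_def)
    show ?thesis
    proof (cases "ascending B C")
      case asc: True
      have "?H Bs = 0" unfolding Bs Bs' by (rule hsplit_stop) (use nsplit asc in simp_all)
      then have Hx: "rib_diff (?H Bs) = 0" by (simp only: rib_diff_eq lin_ext_0)
      \<comment> \<open>The list itself is the splitting of its first face.\<close>
      have "?I' = B" by (rule first_part_eqI[OF finB(1) finC(1) asc cB])
      moreover from this have "?R' = C" using finC(2) by blast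
      ultimately have HB: "?H ((B \<union> C) # Cs) = single Bs" using HBC Bs Bs' by simp
      have "lin_ext (\<lambda>y. ?H (B # y)) b \<in> ?low"
        unfolding b_def
      proof (rule lin_ext_in_free[OF bd_in])
        fix y assume "y \<in> {y \<in> coarse_blocks (map card Bs') (\<Union> (set Bs')). Suc (length y) = length Bs' \<and>
          inversions y \<le> inversions Bs' \<and>
          (\<exists>D Ds. y = D # Ds \<and> hd Bs' \<subseteq> D \<and> (inversions y < inversions Bs' \<or> (\<forall>d\<in>D. \<exists>c\<in>hd Bs'. c \<le> d)))}"
        then obtain D Ds where y: "y \<in> coarse_blocks (map card Bs') (\<Union> (set Bs'))" "Suc (length y) = length Bs'"
          "y = D # Ds" "C \<subseteq> D" "inversions y < inversions Bs' \<or> (\<forall>d\<in>D. \<exists>c\<in>C. c \<le> d)"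
          using Bs' by auto
        show "?H (B # y) \<in> ?low"
        proof (cases "ascending B D")
          case True
          then have "?H (B # y) = 0" using y(3) nsplit by (intro hsplit_stop) simp_all
          then show ?thesis by (simp only: free_0)
        next
          case False
          \<comment> \<open>Letters of \<open>D\<close> that are not below some letter of \<open>C\<close> cannot produce an inversion with \<open>B\<close>.\<close>
          have "inversions y < inversions Bs'"
          proof (rule ccontr)
            assume "\<not> inversions y < inversions Bs'"
            then have "\<forall>d\<in>D. \<exists>c\<in>C. c \<le> d" using y(5) by blast
            then have "ascending B D" using asc unfolding ascending_def by (meson less_le_trans)
            then show False using False by blast
          qed
          have y\<gamma>: "y \<in> coarse_blocks \<gamma> (\<Union> (set Bs'))" by (rule coarse_blocks_trans[OF sub y(1)])
          have "hsplit \<gamma> y \<in> (free (lower \<gamma> (\<Union> (set Bs')) Bs') :: 'k chain set)"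
            by (rule free_mono[OF hsplit_in[OF g(2) y\<gamma>]])
               (use \<open>inversions y < inversions Bs'\<close> y(2) in \<open>auto simp: lower_def\<close>)
          then have "cons_map B (hsplit \<gamma> y) \<in> ?low"
            unfolding tl(3) Bs by (rule cons_map_lower[OF g cB tl(2)])
          moreover have "?H (B # y) = - cons_map B (hsplit \<gamma> y)"
            using nsplit False y(3) by (intro hsplit_step) simp_all
          ultimately show ?thesis by (simp add: free_uminus)
        qed
      qed
      moreover have "single Bs - x + 0 - single Bs = - x" for x :: "nat set list \<Rightarrow> 'k" by simp
      ultimately show ?thesis unfolding 1 Hx HB by (simp only: free_uminus)
    next
      case desc: False
      define h where "h = (hsplit \<gamma> Bs' :: 'k chain)"
      have h_fin [simp]: "h \<in> fin_supp" by (simp add: h_def)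
      have Hx: "?H Bs = - cons_map B h"
        unfolding Bs h_def using nsplit desc Bs' by (intro hsplit_step) simp_all
      note h_in = hsplit_in[OF g(2) tl(1), where 'k = 'k]
      have "h \<in> free {Cs. Cs \<noteq> []}" unfolding h_def by (rule free_mono[OF h_in]) auto
      then have 2: "rib_diff (?H Bs) = - merge_map B h + cons_map B (rib_diff h)"
        unfolding Hx by (subst rib_diff_eq, subst lin_ext_uminus, simp, fold rib_diff_eq)
          (simp add: rib_diff_cons_map)
      have "lin_ext (\<lambda>y. ?H (B # y)) b = lin_ext (\<lambda>y. - cons_map B (hsplit \<gamma> y)) b"
        unfolding b_def
      proof (rule lin_ext_cong_free[OF bd_in])
        fix y assume "y \<in> {y \<in> coarse_blocks (map card Bs') (\<Union> (set Bs')). Suc (length y) = length Bs' \<and>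
          inversions y \<le> inversions Bs' \<and>
          (\<exists>D Ds. y = D # Ds \<and> hd Bs' \<subseteq> D \<and> (inversions y < inversions Bs' \<or> (\<forall>d\<in>D. \<exists>c\<in>hd Bs'. c \<le> d)))}"
        then obtain D Ds where y: "y = D # Ds" "C \<subseteq> D" using Bs' by auto
        have "\<not> ascending B D" using desc y(2) unfolding ascending_def by blast
        then show "?H (B # y) = - cons_map B (hsplit \<gamma> y)"
          using nsplit y by (intro hsplit_step) simp_all
      qed
      also have "\<dots> = - cons_map B (lin_ext (hsplit \<gamma>) b)"
        unfolding lin_ext_fun_uminus cons_map_def by (subst lin_ext_comp) simp_all
      finally have 3: "lin_ext (\<lambda>y. ?H (B # y)) b = - cons_map B (lin_ext (hsplit \<gamma>) b)" .
      \<comment> \<open>The error term behind the first block, which is small by induction.\<close>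
      let ?e = "lin_ext (hsplit \<gamma>) b + rib_diff h - single Bs'"
      have fins: "lin_ext (hsplit \<gamma>) b \<in> fin_supp" by (rule fin_supp_lin_ext) simp
      have e: "cons_map B ?e = cons_map B (lin_ext (hsplit \<gamma>) b) + cons_map B (rib_diff h) - single Bs"
        using fins Bs by (simp add: cons_map_diff cons_map_add)
      have total: "lin_ext ?H (bdry Bs) + rib_diff (?H Bs) - single Bs
          = single (?I' # ?R' # Cs) - merge_map B h + cons_map B ?e"
        unfolding 1 2 3 HBC e by simp
      have "?I' # ?R' # Cs \<in> lower (g # \<gamma>) A Bs"
        using sp(1,2) invBC cross_eq_0_iff[OF finB(1) finC(1,2)] desc Bs Bs' by (simp add: lower_def)
      then have "single (?I' # ?R' # Cs) \<in> ?low" by (rule single_in_free)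
      moreover have "merge_map B h \<in> ?low"
        unfolding merge_map_def h_def
      proof (rule lin_ext_in_free[OF h_in])
        fix y assume "y \<in> {y \<in> coarse_blocks \<gamma> (\<Union> (set Bs')). length y = Suc (length Bs') \<and>
          inversions y \<le> inversions Bs' \<and> (\<exists>D Ds. y = D # Ds \<and> D \<subseteq> hd Bs' \<and> (\<forall>c\<in>hd Bs'. \<exists>d\<in>D. d \<le> c))}"
        then obtain D Ds where y: "y \<in> coarse_blocks \<gamma> (\<Union> (set Bs'))" "length y = Suc (length Bs')"
          "inversions y \<le> inversions Bs'" "y = D # Ds" "\<forall>c\<in>C. \<exists>d\<in>D. d \<le> c" using Bs' by auto
        have mem: "B # D # Ds \<in> coarse_blocks (g # \<gamma>) A"
          unfolding tl(3) using coarse_blocks_Cons_eq[OF g cB tl(2)] y(1,4) by blast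
        have blD: "block_list (B # D # Ds)" by (rule coarse_blocks_block_list[OF mem])
        have finD: "finite D" "B \<inter> D = {}" using blD by (auto simp: block_list_Cons)
        have "\<not> ascending B D" using desc y(5) unfolding ascending_def by (meson less_le_trans)
        then have "inversions ((B \<union> D) # Ds) < inversions (B # y)"
          using inversions_merge[OF blD] cross_eq_0_iff[OF finB(1) finD] y(4) by simp
        also have "\<dots> \<le> inversions Bs"
        proof -
          have "\<Union> (set y) = \<Union> (set Bs')" using y(1) by (auto simp: coarse_blocks_def)
          then show ?thesis using y(3) Bs by simp
        qed
        finally have "(B \<union> D) # Ds \<in> lower (g # \<gamma>) A Bs"
          using coarse_blocks_merge[OF mem] y(2,4) Bs by (simp add: lower_def)
        then show "single ((B \<union> hd y) # tl y) \<in> ?low" using y(4) by (auto intro: single_in_free)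
      qed
      moreover have "cons_map B ?e \<in> ?low"
      proof -
        have "length Bs' < length \<gamma>" using Cons.prems(3) Bs by simp
        from Cons.IH[OF g(2) tl(1) this]
        have "?e \<in> free (lower \<gamma> (\<Union> (set Bs')) Bs')" unfolding b_def h_def .
        then show ?thesis unfolding tl(3) Bs by (rule cons_map_lower[OF g cB tl(2)])
      qed
      ultimately show ?thesis unfolding total by (intro free_add free_diff)
    qed
  qed
qed

text \<open>Subtracting the boundary of the homotopy from a cycle lowers its number of inversions. Since
  inversions are natural numbers, the cycle is exhausted after finitely many steps.\<close>

lemma cycle_is_boundary_below_top:
  assumes \<gamma>: "is_composition m \<gamma>" and k: "k < length \<gamma>"
    and v: "v \<in> free {y \<in> coarse_blocks \<gamma> A. length y = k \<and> inversions y < N}" "v \<in> fin_supp"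
    and cyc: "rib_diff v = 0"
  shows "\<exists>u. u \<in> free {y \<in> coarse_blocks \<gamma> A. length y = Suc k} \<and> u \<in> fin_supp \<and> rib_diff u = (v :: ('k::field) chain)"
  using v cyc
proof (induction N arbitrary: v)
  case 0
  have "v = 0"
  proof
    fix x show "v x = 0 x" using 0(1) by (simp add: freeD)
  qed
  then show ?case
    by (intro exI[of _ 0] conjI) (rule free_0, rule fin_supp_intros, simp only: rib_diff_eq lin_ext_0)
next
  case (Suc N)
  let ?X = "{y \<in> coarse_blocks \<gamma> A. length y = k \<and> inversions y < Suc N}"
  define w where "w = lin_ext (hsplit \<gamma>) v"
  \<comment> \<open>By the homotopy identity, \<open>v\<close> and \<open>\<partial> h v\<close> agree up to fewer inversions, as \<open>\<partial> v = 0\<close>.\<close>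
  define v' where "v' = v - rib_diff w"
  have wfin: "w \<in> fin_supp" unfolding w_def by (rule fin_supp_lin_ext) simp
  have w_in: "w \<in> free {y \<in> coarse_blocks \<gamma> A. length y = Suc k}"
    unfolding w_def
  proof (rule lin_ext_in_free[OF Suc.prems(1)])
    fix x assume "x \<in> ?X"
    then show "hsplit \<gamma> x \<in> (free {y \<in> coarse_blocks \<gamma> A. length y = Suc k} :: 'k chain set)"
      by (intro free_mono[OF hsplit_in[OF \<gamma>, of x A]]) auto
  qed
  have "lin_ext (\<lambda>x. lin_ext (hsplit \<gamma>) (bdry x) + rib_diff (hsplit \<gamma> x) - single x) v
      = lin_ext (hsplit \<gamma>) (rib_diff v) + rib_diff w - v"
    unfolding lin_ext_fun_diff lin_ext_fun_add lin_ext_id[OF Suc.prems(2)]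
    unfolding w_def rib_diff_eq by (subst (1 2) lin_ext_comp) simp_all
  then have v': "v' = - lin_ext (\<lambda>x. lin_ext (hsplit \<gamma>) (bdry x) + rib_diff (hsplit \<gamma> x) - single x) v"
    unfolding Suc.prems(3) v'_def by simp
  have "v' \<in> free {y \<in> coarse_blocks \<gamma> A. length y = k \<and> inversions y < N}"
    unfolding v'
  proof (rule free_uminus, rule lin_ext_in_free[OF Suc.prems(1)])
    fix x assume x: "x \<in> ?X"
    then show "lin_ext (hsplit \<gamma>) (bdry x) + rib_diff (hsplit \<gamma> x) - single x
        \<in> (free {y \<in> coarse_blocks \<gamma> A. length y = k \<and> inversions y < N} :: 'k chain set)"
      using k by (intro free_mono[OF homotopy_modulo_lower[OF \<gamma>, of x A]]) (auto simp: lower_def)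
  qed
  moreover have "v' \<in> fin_supp" using Suc.prems(2) by (simp add: v'_def)
  moreover have "rib_diff v' = 0"
  proof -
    have "rib_diff (v - u) = rib_diff v - rib_diff u" if "u \<in> fin_supp" for u
      unfolding rib_diff_eq by (rule lin_ext_diff[OF Suc.prems(2) that])
    from this[OF fin_supp_maps(3)] have "rib_diff v' = rib_diff v - rib_diff (rib_diff w)"
      unfolding v'_def .
    then show ?thesis by (simp only: Suc.prems(3) rib_diff_rib_diff diff_self)
  qed
  ultimately obtain u where u: "u \<in> free {y \<in> coarse_blocks \<gamma> A. length y = Suc k}" "u \<in> fin_supp" "rib_diff u = v'"
    using Suc.IH by blast
  have "rib_diff (u + w) = rib_diff u + rib_diff w" unfolding rib_diff_eq by (rule lin_ext_add[OF u(2) wfin])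
  then have "rib_diff (u + w) = v" using u(3) by (simp add: v'_def)
  moreover have "u + w \<in> free {y \<in> coarse_blocks \<gamma> A. length y = Suc k}" by (rule free_add[OF u(1) w_in])
  moreover have "u + w \<in> fin_supp" by (rule fin_supp_intros(3)[OF u(2) wfin])
  ultimately show ?case by blast
qed

section \<open>Homology of the ribbon complex\<close>

lemma endo_subset:
  assumes "linear_on_space U f" "V \<subseteq> U" "f ` V \<subseteq> V" "W \<subseteq> V" "f ` W \<subseteq> W"
  shows "endo (V, W) f"
  using assms linear_on_space_subset by (auto simp: endo_def)

lemma has_trace_cong:
  assumes "has_trace V f t" "\<And>v. v \<in> fst V \<Longrightarrow> f v = f' v"
  shows "has_trace V f' t"
proof -
  obtain S where V: "subquotient V" "endo V f" and S: "quot_basis V S"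
    and t: "t = (\<Sum>s\<in>S. quot_coords V S (f s) s)"
    using assms(1) by (auto simp: has_trace_def)
  have sub: "fspace.subspace (fst V)" "snd V \<subseteq> fst V" using V(1) by (auto simp: subquotient_def)
  have "f' (u + v) = f' u + f' v" if "u \<in> fst V" "v \<in> fst V" for u v
  proof -
    have "f (u + v) = f u + f v" using V(2) that by (auto simp: endo_def intro: linear_on_space_add)
    then show ?thesis using assms(2) that fspace.subspace_add[OF sub(1) that] by metis
  qed
  moreover have "f' (scale c v) = scale c (f' v)" if "v \<in> fst V" for c v
  proof -
    have "f (scale c v) = scale c (f v)" using V(2) that by (auto simp: endo_def intro: linear_on_space_scale)
    then show ?thesis using assms(2) that fspace.subspace_scale[OF sub(1) that] by metis
  qed
  moreover have "f' ` fst V = f ` fst V" "f' ` snd V = f ` snd V"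
    using assms(2) sub(2) by (auto intro!: image_cong)
  ultimately have "endo V f'" using V(2) unfolding endo_def linear_on_space_def by metis
  moreover have "t = (\<Sum>s\<in>S. quot_coords V S (f' s) s)"
    unfolding t using assms(2) quot_basis_in[OF S] by (intro sum.cong refl) metis
  ultimately show ?thesis using V(1) S unfolding has_trace_def by blast
qed

context
  fixes n :: nat and \<gamma> :: "nat list"
  assumes n: "1 \<le> n" and \<gamma>: "is_composition n \<gamma>"
begin

text \<open>The basis in terms of disjoint families, on which the recursive description of boundary and homotopy operates.\<close>

lemma rib_basis_eq: "rib_basis \<gamma> k = {y \<in> coarse_blocks \<gamma> {1..n}. length y = k}"
proof -
  have sum: "sum_list \<gamma> = n" using \<gamma> by (simp add: is_composition_def)
  have "Bs \<in> rib_basis \<gamma> k \<longleftrightarrow> Bs \<in> {y \<in> coarse_blocks \<gamma> {1..n}. length y = k}" for Bs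
  proof
    assume "Bs \<in> rib_basis \<gamma> k"
    then obtain \<beta> where "\<beta> \<in> coarsenings \<gamma>" "length \<beta> = k" "Bs \<in> OSP \<beta> n"
      unfolding rib_basis_def sum by blast
    moreover from this(3) have "map card Bs = \<beta>" "\<Union> (set Bs) = {1..n}" "disj_list Bs"
      by (simp_all only: OSP_iff)
    ultimately show "Bs \<in> {y \<in> coarse_blocks \<gamma> {1..n}. length y = k}"
      unfolding coarse_blocks_def by force
  next
    assume "Bs \<in> {y \<in> coarse_blocks \<gamma> {1..n}. length y = k}"
    then have "map card Bs \<in> {\<beta> \<in> coarsenings \<gamma>. length \<beta> = k}" "Bs \<in> OSP (map card Bs) n"
      unfolding coarse_blocks_def OSP_iff by simp_all
    then show "Bs \<in> rib_basis \<gamma> k" unfolding rib_basis_def sum by blast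
  qed
  then show ?thesis by (rule set_eqI)
qed

lemma finite_rib_basis: "finite (rib_basis \<gamma> k)"
  unfolding rib_basis_def using finite_coarsenings[OF \<gamma>] finite_OSP by auto

lemma rib_basis_length:
  assumes "Bs \<in> rib_basis \<gamma> k"
  shows "1 \<le> k" "k \<le> length \<gamma>"
proof -
  have \<beta>: "map card Bs \<in> coarsenings \<gamma>" "length Bs = k"
    using assms by (auto simp: rib_basis_eq coarse_blocks_def)
  have comp: "is_composition n (map card Bs)" by (rule coarsening_composition[OF \<gamma> \<beta>(1)])
  have "length (map card Bs) = card (cut_set (map card Bs)) + 1" by (rule card_cut_set[OF comp n])
  moreover have "card (cut_set (map card Bs)) \<le> card (cut_set \<gamma>)"
    using \<beta>(1) by (intro card_mono finite_cut_set[OF \<gamma>]) (auto simp: coarsenings_def)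
  ultimately show "1 \<le> k" "k \<le> length \<gamma>" using card_cut_set[OF \<gamma> n] \<beta>(2) by simp_all
qed

lemma rib_chains_trivial: "k = 0 \<or> length \<gamma> < k \<Longrightarrow> rib_chains \<gamma> k = ({0} :: ('k::field) chain set)"
proof -
  assume k: "k = 0 \<or> length \<gamma> < k"
  have "rib_basis \<gamma> k = {}"
  proof (rule ccontr)
    assume "rib_basis \<gamma> k \<noteq> {}"
    then obtain Bs where "Bs \<in> rib_basis \<gamma> k" by blast
    from rib_basis_length[OF this] k show False by simp
  qed
  then show ?thesis unfolding rib_chains_def by (simp only: free_empty)
qed

lemma rib_diff_0: "rib_diff 0 = (0 :: ('k::field) chain)"
  unfolding rib_diff_eq by (rule lin_ext_0)

lemma rib_diff_chains: "v \<in> rib_chains \<gamma> (Suc k) \<Longrightarrow> rib_diff v \<in> (rib_chains \<gamma> k :: ('k::field) chain set)"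
  unfolding rib_chains_def rib_diff_eq
proof (rule lin_ext_in_free, assumption)
  fix x assume x: "x \<in> rib_basis \<gamma> (Suc k)"
  then have xc: "x \<in> coarse_blocks \<gamma> {1..n}" "length x = Suc k" by (auto simp: rib_basis_eq)
  have Un: "\<Union> (set x) = {1..n}" "map card x \<in> coarsenings \<gamma>" using xc by (auto simp only: coarse_blocks_def mem_Collect_eq)
  show "bdry x \<in> (free (rib_basis \<gamma> k) :: 'k chain set)"
  proof (rule free_mono[OF bdry_in[OF coarse_blocks_block_list[OF xc(1)]]], rule subsetI)
    fix y assume "y \<in> {y \<in> coarse_blocks (map card x) (\<Union> (set x)). Suc (length y) = length x \<and>
      inversions y \<le> inversions x \<and>
      (\<exists>D Ds. y = D # Ds \<and> hd x \<subseteq> D \<and> (inversions y < inversions x \<or> (\<forall>d\<in>D. \<exists>c\<in>hd x. c \<le> d)))}"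
    then show "y \<in> rib_basis \<gamma> k"
      using coarse_blocks_trans[OF Un(2), of y "{1..n}"] Un(1) xc(2) by (auto simp: rib_basis_eq)
  qed
qed

lemma linear_rib_diff: "linear_on_space (rib_chains \<gamma> k) (rib_diff :: (nat set list \<Rightarrow> 'k::field) \<Rightarrow> _)"
  unfolding rib_chains_def rib_diff_def by (rule linear_lin_ext[OF finite_rib_basis])

lemma linear_rib_act: "linear_on_space (rib_chains \<gamma> k) (rib_act w :: (nat set list \<Rightarrow> 'k::field) \<Rightarrow> _)"
  unfolding rib_chains_def rib_act_def by (rule linear_lin_ext[OF finite_rib_basis])

lemma relabel_rib_basis:
  assumes "w permutes {1..n}" "Bs \<in> rib_basis \<gamma> k"
  shows "relabel w Bs \<in> rib_basis \<gamma> k"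
  using assms relabel_OSP[OF assms(1)] \<gamma> unfolding rib_basis_def is_composition_def by auto

lemma rib_act_chains:
  assumes "w permutes {1..n}" "v \<in> rib_chains \<gamma> k"
  shows "rib_act w v \<in> (rib_chains \<gamma> k :: ('k::field) chain set)"
  using assms(2) unfolding rib_chains_def rib_act_def
  by (rule lin_ext_in_free) (intro single_in_free relabel_rib_basis[OF assms(1)])

lemma relabel_merge_blocks:
  "i \<in> {1..<length Bs} \<Longrightarrow> relabel w (merge_blocks i Bs) = merge_blocks i (relabel w Bs)"
  by (auto simp: relabel_def merge_blocks_def take_map drop_map image_Un)

lemma rib_act_rib_diff: "rib_act w (rib_diff v) = (rib_diff (rib_act w v) :: ('k::field) chain)"
proof -
  have "lin_ext (\<lambda>Bs. single (relabel w Bs)) (bdry Bs) = (bdry (relabel w Bs) :: 'k chain)" for Bs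
  proof -
    have "lin_ext (\<lambda>Bs. single (relabel w Bs)) (bdry Bs) =
        (\<Sum>i = 1..<length Bs. scale ((- 1) ^ (i - 1)) (single (relabel w (merge_blocks i Bs))) :: 'k chain)"
      unfolding bdry_def
      by (subst linear_on_space_sum_scale[OF linear_lin_ext_fin subspace_fin_supp]) simp_all
    also have "\<dots> = (\<Sum>i = 1..<length Bs. scale ((- 1) ^ (i - 1)) (single (merge_blocks i (relabel w Bs))))"
      by (rule sum.cong[OF refl]) (simp only: relabel_merge_blocks)
    also have "\<dots> = bdry (relabel w Bs)" unfolding bdry_def by (simp add: relabel_def)
    finally show ?thesis .
  qed
  then have "rib_act w (rib_diff v) = lin_ext (\<lambda>Bs. bdry (relabel w Bs)) v"
    unfolding rib_act_def rib_diff_eq by (subst lin_ext_comp) simp_all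
  also have "\<dots> = rib_diff (rib_act w v)"
    unfolding rib_act_def rib_diff_eq by (subst lin_ext_comp) simp_all
  finally show ?thesis .
qed

abbreviation (input) cycles :: "nat \<Rightarrow> ('k::field) chain set" where
  "cycles k \<equiv> cycle_space (rib_chains \<gamma>) rib_diff k"

abbreviation (input) boundaries :: "nat \<Rightarrow> ('k::field) chain set" where
  "boundaries k \<equiv> boundary_space (rib_chains \<gamma>) rib_diff k"

lemma subspace_rib_chains: "fspace.subspace (rib_chains \<gamma> k :: ('k::field) chain set)"
  unfolding rib_chains_def by (rule subspace_free)

lemma subspace_cycles: "fspace.subspace (cycles k :: ('k::field) chain set)"
proof (rule fspace.subspaceI)
  show "0 \<in> (cycles k :: 'k chain set)"
    unfolding cycle_space_def mem_Collect_eq by (intro conjI fspace.subspace_0[OF subspace_rib_chains] rib_diff_0)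
next
  fix u v :: "nat set list \<Rightarrow> 'k" assume "u \<in> cycles k" "v \<in> cycles k"
  then have *: "u \<in> rib_chains \<gamma> k" "v \<in> rib_chains \<gamma> k" "rib_diff u = 0" "rib_diff v = 0"
    unfolding cycle_space_def by blast+
  have "rib_diff (u + v) = 0"
    unfolding linear_on_space_add[OF linear_rib_diff *(1,2)] *(3,4) by (rule add_0)
  then show "u + v \<in> cycles k"
    unfolding cycle_space_def mem_Collect_eq using fspace.subspace_add[OF subspace_rib_chains *(1,2)] by blast
next
  fix c and v :: "nat set list \<Rightarrow> 'k" assume "v \<in> cycles k"
  then have *: "v \<in> rib_chains \<gamma> k" "rib_diff v = 0" unfolding cycle_space_def by blast+
  have "rib_diff (scale c v) = 0"
    unfolding linear_on_space_scale[OF linear_rib_diff *(1)] *(2) by (rule fspace.scale_zero_right)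
  then show "scale c v \<in> cycles k"
    unfolding cycle_space_def mem_Collect_eq using fspace.subspace_scale[OF subspace_rib_chains *(1)] by blast
qed

lemma boundaries_subset_cycles: "boundaries k \<subseteq> (cycles k :: ('k::field) chain set)"
  using rib_diff_chains[of _ k] rib_diff_rib_diff unfolding boundary_space_def cycle_space_def by auto

lemma subspace_boundaries: "fspace.subspace (boundaries k :: ('k::field) chain set)"
proof (rule fspace.subspaceI)
  show "0 \<in> (boundaries k :: 'k chain set)"
    unfolding boundary_space_def using fspace.subspace_0[OF subspace_rib_chains] rib_diff_0 by (metis imageI)
next
  fix u v :: "nat set list \<Rightarrow> 'k" assume "u \<in> boundaries k" "v \<in> boundaries k"
  then obtain a b where *: "a \<in> rib_chains \<gamma> (k + 1)" "b \<in> rib_chains \<gamma> (k + 1)" "u = rib_diff a" "v = rib_diff b"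
    unfolding boundary_space_def by blast
  have "u + v = rib_diff (a + b)" unfolding *(3,4) by (rule linear_on_space_add[OF linear_rib_diff *(1,2), symmetric])
  then show "u + v \<in> boundaries k"
    unfolding boundary_space_def using fspace.subspace_add[OF subspace_rib_chains *(1,2)] by blast
next
  fix c and v :: "nat set list \<Rightarrow> 'k" assume "v \<in> boundaries k"
  then obtain a where *: "a \<in> rib_chains \<gamma> (k + 1)" "v = rib_diff a" unfolding boundary_space_def by blast
  have "scale c v = rib_diff (scale c a)" unfolding *(2) by (rule linear_on_space_scale[OF linear_rib_diff *(1), symmetric])
  then show "scale c v \<in> boundaries k"
    unfolding boundary_space_def using fspace.subspace_scale[OF subspace_rib_chains *(1)] by blast
qed

lemma subquotient_homology: "subquotient (homology (rib_chains \<gamma>) rib_diff k :: (nat set list, 'k::field) subquot)"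
  unfolding homology_def subquotient_def fst_conv snd_conv
  by (intro conjI subspace_cycles subspace_boundaries boundaries_subset_cycles)

lemma endo_homology:
  assumes w: "w permutes {1..n}"
  shows "endo (homology (rib_chains \<gamma>) rib_diff k :: (nat set list, 'k::field) subquot) (rib_act w)"
  unfolding homology_def
proof (rule endo_subset[OF linear_rib_act _ _ boundaries_subset_cycles])
  show "cycles k \<subseteq> (rib_chains \<gamma> k :: 'k chain set)" unfolding cycle_space_def by blast
  show "rib_act w ` cycles k \<subseteq> (cycles k :: 'k chain set)"
  proof (rule image_subsetI)
    fix v :: "nat set list \<Rightarrow> 'k" assume "v \<in> cycles k"
    then have v: "v \<in> rib_chains \<gamma> k" "rib_diff v = 0" unfolding cycle_space_def by blast+
    have "rib_diff (rib_act w v) = 0"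
      unfolding rib_act_rib_diff[symmetric] v(2) unfolding rib_act_def by (rule lin_ext_0)
    then show "rib_act w v \<in> cycles k"
      unfolding cycle_space_def using rib_act_chains[OF w v(1)] by blast
  qed
  show "rib_act w ` boundaries k \<subseteq> (boundaries k :: 'k chain set)"
  proof (rule image_subsetI)
    fix v :: "nat set list \<Rightarrow> 'k" assume "v \<in> boundaries k"
    then obtain a where a: "a \<in> rib_chains \<gamma> (k + 1)" "v = rib_diff a" unfolding boundary_space_def by blast
    have "rib_act w v = rib_diff (rib_act w a)" unfolding a(2) by (rule rib_act_rib_diff)
    then show "rib_act w v \<in> boundaries k"
      unfolding boundary_space_def using rib_act_chains[OF w a(1)] by blast
  qed
qed

lemma ribbon_exact:
  assumes "k < length \<gamma>"
  shows "cycles k = (boundaries k :: ('k::field) chain set)"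
proof (rule equalityI[OF _ boundaries_subset_cycles], rule subsetI)
  fix v :: "nat set list \<Rightarrow> 'k" assume "v \<in> cycles k"
  then have v: "v \<in> rib_chains \<gamma> k" "rib_diff v = 0" unfolding cycle_space_def by blast+
  define N where "N = Suc (\<Sum>x\<in>rib_basis \<gamma> k. inversions x)"
  have "inversions x < N" if "x \<in> rib_basis \<gamma> k" for x
    unfolding N_def using member_le_sum[OF that, of inversions] finite_rib_basis by (simp add: less_Suc_eq_le)
  then have "rib_basis \<gamma> k \<subseteq> {y \<in> coarse_blocks \<gamma> {1..n}. length y = k \<and> inversions y < N}"
    by (auto simp: rib_basis_eq)
  then have vN: "v \<in> free {y \<in> coarse_blocks \<gamma> {1..n}. length y = k \<and> inversions y < N}"
    using v(1) free_mono unfolding rib_chains_def by blast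
  have vfin: "v \<in> fin_supp" using v(1) fin_supp_free[OF finite_rib_basis] unfolding rib_chains_def by blast
  obtain u where "u \<in> free {y \<in> coarse_blocks \<gamma> {1..n}. length y = Suc k}" "rib_diff u = v"
    using cycle_is_boundary_below_top[OF \<gamma> assms vN vfin v(2)] by blast
  then have "u \<in> rib_chains \<gamma> (k + 1)" "rib_diff u = v" by (simp_all add: rib_chains_def rib_basis_eq)
  then show "v \<in> boundaries k" unfolding boundary_space_def by blast
qed

definition fixed_points :: "(nat \<Rightarrow> nat) \<Rightarrow> nat \<Rightarrow> nat" where
  "fixed_points w k = card {x \<in> rib_basis \<gamma> k. relabel w x = x}"

text \<open>The Hopf trace argument: the cycles in degree \<open>k + 1\<close> are an extension of the kernel by the image of
  the differential, and the image is all cycles in degree \<open>k\<close> by exactness.\<close>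

lemma has_trace_cycles:
  assumes w: "w permutes {1..n}" and "k \<le> length \<gamma>"
  shows "has_trace (cycles k, {0}) (rib_act w) (\<Sum>j\<le>k. (- 1) ^ (k - j) * of_nat (fixed_points w j) :: 'k::field)"
  using assms(2)
proof (induction k)
  case 0
  have c0: "fixed_points w 0 = 0"
  proof -
    have "rib_basis \<gamma> 0 = {}" using rib_basis_length(1)[of _ 0] by fastforce
    then show ?thesis by (simp add: fixed_points_def)
  qed
  have "cycles 0 = ({0} :: 'k chain set)"
    unfolding cycle_space_def using rib_chains_trivial[of 0] rib_diff_0 by auto
  moreover have "has_trace ({0}, {0}) (rib_act w :: (nat set list \<Rightarrow> 'k) \<Rightarrow> _) 0"
  proof (rule has_trace_zero)
    show "subquotient ({0}, {0 :: nat set list \<Rightarrow> 'k})" by (simp add: subquotient_def)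
    have "rib_act w 0 = (0 :: 'k chain)" unfolding rib_act_def by (rule lin_ext_0)
    then show "endo ({0}, {0}) (rib_act w :: (nat set list \<Rightarrow> 'k) \<Rightarrow> _)"
      unfolding endo_def linear_on_space_def by auto
  qed simp
  moreover have "(\<Sum>j\<le>0. (- 1) ^ (0 - j) * of_nat (fixed_points w j)) = (0 :: 'k)" using c0 by simp
  ultimately show ?case by (simp only:)
next
  case (Suc k)
  let ?U = "rib_chains \<gamma> (Suc k) :: 'k chain set"
  let ?T = "\<lambda>k. \<Sum>j\<le>k. (- 1) ^ (k - j) * of_nat (fixed_points w j) :: 'k"
  have ker: "{u \<in> ?U. rib_diff u = 0} = cycles (Suc k)" by (simp only: cycle_space_def)
  have "rib_diff ` ?U = boundaries k" unfolding boundary_space_def by simp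
  also have "\<dots> = cycles k" by (rule ribbon_exact[symmetric]) (use Suc.prems in simp)
  finally have im: "rib_diff ` ?U = cycles k" .
  have act: "rib_act w ` ?U \<subseteq> ?U" using rib_act_chains[OF w] by blast
  have cyc: "cycles (Suc k) \<subseteq> ?U" unfolding cycle_space_def by blast
  have "rib_act w ` cycles (Suc k) \<subseteq> (cycles (Suc k) :: 'k chain set)"
    using endo_homology[OF w, of "Suc k"] unfolding endo_def homology_def fst_conv by blast
  then obtain t where t: "has_trace (cycles (Suc k), {0}) (rib_act w) (t :: 'k)"
    using has_trace_exists[OF finite_rib_basis subspace_cycles _ linear_on_space_subset[OF linear_rib_act cyc]] cyc
    unfolding rib_chains_def by blast
  have "has_trace (?U, {0}) (rib_act w) (t + ?T k)"
  proof (rule has_trace_kernel_image[OF subspace_rib_chains linear_rib_act act linear_rib_diff])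
    show "rib_diff (rib_act w u) = rib_act w (rib_diff u)" for u :: "nat set list \<Rightarrow> 'k" by (rule rib_act_rib_diff[symmetric])
    show "has_trace ({u \<in> ?U. rib_diff u = 0}, {0}) (rib_act w) t" unfolding ker by (rule t)
    show "has_trace (rib_diff ` ?U, {0}) (rib_act w) (?T k)" unfolding im by (rule Suc.IH) (use Suc.prems in simp)
  qed
  moreover have "has_trace (?U, {0}) (rib_act w) (of_nat (fixed_points w (Suc k)))"
    unfolding rib_chains_def fixed_points_def
  proof (rule has_trace_free[OF finite_rib_basis])
    show "linear_on_space (free (rib_basis \<gamma> (Suc k))) (rib_act w :: (nat set list \<Rightarrow> 'k) \<Rightarrow> _)"
      using linear_rib_act[of "Suc k"] unfolding rib_chains_def .
    show "rib_act w (single x) = (single (relabel w x) :: 'k chain) \<and> relabel w x \<in> rib_basis \<gamma> (Suc k)"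
      if "x \<in> rib_basis \<gamma> (Suc k)" for x
      unfolding rib_act_def using relabel_rib_basis[OF w that] by (simp only: lin_ext_single)
  qed
  ultimately have "t + ?T k = of_nat (fixed_points w (Suc k))" by (rule has_trace_unique)
  then have "t = of_nat (fixed_points w (Suc k)) - ?T k" by (simp add: algebra_simps)
  also have "\<dots> = ?T (Suc k)"
  proof -
    have "(\<Sum>j\<le>k. (- 1) ^ (Suc k - j) * of_nat (fixed_points w j)) = - ?T k"
      unfolding sum_negf[symmetric] by (rule sum.cong) (simp_all add: Suc_diff_le)
    then show ?thesis by simp
  qed
  finally have t': "t = ?T (Suc k)" .
  show ?case using t unfolding t' .
qed

text \<open>The alternating sum of the permutation characters of \<open>M\<^sup>\<beta>\<close>, in the pattern of the ribbon Schur function.\<close>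

definition ribbon_character :: "(nat \<Rightarrow> nat) \<Rightarrow> 'k::field" where
  "ribbon_character w = (\<Sum>\<beta>\<in>coarsenings \<gamma>. (- 1) ^ (length \<gamma> - length \<beta>) *
     of_nat (card {Bs \<in> OSP \<beta> n. relabel w Bs = Bs}))"

lemma alternating_fixed_points:
  "(\<Sum>j\<le>length \<gamma>. (- 1) ^ (length \<gamma> - j) * of_nat (fixed_points w j)) = (ribbon_character w :: 'k::field)"
proof -
  have fin: "finite (coarsenings \<gamma>)" by (rule finite_coarsenings[OF \<gamma>])
  have sum: "sum_list \<gamma> = n" using \<gamma> by (simp add: is_composition_def)
  have len: "length \<beta> \<le> length \<gamma>" if "\<beta> \<in> coarsenings \<gamma>" for \<beta>
  proof -
    have "card (cut_set \<beta>) \<le> card (cut_set \<gamma>)"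
      using that by (intro card_mono finite_cut_set[OF \<gamma>]) (auto simp: coarsenings_def)
    then show ?thesis using card_cut_set[OF \<gamma> n] card_cut_set[OF coarsening_composition[OF \<gamma> that] n] by simp
  qed
  have "fixed_points w j = (\<Sum>\<beta> | \<beta> \<in> coarsenings \<gamma> \<and> length \<beta> = j. card {Bs \<in> OSP \<beta> n. relabel w Bs = Bs})" for j
  proof -
    have "{x \<in> rib_basis \<gamma> j. relabel w x = x} =
        (\<Union>\<beta>\<in>{\<beta> \<in> coarsenings \<gamma>. length \<beta> = j}. {Bs \<in> OSP \<beta> n. relabel w Bs = Bs})"
      by (auto simp: rib_basis_def sum)
    moreover have "card (\<Union>\<beta>\<in>{\<beta> \<in> coarsenings \<gamma>. length \<beta> = j}. {Bs \<in> OSP \<beta> n. relabel w Bs = Bs})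
        = (\<Sum>\<beta> | \<beta> \<in> coarsenings \<gamma> \<and> length \<beta> = j. card {Bs \<in> OSP \<beta> n. relabel w Bs = Bs})"
    proof (rule card_UN_disjoint)
      show "finite {\<beta> \<in> coarsenings \<gamma>. length \<beta> = j}" using fin by simp
      show "\<forall>\<beta>\<in>{\<beta> \<in> coarsenings \<gamma>. length \<beta> = j}. finite {Bs \<in> OSP \<beta> n. relabel w Bs = Bs}"
        using finite_OSP by simp
      have "\<beta> = \<beta>'" if "Bs \<in> OSP \<beta> n" "Bs \<in> OSP \<beta>' n" for \<beta> \<beta>' Bs
        using that unfolding OSP_iff by blast
      then show "\<forall>\<beta>\<in>{\<beta> \<in> coarsenings \<gamma>. length \<beta> = j}. \<forall>\<beta>'\<in>{\<beta> \<in> coarsenings \<gamma>. length \<beta> = j}. \<beta> \<noteq> \<beta>' \<longrightarrow>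
          {Bs \<in> OSP \<beta> n. relabel w Bs = Bs} \<inter> {Bs \<in> OSP \<beta>' n. relabel w Bs = Bs} = {}" by blast
    qed
    ultimately show ?thesis by (simp add: fixed_points_def)
  qed
  then have "(\<Sum>j\<le>length \<gamma>. (- 1) ^ (length \<gamma> - j) * of_nat (fixed_points w j))
      = (\<Sum>j\<le>length \<gamma>. \<Sum>\<beta> | \<beta> \<in> coarsenings \<gamma> \<and> length \<beta> = j.
          (- 1) ^ (length \<gamma> - length \<beta>) * of_nat (card {Bs \<in> OSP \<beta> n. relabel w Bs = Bs}) :: 'k)"
    by (simp add: sum_distrib_left)
  also have "\<dots> = ribbon_character w"
    unfolding ribbon_character_def using fin len by (intro sum.group) auto
  finally show ?thesis .
qed

lemma homology_top: "homology (rib_chains \<gamma>) rib_diff (length \<gamma>) = (cycles (length \<gamma>), {0 :: nat set list \<Rightarrow> 'k::field})"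
proof -
  have "boundaries (length \<gamma>) = {0 :: nat set list \<Rightarrow> 'k}"
    unfolding boundary_space_def using rib_chains_trivial[of "length \<gamma> + 1", where 'k = 'k] rib_diff_0 by simp
  then show ?thesis by (simp add: homology_def)
qed

lemma homology_below_top:
  assumes "k \<noteq> length \<gamma>"
  shows "fst (homology (rib_chains \<gamma>) rib_diff k) \<subseteq> snd (homology (rib_chains \<gamma>) rib_diff k :: (nat set list, 'k::field) subquot)"
proof (cases "k < length \<gamma>")
  case True
  then show ?thesis by (simp only: homology_def fst_conv snd_conv ribbon_exact order_refl)
next
  case False
  then have "cycles k \<subseteq> ({0} :: 'k chain set)"
    using rib_chains_trivial[of k, where 'k = 'k] assms unfolding cycle_space_def by auto
  then show ?thesis using fspace.subspace_0[OF subspace_boundaries] unfolding homology_def fst_conv snd_conv by blast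
qed

lemma has_trace_homology:
  assumes "w permutes {1..n}"
  shows "has_trace (homology (rib_chains \<gamma>) rib_diff k) (rib_act w)
    (if k = length \<gamma> then ribbon_character w else 0 :: 'k::field)"
proof (cases "k = length \<gamma>")
  case True
  show ?thesis
    using has_trace_cycles[OF assms order_refl, where 'k = 'k]
    unfolding True alternating_fixed_points homology_top by simp
next
  case False
  then show ?thesis
    using has_trace_zero[OF subquotient_homology endo_homology[OF assms] homology_below_top[OF False]] by simp
qed

text \<open>All ordered set partitions are fixed by the identity, and their alternating count isolates the words with exactly the descents \<open>D(\<gamma>)\<close>.\<close>

lemma ribbon_character_id:
  "ribbon_character id = (of_nat (card {w \<in> words n (mset_set {1..n}). word_des w = cut_set \<gamma>}) :: 'k::field)"
proof -
  have "ribbon_character id = (\<Sum>\<beta>\<in>coarsenings \<gamma>. (- 1) ^ (length \<gamma> - length \<beta>) *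
      of_nat (card {w \<in> words n (mset_set {1..n}). word_des w \<subseteq> cut_set \<beta>}) :: 'k)"
    unfolding ribbon_character_def
    by (intro sum.cong refl) (simp add: card_OSP card_words_des_subset[OF coarsening_composition[OF \<gamma>]])
  also have "\<dots> = of_nat (card {w \<in> words n (mset_set {1..n}). word_des w = cut_set \<gamma>})"
    by (rule alternating_sum_coarsenings[OF \<gamma> n finite_words])
  finally show ?thesis .
qed

lemma has_trace_id_homology_top:
  "has_trace (homology (rib_chains \<gamma>) rib_diff (length \<gamma>)) (\<lambda>v. v)
    (of_nat (card {w \<in> words n (mset_set {1..n}). word_des w = cut_set \<gamma>}) :: 'k::field)"
proof (rule has_trace_cong)
  show "has_trace (homology (rib_chains \<gamma>) rib_diff (length \<gamma>)) (rib_act id)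
    (of_nat (card {w \<in> words n (mset_set {1..n}). word_des w = cut_set \<gamma>}) :: 'k)"
    using has_trace_homology[OF permutes_id, of "length \<gamma>", where 'k = 'k] ribbon_character_id[where 'k = 'k] by simp
  fix v :: "nat set list \<Rightarrow> 'k" assume "v \<in> fst (homology (rib_chains \<gamma>) rib_diff (length \<gamma>))"
  then have "v \<in> free (rib_basis \<gamma> (length \<gamma>))"
    unfolding homology_def fst_conv cycle_space_def rib_chains_def by blast
  then have "v \<in> fin_supp" by (rule fin_supp_free[OF finite_rib_basis])
  then show "rib_act id v = v" unfolding rib_act_def relabel_id by (rule lin_ext_id)
qed

end

text \<open>A permutation is identified with the word of its values.\<close>

lemma words_des_permutations:
  "card {w \<in> words n (mset_set {1..n}). word_des w = D} = card {\<pi>. \<pi> permutes {1..n} \<and> Des n \<pi> = D}"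
proof -
  have nth: "map \<pi> [1..<Suc n] ! i = \<pi> (Suc i)" if "i < n" for \<pi> :: "nat \<Rightarrow> nat" and i
    using that by (simp del: upt_Suc)
  have des: "word_des (map \<pi> [1..<Suc n]) = Des n \<pi>" for \<pi> :: "nat \<Rightarrow> nat"
  proof -
    have "i \<in> word_des (map \<pi> [1..<Suc n]) \<longleftrightarrow> i \<in> Des n \<pi>" for i
      using nth[of i \<pi>] nth[of "i - 1" \<pi>] by (auto simp: word_des_def Des_def simp del: upt_Suc)
    then show ?thesis by blast
  qed
  have "bij_betw (\<lambda>\<pi>. map \<pi> [1..<Suc n]) {\<pi>. \<pi> permutes {1..n} \<and> Des n \<pi> = D}
      {w \<in> words n (mset_set {1..n}). word_des w = D}"
  proof (rule bij_betw_imageI)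
    show "inj_on (\<lambda>\<pi>. map \<pi> [1..<Suc n]) {\<pi>. \<pi> permutes {1..n} \<and> Des n \<pi> = D}"
    proof (rule inj_onI)
      fix \<pi> \<rho> assume *: "\<pi> \<in> {\<pi>. \<pi> permutes {1..n} \<and> Des n \<pi> = D}" "\<rho> \<in> {\<pi>. \<pi> permutes {1..n} \<and> Des n \<pi> = D}"
        "map \<pi> [1..<Suc n] = map \<rho> [1..<Suc n]"
      show "\<pi> = \<rho>"
      proof
        fix x
        show "\<pi> x = \<rho> x"
        proof (cases "x \<in> {1..n}")
          case True
          then show ?thesis using *(3) by (simp only: map_eq_conv) (simp del: upt_Suc)
        next
          case False
          then show ?thesis using * permutes_not_in[of \<pi> "{1..n}" x] permutes_not_in[of \<rho> "{1..n}" x] by simp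
        qed
      qed
    qed
    show "(\<lambda>\<pi>. map \<pi> [1..<Suc n]) ` {\<pi>. \<pi> permutes {1..n} \<and> Des n \<pi> = D}
        = {w \<in> words n (mset_set {1..n}). word_des w = D}"
    proof (intro equalityI subsetI)
      fix w assume "w \<in> (\<lambda>\<pi>. map \<pi> [1..<Suc n]) ` {\<pi>. \<pi> permutes {1..n} \<and> Des n \<pi> = D}"
      then obtain \<pi> where \<pi>: "w = map \<pi> [1..<Suc n]" "\<pi> permutes {1..n}" "Des n \<pi> = D" by auto
      have "mset w = image_mset \<pi> (mset_set {1..n})"
        by (simp add: \<pi>(1) mset_map[symmetric] mset_upt atLeastLessThanSuc_atLeastAtMost del: upt_Suc mset_map)
          (simp add: mset_map mset_upt atLeastLessThanSuc_atLeastAtMost del: upt_Suc)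
      also have "\<dots> = mset_set (\<pi> ` {1..n})"
        by (rule image_mset_mset_set) (rule inj_on_subset[OF permutes_inj[OF \<pi>(2)] subset_UNIV])
      also have "\<dots> = mset_set {1..n}" using permutes_image[OF \<pi>(2)] by simp
      finally show "w \<in> {w \<in> words n (mset_set {1..n}). word_des w = D}"
        using \<pi> des[of \<pi>] by (simp add: words_def del: upt_Suc)
    next
      fix w assume "w \<in> {w \<in> words n (mset_set {1..n}). word_des w = D}"
      then have w: "mset w = mset_set {1..n}" "length w = n" "word_des w = D" by (auto simp: words_def)
      have set_w: "set w = {1..n}" using w(1) by (metis finite_atLeastAtMost finite_set_mset_mset_set set_mset_mset)
      have "card (set w) = length w" using set_w w(2) by simp
      then have dist: "distinct w" by (rule card_distinct)
      define \<pi> where "\<pi> x = (if x \<in> {1..n} then w ! (x - 1) else x)" for x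
      have map: "map \<pi> [1..<Suc n] = w"
        by (rule nth_equalityI) (simp_all add: \<pi>_def w(2) del: upt_Suc)
      have "\<pi> permutes {1..n}"
      proof (rule bij_imp_permutes)
        have "inj_on \<pi> {1..n}"
          unfolding \<pi>_def inj_on_def using dist w(2) by (auto simp: nth_eq_iff_index_eq)
        moreover have "\<pi> ` {1..n} = {1..n}"
        proof -
          have "\<pi> ` {1..n} = set (map \<pi> [1..<Suc n])" by (simp add: atLeastLessThanSuc_atLeastAtMost del: upt_Suc)
          then show ?thesis unfolding map set_w .
        qed
        ultimately show "bij_betw \<pi> {1..n} {1..n}" by (simp add: bij_betw_def)
      qed (simp only: \<pi>_def if_False)
      moreover have "Des n \<pi> = D" using des[of \<pi>] map w(3) by simp
      ultimately show "w \<in> (\<lambda>\<pi>. map \<pi> [1..<Suc n]) ` {\<pi>. \<pi> permutes {1..n} \<and> Des n \<pi> = D}"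
        using map by (intro image_eqI[of _ _ \<pi>]) auto
    qed
  qed
  from bij_betw_same_card[OF this] show ?thesis by simp
qed

text \<open>The reverse of each maximal run of descents: prepend the cut positions in a suitable order. This
  makes the top homology nonzero.\<close>

lemma ex_word_des:
  assumes "D \<subseteq> {1..<n}"
  shows "\<exists>w. w \<in> words n (mset_set {1..n}) \<and> word_des w = D"
  using assms
proof (induction n arbitrary: D)
  case 0
  then show ?case by (intro exI[of _ "[]"]) (simp add: words_def word_des_def)
next
  case (Suc n)
  obtain v where v: "mset v = mset_set {1..n}" "length v = n" "word_des v = D - {n}"
    using Suc.IH[of "D - {n}"] Suc.prems by (fastforce simp: words_def)
  have set_v: "set v = {1..n}" using v(1) by (metis finite_atLeastAtMost finite_set_mset_mset_set set_mset_mset)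
  show ?case
  proof (cases "n \<in> D")
    case True
    have vne: "v \<noteq> []" using True Suc.prems v(2) by auto
    have "0 < last v" using last_in_set[OF vne] set_v by auto
    moreover have "word_des (map Suc v) = word_des v" by (auto simp: word_des_def)
    moreover have "word_des [1] = {}" by (auto simp: word_des_def)
    ultimately have "word_des (map Suc v @ [1]) = D"
      unfolding word_des_append using vne v(2,3) True by (auto simp: last_map)
    moreover have "mset (map Suc v @ [1]) = mset_set {1..Suc n}"
    proof -
      have "mset (map Suc v) = mset_set (Suc ` {1..n})"
        by (simp add: v(1) image_mset_mset_set)
      moreover have "{1..Suc n} = insert 1 (Suc ` {1..n})" by (auto simp: image_Suc_atLeastAtMost)
      ultimately show ?thesis by simp
    qed
    ultimately show ?thesis using v(2) by (intro exI[of _ "map Suc v @ [1]"]) (simp add: words_def)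
  next
    case False
    have "word_des [Suc n] = {}" by (auto simp: word_des_def)
    moreover have "\<not> Suc n < last v" if "v \<noteq> []" using last_in_set[OF that] set_v by auto
    ultimately have "word_des (v @ [Suc n]) = D"
      unfolding word_des_append using v(3) False by auto
    moreover have "mset (v @ [Suc n]) = mset_set {1..Suc n}"
      using v(1) by (simp add: atLeastAtMostSuc_conv)
    ultimately show ?thesis using v(2) by (intro exI[of _ "v @ [Suc n]"]) (simp add: words_def)
  qed
qed

lemma homology_nonzero_iff:
  assumes n: "1 \<le> n" and \<gamma>: "is_composition n \<gamma>"
  shows "quot_nonzero (homology (rib_chains \<gamma> :: nat \<Rightarrow> (nat set list \<Rightarrow> 'k::field_char_0) set) rib_diff k)
    \<longleftrightarrow> k = length \<gamma>"
    and "quot_dim (homology (rib_chains \<gamma> :: nat \<Rightarrow> 'k chain set) rib_diff (length \<gamma>))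
      = card {\<pi>. \<pi> permutes {1..n} \<and> Des n \<pi> = cut_set \<gamma>}"
proof -
  let ?V = "homology (rib_chains \<gamma> :: nat \<Rightarrow> 'k chain set) rib_diff"
  let ?d = "card {w \<in> words n (mset_set {1..n}). word_des w = cut_set \<gamma>}"
  note tr = has_trace_id_homology_top[OF n \<gamma>, where 'k = 'k]
  show "quot_dim (?V (length \<gamma>)) = card {\<pi>. \<pi> permutes {1..n} \<and> Des n \<pi> = cut_set \<gamma>}"
    using has_trace_id_imp_quot_dim[OF tr] unfolding words_des_permutations .
  obtain w where "w \<in> words n (mset_set {1..n})" "word_des w = cut_set \<gamma>"
    using ex_word_des[OF cut_set_subset[OF \<gamma>]] by blast
  then have "?d \<noteq> 0" using finite_words by (auto simp: card_eq_0_iff)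
  have "quot_nonzero (?V (length \<gamma>))"
  proof (rule ccontr)
    assume "\<not> quot_nonzero (?V (length \<gamma>))"
    then have sub: "fst (?V (length \<gamma>)) \<subseteq> snd (?V (length \<gamma>))" by (simp add: quot_nonzero_def)
    have "subquotient (?V (length \<gamma>))" "endo (?V (length \<gamma>)) (\<lambda>v. v)" using tr by (simp_all add: has_trace_def)
    from has_trace_unique[OF tr has_trace_zero[OF this sub]] show False using \<open>?d \<noteq> 0\<close> by simp
  qed
  then show "quot_nonzero (?V k) \<longleftrightarrow> k = length \<gamma>"
    using homology_below_top[OF n \<gamma>, of k, where 'k = 'k] by (auto simp: quot_nonzero_def)
qed

text \<open>Linearity reduces the claim to the permutation modules \<open>M\<^sup>\<beta>\<close>.\<close>

lemma frob_ribbon: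
  assumes n: "1 \<le> n" and \<gamma>: "is_composition n \<gamma>"
  shows "mconst (1 / fact n) * (\<Sum>w | w permutes {1..n}. mconst (ribbon_character n \<gamma> w) * psum_cycle_type n w)
    = (ribbon \<gamma> :: 'k::field_char_0 mseries)"
proof -
  let ?G = "{w. w permutes {1..n}}"
  let ?fix = "\<lambda>\<beta> w. mconst (of_nat (card {Bs \<in> OSP \<beta> n. relabel w Bs = Bs})) * psum_cycle_type n w :: 'k mseries"
  have "mconst (ribbon_character n \<gamma> w) * psum_cycle_type n w
      = (\<Sum>\<beta>\<in>coarsenings \<gamma>. (- 1) ^ (length \<gamma> - length \<beta>) * ?fix \<beta> w)" for w
    unfolding ribbon_character_def[OF n \<gamma>] mconst_sum mconst_mult mconst_minus_one_power
    by (simp add: sum_distrib_right mult.assoc)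
  then have "(\<Sum>w\<in>?G. mconst (ribbon_character n \<gamma> w) * psum_cycle_type n w)
      = (\<Sum>w\<in>?G. \<Sum>\<beta>\<in>coarsenings \<gamma>. (- 1) ^ (length \<gamma> - length \<beta>) * ?fix \<beta> w)" by simp
  also have "\<dots> = (\<Sum>\<beta>\<in>coarsenings \<gamma>. \<Sum>w\<in>?G. (- 1) ^ (length \<gamma> - length \<beta>) * ?fix \<beta> w)"
    by (rule sum.swap)
  finally have "mconst (1 / fact n) * (\<Sum>w\<in>?G. mconst (ribbon_character n \<gamma> w) * psum_cycle_type n w)
      = (\<Sum>\<beta>\<in>coarsenings \<gamma>. (- 1) ^ (length \<gamma> - length \<beta>) * (mconst (1 / fact n) * (\<Sum>w\<in>?G. ?fix \<beta> w)))"
    by (simp add: sum_distrib_left mult.left_commute)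
  also have "\<dots> = (\<Sum>\<beta>\<in>coarsenings \<gamma>. (- 1) ^ (length \<gamma> - length \<beta>) * hcomp \<beta>)"
  proof (rule sum.cong[OF refl])
    fix \<beta> assume "\<beta> \<in> coarsenings \<gamma>"
    then have "sum_list \<beta> = n" using coarsening_composition[OF \<gamma>] by (simp add: is_composition_def)
    then show "(- 1) ^ (length \<gamma> - length \<beta>) * (mconst (1 / fact n) * (\<Sum>w\<in>?G. ?fix \<beta> w))
        = (- 1) ^ (length \<gamma> - length \<beta>) * (hcomp \<beta> :: 'k mseries)"
      using frob_permutation_module[of \<beta> n, where 'k = 'k] by simp
  qed
  finally show ?thesis by (simp only: ribbon_def)
qed

section \<open>The decorated complex\<close>

lemma all_even_coarsening:
  "is_composition m \<gamma> \<Longrightarrow> \<forall>x\<in>set \<gamma>. even x \<Longrightarrow> \<beta> \<in> coarsenings \<gamma> \<Longrightarrow> \<forall>x\<in>set \<beta>. even x"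
proof (induction \<gamma> arbitrary: m \<beta>)
  case Nil
  then show ?case by (simp add: coarsenings_def)
next
  case (Cons g \<gamma>)
  have g: "0 < g" "is_composition (m - g) \<gamma>" using Cons.prems by simp_all
  show ?case
  proof (cases "\<gamma> = []")
    case True
    then show ?thesis using Cons.prems coarsenings_singleton[OF g(1)] by simp
  next
    case False
    show ?thesis
    proof (cases \<beta>)
      case (Cons b \<beta>')
      then have "b = g \<and> \<beta>' \<in> coarsenings \<gamma> \<or> g < b \<and> (b - g) # \<beta>' \<in> coarsenings \<gamma>"
        using coarsenings_Cons[OF g False] Cons.prems by simp
      then show ?thesis
        using Cons.IH[OF g(2), of \<beta>'] Cons.IH[OF g(2), of "(b - g) # \<beta>'"] Cons.prems Cons by fastforce
    qed simp
  qed
qed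

text \<open>Merging preserves the property of having at most one odd part. Hence the differential of the decorated
  complex never meets two odd adjacent blocks.\<close>

lemma few_odd_coarsening:
  "is_composition m \<gamma> \<Longrightarrow> few_odd \<gamma> \<Longrightarrow> \<beta> \<in> coarsenings \<gamma> \<Longrightarrow> few_odd \<beta>"
proof (induction \<gamma> arbitrary: m \<beta>)
  case Nil
  then have "\<beta> = []" by (auto simp: coarsenings_def)
  then show ?case by (simp add: few_odd_def)
next
  case (Cons g \<gamma>)
  have g: "0 < g" "is_composition (m - g) \<gamma>" using Cons.prems(1) by simp_all
  note fo = Cons.prems(2)[unfolded few_odd_Cons]
  show ?case
  proof (cases "\<gamma> = [] \<or> \<beta> = []")
    case True
    then show ?thesis
    proof
      assume "\<gamma> = []"
      then have "\<beta> = [g]" using Cons.prems(3) coarsenings_singleton[OF g(1)] by simp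
      then show ?thesis by (simp add: few_odd_def)
    next
      assume "\<beta> = []"
      then show ?thesis by (simp add: few_odd_def)
    qed
  next
    case False
    then have "\<gamma> \<noteq> []" by blast
    obtain b \<beta>' where \<beta>: "\<beta> = b # \<beta>'" using False by (meson list.exhaust)
    from Cons.prems(3) have "b = g \<and> \<beta>' \<in> coarsenings \<gamma> \<or> g < b \<and> (b - g) # \<beta>' \<in> coarsenings \<gamma>"
      unfolding \<beta> coarsenings_Cons[OF g \<open>\<gamma> \<noteq> []\<close>] .
    then consider "b = g" "\<beta>' \<in> coarsenings \<gamma>" | "g < b" "(b - g) # \<beta>' \<in> coarsenings \<gamma>" by blast
    then show ?thesis
    proof cases
      case 1
      show ?thesis
      proof (cases "odd g")
        case True
        then have "\<forall>x\<in>set \<gamma>. even x" using fo by simp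
        from all_even_coarsening[OF g(2) this 1(2)] show ?thesis
          unfolding \<beta> few_odd_Cons \<open>b = g\<close> using True by simp
      next
        case False
        then have "few_odd \<gamma>" using fo by simp
        from Cons.IH[OF g(2) this 1(2)] show ?thesis
          unfolding \<beta> few_odd_Cons \<open>b = g\<close> using False by simp
      qed
    next
      case 2
      show ?thesis
      proof (cases "odd g")
        case True
        then have "\<forall>x\<in>set \<gamma>. even x" using fo by simp
        from all_even_coarsening[OF g(2) this 2(2)] have e: "even (b - g)" "\<forall>x\<in>set \<beta>'. even x" by simp_all
        then have "odd b" using True 2(1) by simp
        then show ?thesis unfolding \<beta> few_odd_Cons using e(2) by simp
      next
        case False
        then have "few_odd \<gamma>" using fo by simp
        from Cons.IH[OF g(2) this 2(2)] have e: "few_odd ((b - g) # \<beta>')" .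
        have "odd (b - g) \<longleftrightarrow> odd b" using False 2(1) by simp
        then show ?thesis using e unfolding \<beta> few_odd_Cons by (simp only:)
      qed
    qed
  qed
qed

lemma image_Int_iff: "(\<And>x. x \<in> A \<Longrightarrow> x \<in> P \<longleftrightarrow> f x \<in> Q) \<Longrightarrow> f ` (A \<inter> P) = f ` A \<inter> Q"
  by blast

text \<open>The canonical map on basis elements.\<close>

definition total_decoration :: "dec_osp \<Rightarrow> sum_osp" where
  "total_decoration = (\<lambda>(Bs, \<xi>s). (diamond_list (map card Bs) \<xi>s, Bs))"

lemma component_sum_diff: "component (sum_diff v) \<theta> = rib_diff (component v \<theta>)"
  unfolding sum_diff_def by (rule ext) (simp only: component_def prod.case)

lemma component_eqI: "(\<And>\<theta>. component u \<theta> = component v \<theta>) \<Longrightarrow> u = v"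
proof
  fix p :: sum_osp assume *: "\<And>\<theta>. component u \<theta> = component v \<theta>"
  obtain \<theta> Bs where "p = (\<theta>, Bs)" by (cases p)
  with fun_cong[OF *[of \<theta>], of Bs] show "u p = v p" by (simp only: component_def)
qed

lemma component_0: "component (0 :: sum_osp \<Rightarrow> 'k::field) \<theta> = 0"
  by (rule ext) (simp add: component_def)

lemma dsum_component_iff:
  "v \<in> dsum I U \<longleftrightarrow> (\<forall>\<theta>. if \<theta> \<in> I then component v \<theta> \<in> U \<theta> else component v \<theta> = 0)"
  unfolding dsum_def component_def by (rule mem_Collect_eq)

context
  fixes n :: nat and \<alpha> :: "nat list"
  assumes n: "1 \<le> n" and \<alpha>: "is_composition n \<alpha>" and fo: "few_odd \<alpha>"
begin

lemma sum_\<alpha>: "sum_list \<alpha> = n"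
  using \<alpha> by (simp add: is_composition_def)

lemma fact_comp:
  shows "is_composition n (fact_comp \<alpha> \<theta>)" "cut_set (fact_comp \<alpha> \<theta>) = fact_cuts \<alpha> \<theta>"
    "length (fact_comp \<alpha> \<theta>) = card (fact_cuts \<alpha> \<theta>) + 1"
proof -
  have "fact_cuts \<alpha> \<theta> \<subseteq> {1..<n}" using cut_set_subset[OF \<alpha>] by (auto simp: fact_cuts_def)
  from comp_of_cuts[OF this] show *: "is_composition n (fact_comp \<alpha> \<theta>)" "cut_set (fact_comp \<alpha> \<theta>) = fact_cuts \<alpha> \<theta>"
    by (simp_all add: fact_comp_def sum_\<alpha>)
  show "length (fact_comp \<alpha> \<theta>) = card (fact_cuts \<alpha> \<theta>) + 1"
    using card_cut_set[OF *(1) n] *(2) by simp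
qed

lemma coarsenings_fact_comp:
  "\<beta> \<in> coarsenings (fact_comp \<alpha> \<theta>) \<longleftrightarrow> \<beta> \<in> coarsenings \<alpha> \<and> (\<forall>c\<in>cut_set \<beta>. is_factorization_cut n \<theta> c)"
proof -
  have "sum_list (fact_comp \<alpha> \<theta>) = n" using fact_comp(1) by (simp add: is_composition_def)
  then show ?thesis by (auto simp: coarsenings_def fact_comp(2) sum_\<alpha> fact_cuts_def)
qed

lemma dec_basis_iff:
  "(Bs, \<xi>s) \<in> dec_basis \<alpha> k \<longleftrightarrow> map card Bs \<in> coarsenings \<alpha> \<and> length Bs = k \<and> Bs \<in> OSP (map card Bs) n \<and>
     \<xi>s \<in> dec_lists (map card Bs)"
proof
  assume "(Bs, \<xi>s) \<in> dec_basis \<alpha> k"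
  then obtain \<beta> where \<beta>: "\<beta> \<in> coarsenings \<alpha>" "length \<beta> = k" "Bs \<in> OSP \<beta> n" "length \<xi>s = k"
    "\<forall>i<k. \<xi>s ! i \<in> decorations (\<beta> ! i)" by (auto simp: dec_basis_def sum_\<alpha>)
  have "map card Bs = \<beta>" using \<beta>(3) by (simp add: OSP_def)
  moreover from this have "length Bs = k" using \<beta>(2) by auto
  ultimately show "map card Bs \<in> coarsenings \<alpha> \<and> length Bs = k \<and> Bs \<in> OSP (map card Bs) n \<and> \<xi>s \<in> dec_lists (map card Bs)"
    using \<beta> by (simp add: dec_lists_def list_all2_conv_all_nth)
next
  assume *: "map card Bs \<in> coarsenings \<alpha> \<and> length Bs = k \<and> Bs \<in> OSP (map card Bs) n \<and> \<xi>s \<in> dec_lists (map card Bs)"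
  then show "(Bs, \<xi>s) \<in> dec_basis \<alpha> k"
    unfolding dec_basis_def UN_iff sum_\<alpha>
    by (intro bexI[of _ "map card Bs"]) (auto simp: dec_lists_def list_all2_conv_all_nth)
qed

lemma finite_dec_basis: "finite (dec_basis \<alpha> k)"
proof -
  have "finite {\<xi>s. length \<xi>s = k \<and> (\<forall>i<k. \<xi>s ! i \<in> decorations (\<beta> ! i))}" for \<beta>
  proof (rule finite_subset)
    show "{\<xi>s. length \<xi>s = k \<and> (\<forall>i<k. \<xi>s ! i \<in> decorations (\<beta> ! i))}
        \<subseteq> {\<xi>s. set \<xi>s \<subseteq> (\<Union>i<k. decorations (\<beta> ! i)) \<and> length \<xi>s = k}"
      by (fastforce simp: in_set_conv_nth)
  qed (simp add: finite_lists_length_eq finite_decorations)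
  then show ?thesis unfolding dec_basis_def using finite_coarsenings[OF \<alpha>] finite_OSP by auto
qed

definition sum_basis :: "nat \<Rightarrow> sum_osp set" where
  "sum_basis k = {(\<theta>, Bs). \<theta> \<in> decorations n \<and> Bs \<in> rib_basis (fact_comp \<alpha> \<theta>) k}"

lemma sum_basis_iff:
  "(\<theta>, Bs) \<in> sum_basis k \<longleftrightarrow> \<theta> \<in> decorations n \<and> map card Bs \<in> coarsenings \<alpha> \<and>
     (\<forall>c\<in>cut_set (map card Bs). is_factorization_cut n \<theta> c) \<and> length Bs = k \<and> Bs \<in> OSP (map card Bs) n"
proof -
  have "Bs \<in> OSP (map card Bs) n \<longleftrightarrow> disj_list Bs \<and> \<Union> (set Bs) = {1..n}"
    unfolding OSP_iff by blast
  then show ?thesis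
    unfolding sum_basis_def rib_basis_eq[OF n fact_comp(1)] coarse_blocks_def coarsenings_fact_comp by blast
qed

lemma dec_list_facts:
  assumes "map card Bs \<in> coarsenings \<alpha>"
  shows "is_composition n (map card Bs)" "few_odd (map card Bs)"
  using coarsening_composition[OF \<alpha> assms] few_odd_coarsening[OF \<alpha> fo assms] by auto

text \<open>Unique factorization for the block sizes of each ordered set partition, together with the
  description of the coarsenings of \<open>\<gamma>\<^sub>\<alpha>(\<theta>)\<close>.\<close>

lemma total_decoration_bij: "bij_betw total_decoration (dec_basis \<alpha> k) (sum_basis k)"
proof (rule bij_betw_imageI)
  show "inj_on total_decoration (dec_basis \<alpha> k)"
  proof (rule inj_onI)
    fix x y assume xy: "x \<in> dec_basis \<alpha> k" "y \<in> dec_basis \<alpha> k" "total_decoration x = total_decoration y"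
    obtain Bs \<xi>s Cs \<eta>s where p: "x = (Bs, \<xi>s)" "y = (Cs, \<eta>s)" by (cases x; cases y) auto
    have BC: "Bs = Cs" and eq: "diamond_list (map card Bs) \<xi>s = diamond_list (map card Bs) \<eta>s"
      using xy(3) by (auto simp: p total_decoration_def)
    have \<beta>: "map card Bs \<in> coarsenings \<alpha>" "\<xi>s \<in> dec_lists (map card Bs)" "\<eta>s \<in> dec_lists (map card Bs)"
      using xy(1,2) unfolding p BC dec_basis_iff by auto
    note facts = dec_list_facts[OF \<beta>(1)]
    have "\<xi>s = \<eta>s"
      using inj_onD[OF bij_betw_imp_inj_on[OF diamond_list_bij[OF facts(1) n facts(2)]] eq \<beta>(2,3)] .
    then show "x = y" using p BC by simp
  qed
  show "total_decoration ` dec_basis \<alpha> k = sum_basis k"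
  proof (intro equalityI subsetI)
    fix y assume "y \<in> total_decoration ` dec_basis \<alpha> k"
    then obtain Bs \<xi>s where x: "(Bs, \<xi>s) \<in> dec_basis \<alpha> k" "y = (diamond_list (map card Bs) \<xi>s, Bs)"
      by (auto simp: total_decoration_def)
    have \<beta>: "map card Bs \<in> coarsenings \<alpha>" "length Bs = k" "Bs \<in> OSP (map card Bs) n" "\<xi>s \<in> dec_lists (map card Bs)"
      using x(1) unfolding dec_basis_iff by auto
    note facts = dec_list_facts[OF \<beta>(1)]
    have "diamond_list (map card Bs) \<xi>s \<in> {\<theta> \<in> decorations n. \<forall>c\<in>cut_set (map card Bs). is_factorization_cut n \<theta> c}"
      using bij_betwE[OF diamond_list_bij[OF facts(1) n facts(2)]] \<beta>(4) by blast
    then show "y \<in> sum_basis k" unfolding x(2) sum_basis_iff using \<beta> by blast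
  next
    fix y assume y: "y \<in> sum_basis k"
    obtain \<theta> Bs where p: "y = (\<theta>, Bs)" by (cases y)
    have \<beta>: "map card Bs \<in> coarsenings \<alpha>" "length Bs = k" "Bs \<in> OSP (map card Bs) n"
      "\<theta> \<in> {\<theta> \<in> decorations n. \<forall>c\<in>cut_set (map card Bs). is_factorization_cut n \<theta> c}"
      using y unfolding p sum_basis_iff by auto
    note facts = dec_list_facts[OF \<beta>(1)]
    obtain \<xi>s where "\<xi>s \<in> dec_lists (map card Bs)" "\<theta> = diamond_list (map card Bs) \<xi>s"
      using \<beta>(4) unfolding bij_betw_imp_surj_on[OF diamond_list_bij[OF facts(1) n facts(2)], symmetric] by blast
    then show "y \<in> total_decoration ` dec_basis \<alpha> k"
      using \<beta> by (intro image_eqI[of _ _ "(Bs, \<xi>s)"]) (simp_all add: p total_decoration_def dec_basis_iff)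
  qed
qed

lemma dec_chains_eq: "dec_chains \<alpha> k = free (dec_basis \<alpha> k)"
  by (simp add: dec_chains_def)

lemma sum_chains_eq: "sum_chains \<alpha> k = (free (sum_basis k) :: (sum_osp \<Rightarrow> 'k::field) set)"
proof (intro equalityI subsetI)
  fix v :: "sum_osp \<Rightarrow> 'k" assume v: "v \<in> sum_chains \<alpha> k"
  show "v \<in> free (sum_basis k)"
  proof (rule freeI)
    fix p assume "p \<notin> sum_basis k"
    obtain \<theta> Bs where p: "p = (\<theta>, Bs)" by (cases p)
    have *: "if \<theta> \<in> decorations n then component v \<theta> \<in> rib_chains (fact_comp \<alpha> \<theta>) k else component v \<theta> = 0"
      using v unfolding sum_chains_def mem_Collect_eq sum_\<alpha> by blast
    have "component v \<theta> Bs = 0"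
    proof (cases "\<theta> \<in> decorations n")
      case True
      then have "Bs \<notin> rib_basis (fact_comp \<alpha> \<theta>) k" using \<open>p \<notin> sum_basis k\<close> by (simp add: p sum_basis_def)
      moreover have "component v \<theta> \<in> free (rib_basis (fact_comp \<alpha> \<theta>) k)"
        using * True unfolding rib_chains_def by simp
      ultimately show ?thesis by (simp add: freeD)
    next
      case False
      then have "component v \<theta> = 0" using * by simp
      then show ?thesis using fun_cong[of "component v \<theta>" 0 Bs] by simp
    qed
    then show "v p = 0" by (simp add: p component_def)
  qed
next
  fix v :: "sum_osp \<Rightarrow> 'k" assume v: "v \<in> free (sum_basis k)"
  show "v \<in> sum_chains \<alpha> k"
    unfolding sum_chains_def mem_Collect_eq sum_\<alpha>
  proof
    fix \<theta>
    have "component v \<theta> \<in> rib_chains (fact_comp \<alpha> \<theta>) k"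
      unfolding rib_chains_def component_def
      by (rule freeI, rule freeD[OF v]) (simp add: sum_basis_def)
    moreover have "component v \<theta> = 0" if "\<theta> \<notin> decorations n"
    proof
      fix Bs show "component v \<theta> Bs = 0 Bs"
        unfolding component_def zero_fun_apply by (rule freeD[OF v]) (simp add: sum_basis_def that)
    qed
    ultimately show "if \<theta> \<in> decorations n then component v \<theta> \<in> rib_chains (fact_comp \<alpha> \<theta>) k else component v \<theta> = 0"
      by (simp only: if_cancel split: if_split) blast
  qed
qed

text \<open>The canonical isomorphism in all homological degrees at once.\<close>

definition decomposition :: "(dec_osp \<Rightarrow> 'k::field) \<Rightarrow> (sum_osp \<Rightarrow> 'k)" where
  "decomposition = lin_ext (\<lambda>x. single (total_decoration x))"

lemma component_single: "component (single (\<theta>, Bs)) \<theta>' = (if \<theta>' = \<theta> then single Bs else 0)"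
  by (rule ext) (simp add: component_def single_apply)

lemma component_fin_supp:
  assumes "v \<in> fin_supp"
  shows "component v \<theta> \<in> fin_supp"
proof -
  have "finite (snd ` {p. v p \<noteq> 0})" using assms by (simp add: fin_supp_def)
  moreover have "{Bs. component v \<theta> Bs \<noteq> 0} \<subseteq> snd ` {p. v p \<noteq> 0}" by (force simp: component_def)
  ultimately show ?thesis unfolding fin_supp_def by (metis finite_subset mem_Collect_eq)
qed

lemma linear_component_lift:
  fixes f :: "(nat set list \<Rightarrow> 'k::field) \<Rightarrow> (nat set list \<Rightarrow> 'k)"
  assumes "linear_on_space fin_supp f"
  shows "linear_on_space fin_supp (\<lambda>v. \<lambda>(\<theta>, Bs). f (component v \<theta>) Bs)"
  unfolding linear_on_space_def
proof (intro conjI ballI allI)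
  fix u v :: "sum_osp \<Rightarrow> 'k" assume "u \<in> fin_supp" "v \<in> fin_supp"
  then have *: "component u \<theta> \<in> fin_supp" "component v \<theta> \<in> fin_supp" for \<theta> by (simp_all only: component_fin_supp)
  have "component (u + v) \<theta> = component u \<theta> + component v \<theta>" for \<theta> by (rule ext) (simp add: component_def)
  then have "f (component (u + v) \<theta>) = f (component u \<theta>) + f (component v \<theta>)" for \<theta>
    using linear_on_space_add[OF assms *] by (simp only:)
  then show "(\<lambda>(\<theta>, Bs). f (component (u + v) \<theta>) Bs)
      = (\<lambda>(\<theta>, Bs). f (component u \<theta>) Bs) + (\<lambda>(\<theta>, Bs). f (component v \<theta>) Bs)"
    by (intro ext) (simp add: case_prod_unfold)
next
  fix c and v :: "sum_osp \<Rightarrow> 'k" assume "v \<in> fin_supp"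
  then have *: "component v \<theta> \<in> fin_supp" for \<theta> by (simp only: component_fin_supp)
  have "component (scale c v) \<theta> = scale c (component v \<theta>)" for \<theta> by (rule ext) (simp add: component_def)
  then have "f (component (scale c v) \<theta>) = scale c (f (component v \<theta>))" for \<theta>
    using linear_on_space_scale[OF assms *] by (simp only:)
  then show "(\<lambda>(\<theta>, Bs). f (component (scale c v) \<theta>) Bs) = scale c (\<lambda>(\<theta>, Bs). f (component v \<theta>) Bs)"
    by (intro ext) (simp add: case_prod_unfold)
qed

lemma linear_sum_diff: "linear_on_space fin_supp (sum_diff :: (sum_osp \<Rightarrow> 'k::field) \<Rightarrow> _)"
  unfolding sum_diff_def rib_diff_eq by (rule linear_component_lift[OF linear_lin_ext_fin])

lemma linear_sum_act: "linear_on_space fin_supp (sum_act w :: (sum_osp \<Rightarrow> 'k::field) \<Rightarrow> _)"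
  unfolding sum_act_def rib_act_def by (rule linear_component_lift[OF linear_lin_ext_fin])

lemma merge_in_coarse_blocks:
  "block_list (P @ B # C # R) \<Longrightarrow>
   P @ (B \<union> C) # R \<in> coarse_blocks (map card (P @ B # C # R)) (\<Union> (set (P @ B # C # R)))"
proof (induction P)
  case Nil
  show ?case using coarse_blocks_merge[OF block_list_self[OF Nil[unfolded append_Nil]]] unfolding append_Nil .
next
  case (Cons D P)
  let ?T = "P @ B # C # R"
  have bl: "finite D" "D \<noteq> {}" "D \<inter> \<Union> (set ?T) = {}" "block_list ?T"
    using Cons.prems unfolding append_Cons block_list_Cons by blast+
  have "0 < card D" using bl(1,2) by (simp add: card_gt_0_iff)
  moreover have "is_composition (sum_list (map card ?T)) (map card ?T)"
    using bl(4) by (auto simp: block_list_def is_composition_def card_gt_0_iff)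
  moreover have "map card ?T \<noteq> []" by simp
  ultimately have "D # P @ (B \<union> C) # R \<in> coarse_blocks (card D # map card ?T) (D \<union> \<Union> (set ?T))"
    using coarse_blocks_Cons_eq[OF _ _ _ refl bl(3)] Cons.IH[OF bl(4)] by blast
  moreover have "card D # map card ?T = map card ((D # P) @ B # C # R)"
    "D \<union> \<Union> (set ?T) = \<Union> (set ((D # P) @ B # C # R))" by simp_all
  ultimately show ?case by (simp only: append_Cons)
qed

text \<open>A face of a decorated list has the same total product, and it is again a single basis element since not both merged blocks are odd.\<close>

lemma dec_face_eq:
  assumes x: "(Bs, \<xi>s) \<in> dec_basis \<alpha> k" and i: "i \<in> {1..<length Bs}"
  shows "\<exists>y. dec_face i (Bs, \<xi>s) = (single y :: dec_osp \<Rightarrow> 'k::field) \<and>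
     total_decoration y = (diamond_list (map card Bs) \<xi>s, merge_blocks i Bs) \<and> y \<in> dec_basis \<alpha> (k - 1)"
proof -
  have \<beta>: "map card Bs \<in> coarsenings \<alpha>" "length Bs = k" "Bs \<in> OSP (map card Bs) n" "\<xi>s \<in> dec_lists (map card Bs)"
    using x unfolding dec_basis_iff by auto
  note facts = dec_list_facts[OF \<beta>(1)]
  obtain j where j: "i = Suc j" "Suc j < length Bs" using i by (cases i) auto
  have len: "length \<xi>s = length Bs" using \<beta>(4) by (auto simp: dec_lists_def dest: list_all2_lengthD)
  define B C P R where "B = Bs ! j" and "C = Bs ! Suc j" and "P = take j Bs" and "R = drop (Suc (Suc j)) Bs"
  define \<xi> \<eta> p r where "\<xi> = \<xi>s ! j" and "\<eta> = \<xi>s ! Suc j" and "p = take j \<xi>s" and "r = drop (Suc (Suc j)) \<xi>s"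
  have Bs: "Bs = P @ B # C # R"
    unfolding B_def C_def P_def R_def using j by (simp add: Cons_nth_drop_Suc id_take_nth_drop[symmetric])
  have \<xi>s: "\<xi>s = p @ \<xi> # \<eta> # r"
    unfolding \<xi>_def \<eta>_def p_def r_def using j len by (simp add: Cons_nth_drop_Suc id_take_nth_drop[symmetric])
  have lens: "length P = j" "length p = j" using j len by (simp_all add: P_def p_def)
  have B: "Bs ! (i - 1) = B" "Bs ! i = C" "\<xi>s ! (i - 1) = \<xi>" "\<xi>s ! i = \<eta>"
    using j by (simp_all add: B_def C_def \<xi>_def \<eta>_def)
  have merge: "merge_blocks i Bs = P @ (B \<union> C) # R"
    unfolding merge_blocks_def B using j by (simp add: P_def R_def)
  have "few_odd (card B # card C # map card R)"
    using facts(2) unfolding Bs few_odd_def by (auto split: if_splits)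
  then have par: "\<not> (odd (card B) \<and> odd (card C))" by (auto simp: few_odd_Cons split: if_splits)
  have bl: "block_list Bs"
    using \<beta>(3) facts(1) unfolding block_list_def OSP_iff is_composition_def by (auto simp: card_gt_0_iff)
  have "block_list (B # C # R)" using bl unfolding block_list_def Bs by (induction P) auto
  then have card: "card (B \<union> C) = card B + card C"
    by (intro card_Un_disjoint) (auto simp: block_list_Cons)
  let ?y = "(merge_blocks i Bs, p @ diamond (card B) \<xi> \<eta> # r)"
  have face: "dec_face i (Bs, \<xi>s) = (single ?y :: dec_osp \<Rightarrow> 'k)"
    unfolding dec_face_def prod.case B using par j by (simp only: if_False) (simp add: p_def r_def)
  have map: "map card Bs = map card P @ card B # card C # map card R" by (simp add: Bs)
  have "p \<in> dec_lists (map card P)" "\<xi> # \<eta> # r \<in> dec_lists (card B # card C # map card R)"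
    using \<beta>(4) dec_lists_append[of p "map card P" "\<xi> # \<eta> # r" "card B # card C # map card R"] lens
    unfolding map \<xi>s by simp_all
  from diamond_list_merge[OF facts(1)[unfolded map] facts(2)[unfolded map] this]
  have list: "diamond_list (map card P @ (card B + card C) # map card R) (p @ diamond (card B) \<xi> \<eta> # r)
      = diamond_list (map card Bs) \<xi>s"
    "p @ diamond (card B) \<xi> \<eta> # r \<in> dec_lists (map card P @ (card B + card C) # map card R)"
    unfolding map \<xi>s by blast+
  then have "total_decoration ?y = (diamond_list (map card Bs) \<xi>s, merge_blocks i Bs)"
    unfolding total_decoration_def merge using list(1) by (simp add: card)
  moreover have "?y \<in> dec_basis \<alpha> (k - 1)"
  proof -
    have "\<Union> (set Bs) = {1..n}" using \<beta>(3) unfolding OSP_iff by blast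
    then have "merge_blocks i Bs \<in> coarse_blocks (map card Bs) {1..n}"
      using merge_in_coarse_blocks[OF bl[unfolded Bs]] unfolding merge Bs[symmetric] by (simp only:)
    from coarse_blocks_trans[OF \<beta>(1) this] have "merge_blocks i Bs \<in> coarse_blocks \<alpha> {1..n}" .
    then have "map card (merge_blocks i Bs) \<in> coarsenings \<alpha>"
      "merge_blocks i Bs \<in> OSP (map card (merge_blocks i Bs)) n"
      unfolding coarse_blocks_def OSP_iff by blast+
    moreover have "length (merge_blocks i Bs) = k - 1" unfolding merge using \<beta>(2) Bs by simp
    moreover have "map card (merge_blocks i Bs) = map card P @ (card B + card C) # map card R"
      unfolding merge by (simp add: card)
    ultimately show ?thesis unfolding dec_basis_iff using list(2) by (simp only:)
  qed
  ultimately show ?thesis using face by blast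
qed

lemma dec_diff_chains:
  assumes "v \<in> dec_chains \<alpha> k"
  shows "dec_diff v \<in> (dec_chains \<alpha> (k - 1) :: (dec_osp \<Rightarrow> 'k::field) set)"
  unfolding dec_chains_eq dec_diff_def
proof (rule lin_ext_in_free[OF assms[unfolded dec_chains_eq]])
  fix x assume x: "x \<in> dec_basis \<alpha> k"
  obtain Bs \<xi>s where p: "x = (Bs, \<xi>s)" by (cases x)
  show "(\<Sum>i = 1..<length (fst x). scale ((- 1) ^ (i - 1)) (dec_face i x)) \<in> (free (dec_basis \<alpha> (k - 1)) :: (dec_osp \<Rightarrow> 'k) set)"
  proof (intro fspace.subspace_sum[OF subspace_free] fspace.subspace_scale[OF subspace_free])
    fix i assume "i \<in> {1..<length (fst x)}"
    then have i: "i \<in> {1..<length Bs}" unfolding p fst_conv .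
    obtain y where "dec_face i (Bs, \<xi>s) = (single y :: dec_osp \<Rightarrow> 'k)" "y \<in> dec_basis \<alpha> (k - 1)"
      using dec_face_eq[OF x[unfolded p] i] by blast
    then show "dec_face i x \<in> (free (dec_basis \<alpha> (k - 1)) :: (dec_osp \<Rightarrow> 'k) set)"
      unfolding p by (simp only: single_in_free)
  qed
qed

lemma linear_decomposition: "linear_on_space (dec_chains \<alpha> k) (decomposition :: (dec_osp \<Rightarrow> 'k::field) \<Rightarrow> _)"
  unfolding dec_chains_eq decomposition_def by (rule linear_lin_ext[OF finite_dec_basis])

lemma decomposition_bij: "bij_betw decomposition (dec_chains \<alpha> k) (sum_chains \<alpha> k :: (sum_osp \<Rightarrow> 'k::field) set)"
  unfolding dec_chains_eq sum_chains_eq decomposition_def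
  by (rule bij_betw_free[OF finite_dec_basis total_decoration_bij])

lemma decomposition_single: "decomposition (single x) = single (total_decoration x)"
  by (simp only: decomposition_def lin_ext_single)

text \<open>Both sides are compared on basis elements, where every face is matched with the face of the underlying list.\<close>

lemma decomposition_diff:
  assumes v: "v \<in> dec_chains \<alpha> k"
  shows "decomposition (dec_diff v) = (sum_diff (decomposition v) :: sum_osp \<Rightarrow> 'k::field)"
proof -
  let ?d = "\<lambda>x. \<Sum>i = 1..<length (fst x). scale ((- 1) ^ (i - 1)) (dec_face i x) :: dec_osp \<Rightarrow> 'k"
  have face_fin: "dec_face i x \<in> (fin_supp :: (dec_osp \<Rightarrow> 'k) set)" for i x
    by (cases x) (simp add: dec_face_def split: if_split del: zero_fun_apply)
  have d_fin: "?d x \<in> fin_supp" for x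
    by (intro fspace.subspace_sum[OF subspace_fin_supp] fin_supp_intros face_fin)
  have "decomposition (dec_diff v) = lin_ext (\<lambda>x. decomposition (?d x)) v"
    unfolding decomposition_def dec_diff_def by (rule lin_ext_comp) (rule d_fin)
  also have "\<dots> = lin_ext (\<lambda>x. sum_diff (single (total_decoration x))) v"
  proof (rule lin_ext_cong_free[OF v[unfolded dec_chains_eq]])
    fix x assume x: "x \<in> dec_basis \<alpha> k"
    obtain Bs \<xi>s where p: "x = (Bs, \<xi>s)" by (cases x)
    let ?\<theta> = "diamond_list (map card Bs) \<xi>s"
    have face: "decomposition (dec_face i x) = (single (?\<theta>, merge_blocks i Bs) :: sum_osp \<Rightarrow> 'k)"
      if i: "i \<in> {1..<length Bs}" for i
    proof -
      obtain y where "dec_face i (Bs, \<xi>s) = (single y :: dec_osp \<Rightarrow> 'k)" "total_decoration y = (?\<theta>, merge_blocks i Bs)"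
        using dec_face_eq[OF x[unfolded p] i] by blast
      then show ?thesis by (simp only: p decomposition_single)
    qed
    have "decomposition (?d x) = (\<Sum>i = 1..<length (fst x). scale ((- 1) ^ (i - 1)) (decomposition (dec_face i x)))"
      unfolding decomposition_def
      by (rule linear_on_space_sum_scale[OF linear_lin_ext_fin subspace_fin_supp face_fin])
    also have "\<dots> = (\<Sum>i = 1..<length Bs. scale ((- 1) ^ (i - 1)) (single (?\<theta>, merge_blocks i Bs)))"
      unfolding p fst_conv by (rule sum.cong[OF refl]) (simp only: face[unfolded p])
    also have "\<dots> = sum_diff (single (?\<theta>, Bs))"
    proof
      fix q :: sum_osp obtain \<theta>' Cs where q: "q = (\<theta>', Cs)" by (cases q)
      have "(\<Sum>i = 1..<length Bs. scale ((- 1) ^ (i - 1)) (single (?\<theta>, merge_blocks i Bs))) q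
          = (if \<theta>' = ?\<theta> then bdry Bs Cs else 0 :: 'k)"
        by (auto simp: q sum_fun_apply single_apply bdry_def)
      also have "\<dots> = sum_diff (single (?\<theta>, Bs)) q"
      proof (cases "\<theta>' = ?\<theta>")
        case True
        then show ?thesis by (simp only: q sum_diff_def prod.case component_single True simp_thms if_True rib_diff_single)
      next
        case False
        then show ?thesis by (simp only: q sum_diff_def prod.case component_single False simp_thms if_False rib_diff_0[OF n \<alpha>] zero_fun_apply)
      qed
      finally show "(\<Sum>i = 1..<length Bs. scale ((- 1) ^ (i - 1)) (single (?\<theta>, merge_blocks i Bs))) q
          = (sum_diff (single (?\<theta>, Bs)) :: sum_osp \<Rightarrow> 'k) q" .
    qed
    finally show "decomposition (?d x) = (sum_diff (single (total_decoration x)) :: sum_osp \<Rightarrow> 'k)"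
      by (simp only: p total_decoration_def prod.case)
  qed
  also have "\<dots> = sum_diff (decomposition v)"
    unfolding decomposition_def lin_ext_def[of "\<lambda>x. single (total_decoration x)"] lin_ext_def[of "\<lambda>x. sum_diff (single (total_decoration x))"]
    by (rule linear_on_space_sum_scale[OF linear_sum_diff subspace_fin_supp, symmetric]) simp
  finally show ?thesis .
qed

lemma decomposition_act:
  assumes w: "w permutes {1..n}" and v: "v \<in> dec_chains \<alpha> k"
  shows "decomposition (dec_act w v) = (sum_act w (decomposition v) :: sum_osp \<Rightarrow> 'k::field)"
proof -
  let ?a = "\<lambda>(Bs, \<xi>s). single (relabel w Bs, \<xi>s) :: dec_osp \<Rightarrow> 'k"
  have "decomposition (dec_act w v) = lin_ext (\<lambda>x. decomposition (?a x)) v"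
    unfolding decomposition_def dec_act_def by (rule lin_ext_comp) (simp add: case_prod_unfold)
  also have "\<dots> = lin_ext (\<lambda>x. sum_act w (single (total_decoration x))) v"
  proof (rule lin_ext_cong)
    fix x :: dec_osp obtain Bs \<xi>s where p: "x = (Bs, \<xi>s)" by (cases x)
    let ?\<theta> = "diamond_list (map card Bs) \<xi>s"
    have "map card (relabel w Bs) = map card Bs"
      unfolding relabel_def by (simp add: card_image inj_on_subset[OF permutes_inj[OF w]])
    then have "decomposition (?a x) = single (?\<theta>, relabel w Bs)"
      by (simp only: p prod.case decomposition_single total_decoration_def)
    also have "\<dots> = sum_act w (single (?\<theta>, Bs))"
    proof
      fix q :: sum_osp obtain \<theta>' Cs where q: "q = (\<theta>', Cs)" by (cases q)
      have act0: "rib_act w 0 = (0 :: 'k chain)" unfolding rib_act_def by (rule lin_ext_0)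
      show "single (?\<theta>, relabel w Bs) q = (sum_act w (single (?\<theta>, Bs)) :: sum_osp \<Rightarrow> 'k) q"
      proof (cases "\<theta>' = ?\<theta>")
        case True
        have "sum_act w (single (?\<theta>, Bs)) q = (single (relabel w Bs) Cs :: 'k)"
          by (simp only: q sum_act_def prod.case component_single True simp_thms if_True rib_act_def lin_ext_single)
        then show ?thesis by (simp add: q True single_apply)
      next
        case False
        have "sum_act w (single (?\<theta>, Bs)) q = (0 :: 'k)"
          by (simp only: q sum_act_def prod.case component_single False simp_thms if_False act0 zero_fun_apply)
        then show ?thesis using False by (simp add: q single_apply)
      qed
    qed
    finally show "decomposition (?a x) = (sum_act w (single (total_decoration x)) :: sum_osp \<Rightarrow> 'k)"
      by (simp only: p total_decoration_def prod.case)
  qed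
  also have "\<dots> = sum_act w (decomposition v)"
    unfolding decomposition_def lin_ext_def[of "\<lambda>x. single (total_decoration x)"] lin_ext_def[of "\<lambda>x. sum_act w (single (total_decoration x))"]
    by (rule linear_on_space_sum_scale[OF linear_sum_act subspace_fin_supp, symmetric]) simp
  finally show ?thesis .
qed

lemma sum_part_eq: "sum_part n d e = (free {(\<theta>, Bs). deg_t n \<theta> = d \<and> deg_q n \<theta> = e} :: (sum_osp \<Rightarrow> 'k::field) set)"
proof -
  have "v \<in> sum_part n d e \<longleftrightarrow> v \<in> free {(\<theta>, Bs). deg_t n \<theta> = d \<and> deg_q n \<theta> = e}" for v :: "sum_osp \<Rightarrow> 'k"
  proof -
    have c: "component v \<theta> \<noteq> 0 \<longleftrightarrow> (\<exists>Bs. v (\<theta>, Bs) \<noteq> 0)" for \<theta>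
      unfolding component_def fun_eq_iff by simp
    show ?thesis unfolding sum_part_def free_def mem_Collect_eq c by auto
  qed
  then show ?thesis by blast
qed

text \<open>Bidegrees are additive under the product, so the bijection of bases preserves them.\<close>

lemma decomposition_part:
  "decomposition ` (dec_chains \<alpha> k \<inter> dec_part d e) = (sum_chains \<alpha> k \<inter> sum_part n d e :: (sum_osp \<Rightarrow> 'k::field) set)"
proof -
  let ?P = "{x. dec_deg_t x = d \<and> dec_deg_q x = e}" and ?Q = "{(\<theta>, Bs). deg_t n \<theta> = d \<and> deg_q n \<theta> = e} :: sum_osp set"
  have deg: "x \<in> ?P \<longleftrightarrow> total_decoration x \<in> ?Q" if "x \<in> dec_basis \<alpha> k" for x
  proof -
    obtain Bs \<xi>s where p: "x = (Bs, \<xi>s)" by (cases x)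
    have \<beta>: "map card Bs \<in> coarsenings \<alpha>" "\<xi>s \<in> dec_lists (map card Bs)"
      using that unfolding p dec_basis_iff by auto
    note facts = dec_list_facts[OF \<beta>(1)]
    have "dec_deg_t x = deg_t n (diamond_list (map card Bs) \<xi>s) \<and> dec_deg_q x = deg_q n (diamond_list (map card Bs) \<xi>s)"
      using deg_diamond_list[OF facts(1) n facts(2) \<beta>(2)] by (simp add: p dec_deg_t_def dec_deg_q_def)
    then show ?thesis by (simp add: p total_decoration_def)
  qed
  have "bij_betw total_decoration (dec_basis \<alpha> k \<inter> ?P) (sum_basis k \<inter> ?Q)"
  proof (rule bij_betw_subset[OF total_decoration_bij])
    have "total_decoration ` (dec_basis \<alpha> k \<inter> ?P) = total_decoration ` dec_basis \<alpha> k \<inter> ?Q"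
      by (rule image_Int_iff) (rule deg)
    then show "total_decoration ` (dec_basis \<alpha> k \<inter> ?P) = sum_basis k \<inter> ?Q"
      unfolding bij_betw_imp_surj_on[OF total_decoration_bij] .
  qed (rule Int_lower1)
  from bij_betw_imp_surj_on[OF bij_betw_free[OF finite_Int[OF disjI1[OF finite_dec_basis]] this, where 'k = 'k]]
  have "lin_ext (\<lambda>x. single (total_decoration x)) ` free (dec_basis \<alpha> k \<inter> ?P) = (free (sum_basis k \<inter> ?Q) :: (sum_osp \<Rightarrow> 'k) set)" .
  then show ?thesis
    unfolding dec_chains_eq sum_chains_eq sum_part_eq dec_part_def free_Int decomposition_def .
qed

lemma is_decomposition_iso_decomposition:
  "is_decomposition_iso \<alpha> (\<lambda>_. decomposition :: (dec_osp \<Rightarrow> 'k::field) \<Rightarrow> (sum_osp \<Rightarrow> 'k))"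
  unfolding is_decomposition_iso_def sum_\<alpha>
proof (intro conjI allI ballI impI)
  fix k
  show "linear_on_space (dec_chains \<alpha> k) (decomposition :: (dec_osp \<Rightarrow> 'k) \<Rightarrow> (sum_osp \<Rightarrow> 'k))"
    by (rule linear_decomposition)
  show "bij_betw decomposition (dec_chains \<alpha> k) (sum_chains \<alpha> k :: (sum_osp \<Rightarrow> 'k) set)"
    by (rule decomposition_bij)
  show "decomposition (dec_diff v) = (sum_diff (decomposition v) :: sum_osp \<Rightarrow> 'k)"
    if "v \<in> dec_chains \<alpha> (k + 1)" for v by (rule decomposition_diff[OF that])
  show "decomposition (dec_act w v) = (sum_act w (decomposition v) :: sum_osp \<Rightarrow> 'k)"
    if "w permutes {1..n}" "v \<in> dec_chains \<alpha> k" for w v by (rule decomposition_act[OF that])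
  show "decomposition ` (dec_chains \<alpha> k \<inter> dec_part d e) = (sum_chains \<alpha> k \<inter> sum_part n d e :: (sum_osp \<Rightarrow> 'k) set)"
    for d e by (rule decomposition_part)
qed

lemma is_canonical_decomposition:
  "is_canonical \<alpha> (\<lambda>_. decomposition :: (dec_osp \<Rightarrow> 'k::field) \<Rightarrow> (sum_osp \<Rightarrow> 'k))"
  unfolding is_canonical_def by (auto simp only: decomposition_single total_decoration_def prod.case)

subsection \<open>Homology of the decorated complex\<close>

definition degree_part :: "nat \<Rightarrow> nat \<Rightarrow> decoration set" where
  "degree_part d e = {\<theta> \<in> decorations n. deg_t n \<theta> = d \<and> deg_q n \<theta> = e}"

lemma finite_degree_part: "finite (degree_part d e)"
  unfolding degree_part_def using finite_decorations by simp

lemma sum_chains_part: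
  "sum_chains \<alpha> k \<inter> sum_part n d e
    = (dsum (degree_part d e) (\<lambda>\<theta>. rib_chains (fact_comp \<alpha> \<theta>) k) :: (sum_osp \<Rightarrow> 'k::field) set)"
proof -
  have "v \<in> sum_chains \<alpha> k \<inter> sum_part n d e \<longleftrightarrow>
      v \<in> dsum (degree_part d e) (\<lambda>\<theta>. rib_chains (fact_comp \<alpha> \<theta>) k)" for v :: "sum_osp \<Rightarrow> 'k"
  proof -
    have 0: "0 \<in> (rib_chains \<gamma> k :: 'k chain set)" for \<gamma>
      unfolding rib_chains_def by (rule free_0)
    show ?thesis
    proof
      assume "v \<in> sum_chains \<alpha> k \<inter> sum_part n d e"
      then have "(if \<theta> \<in> decorations n then component v \<theta> \<in> rib_chains (fact_comp \<alpha> \<theta>) k else component v \<theta> = 0)"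
        "component v \<theta> \<noteq> 0 \<longrightarrow> deg_t n \<theta> = d \<and> deg_q n \<theta> = e" for \<theta>
        unfolding sum_chains_def sum_part_def sum_\<alpha> Int_iff mem_Collect_eq by blast+
      then show "v \<in> dsum (degree_part d e) (\<lambda>\<theta>. rib_chains (fact_comp \<alpha> \<theta>) k)"
        unfolding dsum_component_iff degree_part_def mem_Collect_eq by metis
    next
      assume "v \<in> dsum (degree_part d e) (\<lambda>\<theta>. rib_chains (fact_comp \<alpha> \<theta>) k)"
      then have *: "if \<theta> \<in> decorations n \<and> deg_t n \<theta> = d \<and> deg_q n \<theta> = e
          then component v \<theta> \<in> rib_chains (fact_comp \<alpha> \<theta>) k else component v \<theta> = 0" for \<theta>
        unfolding dsum_component_iff degree_part_def mem_Collect_eq by blast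
      then show "v \<in> sum_chains \<alpha> k \<inter> sum_part n d e"
        unfolding sum_chains_def sum_part_def sum_\<alpha> Int_iff mem_Collect_eq using 0 by metis
    qed
  qed
  then show ?thesis by blast
qed

lemma decomposition_inj: "u \<in> dec_chains \<alpha> k \<Longrightarrow> v \<in> dec_chains \<alpha> k \<Longrightarrow>
    decomposition u = (decomposition v :: sum_osp \<Rightarrow> 'k::field) \<Longrightarrow> u = v"
  by (rule inj_onD[OF bij_betw_imp_inj_on[OF decomposition_bij]])

lemma decomposition_0: "decomposition 0 = (0 :: sum_osp \<Rightarrow> 'k::field)"
  unfolding decomposition_def by (rule lin_ext_0)

abbreviation (input) chains_part :: "nat \<Rightarrow> nat \<Rightarrow> nat \<Rightarrow> (dec_osp \<Rightarrow> 'k::field) set" where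
  "chains_part k d e \<equiv> dec_chains \<alpha> k \<inter> dec_part d e"

text \<open>A chain is a cycle if and only if all components of its image are. This is the first half of transporting
  homology along the decomposition.\<close>

lemma dec_cycles_eq:
  "cycle_space (dec_chains \<alpha>) dec_diff k \<inter> dec_part d e
    = {v \<in> chains_part k d e. (decomposition v :: sum_osp \<Rightarrow> 'k::field) \<in>
        dsum (degree_part d e) (\<lambda>\<theta>. cycle_space (rib_chains (fact_comp \<alpha> \<theta>)) rib_diff k)}"
proof -
  have "dec_diff v = 0 \<longleftrightarrow> (decomposition v :: sum_osp \<Rightarrow> 'k) \<in>
      dsum (degree_part d e) (\<lambda>\<theta>. cycle_space (rib_chains (fact_comp \<alpha> \<theta>)) rib_diff k)"
    if v: "v \<in> chains_part k d e" for v :: "dec_osp \<Rightarrow> 'k"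
  proof -
    have vk: "v \<in> dec_chains \<alpha> k" using v by blast
    let ?v = "decomposition v"
    have mem: "?v \<in> dsum (degree_part d e) (\<lambda>\<theta>. rib_chains (fact_comp \<alpha> \<theta>) k)"
      using imageI[OF v, of decomposition] unfolding decomposition_part sum_chains_part .
    have "dec_diff v = 0 \<longleftrightarrow> decomposition (dec_diff v) = (0 :: sum_osp \<Rightarrow> 'k)"
    proof
      assume "decomposition (dec_diff v) = (0 :: sum_osp \<Rightarrow> 'k)"
      then have "decomposition (dec_diff v) = (decomposition 0 :: sum_osp \<Rightarrow> 'k)" by (simp only: decomposition_0)
      moreover have "0 \<in> (dec_chains \<alpha> (k - 1) :: (dec_osp \<Rightarrow> 'k) set)" unfolding dec_chains_def by (rule free_0)
      ultimately show "dec_diff v = 0" by (intro decomposition_inj[OF dec_diff_chains[OF vk]])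
    qed (simp only: decomposition_0)
    also have "\<dots> \<longleftrightarrow> sum_diff ?v = 0" unfolding decomposition_diff[OF vk] ..
    also have "\<dots> \<longleftrightarrow> (\<forall>\<theta>. rib_diff (component ?v \<theta>) = 0)"
    proof
      assume *: "sum_diff ?v = 0"
      show "\<forall>\<theta>. rib_diff (component ?v \<theta>) = 0"
        unfolding component_sum_diff[symmetric] * by (intro allI component_0)
    next
      assume "\<forall>\<theta>. rib_diff (component ?v \<theta>) = 0"
      then show "sum_diff ?v = 0"
        by (intro component_eqI) (simp only: component_sum_diff component_0)
    qed
    also have "\<dots> \<longleftrightarrow> ?v \<in> dsum (degree_part d e) (\<lambda>\<theta>. cycle_space (rib_chains (fact_comp \<alpha> \<theta>)) rib_diff k)"
      using mem rib_diff_0[OF n \<alpha>, where 'k = 'k] unfolding dsum_component_iff cycle_space_def mem_Collect_eq by metis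
    finally show ?thesis .
  qed
  then show ?thesis unfolding cycle_space_def[of "dec_chains \<alpha>"] by blast
qed

text \<open>A boundary downstairs is bounded in each summand separately; the bounding chains are assembled into one
  chain of the same bidegree, which is then pulled back.\<close>

lemma dec_boundaries_eq:
  "boundary_space (dec_chains \<alpha>) dec_diff k \<inter> dec_part d e
    = {v \<in> chains_part k d e. (decomposition v :: sum_osp \<Rightarrow> 'k::field) \<in>
        dsum (degree_part d e) (\<lambda>\<theta>. boundary_space (rib_chains (fact_comp \<alpha> \<theta>)) rib_diff k)}"
proof (intro equalityI subsetI)
  fix v :: "dec_osp \<Rightarrow> 'k" assume "v \<in> boundary_space (dec_chains \<alpha>) dec_diff k \<inter> dec_part d e"
  then obtain u where u: "u \<in> dec_chains \<alpha> (k + 1)" and vu: "v = dec_diff u" and vd: "v \<in> dec_part d e"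
    unfolding boundary_space_def by blast
  have "v \<in> dec_chains \<alpha> k" using dec_diff_chains[OF u] unfolding vu by (simp only: add_diff_cancel_right')
  then have v: "v \<in> chains_part k d e" using vd by blast
  have mem: "decomposition v \<in> dsum (degree_part d e) (\<lambda>\<theta>. rib_chains (fact_comp \<alpha> \<theta>) k)"
    using imageI[OF v, of decomposition] unfolding decomposition_part sum_chains_part .
  have du: "decomposition u \<in> sum_chains \<alpha> (k + 1)"
    using bij_betwE[OF decomposition_bij] u by blast
  have comp: "component (decomposition v) \<theta> = rib_diff (component (decomposition u) \<theta>)" for \<theta>
    unfolding vu decomposition_diff[OF u] component_sum_diff ..
  have "component (decomposition v) \<theta> \<in> boundary_space (rib_chains (fact_comp \<alpha> \<theta>)) rib_diff k"
    if "\<theta> \<in> degree_part d e" for \<theta>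
  proof -
    have "\<theta> \<in> decorations n" using that unfolding degree_part_def by blast
    then have "component (decomposition u) \<theta> \<in> rib_chains (fact_comp \<alpha> \<theta>) (k + 1)"
      using du unfolding sum_chains_def sum_\<alpha> mem_Collect_eq by metis
    then show ?thesis unfolding comp boundary_space_def by (rule imageI)
  qed
  then have "decomposition v \<in> dsum (degree_part d e) (\<lambda>\<theta>. boundary_space (rib_chains (fact_comp \<alpha> \<theta>)) rib_diff k)"
    using mem unfolding dsum_component_iff by metis
  with v show "v \<in> {v \<in> chains_part k d e. decomposition v \<in>
      dsum (degree_part d e) (\<lambda>\<theta>. boundary_space (rib_chains (fact_comp \<alpha> \<theta>)) rib_diff k)}" by blast
next
  fix v :: "dec_osp \<Rightarrow> 'k"
  assume "v \<in> {v \<in> chains_part k d e. decomposition v \<in>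
      dsum (degree_part d e) (\<lambda>\<theta>. boundary_space (rib_chains (fact_comp \<alpha> \<theta>)) rib_diff k)}"
  then have v: "v \<in> dec_chains \<alpha> k" "v \<in> dec_part d e" and
    mem: "\<And>\<theta>. if \<theta> \<in> degree_part d e then component (decomposition v) \<theta> \<in> rib_diff ` rib_chains (fact_comp \<alpha> \<theta>) (k + 1)
      else component (decomposition v) \<theta> = 0"
    unfolding dsum_component_iff boundary_space_def by blast+
  have "\<exists>b. \<theta> \<in> degree_part d e \<longrightarrow> b \<in> rib_chains (fact_comp \<alpha> \<theta>) (k + 1) \<and> component (decomposition v) \<theta> = rib_diff b" for \<theta>
  proof (cases "\<theta> \<in> degree_part d e")
    case True
    then show ?thesis using mem[of \<theta>] unfolding if_P[OF True] by blast
  qed blast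
  then obtain b where b: "\<And>\<theta>. \<theta> \<in> degree_part d e \<Longrightarrow> b \<theta> \<in> rib_chains (fact_comp \<alpha> \<theta>) (k + 1)"
    "\<And>\<theta>. \<theta> \<in> degree_part d e \<Longrightarrow> component (decomposition v) \<theta> = rib_diff (b \<theta>)" by metis
  define u :: "sum_osp \<Rightarrow> 'k" where "u = (\<lambda>(\<theta>, Bs). if \<theta> \<in> degree_part d e then b \<theta> Bs else 0)"
  have comp: "component u \<theta> = (if \<theta> \<in> degree_part d e then b \<theta> else 0)" for \<theta>
    by (rule ext) (simp add: component_def u_def)
  have "u \<in> dsum (degree_part d e) (\<lambda>\<theta>. rib_chains (fact_comp \<alpha> \<theta>) (k + 1))"
    unfolding dsum_component_iff comp using b(1) by simp
  then have "u \<in> decomposition ` chains_part (k + 1) d e"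
    unfolding decomposition_part sum_chains_part .
  then obtain y where y: "y \<in> dec_chains \<alpha> (k + 1)" "u = decomposition y" by blast
  have "decomposition (dec_diff y) = decomposition v"
    unfolding decomposition_diff[OF y(1)]
  proof (rule component_eqI)
    fix \<theta>
    have "component (sum_diff (decomposition y)) \<theta> = rib_diff (if \<theta> \<in> degree_part d e then b \<theta> else 0)"
      unfolding component_sum_diff y(2)[symmetric] comp ..
    also have "\<dots> = component (decomposition v) \<theta>"
    proof (cases "\<theta> \<in> degree_part d e")
      case True
      then show ?thesis using b(2)[OF True] by (simp only: if_True)
    next
      case False
      then have "component (decomposition v) \<theta> = 0" using mem[of \<theta>] by (simp only: if_False)
      then show ?thesis using False by (simp only: if_False rib_diff_0[OF n \<alpha>])
    qed
    finally show "component (sum_diff (decomposition y)) \<theta> = component (decomposition v) \<theta>" .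
  qed
  moreover have "dec_diff y \<in> dec_chains \<alpha> k"
    using dec_diff_chains[OF y(1)] by (simp only: add_diff_cancel_right')
  ultimately have "dec_diff y = v" by (intro decomposition_inj[OF _ v(1)])
  then show "v \<in> boundary_space (dec_chains \<alpha>) dec_diff k \<inter> dec_part d e"
    unfolding boundary_space_def using y(1) v(2) by blast
qed

lemma dec_act_chains_part:
  assumes w: "w permutes {1..n}" and v: "v \<in> chains_part k d e"
  shows "dec_act w v \<in> (chains_part k d e :: (dec_osp \<Rightarrow> 'k::field) set)"
  using v unfolding dec_chains_def dec_part_def free_Int dec_act_def
proof (rule lin_ext_in_free)
  fix x assume "x \<in> dec_basis \<alpha> k \<inter> {x. dec_deg_t x = d \<and> dec_deg_q x = e}"
  moreover obtain Bs \<xi>s where p: "x = (Bs, \<xi>s)" by (cases x)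
  ultimately have x: "(Bs, \<xi>s) \<in> dec_basis \<alpha> k" "dec_deg_t (Bs, \<xi>s) = d" "dec_deg_q (Bs, \<xi>s) = e" by blast+
  have card: "card (w ` B) = card B" for B by (rule card_image[OF inj_on_subset[OF permutes_inj[OF w] subset_UNIV]])
  have map: "map card (relabel w Bs) = map card Bs" unfolding relabel_def by (simp add: card)
  have len: "length (relabel w Bs) = length Bs" by (simp add: relabel_def)
  have "(relabel w Bs, \<xi>s) \<in> dec_basis \<alpha> k"
    using x(1) relabel_OSP[OF w, of Bs "map card Bs"] unfolding dec_basis_iff map len by blast
  moreover have "dec_deg_t (relabel w Bs, \<xi>s) = d" "dec_deg_q (relabel w Bs, \<xi>s) = e"
    using x(2,3) unfolding dec_deg_t_def dec_deg_q_def prod.case len by (simp_all add: relabel_def card)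
  ultimately show "(case x of (Bs, \<xi>s) \<Rightarrow> single (relabel w Bs, \<xi>s))
      \<in> (free (dec_basis \<alpha> k \<inter> {x. dec_deg_t x = d \<and> dec_deg_q x = e}) :: (dec_osp \<Rightarrow> 'k) set)"
    unfolding p prod.case by (intro single_in_free) blast
qed

definition homology_character :: "nat \<Rightarrow> nat \<Rightarrow> nat \<Rightarrow> (nat \<Rightarrow> nat) \<Rightarrow> 'k::field" where
  "homology_character k d e w =
     (\<Sum>\<theta>\<in>degree_part d e. if k = length (fact_comp \<alpha> \<theta>) then ribbon_character n (fact_comp \<alpha> \<theta>) w else 0)"

lemma has_trace_dec_homology:
  assumes w: "w permutes {1..n}"
  shows "has_trace (dec_homology \<alpha> k d e) (dec_act w) (homology_character k d e w :: 'k::field)"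
proof -
  let ?\<gamma> = "fact_comp \<alpha>"
  let ?Z = "\<lambda>\<theta>. cycle_space (rib_chains (?\<gamma> \<theta>)) rib_diff k :: 'k chain set"
  let ?B = "\<lambda>\<theta>. boundary_space (rib_chains (?\<gamma> \<theta>)) rib_diff k :: 'k chain set"
  note \<gamma> = fact_comp(1)
  have tr: "has_trace (dsum (degree_part d e) ?Z, dsum (degree_part d e) ?B) (sum_act w)
      (homology_character k d e w :: 'k)"
    unfolding homology_character_def
  proof (rule has_trace_dsum[OF finite_degree_part])
    fix \<theta>
    show "subquotient (?Z \<theta>, ?B \<theta>)" by (rule subquotient_homology[OF n \<gamma>, unfolded homology_def])
    show "endo (?Z \<theta>, ?B \<theta>) (rib_act w)" by (rule endo_homology[OF n \<gamma> w, unfolded homology_def])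
    show "has_trace (?Z \<theta>, ?B \<theta>) (rib_act w)
        (if k = length (?\<gamma> \<theta>) then ribbon_character n (?\<gamma> \<theta>) w else 0 :: 'k)"
      by (rule has_trace_homology[OF n \<gamma> w, unfolded homology_def])
    show "sum_act w v (\<theta>, Bs) = rib_act w (\<lambda>Bs. v (\<theta>, Bs)) Bs" for v :: "sum_osp \<Rightarrow> 'k" and Bs
      unfolding sum_act_def prod.case component_def ..
    show "rib_act w 0 = (0 :: 'k chain)" unfolding rib_act_def by (rule lin_ext_0)
  qed
  show ?thesis
    unfolding dec_homology_def dec_cycles_eq dec_boundaries_eq
  proof (rule has_trace_pullback[OF _ _ _ _ _ _ tr])
    show "fspace.subspace (chains_part k d e :: (dec_osp \<Rightarrow> 'k) set)"
      unfolding dec_chains_def dec_part_def free_Int by (rule subspace_free)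
    show "linear_on_space (chains_part k d e) (dec_act w :: (dec_osp \<Rightarrow> 'k) \<Rightarrow> _)"
      unfolding dec_chains_def dec_part_def free_Int dec_act_def
      by (rule linear_lin_ext) (use finite_dec_basis in blast)
    show "linear_on_space (chains_part k d e) (decomposition :: (dec_osp \<Rightarrow> 'k) \<Rightarrow> _)"
      by (rule linear_on_space_subset[OF linear_decomposition Int_lower1])
    have "dsum (degree_part d e) ?Z \<subseteq> dsum (degree_part d e) (\<lambda>\<theta>. rib_chains (?\<gamma> \<theta>) k)"
      unfolding dsum_component_iff subset_iff cycle_space_def mem_Collect_eq by metis
    then show "dsum (degree_part d e) ?Z \<subseteq> decomposition ` chains_part k d e"
      unfolding decomposition_part sum_chains_part .
    show "dec_act w v \<in> chains_part k d e" if "v \<in> chains_part k d e" for v :: "dec_osp \<Rightarrow> 'k"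
      by (rule dec_act_chains_part[OF w that])
    show "decomposition (dec_act w v) = (sum_act w (decomposition v) :: sum_osp \<Rightarrow> 'k)"
      if "v \<in> chains_part k d e" for v :: "dec_osp \<Rightarrow> 'k"
      by (rule decomposition_act[OF w IntD1[OF that]])
  qed
qed

definition top_part :: "nat \<Rightarrow> nat \<Rightarrow> nat \<Rightarrow> decoration set" where
  "top_part k d e = {\<theta> \<in> degree_part d e. card (fact_cuts \<alpha> \<theta>) + 1 = k}"

text \<open>Only the summands whose top degree is \<open>k\<close> contribute, each with its ribbon Schur function.\<close>

lemma frob_dec_homology:
  "frob_ch n dec_act (dec_homology \<alpha> k d e) = (\<Sum>\<theta>\<in>top_part k d e. ribbon (fact_comp \<alpha> \<theta>) :: 'k::field_char_0 mseries)"
proof -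
  let ?G = "{w. w permutes {1..n}}"
  have ch: "homology_character k d e w = (\<Sum>\<theta>\<in>top_part k d e. ribbon_character n (fact_comp \<alpha> \<theta>) w :: 'k)" for w
    unfolding homology_character_def top_part_def fact_comp(3) eq_commute[of k]
    by (rule sum.inter_filter[OF finite_degree_part, symmetric])
  have "quot_trace (dec_homology \<alpha> k d e) (dec_act w) = (\<Sum>\<theta>\<in>top_part k d e. ribbon_character n (fact_comp \<alpha> \<theta>) w :: 'k)"
    if "w \<in> ?G" for w
    using has_trace_imp_quot_trace[OF has_trace_dec_homology[OF that[unfolded mem_Collect_eq], of k d e, where 'k = 'k]] unfolding ch .
  then have "frob_ch n dec_act (dec_homology \<alpha> k d e)
      = mconst (1 / fact n) * (\<Sum>w\<in>?G. \<Sum>\<theta>\<in>top_part k d e. mconst (ribbon_character n (fact_comp \<alpha> \<theta>) w :: 'k) * psum_cycle_type n w)"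
    unfolding frob_ch_def by (simp add: mconst_sum sum_distrib_right)
  also have "\<dots> = (\<Sum>\<theta>\<in>top_part k d e. mconst (1 / fact n) *
      (\<Sum>w\<in>?G. mconst (ribbon_character n (fact_comp \<alpha> \<theta>) w :: 'k) * psum_cycle_type n w))"
    by (subst sum.swap) (simp only: sum_distrib_left)
  also have "\<dots> = (\<Sum>\<theta>\<in>top_part k d e. ribbon (fact_comp \<alpha> \<theta>))"
    by (intro sum.cong refl frob_ribbon[OF n fact_comp(1)])
  finally show ?thesis .
qed

lemma frob_dec_homology_zero:
  assumes "\<not> quot_nonzero (dec_homology \<alpha> k d e :: (dec_osp, 'k::field_char_0) subquot)"
  shows "frob_ch n dec_act (dec_homology \<alpha> k d e) = (0 :: 'k mseries)"
proof -
  let ?V = "dec_homology \<alpha> k d e :: (dec_osp, 'k) subquot"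
  have sub: "fst ?V \<subseteq> snd ?V" using assms unfolding quot_nonzero_def by blast
  have "quot_trace ?V (dec_act w) = 0" if "w permutes {1..n}" for w
  proof -
    have "subquotient ?V" "endo ?V (dec_act w)"
      using has_trace_dec_homology[OF that, of k d e, where 'k = 'k] unfolding has_trace_def by blast+
    then show ?thesis by (intro has_trace_imp_quot_trace has_trace_zero[OF _ _ sub])
  qed
  then show ?thesis unfolding frob_ch_def by simp
qed

lemma degree_part_nonempty:
  assumes "quot_nonzero (dec_homology \<alpha> k d e :: (dec_osp, 'k::field_char_0) subquot)"
  shows "degree_part d e \<noteq> {}"
proof
  assume empty: "degree_part d e = {}"
  have "fst (dec_homology \<alpha> k d e :: (dec_osp, 'k) subquot) \<subseteq> snd (dec_homology \<alpha> k d e)"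
    unfolding dec_homology_def dec_cycles_eq dec_boundaries_eq fst_conv snd_conv empty dsum_def by simp
  then show False using assms unfolding quot_nonzero_def by blast
qed

text \<open>The sum over bidegrees with nonzero homology may be enlarged to all bidegrees of decorations, because
  vanishing homology has trace zero. It is then regrouped by decorations.\<close>

lemma frob_ch_tq_dec_homology:
  "frob_ch_tq n dec_act (dec_homology \<alpha> k) =
     (\<Sum>\<theta> | \<theta> \<in> decorations n \<and> card (fact_cuts \<alpha> \<theta>) + 1 = k.
        tq_monom (deg_t n \<theta>) (deg_q n \<theta>) (ribbon (fact_comp \<alpha> \<theta>) :: 'k::field_char_0 mseries))"
proof -
  let ?V = "dec_homology \<alpha> k :: nat \<Rightarrow> nat \<Rightarrow> (dec_osp, 'k) subquot"
  let ?deg = "\<lambda>\<theta>. (deg_t n \<theta>, deg_q n \<theta>)"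
  let ?P = "?deg ` decorations n"
  let ?m = "\<lambda>\<theta>. tq_monom (deg_t n \<theta>) (deg_q n \<theta>) (ribbon (fact_comp \<alpha> \<theta>) :: 'k mseries)"
  let ?T = "{\<theta>. \<theta> \<in> decorations n \<and> card (fact_cuts \<alpha> \<theta>) + 1 = k}"
  have tq_sum: "tq_monom d e (sum f I) = (\<Sum>i\<in>I. tq_monom d e (f i))" for d e I and f :: "decoration \<Rightarrow> 'k mseries"
    unfolding tq_monom_def by (induction I rule: infinite_finite_induct) (simp_all add: add_monom[symmetric])
  have tq_0: "tq_monom d e (0 :: 'k mseries) = 0" for d e unfolding tq_monom_def by simp
  have fin: "finite ?P" using finite_decorations by (rule finite_imageI)
  have "frob_ch_tq n dec_act ?V = (\<Sum>p\<in>?P. case p of (d, e) \<Rightarrow> tq_monom d e (frob_ch n dec_act (?V d e)))"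
    unfolding frob_ch_tq_def
  proof (rule sum.mono_neutral_left[OF fin])
    show "{(d, e). quot_nonzero (?V d e)} \<subseteq> ?P"
    proof
      fix p assume "p \<in> {(d, e). quot_nonzero (?V d e)}"
      moreover obtain d e where p: "p = (d, e)" by (cases p)
      ultimately have "quot_nonzero (?V d e)" by blast
      then obtain \<theta> where "\<theta> \<in> degree_part d e" using degree_part_nonempty by blast
      then show "p \<in> ?P" unfolding p degree_part_def by blast
    qed
    show "\<forall>p\<in>?P - {(d, e). quot_nonzero (?V d e)}. (case p of (d, e) \<Rightarrow> tq_monom d e (frob_ch n dec_act (?V d e))) = 0"
    proof
      fix p assume "p \<in> ?P - {(d, e). quot_nonzero (?V d e)}"
      moreover obtain d e where p: "p = (d, e)" by (cases p)
      ultimately have "\<not> quot_nonzero (?V d e)" by blast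
      from frob_dec_homology_zero[OF this] show "(case p of (d, e) \<Rightarrow> tq_monom d e (frob_ch n dec_act (?V d e))) = 0"
        unfolding p prod.case by (simp only: tq_0)
    qed
  qed
  also have "\<dots> = (\<Sum>p\<in>?P. \<Sum>\<theta>\<in>{\<theta> \<in> ?T. ?deg \<theta> = p}. ?m \<theta>)"
  proof (rule sum.cong[OF refl])
    fix p assume "p \<in> ?P"
    obtain d e where p: "p = (d, e)" by (cases p)
    have "{\<theta> \<in> ?T. ?deg \<theta> = p} = top_part k d e"
      unfolding p top_part_def degree_part_def by blast
    moreover have "deg_t n \<theta> = d" "deg_q n \<theta> = e" if "\<theta> \<in> top_part k d e" for \<theta>
      using that unfolding top_part_def degree_part_def by blast+
    ultimately show "(case p of (d, e) \<Rightarrow> tq_monom d e (frob_ch n dec_act (?V d e))) = (\<Sum>\<theta>\<in>{\<theta> \<in> ?T. ?deg \<theta> = p}. ?m \<theta>)"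
      unfolding p prod.case frob_dec_homology tq_sum by (intro sum.cong) simp_all
  qed
  also have "\<dots> = (\<Sum>\<theta>\<in>?T. ?m \<theta>)"
    by (rule sum.group[OF _ fin]) (use finite_decorations in auto)
  finally show ?thesis .
qed

lemma tq_coeff_sum:
  "tq_coeff (\<Sum>i\<in>I. tq_monom (a i) (b i) (f i)) d e
    = (\<Sum>i\<in>I. if a i = d \<and> b i = e then f i else 0 :: 'a::comm_monoid_add)"
  by (induction I rule: infinite_finite_induct) (auto simp: tq_coeff_def tq_monom_def)

lemma tq_coeff_dec_homology:
  "tq_coeff (frob_ch_tq n dec_act (dec_homology \<alpha> k)) d e
    = (\<Sum>\<theta>\<in>top_part k d e. ribbon (fact_comp \<alpha> \<theta>) :: 'k::field_char_0 mseries)"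
proof -
  have "finite {\<theta>. \<theta> \<in> decorations n \<and> card (fact_cuts \<alpha> \<theta>) + 1 = k}" using finite_decorations by simp
  then show ?thesis
    unfolding frob_ch_tq_dec_homology tq_coeff_sum
    by (subst sum.inter_filter[symmetric]) (auto simp: top_part_def degree_part_def intro!: sum.cong)
qed

text \<open>Decorations with the same composition are collected into a multiplicity.\<close>

lemma ribbon_positive_dec_homology:
  "ribbon_positive (tq_coeff (frob_ch_tq n dec_act (dec_homology \<alpha> k) :: 'k::field_char_0 mseries poly poly) d e)"
proof -
  let ?\<gamma> = "fact_comp \<alpha>" and ?T = "top_part k d e"
  have fin: "finite ?T" using finite_degree_part by (simp add: top_part_def)
  have "(\<Sum>\<theta>\<in>?T. ribbon (?\<gamma> \<theta>)) = (\<Sum>\<gamma>\<in>?\<gamma> ` ?T. \<Sum>\<theta>\<in>{\<theta> \<in> ?T. ?\<gamma> \<theta> = \<gamma>}. ribbon (?\<gamma> \<theta>) :: 'k mseries)"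
    by (rule sum.image_gen[OF fin])
  also have "\<dots> = (\<Sum>\<gamma>\<in>?\<gamma> ` ?T. of_nat (card {\<theta> \<in> ?T. ?\<gamma> \<theta> = \<gamma>}) * ribbon \<gamma>)"
    by (intro sum.cong refl) simp
  finally have "(\<Sum>\<theta>\<in>?T. ribbon (?\<gamma> \<theta>)) = (\<Sum>\<gamma>\<in>?\<gamma> ` ?T. of_nat (card {\<theta> \<in> ?T. ?\<gamma> \<theta> = \<gamma>}) * ribbon \<gamma> :: 'k mseries)" .
  moreover have "\<forall>\<gamma>\<in>?\<gamma> ` ?T. \<forall>a\<in>set \<gamma>. 0 < a" using fact_comp(1) by (auto simp: is_composition_def)
  ultimately show ?thesis
    unfolding tq_coeff_dec_homology ribbon_positive_def
    by (intro exI[of _ "?\<gamma> ` ?T"] exI[of _ "\<lambda>\<gamma>. card {\<theta> \<in> ?T. ?\<gamma> \<theta> = \<gamma>}"] conjI finite_imageI fin)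
qed

lemma schur_positive_dec_homology:
  "schur_positive (tq_coeff (frob_ch_tq n dec_act (dec_homology \<alpha> k) :: 'k::field_char_0 mseries poly poly) d e)"
  unfolding tq_coeff_dec_homology
  by (intro schur_positive_sum schur_positive_ribbon[OF fact_comp(1) n])

end

theorem theorem3p11:
  fixes n :: nat and \<alpha> :: "nat list"
  assumes "n \<ge> 1"
    and "is_composition n \<alpha>"
    and "length (filter odd \<alpha>) \<le> 1"
  shows "(\<exists>\<Phi> :: nat \<Rightarrow> (dec_osp \<Rightarrow> 'k::field_char_0) \<Rightarrow> (sum_osp \<Rightarrow> 'k).
            is_decomposition_iso \<alpha> \<Phi> \<and> is_canonical \<alpha> \<Phi>) \<and>
    (\<forall>k. (frob_ch_tq n dec_act (dec_homology \<alpha> k) :: 'k mseries poly poly) =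
       (\<Sum>\<theta> | \<theta> \<in> decorations n \<and> card (fact_cuts \<alpha> \<theta>) + 1 = k.
          tq_monom (deg_t n \<theta>) (deg_q n \<theta>) (ribbon (fact_comp \<alpha> \<theta>)))) \<and>
    (\<forall>k d e.
       ribbon_positive (tq_coeff (frob_ch_tq n dec_act (dec_homology \<alpha> k) :: 'k mseries poly poly) d e) \<and>
       schur_positive (tq_coeff (frob_ch_tq n dec_act (dec_homology \<alpha> k) :: 'k mseries poly poly) d e)) \<and>
    (\<forall>\<theta>\<in>decorations n.
       (\<forall>k. quot_nonzero (homology (rib_chains (fact_comp \<alpha> \<theta>) :: nat \<Rightarrow> (nat set list \<Rightarrow> 'k) set) rib_diff k)
          \<longleftrightarrow> k = card (fact_cuts \<alpha> \<theta>) + 1) \<and>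
       quot_dim (homology (rib_chains (fact_comp \<alpha> \<theta>) :: nat \<Rightarrow> (nat set list \<Rightarrow> 'k) set) rib_diff
            (card (fact_cuts \<alpha> \<theta>) + 1))
         = card {\<pi>. \<pi> permutes {1..n} \<and> Des n \<pi> = fact_cuts \<alpha> \<theta>})"
proof -
  have fo: "few_odd \<alpha>" using assms(3) by (simp add: few_odd_def)
  note c = assms(1,2) fo
  note \<gamma> = fact_comp[OF c]
  show ?thesis
  proof (intro conjI allI ballI)
    show "\<exists>\<Phi> :: nat \<Rightarrow> (dec_osp \<Rightarrow> 'k) \<Rightarrow> (sum_osp \<Rightarrow> 'k). is_decomposition_iso \<alpha> \<Phi> \<and> is_canonical \<alpha> \<Phi>"
      using is_decomposition_iso_decomposition[OF c, where 'k = 'k] is_canonical_decomposition[OF c, where 'k = 'k] by blast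
    fix \<theta> assume "\<theta> \<in> decorations n"
    show "quot_nonzero (homology (rib_chains (fact_comp \<alpha> \<theta>) :: nat \<Rightarrow> (nat set list \<Rightarrow> 'k) set) rib_diff k)
        \<longleftrightarrow> k = card (fact_cuts \<alpha> \<theta>) + 1" for k
      using homology_nonzero_iff(1)[OF c(1) \<gamma>(1), where 'k = 'k] unfolding \<gamma>(3) .
    show "quot_dim (homology (rib_chains (fact_comp \<alpha> \<theta>) :: nat \<Rightarrow> (nat set list \<Rightarrow> 'k) set) rib_diff
            (card (fact_cuts \<alpha> \<theta>) + 1))
         = card {\<pi>. \<pi> permutes {1..n} \<and> Des n \<pi> = fact_cuts \<alpha> \<theta>}"
      using homology_nonzero_iff(2)[OF c(1) \<gamma>(1), where 'k = 'k] unfolding \<gamma>(2,3) .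
  qed (rule frob_ch_tq_dec_homology[OF c] ribbon_positive_dec_homology[OF c] schur_positive_dec_homology[OF c])+
qed

end
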